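(* Let $M$ be an invertible $3\times3$ complex matrix, and let $\mathcal{S}\subset\mathbb{C}^2$ be a smooth $M$-admissible compact strongly $\mathbb{C}$-convex hypersurface bounding a domain $\Omega$. Then the space $W(\mathcal{S})=\{\tau(\nu_M)h:h\in(\ker\mathbf{L}_{\mathcal{S}})^\perp\}\subset L^2(\mathcal{S},|\nu_M|)$ satisfies $$\overline{W(\mathcal{S})}=H^2_{\mathsf{dual}}(\mathcal{S}),$$ where $\overline{W(\mathcal{S})}=\{\overline f:f\in W(\mathcal{S})\}$ is the complex-conjugate space.
   Context: Write $M=\begin{pmatrix}c_1&a_1&a_2\\ b_1&m_{11}&m_{12}\\ b_2&m_{21}&m_{22}\end{pmatrix}$ and $\Phi_M((z_1,z_2),(w_1,w_2))=(1,w_1,w_2)\,M\,(1,z_1,z_2)^T$. For a smooth real hypersurface $\mathcal{S}\subset\mathbb{C}^2$ with defining function $\rho$ put $\mu_1=\partial\rho/\partial\zeta_2$, $\mu_2=-\partial\rho/\partial\zeta_1$. $\mathcal{S}$ is $M$-admissible if for all $\zeta\in\mathcal{S}$ $$\det\begin{pmatrix}m_{11}\mu_1(\zeta)+m_{12}\mu_2(\zeta)&m_{11}\zeta_1+m_{12}\zeta_2+b_1\\ m_{21}\mu_1(\zeta)+m_{22}\mu_2(\zeta)&m_{21}\zeta_1+m_{22}\zeta_2+b_2\end{pmatrix}\ne0.$$ Then $w_M=(w_{1,M},w_{2,M})$ is the unique $\mathbb{C}^2$-valued function on $\mathcal{S}$ such that the complex tangent line to $\mathcal{S}$ at each $\zeta$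 is $\{z:\Phi_M(z,w_M(\zeta))=0\}$. Set $$\nu_M=\frac{1}{(2\pi i)^2}\left(\begin{pmatrix}dw_{1,M}&dw_{2,M}\end{pmatrix}\begin{pmatrix}m_{11}&m_{12}\\ m_{21}&m_{22}\end{pmatrix}\begin{pmatrix}a_2\\ -a_1\end{pmatrix}+\begin{vmatrix}m_{11}&m_{12}\\ m_{21}&m_{22}\end{vmatrix}(w_{2,M}dw_{1,M}-w_{1,M}dw_{2,M})\right)\wedge d\zeta_1\wedge d\zeta_2 .$$ This is a nowhere-vanishing 3-form on $\mathcal{S}$, so $\nu_M=\tau(\nu_M)\,|\nu_M|$ with $\tau(\nu_M)$ a unimodular function and $|\nu_M|$ a positive 3-form ($\mathcal{S}$ oriented as the boundary of $\Omega$), viewed as a measure; $\perp$ is taken in $L^2(\mathcal{S},|\nu_M|)$. Strong $\mathbb{C}$-convexity: a connected smooth strongly pseudoconvex real hypersurface is strongly $\mathbb{C}$-convex if for each of its points $p$, after an automorphism of $\mathbb{C}\mathbb{P}^2$ moving $p$ to $0$ and putting the hypersurface near $0$ in the form $\operatorname{Im}\zeta_2=\alpha|\zeta_1|^2+\operatorname{Re}(b\zeta_1^2)+c(\operatorname{Re}\zeta_2)^2+O(\|(\zeta_1,\operatorname{Re}\zeta_2)\|^3)$ (always possible), the form $\alpha|\zeta_1|^2+\operatorname{Re}(b\zeta_1^2)$ is positive definite in $\zeta_1$. Leray transform: for $z\in\Omega$, $\mathbf{L}_{\mathcal{S}}f(z)=\int_{\mathcal{S}}f(\zeta)\frac{1}{(2\pi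 i)^2}\frac{\partial\rho(\zeta)\wedge\bar\partial\partial\rho(\zeta)}{\langle\partial\rho(\zeta),\zeta-z\rangle^2}$. By a theorem of Lanzani and Stein (taken as known), taking boundary values this defines (by extension from, e.g., $C^1$ functions) a bounded projection $\mathbf{L}_{\mathcal{S}}$ on $L^2(\mathcal{S},|\nu_M|)$ with range the Hardy space $H^2(\mathcal{S})$ of $L^2$ boundary values of holomorphic functions on $\Omega$. The same applies to every compact strongly $\mathbb{C}$-convex hypersurface. Dual objects: it is known that $w_M$ is a diffeomorphism from $\mathcal{S}$ onto a compact strongly $\mathbb{C}$-convex hypersurface $\mathcal{S}_{\mathsf{dual}}$ bounding a domain $\Omega_{\mathsf{dual}}\subset\mathbb{C}^2$. The projective dual Hardy space is the pullback $H^2_{\mathsf{dual}}(\mathcal{S}):=w_M^*\big(H^2(\mathcal{S}_{\mathsf{dual}})\big)=\{F\circ w_M:F\in H^2(\mathcal{S}_{\mathsf{dual}})\}$, where $H^2(\mathcal{S}_{\mathsf{dual}})$ is the Hardy space of $L^2$ boundary values of holomorphic functions on $\Omega_{\mathsf{dual}}$. *)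

theory Defs
  imports "HOL-Analysis.Analysis"
begin

type_synonym C2 = "complex ^ 2"

section \<open>Smooth and holomorphic functions\<close>

primrec Ck_on :: "nat \<Rightarrow> ('a::euclidean_space \<Rightarrow> 'b::real_normed_vector) \<Rightarrow> 'a set \<Rightarrow> bool" where
  "Ck_on 0 f U \<longleftrightarrow> continuous_on U f"
| "Ck_on (Suc k) f U \<longleftrightarrow> (\<forall>x\<in>U. f differentiable (at x)) \<and>
     (\<forall>v. Ck_on k (\<lambda>x. frechet_derivative f (at x) v) U)"

definition smooth_on :: "('a::euclidean_space \<Rightarrow> 'b::real_normed_vector) \<Rightarrow> 'a set \<Rightarrow> bool" where
  "smooth_on f U \<longleftrightarrow> (\<forall>k. Ck_on k f U)"

definition C1_function :: "C2 set \<Rightarrow> (C2 \<Rightarrow> complex) \<Rightarrow> bool" where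
  "C1_function S f \<longleftrightarrow> (\<exists>U F. open U \<and> S \<subseteq> U \<and> Ck_on 1 F U \<and> (\<forall>\<zeta>\<in>S. F \<zeta> = f \<zeta>))"

definition holomorphic2_on :: "(C2 \<Rightarrow> complex) \<Rightarrow> C2 set \<Rightarrow> bool" where
  "holomorphic2_on F \<Omega> \<longleftrightarrow>
     (\<forall>z\<in>\<Omega>. \<exists>D. (F has_derivative D) (at z) \<and> (\<forall>c v. D (c *s v) = c * D v))"

definition diffeomorphism_on :: "(C2 \<Rightarrow> C2) \<Rightarrow> C2 set \<Rightarrow> C2 set \<Rightarrow> bool" where
  "diffeomorphism_on f S T \<longleftrightarrow> f ` S = T \<and>
     (\<exists>U F. open U \<and> S \<subseteq> U \<and> smooth_on F U \<and> (\<forall>\<zeta>\<in>S. F \<zeta> = f \<zeta>)) \<and>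
     (\<exists>V G. open V \<and> T \<subseteq> V \<and> smooth_on G V \<and> (\<forall>\<zeta>\<in>S. G (f \<zeta>) = \<zeta>))"

definition d_zeta :: "2 \<Rightarrow> (C2 \<Rightarrow> complex) \<Rightarrow> C2 \<Rightarrow> complex" where
  "d_zeta j f \<zeta> = (frechet_derivative f (at \<zeta>) (axis j 1)
                   - \<i> * frechet_derivative f (at \<zeta>) (axis j \<i>)) / 2"

definition d_zetabar :: "2 \<Rightarrow> (C2 \<Rightarrow> complex) \<Rightarrow> C2 \<Rightarrow> complex" where
  "d_zetabar j f \<zeta> = (frechet_derivative f (at \<zeta>) (axis j 1)
                   + \<i> * frechet_derivative f (at \<zeta>) (axis j \<i>)) / 2"

definition d_rho :: "(C2 \<Rightarrow> real) \<Rightarrow> 2 \<Rightarrow> C2 \<Rightarrow> complex" where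
  "d_rho \<rho> j = d_zeta j (\<lambda>\<zeta>. complex_of_real (\<rho> \<zeta>))"

definition levi_coeff :: "(C2 \<Rightarrow> real) \<Rightarrow> 2 \<Rightarrow> 2 \<Rightarrow> C2 \<Rightarrow> complex" where
  "levi_coeff \<rho> j k = d_zetabar k (d_rho \<rho> j)"

definition grad :: "(C2 \<Rightarrow> real) \<Rightarrow> C2 \<Rightarrow> C2" where
  "grad \<rho> \<zeta> = (\<Sum>e\<in>Basis. frechet_derivative \<rho> (at \<zeta>) e *\<^sub>R e)"


section \<open>Smooth hypersurfaces bounding a domain\<close>

definition defining_function :: "(C2 \<Rightarrow> real) \<Rightarrow> C2 set \<Rightarrow> C2 set \<Rightarrow> bool" where
  "defining_function \<rho> S \<Omega> \<longleftrightarrow>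
     (\<exists>U. open U \<and> S \<subseteq> U \<and> smooth_on \<rho> U \<and>
          S = {\<zeta>\<in>U. \<rho> \<zeta> = 0} \<and> \<Omega> \<inter> U = {\<zeta>\<in>U. \<rho> \<zeta> < 0} \<and>
          (\<forall>\<zeta>\<in>S. grad \<rho> \<zeta> \<noteq> 0))"

definition bounds_domain :: "C2 set \<Rightarrow> C2 set \<Rightarrow> bool" where
  "bounds_domain S \<Omega> \<longleftrightarrow>
     open \<Omega> \<and> connected \<Omega> \<and> \<Omega> \<noteq> {} \<and> bounded \<Omega> \<and> frontier \<Omega> = S"

(* The value does not depend on the defining function. *)
definition outer_normal :: "C2 set \<Rightarrow> C2 set \<Rightarrow> C2 \<Rightarrow> C2" where
  "outer_normal S \<Omega> \<zeta> = (THE n. \<exists>\<rho>. defining_function \<rho> S \<Omega> \<and> n = sgn (grad \<rho> \<zeta>))"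

definition strongly_pseudoconvex :: "(C2 \<Rightarrow> real) \<Rightarrow> C2 set \<Rightarrow> bool" where
  "strongly_pseudoconvex \<rho> S \<longleftrightarrow>
     (\<forall>\<zeta>\<in>S. \<forall>t::C2. t \<noteq> 0 \<longrightarrow> (\<Sum>j\<in>UNIV. d_rho \<rho> j \<zeta> * t $ j) = 0 \<longrightarrow>
        Re (\<Sum>j\<in>UNIV. \<Sum>k\<in>UNIV. levi_coeff \<rho> j k \<zeta> * t $ j * cnj (t $ k)) > 0)"

definition homog :: "C2 \<Rightarrow> complex ^ 3" where
  "homog z = vector [1, z $ 1, z $ 2]"

(* Image of a subset of the affine chart [1 : z1 : z2] of CP^2 under the automorphism given
   by an invertible matrix A, intersected with the same chart. *)
definition projective_image :: "complex ^ 3 ^ 3 \<Rightarrow> C2 set \<Rightarrow> C2 set" where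
  "projective_image A S =
     {vector [(A *v homog z) $ 2 / (A *v homog z) $ 1, (A *v homog z) $ 3 / (A *v homog z) $ 1]
      | z. z \<in> S \<and> (A *v homog z) $ 1 \<noteq> 0}"

definition quadratic_normal_form :: "C2 set \<Rightarrow> real \<Rightarrow> complex \<Rightarrow> real \<Rightarrow> bool" where
  "quadratic_normal_form T \<alpha> b c \<longleftrightarrow>
     (\<exists>N (R :: complex \<times> real \<Rightarrow> real) C. open N \<and> (0::C2) \<in> N \<and>
        (\<forall>\<zeta>\<in>N. \<bar>R (\<zeta> $ 1, Re (\<zeta> $ 2))\<bar> \<le> C * norm (\<zeta> $ 1, Re (\<zeta> $ 2)) ^ 3) \<and>
        N \<inter> T = {\<zeta>\<in>N. Im (\<zeta> $ 2) =
           \<alpha> * (cmod (\<zeta> $ 1))\<^sup>2 + Re (b * (\<zeta> $ 1)\<^sup>2) + c * (Re (\<zeta> $ 2))\<^sup>2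
           + R (\<zeta> $ 1, Re (\<zeta> $ 2))})"

(* The automorphism is existentially quantified: composing with (z1, z2) -> (z1, -z2) changes
   the sign of the quadratic form, so only the existential reading is meaningful. *)
definition strongly_C_convex :: "(C2 \<Rightarrow> real) \<Rightarrow> C2 set \<Rightarrow> bool" where
  "strongly_C_convex \<rho> S \<longleftrightarrow>
     connected S \<and> strongly_pseudoconvex \<rho> S \<and>
     (\<forall>p\<in>S. \<exists>A :: complex ^ 3 ^ 3. \<exists>\<alpha> b c.
        invertible A \<and> (A *v homog p) $ 2 = 0 \<and> (A *v homog p) $ 3 = 0 \<and>
        quadratic_normal_form (projective_image A S) \<alpha> b c \<and>
        (\<forall>\<zeta>\<^sub>1. \<zeta>\<^sub>1 \<noteq> 0 \<longrightarrow> \<alpha> * (cmod \<zeta>\<^sub>1)\<^sup>2 + Re (b * \<zeta>\<^sub>1\<^sup>2) > 0))"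

definition strongly_C_convex_boundary :: "(C2 \<Rightarrow> real) \<Rightarrow> C2 set \<Rightarrow> C2 set \<Rightarrow> bool" where
  "strongly_C_convex_boundary \<rho> S \<Omega> \<longleftrightarrow>
     compact S \<and> bounds_domain S \<Omega> \<and> defining_function \<rho> S \<Omega> \<and> strongly_C_convex \<rho> S"


section \<open>Surface measure and 3-forms\<close>

definition hypersurface_chart :: "C2 set \<Rightarrow> (real ^ 3) set \<Rightarrow> (real ^ 3 \<Rightarrow> C2) \<Rightarrow> bool" where
  "hypersurface_chart S V \<phi> \<longleftrightarrow>
     open V \<and> smooth_on \<phi> V \<and> (\<forall>x\<in>V. inj (frechet_derivative \<phi> (at x))) \<and>
     openin (top_of_set S) (\<phi> ` V) \<and> (\<exists>\<psi>. homeomorphism V (\<phi> ` V) \<phi> \<psi>)"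

definition area_factor :: "(real ^ 3 \<Rightarrow> C2) \<Rightarrow> real ^ 3 \<Rightarrow> real" where
  "area_factor \<phi> x = sqrt (det (\<chi> i j.
     frechet_derivative \<phi> (at x) (axis i 1) \<bullet> frechet_derivative \<phi> (at x) (axis j 1)) :: real)"

definition surface_measure :: "C2 set \<Rightarrow> C2 measure" where
  "surface_measure S = (THE \<sigma>. sets \<sigma> = sets (restrict_space borel S) \<and>
     (\<forall>V \<phi>. hypersurface_chart S V \<phi> \<longrightarrow> (\<forall>A\<in>sets \<sigma>. A \<subseteq> \<phi> ` V \<longrightarrow>
        emeasure \<sigma> A =
          (\<integral>\<^sup>+x. ennreal (area_factor \<phi> x) * indicator {x\<in>V. \<phi> x \<in> A} x \<partial>lborel))))"

type_synonym form1 = "C2 \<Rightarrow> complex"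
type_synonym form3 = "C2 \<Rightarrow> C2 \<Rightarrow> C2 \<Rightarrow> complex"

definition wedge3 :: "form1 \<Rightarrow> form1 \<Rightarrow> form1 \<Rightarrow> form3" where
  "wedge3 \<alpha> \<beta> \<gamma> u v w =
     det (vector [vector [\<alpha> u, \<alpha> v, \<alpha> w], vector [\<beta> u, \<beta> v, \<beta> w], vector [\<gamma> u, \<gamma> v, \<gamma> w]]
          :: complex ^ 3 ^ 3)"

definition dzeta :: "2 \<Rightarrow> form1" where "dzeta j v = v $ j"

definition dzetabar :: "2 \<Rightarrow> form1" where "dzetabar j v = cnj (v $ j)"

definition real_coords :: "C2 \<Rightarrow> real ^ 4" where
  "real_coords v = vector [Re (v $ 1), Im (v $ 1), Re (v $ 2), Im (v $ 2)]"

(* Positively oriented orthonormal bases of the tangent space; S is oriented as the boundary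
   of the domain (outward normal first). *)
definition oriented_frame :: "C2 set \<Rightarrow> C2 set \<Rightarrow> C2 \<Rightarrow> C2 \<times> C2 \<times> C2 \<Rightarrow> bool" where
  "oriented_frame S \<Omega> \<zeta> = (\<lambda>(e\<^sub>1, e\<^sub>2, e\<^sub>3).
     let n = outer_normal S \<Omega> \<zeta> in
     norm e\<^sub>1 = 1 \<and> norm e\<^sub>2 = 1 \<and> norm e\<^sub>3 = 1 \<and>
     e\<^sub>1 \<bullet> e\<^sub>2 = 0 \<and> e\<^sub>1 \<bullet> e\<^sub>3 = 0 \<and> e\<^sub>2 \<bullet> e\<^sub>3 = 0 \<and>
     e\<^sub>1 \<bullet> n = 0 \<and> e\<^sub>2 \<bullet> n = 0 \<and> e\<^sub>3 \<bullet> n = 0 \<and>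
     det (vector [real_coords n, real_coords e\<^sub>1, real_coords e\<^sub>2, real_coords e\<^sub>3]
          :: real ^ 4 ^ 4) > 0)"

(* The density of a 3-form on S with respect to the volume form of S. *)
definition form_density :: "C2 set \<Rightarrow> C2 set \<Rightarrow> (C2 \<Rightarrow> form3) \<Rightarrow> C2 \<Rightarrow> complex" where
  "form_density S \<Omega> \<omega> \<zeta> =
     (case SOME e. oriented_frame S \<Omega> \<zeta> e of (e\<^sub>1, e\<^sub>2, e\<^sub>3) \<Rightarrow> \<omega> \<zeta> e\<^sub>1 e\<^sub>2 e\<^sub>3)"

definition form_integral :: "C2 set \<Rightarrow> C2 set \<Rightarrow> (C2 \<Rightarrow> form3) \<Rightarrow> complex" where
  "form_integral S \<Omega> \<omega> = (\<integral>\<zeta>. form_density S \<Omega> \<omega> \<zeta> \<partial>surface_measure S)"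


section \<open>Function spaces\<close>

definition L2 :: "C2 measure \<Rightarrow> (C2 \<Rightarrow> complex) set" where
  "L2 \<mu> = {f \<in> borel_measurable \<mu>. integrable \<mu> (\<lambda>\<zeta>. (cmod (f \<zeta>))\<^sup>2)}"

definition ae_class :: "C2 measure \<Rightarrow> (C2 \<Rightarrow> complex) \<Rightarrow> (C2 \<Rightarrow> complex) set" where
  "ae_class \<mu> f = {g \<in> borel_measurable \<mu>. AE \<zeta> in \<mu>. g \<zeta> = f \<zeta>}"

definition L2_normsq :: "C2 measure \<Rightarrow> (C2 \<Rightarrow> complex) \<Rightarrow> ennreal" where
  "L2_normsq \<mu> f = (\<integral>\<^sup>+\<zeta>. ennreal ((cmod (f \<zeta>))\<^sup>2) \<partial>\<mu>)"

definition orthogonal_complement ::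
  "C2 measure \<Rightarrow> (C2 \<Rightarrow> complex) set \<Rightarrow> (C2 \<Rightarrow> complex) set" where
  "orthogonal_complement \<mu> K = {h \<in> L2 \<mu>. \<forall>k\<in>K. (\<integral>\<zeta>. h \<zeta> * cnj (k \<zeta>) \<partial>\<mu>) = 0}"

(* Boundary values are limits in L^2 of translates along the inward normal. *)
definition hardy_space :: "C2 set \<Rightarrow> C2 set \<Rightarrow> (C2 \<Rightarrow> complex) set" where
  "hardy_space S \<Omega> = {f \<in> L2 (surface_measure S). \<exists>F. holomorphic2_on F \<Omega> \<and>
     ((\<lambda>\<epsilon>. L2_normsq (surface_measure S)
              (\<lambda>\<zeta>. F (\<zeta> - \<epsilon> *\<^sub>R outer_normal S \<Omega> \<zeta>) - f \<zeta>)) \<longlongrightarrow> 0) (at_right 0)}"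


section \<open>The Leray transform\<close>

(* The form d' rho wedge d'' d' rho, where d'' d' rho is the sum over j, k of
   (d^2 rho / d zeta_j d zetabar_k) dzetabar_k wedge dzeta_j. *)
definition leray_form :: "(C2 \<Rightarrow> real) \<Rightarrow> C2 \<Rightarrow> form3" where
  "leray_form \<rho> \<zeta> u v w = (\<Sum>i\<in>UNIV. \<Sum>j\<in>UNIV. \<Sum>k\<in>UNIV.
     d_rho \<rho> i \<zeta> * levi_coeff \<rho> j k \<zeta> * wedge3 (dzeta i) (dzetabar k) (dzeta j) u v w)"

definition leray :: "(C2 \<Rightarrow> real) \<Rightarrow> C2 set \<Rightarrow> C2 set \<Rightarrow> (C2 \<Rightarrow> complex) \<Rightarrow> C2 \<Rightarrow> complex" where
  "leray \<rho> S \<Omega> f z = form_integral S \<Omega> (\<lambda>\<zeta> u v w.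
     f \<zeta> * (1 / (2 * complex_of_real pi * \<i>)\<^sup>2) * leray_form \<rho> \<zeta> u v w
         / (\<Sum>j\<in>UNIV. d_rho \<rho> j \<zeta> * (\<zeta> $ j - z $ j))\<^sup>2)"

definition leray_boundary ::
  "(C2 \<Rightarrow> real) \<Rightarrow> C2 set \<Rightarrow> C2 set \<Rightarrow> (C2 \<Rightarrow> complex) \<Rightarrow> C2 \<Rightarrow> complex" where
  "leray_boundary \<rho> S \<Omega> f \<zeta> = Lim (at \<zeta> within \<Omega>) (leray \<rho> S \<Omega> f)"

(* The graph of the Leray operator on L^2: the L^2-closure of the graph of
   the boundary-value operator on functions of class C^1. *)
definition leray_graph ::
  "(C2 \<Rightarrow> real) \<Rightarrow> C2 set \<Rightarrow> C2 set \<Rightarrow> C2 measure \<Rightarrow> (C2 \<Rightarrow> complex) \<Rightarrow> (C2 \<Rightarrow> complex) \<Rightarrow> bool" where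
  "leray_graph \<rho> S \<Omega> \<mu> f g \<longleftrightarrow> f \<in> L2 \<mu> \<and> g \<in> L2 \<mu> \<and>
     (\<exists>\<phi> :: nat \<Rightarrow> C2 \<Rightarrow> complex. (\<forall>n. C1_function S (\<phi> n)) \<and>
        (\<lambda>n. L2_normsq \<mu> (\<lambda>\<zeta>. \<phi> n \<zeta> - f \<zeta>)) \<longlonglongrightarrow> 0 \<and>
        (\<lambda>n. L2_normsq \<mu> (\<lambda>\<zeta>. leray_boundary \<rho> S \<Omega> (\<phi> n) \<zeta> - g \<zeta>)) \<longlonglongrightarrow> 0)"

definition leray_kernel ::
  "(C2 \<Rightarrow> real) \<Rightarrow> C2 set \<Rightarrow> C2 set \<Rightarrow> C2 measure \<Rightarrow> (C2 \<Rightarrow> complex) set" where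
  "leray_kernel \<rho> S \<Omega> \<mu> = {f. leray_graph \<rho> S \<Omega> \<mu> f (\<lambda>_. 0)}"

(* The theorem of Lanzani and Stein: on a compact strongly C-convex hypersurface, boundary
   values of the Leray transform define a bounded projection of L^2 onto the Hardy space, for
   every measure with continuous positive density with respect to surface measure.
   The bound makes the (linear) relation leray_graph single-valued modulo null functions. *)
definition Lanzani_Stein_theorem :: bool where
  "Lanzani_Stein_theorem \<longleftrightarrow> (\<forall>\<rho> S \<Omega> q.
     strongly_C_convex_boundary \<rho> S \<Omega> \<and> continuous_on S q \<and> (\<forall>\<zeta>\<in>S. q \<zeta> > 0) \<longrightarrow>
     (let \<mu> = density (surface_measure S) (\<lambda>\<zeta>. ennreal (q \<zeta>)) in
        (\<forall>f. C1_function S f \<longrightarrow> (\<forall>\<zeta>\<in>S. \<exists>l. (leray \<rho> S \<Omega> f \<longlongrightarrow> l) (at \<zeta> within \<Omega>))) \<and>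
        (\<forall>f\<in>L2 \<mu>. \<exists>g. leray_graph \<rho> S \<Omega> \<mu> f g) \<and>
        (\<exists>C::real. \<forall>f g. leray_graph \<rho> S \<Omega> \<mu> f g \<longrightarrow> L2_normsq \<mu> g \<le> ennreal C * L2_normsq \<mu> f) \<and>
        (\<forall>f g. leray_graph \<rho> S \<Omega> \<mu> f g \<longrightarrow> leray_graph \<rho> S \<Omega> \<mu> g g) \<and>
        {g. \<exists>f. leray_graph \<rho> S \<Omega> \<mu> f g} = hardy_space S \<Omega>))"


section \<open>The pairing given by M and projective duality\<close>

definition Phi :: "complex ^ 3 ^ 3 \<Rightarrow> C2 \<Rightarrow> C2 \<Rightarrow> complex" where
  "Phi M z w = (\<Sum>i\<in>UNIV. homog w $ i * (M *v homog z) $ i)"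

abbreviation "a\<^sub>1 M \<equiv> M $ 1 $ 2"
abbreviation "a\<^sub>2 M \<equiv> M $ 1 $ 3"
abbreviation "b\<^sub>1 M \<equiv> M $ 2 $ 1"
abbreviation "b\<^sub>2 M \<equiv> M $ 3 $ 1"
abbreviation "m\<^sub>1\<^sub>1 M \<equiv> M $ 2 $ 2"
abbreviation "m\<^sub>1\<^sub>2 M \<equiv> M $ 2 $ 3"
abbreviation "m\<^sub>2\<^sub>1 M \<equiv> M $ 3 $ 2"
abbreviation "m\<^sub>2\<^sub>2 M \<equiv> M $ 3 $ 3"

definition M_admissible :: "complex ^ 3 ^ 3 \<Rightarrow> (C2 \<Rightarrow> real) \<Rightarrow> C2 set \<Rightarrow> bool" where
  "M_admissible M \<rho> S \<longleftrightarrow> (\<forall>\<zeta>\<in>S.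
     let \<mu>\<^sub>1 = d_rho \<rho> 2 \<zeta>; \<mu>\<^sub>2 = - d_rho \<rho> 1 \<zeta> in
     det (vector
       [vector [m\<^sub>1\<^sub>1 M * \<mu>\<^sub>1 + m\<^sub>1\<^sub>2 M * \<mu>\<^sub>2, m\<^sub>1\<^sub>1 M * \<zeta> $ 1 + m\<^sub>1\<^sub>2 M * \<zeta> $ 2 + b\<^sub>1 M],
        vector [m\<^sub>2\<^sub>1 M * \<mu>\<^sub>1 + m\<^sub>2\<^sub>2 M * \<mu>\<^sub>2, m\<^sub>2\<^sub>1 M * \<zeta> $ 1 + m\<^sub>2\<^sub>2 M * \<zeta> $ 2 + b\<^sub>2 M]]
       :: complex ^ 2 ^ 2) \<noteq> 0)"

definition complex_tangent_line :: "(C2 \<Rightarrow> real) \<Rightarrow> C2 \<Rightarrow> C2 set" where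
  "complex_tangent_line \<rho> \<zeta> = {z. (\<Sum>j\<in>UNIV. d_rho \<rho> j \<zeta> * (z $ j - \<zeta> $ j)) = 0}"

definition w_map :: "complex ^ 3 ^ 3 \<Rightarrow> (C2 \<Rightarrow> real) \<Rightarrow> C2 \<Rightarrow> C2" where
  "w_map M \<rho> \<zeta> = (THE w. complex_tangent_line \<rho> \<zeta> = {z. Phi M z w = 0})"

(* The derivative within S is determined on the tangent space of S only; form_density
   evaluates it there. *)
definition dw :: "complex ^ 3 ^ 3 \<Rightarrow> (C2 \<Rightarrow> real) \<Rightarrow> C2 set \<Rightarrow> 2 \<Rightarrow> C2 \<Rightarrow> form1" where
  "dw M \<rho> S j \<zeta> v = frechet_derivative (w_map M \<rho>) (at \<zeta> within S) v $ j"

definition nu_form :: "complex ^ 3 ^ 3 \<Rightarrow> (C2 \<Rightarrow> real) \<Rightarrow> C2 set \<Rightarrow> C2 \<Rightarrow> form3" where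
  "nu_form M \<rho> S \<zeta> u v w = 1 / (2 * complex_of_real pi * \<i>)\<^sup>2 *
     wedge3 (\<lambda>t. dw M \<rho> S 1 \<zeta> t * (m\<^sub>1\<^sub>1 M * a\<^sub>2 M - m\<^sub>1\<^sub>2 M * a\<^sub>1 M)
               + dw M \<rho> S 2 \<zeta> t * (m\<^sub>2\<^sub>1 M * a\<^sub>2 M - m\<^sub>2\<^sub>2 M * a\<^sub>1 M)
               + (m\<^sub>1\<^sub>1 M * m\<^sub>2\<^sub>2 M - m\<^sub>1\<^sub>2 M * m\<^sub>2\<^sub>1 M) *
                   (w_map M \<rho> \<zeta> $ 2 * dw M \<rho> S 1 \<zeta> t - w_map M \<rho> \<zeta> $ 1 * dw M \<rho> S 2 \<zeta> t))
            (dzeta 1) (dzeta 2) u v w"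

definition nu_measure :: "complex ^ 3 ^ 3 \<Rightarrow> (C2 \<Rightarrow> real) \<Rightarrow> C2 set \<Rightarrow> C2 set \<Rightarrow> C2 measure" where
  "nu_measure M \<rho> S \<Omega> =
     density (surface_measure S) (\<lambda>\<zeta>. ennreal (cmod (form_density S \<Omega> (nu_form M \<rho> S) \<zeta>)))"

definition tau :: "complex ^ 3 ^ 3 \<Rightarrow> (C2 \<Rightarrow> real) \<Rightarrow> C2 set \<Rightarrow> C2 set \<Rightarrow> C2 \<Rightarrow> complex" where
  "tau M \<rho> S \<Omega> \<zeta> = sgn (form_density S \<Omega> (nu_form M \<rho> S) \<zeta>)"

definition dual_surface :: "complex ^ 3 ^ 3 \<Rightarrow> (C2 \<Rightarrow> real) \<Rightarrow> C2 set \<Rightarrow> C2 set" where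
  "dual_surface M \<rho> S = w_map M \<rho> ` S"

definition dual_domain :: "complex ^ 3 ^ 3 \<Rightarrow> (C2 \<Rightarrow> real) \<Rightarrow> C2 set \<Rightarrow> C2 set" where
  "dual_domain M \<rho> S = (THE \<Omega>'. bounds_domain (dual_surface M \<rho> S) \<Omega>')"

(* The known duality theorem for strongly C-convex hypersurfaces. *)
definition Projective_duality_theorem :: bool where
  "Projective_duality_theorem \<longleftrightarrow> (\<forall>M \<rho> S \<Omega>.
     invertible M \<and> strongly_C_convex_boundary \<rho> S \<Omega> \<and> M_admissible M \<rho> S \<longrightarrow>
     diffeomorphism_on (w_map M \<rho>) S (dual_surface M \<rho> S) \<and>
     (\<exists>\<rho>'. strongly_C_convex_boundary \<rho>' (dual_surface M \<rho> S) (dual_domain M \<rho> S)))"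

definition hardy_dual :: "complex ^ 3 ^ 3 \<Rightarrow> (C2 \<Rightarrow> real) \<Rightarrow> C2 set \<Rightarrow> (C2 \<Rightarrow> complex) set" where
  "hardy_dual M \<rho> S =
     {F \<circ> w_map M \<rho> | F. F \<in> hardy_space (dual_surface M \<rho> S) (dual_domain M \<rho> S)}"

definition W_space ::
  "complex ^ 3 ^ 3 \<Rightarrow> (C2 \<Rightarrow> real) \<Rightarrow> C2 set \<Rightarrow> C2 set \<Rightarrow> (C2 \<Rightarrow> complex) set" where
  "W_space M \<rho> S \<Omega> =
     {(\<lambda>\<zeta>. tau M \<rho> S \<Omega> \<zeta> * h \<zeta>) | h.
        h \<in> orthogonal_complement (nu_measure M \<rho> S \<Omega>)
               (leray_kernel \<rho> S \<Omega> (nu_measure M \<rho> S \<Omega>))}"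

definition conjugate_space :: "(C2 \<Rightarrow> complex) set \<Rightarrow> (C2 \<Rightarrow> complex) set" where
  "conjugate_space W = {(\<lambda>\<zeta>. cnj (f \<zeta>)) | f. f \<in> W}"

end

theory Submission
  imports Defs
begin

text \<open>
The vector \<open>th(w(p))\<close> of the coefficients of \<open>z\<close> in \<open>\<Phi>(z, w(p))\<close> is proportional to \<open>\<partial>\<rho>\<close> at \<open>p\<close>, so
\<open>\<Phi>(z, w(p)) = th(w(p)) (z - p)\<close> and \<open>L f(z) = \<integral> f(p) \<Phi>(z, w(p))\<^sup>-\<^sup>2 \<nu>(p)\<close>. The form \<open>\<nu>\<close> of the dual hypersurface
pulls back to \<open>\<nu>\<close> up to sign, so the dual Leray transform is integration against the same kernel, now in the
other variable. Let \<open>B(f, g) = \<integral> f g \<nu>\<close>, and let \<open>P\<close>, \<open>Q\<close> be the Leray projection and the dual one pulled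
back to \<open>S\<close>; the claim is that the \<open>B\<close>-annihilator of \<open>ker P\<close> is \<open>ran Q\<close>. Since \<open>\<Phi>(z, w(p)) \<noteq> 0\<close> for
\<open>z \<in> \<Omega>\<close>, the kernel functions \<open>p \<mapsto> \<Phi>(z, w(p))\<^sup>-\<^sup>2\<close> lie in \<open>ran Q\<close>, and symmetrically for \<open>P\<close>. If \<open>u\<close> is
\<open>B\<close>-orthogonal to all of them then \<open>P u = 0\<close>: the Leray integrals of \<open>C\<^sup>1\<close> approximants of \<open>u\<close> tend to 0 in
\<open>\<Omega>\<close>, and integrals of \<open>|F|\<^sup>2\<close> over boundary layers, which by subharmonicity do not decrease as the layers
approach \<open>S\<close>, carry this over to the boundary values. The annihilator identity is then Riesz representation.
\<close>

section \<open>Calculus of continuously differentiable functions\<close>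

text \<open>That \<open>Phi\<close> has no zero for z in \<Omega> is a global fact. The points lying
  on some complex tangent line form a closed set, which is open away from S since the incidence
  equation is submersive there; on each of the connected sets \<Omega> and exterior it is therefore
  all or nothing. A point on no tangent line exists by an extremal argument, and it cannot lie in
  the exterior, because a tangent line leaves every bounded set. The other obstacle is that on L^2
  the Leray operator exists only as a closure of its restriction to C^1 functions, up to null
  functions. Operators are therefore relations, and vanishing of all integrals inside \<Omega> says
  nothing directly about boundary values. Two comparisons for |F|^2 bridge the gap: layers of
  different depth through Green's identity, where the factor exp(K \<rho>) |grad \<rho>|^2 absorbs
  the Laplacian of \<rho>, and thin layers with S through Fubini along straight segments transversal
  to S. Symmetry of the data under exchange of the two hypersurfaces, with M transposed, halves the
  work.\<close>

lemmas has_derivative_vec_nth = bounded_linear.has_derivative[OF bounded_linear_vec_nth]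

text \<open>\<open>frechet_derivative\<close> depends on the function near the point, so agreement
  on U passes to derivatives because U is open.\<close>

lemma Ck_on_cong:
  assumes "open U" "\<And>x. x \<in> U \<Longrightarrow> f x = g x" "Ck_on k f U"
  shows "Ck_on k g U" using assms(2,3)
proof (induction k arbitrary: f g)
  case 0
  then show ?case by (simp cong: continuous_on_cong)
next
  case (Suc k)
  have D: "(g has_derivative frechet_derivative f (at x)) (at x)" if "x \<in> U" for x
    using Suc.prems that frechet_derivative_works has_derivative_transform_within_open[OF _ assms(1) that]
    by (metis (no_types, lifting) Ck_on.simps(2))
  have E: "frechet_derivative f (at x) = frechet_derivative g (at x)" if "x \<in> U" for x
    using frechet_derivative_at[OF D[OF that]] .
  have "Ck_on k (\<lambda>x. frechet_derivative g (at x) v) U" for v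
  proof (rule Suc.IH)
    show "frechet_derivative f (at x) v = frechet_derivative g (at x) v" if "x \<in> U" for x using E[OF that] by simp
    show "Ck_on k (\<lambda>x. frechet_derivative f (at x) v) U" using Suc.prems(2) by simp
  qed
  then show ?case using D unfolding Ck_on.simps differentiable_def by blast
qed

text \<open>Replaces the choice hidden in \<open>frechet_derivative\<close> by an explicit
  derivative \<open>D\<close>; the closure properties below are inductions through this
  rule.\<close>

lemma Ck_on_SucI:
  assumes "open U" "\<And>x. x \<in> U \<Longrightarrow> (f has_derivative D x) (at x)" "\<And>v. Ck_on k (\<lambda>x. D x v) U"
  shows "Ck_on (Suc k) f U"
proof -
  have E: "D x = frechet_derivative f (at x)" if "x \<in> U" for x using frechet_derivative_at[OF assms(2)[OF that]] .
  have "Ck_on k (\<lambda>x. frechet_derivative f (at x) v) U" for v by (rule Ck_on_cong[OF assms(1) _ assms(3)[of v]]) (simp add: E)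
  then show ?thesis using assms(2) unfolding Ck_on.simps differentiable_def by blast
qed

lemma Ck_on_SucD:
  assumes "Ck_on (Suc k) f U"
  shows "x \<in> U \<Longrightarrow> (f has_derivative frechet_derivative f (at x)) (at x)"
    and "Ck_on k (\<lambda>x. frechet_derivative f (at x) v) U" using assms frechet_derivative_works by auto

lemma Ck_on_Suc_mono: "Ck_on (Suc k) f U \<Longrightarrow> Ck_on k f U"
proof (induction k arbitrary: f)
  case 0
  then show ?case by (auto simp: differentiable_imp_continuous_within intro!: continuous_at_imp_continuous_on)
next
  case (Suc k)
  then show ?case by (metis Ck_on.simps(2))
qed

lemma Ck_on_imp_continuous_on: "Ck_on k f U \<Longrightarrow> continuous_on U f" by (induction k) (use Ck_on_Suc_mono in auto)

lemma Ck_on_subset: "Ck_on k f U \<Longrightarrow> V \<subseteq> U \<Longrightarrow> Ck_on k f V" by (induction k arbitrary: f) (auto intro: continuous_on_subset)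

lemma Ck_on_const: "open U \<Longrightarrow> Ck_on k (\<lambda>x. c) U"
proof (induction k arbitrary: c)
  case (Suc k)
  show ?case by (rule Ck_on_SucI[OF Suc.prems has_derivative_const Suc.IH[OF Suc.prems]])
qed auto

lemma Ck_on_linear:
  assumes "open U" "bounded_linear L"
  shows "Ck_on k L U"
proof (cases k)
  case 0
  then show ?thesis using assms linear_continuous_on by auto
next
  case (Suc j)
  show ?thesis unfolding Suc
    by (rule Ck_on_SucI[OF assms(1) bounded_linear_imp_has_derivative[OF assms(2)] Ck_on_const[OF assms(1)]])
qed

lemma Ck_on_bounded_linear:
  assumes "open U" "bounded_linear L" "Ck_on k f U"
  shows "Ck_on k (\<lambda>x. L (f x)) U" using assms(3)
proof (induction k arbitrary: f)
  case 0
  then show ?case by (auto intro: bounded_linear.continuous_on[OF assms(2)])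
next
  case (Suc k)
  show ?case by (rule Ck_on_SucI[OF assms(1) bounded_linear.has_derivative[OF assms(2) Ck_on_SucD(1)[OF Suc.prems]]
            Suc.IH[OF Ck_on_SucD(2)[OF Suc.prems]]])
qed

lemma Ck_on_add:
  assumes "open U" "Ck_on k f U" "Ck_on k g U"
  shows "Ck_on k (\<lambda>x. f x + g x) U" using assms(2,3)
proof (induction k arbitrary: f g)
  case 0
  then show ?case by (auto intro: continuous_intros)
next
  case (Suc k)
  show ?case
    by (rule Ck_on_SucI[OF assms(1) has_derivative_add[OF Ck_on_SucD(1)[OF Suc.prems(1)] Ck_on_SucD(1)[OF Suc.prems(2)]]
          Suc.IH[OF Ck_on_SucD(2)[OF Suc.prems(1)] Ck_on_SucD(2)[OF Suc.prems(2)]]])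
qed

lemma Ck_on_minus: "open U \<Longrightarrow> Ck_on k f U \<Longrightarrow> Ck_on k (\<lambda>x. - f x) U"
  by (rule Ck_on_bounded_linear[where L=uminus]) (auto intro: bounded_linear_minus bounded_linear_ident)

lemma Ck_on_diff: "open U \<Longrightarrow> Ck_on k f U \<Longrightarrow> Ck_on k g U \<Longrightarrow> Ck_on k (\<lambda>x. f x - g x) U"
  using Ck_on_add[of U k f "\<lambda>x. - g x"] Ck_on_minus by auto

lemma Ck_on_sum:
  assumes "open U" "\<And>i. i \<in> I \<Longrightarrow> Ck_on k (f i) U"
  shows "Ck_on k (\<lambda>x. \<Sum>i\<in>I. f i x) U"
  using assms(2) by (induction I rule: infinite_finite_induct) (auto intro!: Ck_on_const Ck_on_add assms(1))

lemma Ck_on_bilinear: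
  assumes "open U" "bounded_bilinear B" "Ck_on k f U" "Ck_on k g U"
  shows "Ck_on k (\<lambda>x. B (f x) (g x)) U" using assms(3,4)
proof (induction k arbitrary: f g)
  case 0
  then show ?case by (auto intro: bounded_bilinear.continuous_on[OF assms(2)])
next
  case (Suc k)
  show ?case
    by (rule Ck_on_SucI[OF assms(1) bounded_bilinear.FDERIV[OF assms(2) Ck_on_SucD(1)[OF Suc.prems(1)] Ck_on_SucD(1)[OF Suc.prems(2)]]])
      (auto intro!: Ck_on_add assms(1) Suc.IH Ck_on_SucD(2)[OF Suc.prems(1)] Ck_on_SucD(2)[OF Suc.prems(2)]
          Ck_on_Suc_mono[OF Suc.prems(1)] Ck_on_Suc_mono[OF Suc.prems(2)])
qed

lemmas Ck_on_scaleR = Ck_on_bilinear[OF _ bounded_bilinear_scaleR]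
lemmas Ck_on_mult = Ck_on_bilinear[OF _ bounded_bilinear_mult]

lemma Ck_on_inverse:
  fixes f :: "'a::euclidean_space \<Rightarrow> 'b::real_normed_div_algebra"
  assumes "open U" "Ck_on k f U" "\<And>x. x \<in> U \<Longrightarrow> f x \<noteq> 0"
  shows "Ck_on k (\<lambda>x. inverse (f x)) U" using assms(2)
proof (induction k)
  case 0
  then show ?case using assms(3) by (auto intro: continuous_on_inverse)
next
  case (Suc k)
  note IH = Suc.IH[OF Ck_on_Suc_mono[OF Suc.prems]]
  show ?case by (rule Ck_on_SucI[OF assms(1) Deriv.has_derivative_inverse[OF assms(3) Ck_on_SucD(1)[OF Suc.prems]]])
      (auto intro!: Ck_on_minus Ck_on_mult assms(1) IH Ck_on_SucD(2)[OF Suc.prems])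
qed

lemma Ck_on_compose:
  fixes f :: "'b::euclidean_space \<Rightarrow> 'c::real_normed_vector" and g :: "'a::euclidean_space \<Rightarrow> 'b"
  assumes "open U" "Ck_on k g U" "open V" "Ck_on k f V" "\<And>x. x \<in> U \<Longrightarrow> g x \<in> V"
  shows "Ck_on k (\<lambda>x. f (g x)) U" using assms(2,4)
proof (induction k arbitrary: f)
  case 0
  then show ?case using assms(5) by (auto intro: continuous_on_compose2)
next
  case (Suc k)
  \<comment> \<open>\<open>Ck_on\<close> controls derivatives in fixed directions, whereas the chain
    rule applies the derivative of f in a direction that depends on x. Expanding in the basis makes
    the directions fixed.\<close>
  let ?D = "\<lambda>x v. \<Sum>b\<in>Basis. (frechet_derivative g (at x) v \<bullet> b) *\<^sub>R frechet_derivative f (at (g x)) b"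
  have D: "((\<lambda>x. f (g x)) has_derivative ?D x) (at x)" if "x \<in> U" for x
  proof -
    have f': "(f has_derivative frechet_derivative f (at (g x))) (at (g x))"
      using Ck_on_SucD(1)[OF Suc.prems(2)] assms(5)[OF that] by auto
    interpret f': linear "frechet_derivative f (at (g x))" using f' has_derivative_linear by blast
    have "((\<lambda>x. f (g x)) has_derivative (\<lambda>v. frechet_derivative f (at (g x)) (frechet_derivative g (at x) v))) (at x)"
      using has_derivative_compose[OF Ck_on_SucD(1)[OF Suc.prems(1) that] f'] .
    moreover have "frechet_derivative f (at (g x)) (frechet_derivative g (at x) v) = ?D x v" for v
      by (subst euclidean_representation[symmetric, of "frechet_derivative g (at x) v"])
        (simp only: f'.sum f'.scale)
    ultimately show ?thesis by simp
  qed
  have inn: "bounded_linear (\<lambda>y::'b. y \<bullet> b)" for b by (rule bounded_linear_inner_left)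
  have "Ck_on k (\<lambda>x. ?D x v) U" for v by (intro Ck_on_sum Ck_on_scaleR assms(1) Suc.IH[OF Ck_on_Suc_mono[OF Suc.prems(1)]]
        Ck_on_SucD(2)[OF Suc.prems(2)] Ck_on_bounded_linear[OF assms(1) inn Ck_on_SucD(2)[OF Suc.prems(1)]])
  then show ?case by (intro Ck_on_SucI[OF assms(1) D])
qed

lemma smooth_on_has_derivative:
  "smooth_on f U \<Longrightarrow> x \<in> U \<Longrightarrow> (f has_derivative frechet_derivative f (at x)) (at x)"
  unfolding smooth_on_def using Ck_on_SucD(1)[of 0] by blast

lemma smooth_on_frechet:
  "smooth_on f U \<Longrightarrow> smooth_on (\<lambda>x. frechet_derivative f (at x) v) U" unfolding smooth_on_def using Ck_on_SucD(2) by blast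

lemma smooth_on_continuous: "smooth_on f U \<Longrightarrow> continuous_on U f"
  unfolding smooth_on_def using Ck_on_imp_continuous_on by blast

lemma smooth_on_subset: "smooth_on f U \<Longrightarrow> V \<subseteq> U \<Longrightarrow> smooth_on f V" unfolding smooth_on_def using Ck_on_subset by blast

lemma smooth_on_compose:
  fixes f :: "'b::euclidean_space \<Rightarrow> 'c::real_normed_vector" and g :: "'a::euclidean_space \<Rightarrow> 'b"
  assumes "open U" "smooth_on g U" "open V" "smooth_on f V" "\<And>x. x \<in> U \<Longrightarrow> g x \<in> V"
  shows "smooth_on (\<lambda>x. f (g x)) U" using assms Ck_on_compose unfolding smooth_on_def by blast

lemma smooth_on_bounded_linear:
  "open U \<Longrightarrow> bounded_linear L \<Longrightarrow> smooth_on f U \<Longrightarrow> smooth_on (\<lambda>x. L (f x)) U"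
  unfolding smooth_on_def using Ck_on_bounded_linear by blast

lemma smooth_on_cong:
  "open U \<Longrightarrow> (\<And>x. x \<in> U \<Longrightarrow> f x = g x) \<Longrightarrow> smooth_on f U \<Longrightarrow> smooth_on g U" unfolding smooth_on_def using Ck_on_cong by blast

section \<open>Local coordinates of a hypersurface\<close>

text \<open>A linear map that permutes the standard basis up to sign takes boxes to boxes with the
  same side lengths, and boxes determine \<open>lborel\<close>. It identifies the measures of real^3
  x real and C^2 without a Jacobian.\<close>

lemma lborel_distr_signed_basis:
  fixes L :: "'a::euclidean_space \<Rightarrow> 'b::euclidean_space"
  assumes L: "linear L" and bij: "bij_betw c Basis Basis"
    and Li: "\<And>i. i \<in> Basis \<Longrightarrow> L i = s i *\<^sub>R c i"
    and s: "\<And>i. i \<in> Basis \<Longrightarrow> s i = 1 \<or> s i = (-1::real)"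
  shows "distr lborel lborel L = lborel"
proof -
  have coord: "L x \<bullet> c i = s i * (x \<bullet> i)" if "i \<in> Basis" for x i
  proof -
    interpret linear L by fact
    have "L x = (\<Sum>j\<in>Basis. (x \<bullet> j) *\<^sub>R (s j *\<^sub>R c j))"
      by (subst euclidean_representation[symmetric, of x]) (simp only: sum scale Li cong: sum.cong)
    then have "L x \<bullet> c i = (\<Sum>j\<in>Basis. (x \<bullet> j) * s j * (c j \<bullet> c i))" by (simp add: inner_sum_left ac_simps)
    also have "\<dots> = (\<Sum>j\<in>Basis. if j = i then (x \<bullet> j) * s j else 0)"
    proof (rule sum.cong)
      fix j :: 'a assume j: "j \<in> Basis"
      have "c j = c i \<longleftrightarrow> j = i" "c j \<in> Basis" "c i \<in> Basis" using bij j that by (auto simp: bij_betw_def inj_on_def)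
      then show "(x \<bullet> j) * s j * (c j \<bullet> c i) = (if j = i then (x \<bullet> j) * s j else 0)" by (auto simp: inner_Basis)
    qed simp
    also have "\<dots> = s i * (x \<bullet> i)" using that by (simp add: mult.commute)
    finally show ?thesis .
  qed
  have mL: "L \<in> borel_measurable borel"
    using L linear_continuous_on linear_conv_bounded_linear by (intro borel_measurable_continuous_onI) blast
  have "lborel = distr lborel lborel L"
  proof (rule lborel_eqI)
    fix l u :: 'b assume lu: "\<And>b. b \<in> Basis \<Longrightarrow> l \<bullet> b \<le> u \<bullet> b"
    \<comment> \<open>Corners of the preimage of the box: a sign -1 exchanges the two bounds of that
      coordinate.\<close>
    define l' u' where "l' = (\<Sum>i\<in>Basis. (if s i = 1 then l \<bullet> c i else - (u \<bullet> c i)) *\<^sub>R i :: 'a)"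
      and "u' = (\<Sum>i\<in>Basis. (if s i = 1 then u \<bullet> c i else - (l \<bullet> c i)) *\<^sub>R i :: 'a)"
    have l'i: "l' \<bullet> i = (if s i = 1 then l \<bullet> c i else - (u \<bullet> c i))"
      and u'i: "u' \<bullet> i = (if s i = 1 then u \<bullet> c i else - (l \<bullet> c i))" if "i \<in> Basis" for i
      using that by (simp_all add: l'_def u'_def)
    have bB: "c i \<in> Basis" if "i \<in> Basis" for i using bij that by (auto simp: bij_betw_def)
    have "L x \<in> box l u \<longleftrightarrow> x \<in> box l' u'" for x
    proof -
      have "L x \<in> box l u \<longleftrightarrow> (\<forall>b\<in>c ` Basis. l \<bullet> b < L x \<bullet> b \<and> L x \<bullet> b < u \<bullet> b)" using bij by (simp add: mem_box bij_betw_def)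
      also have "\<dots> \<longleftrightarrow> (\<forall>i\<in>Basis. l' \<bullet> i < x \<bullet> i \<and> x \<bullet> i < u' \<bullet> i)" using s by (fastforce simp: coord l'i u'i)
      finally show ?thesis by (simp add: mem_box)
    qed
    then have "L -` box l u \<inter> space lborel = box l' u'" by auto
    then have "emeasure (distr lborel lborel L) (box l u) = emeasure lborel (box l' u')"
      using mL by (subst emeasure_distr) auto
    also have "\<dots> = (\<Prod>i\<in>Basis. (u' - l') \<bullet> i)" using lu s bB by (intro emeasure_lborel_box) (simp add: l'i u'i)
    also have "(\<Prod>i\<in>Basis. (u' - l') \<bullet> i) = (\<Prod>i\<in>Basis. (u - l) \<bullet> c i)"
      by (rule prod.cong) (auto simp: inner_diff_left l'i u'i)
    also have "\<dots> = (\<Prod>b\<in>Basis. (u - l) \<bullet> b)" by (rule prod.reindex_bij_betw[OF bij])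
    finally show "emeasure (distr lborel lborel L) (box l u) = (\<Prod>b\<in>Basis. (u - l) \<bullet> b)" .
  qed simp
  then show ?thesis by simp
qed

section \<open>Hypersurfaces with a fixed defining function, and box coordinates\<close>

locale hypersurface =
  fixes \<rho> :: "C2 \<Rightarrow> real" and S \<Omega> U :: "C2 set"
  assumes open_U: "open U" and S_U: "S \<subseteq> U" and smooth_\<rho>: "smooth_on \<rho> U"
    and S_eq: "S = {p\<in>U. \<rho> p = 0}" and Om_U: "\<Omega> \<inter> U = {p\<in>U. \<rho> p < 0}"
    and grad_nz: "\<And>p. p \<in> S \<Longrightarrow> grad \<rho> p \<noteq> 0"
    and compact_S: "compact S" and bd: "bounds_domain S \<Omega>"
begin

abbreviation "D\<rho> p \<equiv> frechet_derivative \<rho> (at p)"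

lemma \<rho>_deriv: "p \<in> U \<Longrightarrow> (\<rho> has_derivative D\<rho> p) (at p)" using smooth_on_has_derivative[OF smooth_\<rho>] .

lemma D\<rho>_linear: "p \<in> U \<Longrightarrow> linear (D\<rho> p)" using \<rho>_deriv has_derivative_linear by blast

lemma D\<rho>_cont: "continuous_on U (\<lambda>p. D\<rho> p v)" by (intro smooth_on_continuous smooth_on_frechet smooth_\<rho>)

lemma D\<rho>_grad: "p \<in> U \<Longrightarrow> D\<rho> p v = v \<bullet> grad \<rho> p"
proof -
  assume "p \<in> U"
  then interpret linear "D\<rho> p" by (rule D\<rho>_linear)
  have "D\<rho> p v = (\<Sum>e\<in>Basis. (v \<bullet> e) * D\<rho> p e)"
    by (subst euclidean_representation[symmetric, of v]) (simp only: sum scale real_scaleR_def)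
  also have "\<dots> = v \<bullet> grad \<rho> p" by (simp add: grad_def inner_sum_right mult.commute)
  finally show ?thesis .
qed

text \<open>Coordinates (x, s) near p in which s is the value of \<rho>. The unit vector e is plus
  or minus a standard basis vector in the construction below, j embeds real^3 as the hyperplane
  orthogonal to e and k projects back, so fixing x gives a straight segment in direction e. Q
  inverts (k, \<rho>) on the box, and c, C bound the slope of \<rho> along these segments.\<close>

definition box_coords :: "C2 \<Rightarrow> C2 \<Rightarrow> (real^3 \<Rightarrow> C2) \<Rightarrow> (C2 \<Rightarrow> real^3) \<Rightarrow> real^3 \<Rightarrow> real \<Rightarrow> real \<Rightarrow> real
    \<Rightarrow> ((real^3) \<times> real \<Rightarrow> C2) \<Rightarrow> bool" where
  "box_coords p e j k x0 r c C Q \<longleftrightarrow>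
    linear j \<and> linear k \<and> (\<forall>x t. k (j x + t *\<^sub>R e) = x) \<and> e \<bullet> e = 1 \<and> (\<forall>x. j x \<bullet> e = 0) \<and>
    (\<forall>q. j (k q) + (q \<bullet> e) *\<^sub>R e = q) \<and>
    distr lborel lborel (\<lambda>(x, t). j x + t *\<^sub>R e) = lborel \<and>
    0 < r \<and> 0 < c \<and> Q (x0, 0) = p \<and>
    smooth_on Q (ball x0 r \<times> {-r<..<r}) \<and>
    open (Q ` (ball x0 r \<times> {-r<..<r})) \<and> Q ` (ball x0 r \<times> {-r<..<r}) \<subseteq> U \<and>
    (\<forall>x\<in>ball x0 r. \<forall>s\<in>{-r<..<r}. \<rho> (Q (x, s)) = s \<and> k (Q (x, s)) = x) \<and>
    (\<forall>q\<in>Q ` (ball x0 r \<times> {-r<..<r}). c \<le> D\<rho> q e \<and> D\<rho> q e \<le> C)"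

lemma box_coordsD:
  assumes "box_coords p e j k x0 r c C Q"
  shows "linear j" "linear k" "k (j x + t *\<^sub>R e) = x" "e \<bullet> e = 1" "j x \<bullet> e = 0"
    "j (k q) + (q \<bullet> e) *\<^sub>R e = q"
    "distr lborel lborel (\<lambda>(x, t). j x + t *\<^sub>R e) = lborel"
    "0 < r" "0 < c" "Q (x0, 0) = p"
    "smooth_on Q (ball x0 r \<times> {-r<..<r})"
    "open (Q ` (ball x0 r \<times> {-r<..<r}))" "Q ` (ball x0 r \<times> {-r<..<r}) \<subseteq> U"
    "x \<in> ball x0 r \<Longrightarrow> s \<in> {-r<..<r} \<Longrightarrow> \<rho> (Q (x, s)) = s"
    "x \<in> ball x0 r \<Longrightarrow> s \<in> {-r<..<r} \<Longrightarrow> k (Q (x, s)) = x"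
    "q \<in> Q ` (ball x0 r \<times> {-r<..<r}) \<Longrightarrow> c \<le> D\<rho> q e"
    "q \<in> Q ` (ball x0 r \<times> {-r<..<r}) \<Longrightarrow> D\<rho> q e \<le> C" using assms unfolding box_coords_def by blast+

text \<open>The inverse function theorem is applied to the map that replaces the e-coordinate of a
  point by the value of \<rho> there.\<close>

lemma box_coords_exist:
  assumes p: "p \<in> S"
  obtains e u a x0 r c C Q where "box_coords p e u a x0 r c C Q"
proof -
  have pU: "p \<in> U" and \<rho>p: "\<rho> p = 0" using p S_eq by auto
  have "\<exists>b\<in>Basis. D\<rho> p b \<noteq> 0"
  proof (rule ccontr)
    assume "\<not> ?thesis"
    then have "grad \<rho> p = 0" by (simp add: grad_def)
    with grad_nz[OF p] show False by simp
  qed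
  then obtain b where b: "b \<in> Basis" "D\<rho> p b \<noteq> 0" by blast
  \<comment> \<open>Orients e so that \<rho> increases along it.\<close>
  define sg where "sg = sgn (D\<rho> p b)"
  define e where "e = sg *\<^sub>R b"
  have sg: "sg = 1 \<or> sg = -1" "sg * sg = 1" using b(2) by (auto simp: sg_def sgn_if)
  have ee: "e \<bullet> e = 1" using b sg by (auto simp: e_def)
  have De: "D\<rho> p e > 0"
  proof -
    have "D\<rho> p e = sg * D\<rho> p b" unfolding e_def using linear_scale[OF D\<rho>_linear[OF pU]] by simp
    then show ?thesis using b(2) by (auto simp: sg_def sgn_if)
  qed
  have "card (Basis :: (real^3) set) = card (Basis - {b} :: C2 set)" using b(1) by (simp add: DIM_cart card_Diff_singleton)
  then obtain d where d: "bij_betw d (Basis :: (real^3) set) (Basis - {b})"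
    using finite_same_card_bij[of Basis "Basis - {b}"] by (metis finite_Basis finite_Diff)
  define u where "u x = (\<Sum>i\<in>Basis. (x \<bullet> i) *\<^sub>R d i)" for x :: "real^3"
  define a where "a q = (\<Sum>i\<in>Basis. (q \<bullet> d i) *\<^sub>R i)" for q
  have dB: "d i \<in> Basis" "d i \<noteq> b" if "i \<in> Basis" for i using d that by (auto simp: bij_betw_def)
  have dinj: "d i = d j \<longleftrightarrow> i = j" if "i \<in> Basis" "j \<in> Basis" for i j using d that by (auto simp: bij_betw_def inj_on_def)
  have linu: "linear u" unfolding u_def
    by (auto simp: linear_iff inner_add_left scaleR_left_distrib sum.distrib scaleR_sum_right)
  have lina: "linear a" unfolding a_def
    by (auto simp: linear_iff inner_add_left scaleR_left_distrib sum.distrib scaleR_sum_right)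
  have db: "d i \<bullet> b = 0" "b \<bullet> d i = 0" if "i \<in> Basis" for i using dB[OF that] b(1) by (auto simp: inner_Basis)
  have ue: "u x \<bullet> e = 0" for x unfolding u_def e_def by (simp add: inner_sum_left db)
  have ud: "u x \<bullet> d j = x \<bullet> j" if "j \<in> Basis" for x j
  proof -
    have "u x \<bullet> d j = (\<Sum>i\<in>Basis. if i = j then x \<bullet> i else 0)" unfolding u_def inner_sum_left
      by (rule sum.cong) (use that dB dinj in \<open>auto simp: inner_Basis\<close>)
    then show ?thesis using that by simp
  qed
  have au: "a (u x + t *\<^sub>R e) = x" for x t unfolding a_def inner_add_left by (simp add: e_def db ud euclidean_representation)
  have rep: "u (a q) + (q \<bullet> e) *\<^sub>R e = q" for q
  proof -
    have "u (a q) = (\<Sum>i\<in>Basis. (q \<bullet> d i) *\<^sub>R d i)" unfolding u_def by (rule sum.cong) (auto simp: a_def)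
    also have "\<dots> = (\<Sum>i\<in>Basis - {b}. (q \<bullet> i) *\<^sub>R i)" by (rule sum.reindex_bij_betw[OF d])
    also have "(\<Sum>i\<in>Basis - {b}. (q \<bullet> i) *\<^sub>R i) = q - (q \<bullet> b) *\<^sub>R b"
      using b(1) by (simp add: sum_diff1 euclidean_representation)
    moreover have "(q \<bullet> e) *\<^sub>R e = (q \<bullet> b) *\<^sub>R b" using sg by (auto simp: e_def)
    ultimately show ?thesis by simp
  qed
  let ?f = "\<lambda>(x,t::real). if t = 0 then d x else b" and ?s = "\<lambda>(x,t::real). if t = 0 then 1 else sg"
  have meas: "distr lborel lborel (\<lambda>(x, t). u x + t *\<^sub>R e) = lborel"
  proof (rule lborel_distr_signed_basis[where c="?f" and s="?s"])
    show "linear (\<lambda>(x, t). u x + t *\<^sub>R e)" using linu by (auto simp: linear_iff scaleR_left_distrib scaleR_right_distrib)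
    have "bij_betw ?f (Basis \<times> {0} \<union> {0} \<times> {1}) ((Basis - {b}) \<union> {b})"
    proof (rule bij_betw_combine)
      have "?f ` (Basis \<times> {0}) = d ` Basis" by force
      then show "bij_betw ?f (Basis \<times> {0}) (Basis - {b})" using d by (auto simp: bij_betw_def inj_on_def)
    qed (auto simp: bij_betw_def)
    moreover have "Basis \<times> {0} \<union> {0} \<times> {1} = (Basis :: ((real^3) \<times> real) set)" by (auto simp: Basis_prod_def)
    ultimately show "bij_betw ?f Basis Basis" using b(1) by (simp add: insert_absorb)
    show "(\<lambda>(x, t). u x + t *\<^sub>R e) i = ?s i *\<^sub>R ?f i" if "i \<in> Basis" for i
    proof -
      have "u j = d j" if "j \<in> Basis" for j
      proof -
        have "u j = (\<Sum>i\<in>Basis. if i = j then d i else 0)"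
          unfolding u_def by (rule sum.cong) (use that in \<open>auto simp: inner_Basis\<close>)
        then show ?thesis using that by simp
      qed
      moreover have "u 0 = 0" by (simp add: u_def)
      ultimately show ?thesis using that by (auto simp: Basis_prod_def e_def)
    qed
    show "?s i = 1 \<or> ?s i = -1" for i :: "(real^3) \<times> real" using sg by (auto split: prod.split)
  qed
  \<comment> \<open>Half and twice the slope at p bound the slope on the neighbourhood
    \<open>U0\<close>.\<close>
  define c C where "c = D\<rho> p e / 2" and "C = 2 * D\<rho> p e"
  define U0 where "U0 = U \<inter> (\<lambda>q. D\<rho> q e) -` {c<..<C}"
  have U0: "open U0" unfolding U0_def by (rule continuous_open_preimage[OF D\<rho>_cont open_U]) simp
  have pU0: "p \<in> U0" using pU De by (auto simp: U0_def c_def C_def)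
  define h where "h q = q + (\<rho> q - q \<bullet> e) *\<^sub>R e" for q
  define h' where "h' q v = v + (D\<rho> q v - v \<bullet> e) *\<^sub>R e" for q v
  have derh: "(h has_derivative h' q) (at q)" if "q \<in> U0" for q unfolding h_def[abs_def] h'_def[abs_def]
    by (rule derivative_eq_intros \<rho>_deriv refl | use that in \<open>simp add: U0_def\<close>)+
  have bl: "bounded_linear (h' q)" if "q \<in> U0" for q using derh[OF that] has_derivative_bounded_linear by blast
  \<comment> \<open>\<open>h'\<close> is a rank one perturbation of the identity, so its inverse is
    explicit; this formula drives the smoothness proof for g.\<close>
  define invh' where "invh' q v = v + ((v \<bullet> e - D\<rho> q v) / D\<rho> q e) *\<^sub>R e" for q v
  have Dadd: "D\<rho> q (v + s *\<^sub>R e) = D\<rho> q v + s * D\<rho> q e" if "q \<in> U0" for q v s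
    using D\<rho>_linear[of q] that by (simp add: U0_def linear_iff)
  have De0: "D\<rho> q e > 0" if "q \<in> U0" for q using that De by (auto simp: U0_def c_def)
  have inv1: "h' q (invh' q v) = v" if "q \<in> U0" for q v using De0[OF that] unfolding h'_def invh'_def
    by (simp add: Dadd[OF that] inner_add_left ee scaleR_left_distrib[symmetric] field_simps)
  have inv2: "invh' q (h' q v) = v" if "q \<in> U0" for q v
  proof -
    have "h' q v \<bullet> e = D\<rho> q v" by (simp add: h'_def inner_add_left ee)
    moreover have "D\<rho> q (h' q v) = D\<rho> q v + (D\<rho> q v - v \<bullet> e) * D\<rho> q e" by (simp add: h'_def Dadd[OF that])
    ultimately have "invh' q (h' q v) = h' q v - (D\<rho> q v - v \<bullet> e) *\<^sub>R e"
      using De0[OF that] by (simp add: invh'_def scaleR_left_diff_distrib)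
    then show ?thesis by (simp add: h'_def)
  qed
  have blinv: "bounded_linear (invh' q)" if "q \<in> U0" for q
  proof -
    interpret D: linear "D\<rho> q" using D\<rho>_linear that by (simp add: U0_def)
    have "linear (invh' q)"
      by (rule linearI) (simp_all add: invh'_def D.add D.scale inner_add_left algebra_simps add_divide_distrib diff_divide_distrib)
    then show ?thesis by (simp add: linear_conv_bounded_linear)
  qed
  have 1: "(h has_derivative blinfun_apply (Blinfun (h' q))) (at q)" if "q \<in> U0" for q
    using derh[OF that] bl[OF that] by (simp add: bounded_linear_Blinfun_apply)
  have 2: "continuous_on U0 (\<lambda>q. Blinfun (h' q))"
  proof (rule continuous_on_blinfun_componentwise)
    fix i :: C2 assume "i \<in> Basis"
    have "continuous_on U0 (\<lambda>q. h' q i)" unfolding h'_def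
      by (intro continuous_intros continuous_on_subset[OF D\<rho>_cont]) (auto simp: U0_def)
    then show "continuous_on U0 (\<lambda>q. blinfun_apply (Blinfun (h' q)) i)"
      using bl by (simp add: bounded_linear_Blinfun_apply cong: continuous_on_cong)
  qed
  have 3: "Blinfun (invh' p) o\<^sub>L Blinfun (h' p) = id_blinfun"
    by (rule blinfun_eqI) (simp add: bounded_linear_Blinfun_apply bl blinv pU0 inv2)
  obtain U1 V g g' where U1: "open U1" "U1 \<subseteq> U0" "p \<in> U1" and V: "open V" "h p \<in> V"
    and hom: "homeomorphism U1 V h g"
    and derg: "\<And>y. y \<in> V \<Longrightarrow> (g has_derivative (g' y)) (at y)"
    and g': "\<And>y. y \<in> V \<Longrightarrow> g' y = inv (blinfun_apply (Blinfun (h' (g y))))"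
    by (rule inverse_function_theorem[OF U0 1 2 pU0 3]; (assumption | rule that; assumption))
  have gU1: "g y \<in> U1" "h (g y) = y" if "y \<in> V" for y using hom that by (auto simp: homeomorphism_def)
  have gh: "g (h q) = q" "h q \<in> V" if "q \<in> U1" for q using hom that by (auto simp: homeomorphism_def)
  have g'eq: "g' y = invh' (g y)" if "y \<in> V" for y
  proof -
    have "g y \<in> U0" using gU1[OF that] U1 by auto
    then have "inv (h' (g y)) = invh' (g y)" using inv1 inv2 by (intro inv_unique_comp) (auto simp: fun_eq_iff)
    then show ?thesis using g'[OF that] bl[OF \<open>g y \<in> U0\<close>] by (simp add: bounded_linear_Blinfun_apply)
  qed
  have D\<rho>smooth: "smooth_on (\<lambda>q. D\<rho> q v) U0" for v
    by (rule smooth_on_subset[OF smooth_on_frechet[OF smooth_\<rho>]]) (auto simp: U0_def)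
  \<comment> \<open>Bootstrapping: g' y is a rational expression in derivatives of \<rho> at g y, so
    each order of differentiability of g yields the next.\<close>
  have "Ck_on k g V" for k
  proof (induction k)
    case 0
    then show ?case using hom by (auto simp: homeomorphism_def)
  next
    case (Suc k)
    show ?case
    proof (rule Ck_on_SucI[OF V(1) derg])
      fix v
      have DD: "Ck_on k (\<lambda>y. D\<rho> (g y) w) V" for w by (rule Ck_on_compose[OF V(1) Suc U0])
          (use D\<rho>smooth gU1 U1 in \<open>auto simp: smooth_on_def\<close>)
      have "Ck_on k (\<lambda>y. v + ((v \<bullet> e - D\<rho> (g y) v) * inverse (D\<rho> (g y) e)) *\<^sub>R e) V"
      proof (intro Ck_on_add Ck_on_const V(1) Ck_on_scaleR Ck_on_mult Ck_on_diff Ck_on_inverse DD)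
        show "D\<rho> (g y) e \<noteq> 0" if "y \<in> V" for y using De0[of "g y"] gU1[OF that] U1 by auto
      qed
      then show "Ck_on k (\<lambda>y. g' y v) V" by (rule Ck_on_cong[OF V(1), rotated]) (simp add: g'eq invh'_def field_simps)
    qed
  qed
  then have smg: "smooth_on g V" by (simp add: smooth_on_def)
  define L where "L = (\<lambda>(x, t::real). u x + t *\<^sub>R e)"
  have linL: "linear L" unfolding L_def using linu by (auto simp: linear_iff scaleR_left_distrib scaleR_right_distrib)
  have contL: "continuous_on A L" for A using linL linear_continuous_on linear_conv_bounded_linear by blast
  define x0 where "x0 = a p"
  have hp: "h p = L (x0, 0)"
    using rep[of p] \<rho>p by (simp add: h_def L_def x0_def) (metis add_diff_cancel_right' diff_conv_add_uminus scaleR_minus_left)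
  have "open (L -` V)" using contL[of UNIV] V(1) by (simp add: continuous_on_open_vimage)
  moreover have "(x0, 0) \<in> L -` V" using hp V(2) by simp
  ultimately obtain A B where AB: "open A" "open B" "x0 \<in> A" "0 \<in> B" "A \<times> B \<subseteq> L -` V" by (metis open_prod_elim mem_Sigma_iff)
  obtain r1 where r1: "r1 > 0" "ball x0 r1 \<subseteq> A" using AB openE by blast
  obtain r2 where r2: "r2 > 0" "ball 0 r2 \<subseteq> B" using AB openE by blast
  define r where "r = min r1 r2"
  have r: "r > 0" using r1 r2 by (simp add: r_def)
  have boxV: "L (x, s) \<in> V" if "x \<in> ball x0 r" "s \<in> {-r<..<r}" for x s
  proof -
    have "x \<in> A" "s \<in> B" using that r1 r2 by (auto simp: r_def dist_real_def)
    then show ?thesis using AB by auto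
  qed
  define Q where "Q y = g (L y)" for y
  let ?B = "ball x0 r \<times> {-r<..<r}"
  have QB: "\<rho> (Q (x, s)) = s \<and> a (Q (x, s)) = x" if "x \<in> ball x0 r" "s \<in> {-r<..<r}" for x s
  proof -
    have *: "h (Q (x, s)) = L (x, s)" using gU1[OF boxV[OF that]] by (simp add: Q_def)
    have "\<rho> (Q (x, s)) = h (Q (x, s)) \<bullet> e" by (simp add: h_def inner_add_left ee)
    also have "\<dots> = s" unfolding * by (simp add: L_def inner_add_left ee ue)
    finally have 1: "\<rho> (Q (x, s)) = s" .
    have "a (h q) = a q" for q
    proof -
      have "h q = (u (a q) + (q \<bullet> e) *\<^sub>R e) + (\<rho> q - q \<bullet> e) *\<^sub>R e" unfolding rep by (simp add: h_def)
      then have "h q = u (a q) + (\<rho> q) *\<^sub>R e" by (simp add: scaleR_left_diff_distrib)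
      then show ?thesis by (simp add: au)
    qed
    then have "a (Q (x, s)) = a (L (x, s))" using * by metis
    also have "\<dots> = x" by (simp add: L_def au)
    finally show ?thesis using 1 by simp
  qed
  have smQ: "smooth_on Q ?B" unfolding Q_def[abs_def]
  proof (rule smooth_on_compose[OF _ _ V(1) smg])
    show "open ?B" by (intro open_Times) auto
    then show "smooth_on L ?B" using linL by (simp add: smooth_on_def Ck_on_linear linear_conv_bounded_linear)
  qed (use boxV in auto)
  have op: "open (Q ` ?B)"
  proof -
    have "Q ` ?B = U1 \<inter> h -` {y. (a y, y \<bullet> e) \<in> ?B}"
    proof (intro equalityI subsetI)
      fix q assume "q \<in> Q ` ?B"
      then obtain x s where xs: "x \<in> ball x0 r" "s \<in> {-r<..<r}" "q = Q (x, s)" by auto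
      have "h q = L (x, s)" "q \<in> U1" using gU1[OF boxV[OF xs(1,2)]] xs by (auto simp: Q_def)
      then show "q \<in> U1 \<inter> h -` {y. (a y, y \<bullet> e) \<in> ?B}" using xs by (auto simp: L_def au inner_add_left ue ee)
    next
      fix q assume q: "q \<in> U1 \<inter> h -` {y. (a y, y \<bullet> e) \<in> ?B}"
      then have "Q (a (h q), h q \<bullet> e) = q" using rep[of "h q"] gh[of q] by (simp add: Q_def L_def)
      then show "q \<in> Q ` ?B" using q by (metis (no_types, lifting) IntE image_eqI mem_Collect_eq vimageE)
    qed
    moreover have "open {y. (a y, y \<bullet> e) \<in> ?B}"
    proof -
      have "continuous_on UNIV (\<lambda>y. (a y, y \<bullet> e))"
        using lina by (intro continuous_intros) (simp add: linear_continuous_on linear_conv_bounded_linear)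
      then have "open ((\<lambda>y. (a y, y \<bullet> e)) -` ?B)" by (intro open_vimage open_Times) auto
      then show ?thesis by (simp add: vimage_def)
    qed
    moreover have "continuous_on U1 h" using hom by (simp add: homeomorphism_def)
    ultimately show ?thesis using U1(1) by (simp only: continuous_open_preimage)
  qed
  have QU1: "Q ` ?B \<subseteq> U1" using gU1(1)[OF boxV] by (auto simp: Q_def)
  have "box_coords p e u a x0 r c C Q" unfolding box_coords_def
  proof (intro conjI allI ballI)
    show "0 < c" using De by (simp add: c_def)
    show "Q (x0, 0) = p" using hp gh[OF U1(3)] by (simp add: Q_def)
    show "Q ` ?B \<subseteq> U" using QU1 U1(2) by (auto simp: U0_def)
    show "c \<le> D\<rho> q e" "D\<rho> q e \<le> C" if "q \<in> Q ` ?B" for q using that QU1 U1(2) by (force simp: U0_def)+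
  qed (use QB in \<open>auto simp only: linu lina au ee ue rep meas r smQ op\<close>)
  then show thesis by (rule that)
qed

end

lemma hypersurface_chart_image: "hypersurface_chart S V f \<Longrightarrow> f ` V \<subseteq> S"
  unfolding hypersurface_chart_def by (metis openin_imp_subset)

section \<open>Charts, tangent spaces and the outer normal\<close>

context hypersurface
begin

lemma closed_S: "closed S" using compact_S compact_imp_closed by blast

lemma open_Om: "open \<Omega>" and connected_Om: "connected \<Omega>" and Om_nonempty: "\<Omega> \<noteq> {}"
  and bounded_Om: "bounded \<Omega>" and frontier_Om: "frontier \<Omega> = S" using bd unfolding bounds_domain_def by auto

lemma closure_Om: "closure \<Omega> = \<Omega> \<union> S" using frontier_Om open_Om by (metis closure_Un_frontier)

lemma Om_S_disjoint: "\<Omega> \<inter> S = {}" using frontier_Om open_Om by (auto simp: frontier_def interior_open)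

text \<open>The slice s = 0 of a box. The linear map k is a left inverse, which gives both the
  homeomorphism and the injectivity of the derivative.\<close>

lemma box_chart:
  assumes box: "box_coords p e j k x0 r c C Q"
  shows "hypersurface_chart S (ball x0 r) (\<lambda>x. Q (x, 0))"
proof -
  note link = box_coordsD(2)[OF box] and r = box_coordsD(8)[OF box] and p0 = box_coordsD(10)[OF box]
    and sm = box_coordsD(11)[OF box] and op = box_coordsD(12)[OF box] and sub = box_coordsD(13)[OF box]
    and Q = box_coordsD(14)[OF box] and Qk = box_coordsD(15)[OF box]
  define f where "f x = Q (x, 0)" for x
  let ?V = "ball x0 r" let ?B = "ball x0 r \<times> {-r<..<r}"
  have "bounded_linear (\<lambda>x::real^3. (x, 0::real))" by (intro bounded_linear_Pair bounded_linear_ident bounded_linear_zero)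
  then have smf: "smooth_on f ?V" unfolding f_def[abs_def] using r
    by (intro smooth_on_compose[OF _ _ _ sm]) (auto simp: smooth_on_def Ck_on_linear open_Times)
  have kf: "k (f x) = x" if "x \<in> ?V" for x using Qk[OF that, of 0] r by (simp add: f_def)
  have inj: "inj (frechet_derivative f (at x))" if "x \<in> ?V" for x
  proof -
    have "((\<lambda>x. k (f x)) has_derivative (\<lambda>v. k (frechet_derivative f (at x) v))) (at x)"
      using bounded_linear.has_derivative[OF _ smooth_on_has_derivative[OF smf that]] link
      by (simp add: linear_conv_bounded_linear)
    then have "((\<lambda>x. x) has_derivative (\<lambda>v. k (frechet_derivative f (at x) v))) (at x)"
      by (rule has_derivative_transform_within_open[OF _ open_ball that]) (use kf in auto)
    then have "(\<lambda>v. k (frechet_derivative f (at x) v)) = (\<lambda>v. v)" using has_derivative_unique has_derivative_ident by blast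
    then show ?thesis by (metis injI)
  qed
  have im: "f ` ?V = S \<inter> Q ` ?B"
  proof (intro equalityI subsetI)
    fix q assume "q \<in> f ` ?V"
    then obtain x where x: "x \<in> ?V" "q = Q (x, 0)" by (auto simp: f_def)
    then show "q \<in> S \<inter> Q ` ?B" using Q[OF x(1), of 0] r sub by (auto simp: S_eq)
  next
    fix q assume "q \<in> S \<inter> Q ` ?B"
    then obtain x s where xs: "x \<in> ?V" "s \<in> {-r<..<r}" "q = Q (x, s)" "\<rho> q = 0" by (auto simp: S_eq)
    then have "s = 0" using Q by auto
    then show "q \<in> f ` ?V" using xs by (auto simp: f_def)
  qed
  have "homeomorphism ?V (f ` ?V) f k" unfolding homeomorphism_def
  proof (intro conjI)
    show "continuous_on ?V f" using smooth_on_continuous[OF smf] .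
    show "continuous_on (f ` ?V) k" using link by (simp add: linear_continuous_on linear_conv_bounded_linear)
    show "\<forall>x\<in>?V. k (f x) = x" using kf by blast
    show "f ` ?V = f ` ?V" ..
    show "k ` f ` ?V = ?V" by (simp add: image_image kf)
    show "\<forall>y\<in>f ` ?V. f (k y) = y" by (simp add: kf)
  qed
  then have "hypersurface_chart S ?V f" unfolding hypersurface_chart_def using smf inj im op by (auto intro: openin_open_Int)
  then show ?thesis unfolding f_def .
qed

lemma chart_exists:
  assumes "p \<in> S"
  obtains V f x where "hypersurface_chart S V f" "x \<in> V" "p = f x"
proof -
  obtain e j q x0 r c C Q where box: "box_coords p e j q x0 r c C Q" using box_coords_exist[OF assms] .
  show thesis using that[OF box_chart[OF box], of x0] box_coordsD(8,10)[OF box] by simp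
qed

text \<open>Differentiating the composition of \<rho> with the chart, which is 0, gives one
  inclusion; both spaces have real dimension 3.\<close>

lemma chart_tangent:
  assumes "hypersurface_chart S V f" "x \<in> V"
  shows "range (frechet_derivative f (at x)) = {v. D\<rho> (f x) v = 0}"
proof -
  have V: "open V" and sm: "smooth_on f V" and inj: "inj (frechet_derivative f (at x))"
    using assms by (auto simp: hypersurface_chart_def)
  have im: "f ` V \<subseteq> S" using hypersurface_chart_image[OF assms(1)] .
  have fx: "f x \<in> S" using im assms(2) by auto
  then have fU: "f x \<in> U" using S_U by auto
  have d: "(f has_derivative frechet_derivative f (at x)) (at x)" by (rule smooth_on_has_derivative[OF sm assms(2)])
  then have lin: "linear (frechet_derivative f (at x))" by (rule has_derivative_linear)
  have "((\<lambda>x. \<rho> (f x)) has_derivative (\<lambda>v. D\<rho> (f x) (frechet_derivative f (at x) v))) (at x)"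
    by (rule has_derivative_compose[OF d \<rho>_deriv[OF fU]])
  moreover have "((\<lambda>x. \<rho> (f x)) has_derivative (\<lambda>v. 0)) (at x)"
    by (rule has_derivative_transform_within_open[OF has_derivative_const[of 0] V assms(2)])
      (use im S_eq in force)
  ultimately have "(\<lambda>v. D\<rho> (f x) (frechet_derivative f (at x) v)) = (\<lambda>v. 0)" using has_derivative_unique by blast
  then have sub: "range (frechet_derivative f (at x)) \<subseteq> {v. D\<rho> (f x) v = 0}" by (auto dest: fun_cong)
  have eq: "{v. D\<rho> (f x) v = 0} = {v. grad \<rho> (f x) \<bullet> v = 0}" using D\<rho>_grad[OF fU] by (simp add: inner_commute)
  have "dim {v. D\<rho> (f x) v = 0} = 3" unfolding eq using dim_hyperplane[OF grad_nz[OF fx]] by (simp add: DIM_cart)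
  moreover have "dim (range (frechet_derivative f (at x))) = 3"
    using dim_image_eq[OF lin, of UNIV] inj by (simp add: dim_UNIV)
  ultimately show ?thesis
    using sub eq by (intro subspace_dim_equal) (auto simp: linear_subspace_image lin subspace_hyperplane)
qed

text \<open>A derivative within S is not determined as a linear map on C^2. Composed with a chart it
  becomes a derivative on an open set, so its values on tangent vectors are determined. This makes
  derivatives of functions known only on S usable.\<close>

lemma tangent_derivative_unique:
  assumes "p \<in> S" "(f has_derivative D1) (at p within S)" "(f has_derivative D2) (at p within S)"
    and "D\<rho> p v = 0"
  shows "D1 v = D2 v"
proof -
  obtain V g x where ch: "hypersurface_chart S V g" and x: "x \<in> V" "p = g x" using chart_exists[OF assms(1)] .
  have V: "open V" and sm: "smooth_on g V" using ch by (auto simp: hypersurface_chart_def)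
  let ?d = "frechet_derivative g (at x)"
  have d: "(g has_derivative ?d) (at x within V)"
    using smooth_on_has_derivative[OF sm x(1)] has_derivative_at_withinI by blast
  have "((\<lambda>x. f (g x)) has_derivative (\<lambda>v. D (?d v))) (at x)" if "(f has_derivative D) (at p within S)" for D
  proof -
    have "(f has_derivative D) (at (g x) within g ` V)"
      using that hypersurface_chart_image[OF ch] x by (auto intro: has_derivative_subset)
    then have "((\<lambda>x. f (g x)) has_derivative (\<lambda>v. D (?d v))) (at x within V)" using has_derivative_in_compose[OF d] by blast
    then show ?thesis by (simp only: at_within_open[OF x(1) V])
  qed
  then have "(\<lambda>v. D1 (?d v)) = (\<lambda>v. D2 (?d v))" using assms(2,3) has_derivative_unique by blast
  moreover obtain u where "v = ?d u" using chart_tangent[OF ch x(1)] assms(4) x(2) by auto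
  ultimately show ?thesis by (metis)
qed

lemma tangent_derivative_zero:
  assumes "p \<in> S" "(f has_derivative f') (at p within S)" "\<And>y. y \<in> S \<Longrightarrow> f y = c" "D\<rho> p v = 0"
  shows "f' v = 0"
  using tangent_derivative_unique[OF assms(1,2) has_derivative_transform[OF assms(1,3) has_derivative_const] assms(4)] .

lemma moves_inside:
  assumes "p \<in> S" "D\<rho> p v > 0"
  shows "\<forall>\<^sub>F t in at_right 0. p - t *\<^sub>R v \<in> \<Omega>"
proof -
  have p: "p \<in> U" "\<rho> p = 0" using assms(1) S_eq by auto
  have d0: "((\<lambda>t. p - t *\<^sub>R v) has_derivative (\<lambda>t. - (t *\<^sub>R v))) (at 0)" by (auto intro!: derivative_eq_intros)
  have "((\<lambda>t. \<rho> (p - t *\<^sub>R v)) has_derivative (\<lambda>t. D\<rho> p (- (t *\<^sub>R v)))) (at 0)"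
    using has_derivative_compose[OF d0, of \<rho> "D\<rho> p"] \<rho>_deriv[OF p(1)] by simp
  then have "((\<lambda>t. \<rho> (p - t *\<^sub>R v)) has_field_derivative - D\<rho> p v) (at 0)" unfolding has_field_derivative_def
    by (rule has_derivative_eq_rhs) (simp add: fun_eq_iff linear_neg[OF D\<rho>_linear[OF p(1)]] linear_scale[OF D\<rho>_linear[OF p(1)]])
  then obtain d where d: "d > 0" "\<And>h. h > 0 \<Longrightarrow> h < d \<Longrightarrow> \<rho> (p - (0 + h) *\<^sub>R v) < \<rho> (p - 0 *\<^sub>R v)"
    using DERIV_neg_dec_right[of "\<lambda>t. \<rho> (p - t *\<^sub>R v)" "- D\<rho> p v" 0] assms(2) by auto
  have neg: "\<forall>\<^sub>F t in at_right 0. \<rho> (p - t *\<^sub>R v) < 0"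
    unfolding eventually_at_right_field using d p(2) by (intro exI[of _ d]) auto
  have "((\<lambda>t. p - t *\<^sub>R v) \<longlongrightarrow> p) (at_right 0)" by (auto intro!: tendsto_eq_intros)
  then have "\<forall>\<^sub>F t in at_right 0. p - t *\<^sub>R v \<in> U" using open_U p(1) by (rule topological_tendstoD)
  with neg show ?thesis by eventually_elim (use Om_U in auto)
qed

lemma defining: "defining_function \<rho> S \<Omega>" unfolding defining_function_def
  using open_U S_U smooth_\<rho> S_eq Om_U grad_nz by blast

text \<open>Two defining functions share the tangent space, so their gradients are proportional. A
  negative factor is impossible: the points p - t grad \<rho>(p) lie in \<Omega> for small t > 0,
  and the other function would be positive there.\<close>

lemma outer_normal_eq:
  assumes p: "p \<in> S"
  shows "outer_normal S \<Omega> p = sgn (grad \<rho> p)" unfolding outer_normal_def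
proof (rule the_equality)
  show "\<exists>\<rho>'. defining_function \<rho>' S \<Omega> \<and> sgn (grad \<rho> p) = sgn (grad \<rho>' p)" using defining by blast
  fix n assume "\<exists>\<rho>'. defining_function \<rho>' S \<Omega> \<and> n = sgn (grad \<rho>' p)"
  then obtain \<rho>' where \<rho>': "defining_function \<rho>' S \<Omega>" "n = sgn (grad \<rho>' p)" by blast
  then obtain U' where U': "open U'" "S \<subseteq> U'" "smooth_on \<rho>' U'" "S = {p\<in>U'. \<rho>' p = 0}"
    "\<Omega> \<inter> U' = {p\<in>U'. \<rho>' p < 0}" "\<forall>p\<in>S. grad \<rho>' p \<noteq> 0" unfolding defining_function_def by blast
  interpret h': hypersurface \<rho>' S \<Omega> U' by unfold_locales (use U' compact_S bd in blast)+
  define g g' where "g = grad \<rho> p" and "g' = grad \<rho>' p"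
  have gg: "g \<noteq> 0" "g' \<noteq> 0" using grad_nz h'.grad_nz p by (auto simp: g_def g'_def)
  have pU: "p \<in> U" "p \<in> U'" using p S_U U' by auto
  obtain V u x where ch: "hypersurface_chart S V u" and x: "x \<in> V" "p = u x" using chart_exists[OF p] .
  have perp: "v \<bullet> g = 0 \<longleftrightarrow> v \<bullet> g' = 0" for v
    using chart_tangent[OF ch x(1)] h'.chart_tangent[OF ch x(1)] D\<rho>_grad[OF pU(1)] h'.D\<rho>_grad[OF pU(2)]
    by (auto simp: x g_def g'_def)
  define c where "c = (g' \<bullet> g) / (g \<bullet> g)"
  have "(g' - c *\<^sub>R g) \<bullet> g = 0" using gg by (simp add: c_def inner_diff_left)
  then have "(g' - c *\<^sub>R g) \<bullet> g' = 0" "(g' - c *\<^sub>R g) \<bullet> g = 0" using perp by auto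
  then have "(g' - c *\<^sub>R g) \<bullet> (g' - c *\<^sub>R g) = 0" by (simp add: inner_diff_right)
  then have g'c: "g' = c *\<^sub>R g" by simp
  have "D\<rho> p g > 0" using D\<rho>_grad[OF pU(1)] gg by (simp add: g_def)
  then have in\<Omega>: "\<forall>\<^sub>F t in at_right 0. p - t *\<^sub>R g \<in> \<Omega>" by (rule moves_inside[OF p])
  have "\<not> c < 0"
  proof
    assume "c < 0"
    then have "h'.D\<rho> p (- g) > 0" using h'.D\<rho>_grad[OF pU(2)] gg g'c by (simp add: g'_def[symmetric] mult_neg_pos)
    let ?f = "\<lambda>t. \<rho>' (p - t *\<^sub>R g)"
    have d0: "((\<lambda>t. p - t *\<^sub>R g) has_derivative (\<lambda>t. - (t *\<^sub>R g))) (at 0)" by (auto intro!: derivative_eq_intros)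
    have "(?f has_derivative (\<lambda>t. h'.D\<rho> p (- (t *\<^sub>R g)))) (at 0)"
      using has_derivative_compose[OF d0, of \<rho>' "h'.D\<rho> p"] h'.\<rho>_deriv[OF pU(2)] by simp
    then have "(?f has_field_derivative h'.D\<rho> p (- g)) (at 0)" unfolding has_field_derivative_def
      by (rule has_derivative_eq_rhs) (simp add: fun_eq_iff linear_neg[OF h'.D\<rho>_linear[OF pU(2)]] linear_scale[OF h'.D\<rho>_linear[OF pU(2)]])
    then obtain d where d: "d > 0" "\<And>h. h > 0 \<Longrightarrow> h < d \<Longrightarrow> ?f 0 < ?f (0 + h)"
      using DERIV_pos_inc_right[of ?f "h'.D\<rho> p (- g)" 0] \<open>h'.D\<rho> p (- g) > 0\<close> by metis
    have "?f 0 = 0" using p U' by auto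
    then have pos: "\<forall>\<^sub>F t in at_right 0. \<rho>' (p - t *\<^sub>R g) > 0"
      unfolding eventually_at_right_field using d by (intro exI[of _ d]) auto
    have "((\<lambda>t. p - t *\<^sub>R g) \<longlongrightarrow> p) (at_right 0)" by (auto intro!: tendsto_eq_intros)
    then have "\<forall>\<^sub>F t in at_right 0. p - t *\<^sub>R g \<in> U'" using U'(1) pU(2) by (rule topological_tendstoD)
    with pos in\<Omega> have "\<forall>\<^sub>F t in at_right (0::real). False" by eventually_elim (use U' in force)
    then show False by simp
  qed
  moreover have "c \<noteq> 0" using g'c gg by auto
  ultimately have "c > 0" by simp
  then show "n = sgn (grad \<rho> p)" using \<rho>'(2) g'c gg by (simp add: g_def[symmetric] g'_def[symmetric] sgn_scaleR)
qed

end

section \<open>Surface measure\<close>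

text \<open>The area formula as an identity that admits the value infinity: an image of finite
  measure would make the Jacobian integrable.\<close>

lemma emeasure_differentiable_image:
  fixes g :: "real^'n::{finite,wellorder} \<Rightarrow> real^'n::_"
  assumes X: "X \<in> sets borel" and inj: "inj_on g X"
    and der: "\<And>x. x \<in> X \<Longrightarrow> (g has_derivative g' x) (at x within X)"
    and meas: "(\<lambda>x. indicator X x * \<bar>det (matrix (g' x))\<bar>) \<in> borel_measurable borel"
  shows "emeasure lebesgue (g ` X) = (\<integral>\<^sup>+x. ennreal (indicator X x * \<bar>det (matrix (g' x))\<bar>) \<partial>lborel)"
proof -
  let ?d = "\<lambda>x. \<bar>det (matrix (g' x))\<bar>"
  have XL: "X \<in> sets lebesgue" using X by simp
  note key = has_measure_differentiable_image[OF XL der inj]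
  have hi: "((\<lambda>x. indicator X x * ?d x) has_integral m) UNIV \<longleftrightarrow> (?d has_integral m) X" for m
  proof -
    have "(\<lambda>x. indicator X x * ?d x) = (\<lambda>x. if x \<in> X then ?d x else 0)" by auto
    then show ?thesis by (simp only: has_integral_restrict_UNIV)
  qed
  have img: "g ` X \<in> sets lebesgue"
    by (rule differentiable_image_in_sets_lebesgue[OF XL]) (use der in \<open>auto simp: differentiable_on_def differentiable_def\<close>)
  show ?thesis
  proof (cases "(\<integral>\<^sup>+x. ennreal (indicator X x * ?d x) \<partial>lborel) = \<infinity>")
    case False
    then obtain m where m: "(\<integral>\<^sup>+x. ennreal (indicator X x * ?d x) \<partial>lborel) = ennreal m" "m \<ge> 0"
      by (cases "\<integral>\<^sup>+x. ennreal (indicator X x * ?d x) \<partial>lborel") auto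
    have "((\<lambda>x. indicator X x * ?d x) has_integral m) UNIV" by (rule nn_integral_has_integral) (use meas m in auto)
    then have "g ` X \<in> lmeasurable" "measure lebesgue (g ` X) = m" using key[of m] hi by auto
    then show ?thesis using m emeasure_eq_ennreal_measure[OF fmeasurableD2[of "g ` X"]] by simp
  next
    case True
    have "\<not> g ` X \<in> lmeasurable"
    proof
      assume "g ` X \<in> lmeasurable"
      then have "(?d has_integral measure lebesgue (g ` X)) X" using key by blast
      then have "(\<integral>\<^sup>+x. indicator X x * ?d x \<partial>lborel) = ennreal (measure lebesgue (g ` X))"
        by (intro nn_integral_has_integral_lebesgue) auto
      with True show False by simp
    qed
    then have "\<not> emeasure lebesgue (g ` X) < \<infinity>" using img by (simp add: fmeasurable_def)
    then have "emeasure lebesgue (g ` X) = \<infinity>" by (simp only: less_top[symmetric] infinity_ennreal_def) simp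
    then show ?thesis using True by (simp only:)
  qed
qed

lemma nn_integral_change_of_variables:
  fixes g :: "real^'n::{finite,wellorder} \<Rightarrow> real^'n::_"
  assumes X: "X \<in> sets borel" and Y: "g ` X \<in> sets borel" and inj: "inj_on g X"
    and der: "\<And>x. x \<in> X \<Longrightarrow> (g has_derivative g' x) (at x within X)"
    and meas: "(\<lambda>x. indicator X x * \<bar>det (matrix (g' x))\<bar>) \<in> borel_measurable borel"
    and f: "f \<in> borel_measurable borel"
  shows "(\<integral>\<^sup>+y. f y * indicator (g ` X) y \<partial>lborel) =
    (\<integral>\<^sup>+x. f (g x) * ennreal (indicator X x * \<bar>det (matrix (g' x))\<bar>) \<partial>lborel)"
proof -
  let ?d = "\<lambda>x. ennreal (indicator X x * \<bar>det (matrix (g' x))\<bar>)"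
  have md: "?d \<in> borel_measurable borel" using meas by measurable
  \<comment> \<open>A Borel extension of g to the whole space. The density vanishes off X, so the
    value 0 has no effect.\<close>
  define h where "h x = (if x \<in> X then g x else 0)" for x
  have contg: "continuous_on X g"
    using der by (auto simp: continuous_on_eq_continuous_within intro: has_derivative_continuous)
  have mh: "h \<in> borel_measurable borel" unfolding h_def[abs_def] using X contg
    by (intro borel_measurable_continuous_on_if) (auto intro: continuous_intros)
  have "distr (density lborel ?d) borel h = density lborel (indicator (g ` X))"
  proof (rule measure_eqI)
    fix B assume "B \<in> sets (distr (density lborel ?d) borel h)"
    then have B: "B \<in> sets borel" by simp
    let ?XB = "X \<inter> h -` B"
    have XB: "?XB \<in> sets borel" using X measurable_sets[OF mh B] by auto
    have "emeasure (distr (density lborel ?d) borel h) B = (\<integral>\<^sup>+x. ?d x * indicator (h -` B) x \<partial>lborel)"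
      using B mh md measurable_sets[OF mh B] by (simp add: emeasure_distr emeasure_density)
    also have "\<dots> = (\<integral>\<^sup>+x. ennreal (indicator ?XB x * \<bar>det (matrix (g' x))\<bar>) \<partial>lborel)"
      by (rule nn_integral_cong) (auto simp: indicator_def)
    also have "\<dots> = emeasure lebesgue (g ` ?XB)"
    proof (rule emeasure_differentiable_image[symmetric, OF XB])
      show "inj_on g ?XB" using inj by (rule inj_on_subset) auto
      show "(g has_derivative g' x) (at x within ?XB)" if "x \<in> ?XB" for x
        using der[of x] that by (auto intro: has_derivative_subset)
      have "(\<lambda>x. indicator ?XB x * \<bar>det (matrix (g' x))\<bar>) = (\<lambda>x. indicator (h -` B) x * (indicator X x * \<bar>det (matrix (g' x))\<bar>))"
        by (auto simp: indicator_def fun_eq_iff)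
      also have "\<dots> \<in> borel_measurable borel"
      proof (rule borel_measurable_times[OF borel_measurable_indicator meas])
        show "h -` B \<in> sets borel" using measurable_sets[OF mh B] by auto
      qed
      finally show "(\<lambda>x. indicator ?XB x * \<bar>det (matrix (g' x))\<bar>) \<in> borel_measurable borel" .
    qed
    also have "g ` ?XB = g ` X \<inter> B" by (auto simp: h_def)
    also have "emeasure lebesgue (g ` X \<inter> B) = emeasure lborel (g ` X \<inter> B)" using Y B by simp
    also have "\<dots> = emeasure (density lborel (indicator (g ` X))) B"
    proof -
      have "emeasure (density lborel (indicator (g ` X))) B = (\<integral>\<^sup>+x. indicator (g ` X) x * indicator B x \<partial>lborel)"
        using Y B by (intro emeasure_density) auto
      also have "\<dots> = (\<integral>\<^sup>+x. indicator (g ` X \<inter> B) x \<partial>lborel)" by (rule nn_integral_cong) (auto simp: indicator_def)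
      finally show ?thesis using Y B by simp
    qed
    finally show "emeasure (distr (density lborel ?d) borel h) B = emeasure (density lborel (indicator (g ` X))) B" .
  qed simp
  then have "(\<integral>\<^sup>+y. f y \<partial>distr (density lborel ?d) borel h) = (\<integral>\<^sup>+y. f y \<partial>density lborel (indicator (g ` X)))" by simp
  moreover have "(\<integral>\<^sup>+y. f y \<partial>distr (density lborel ?d) borel h) = (\<integral>\<^sup>+x. ?d x * f (h x) \<partial>lborel)"
    using mh md f by (subst nn_integral_distr) (auto simp: nn_integral_density)
  moreover have "(\<integral>\<^sup>+x. ?d x * f (h x) \<partial>lborel) = (\<integral>\<^sup>+x. f (g x) * ?d x \<partial>lborel)"
    by (rule nn_integral_cong) (auto simp: indicator_def h_def mult.commute)
  moreover have "(\<integral>\<^sup>+y. f y \<partial>density lborel (indicator (g ` X))) = (\<integral>\<^sup>+y. f y * indicator (g ` X) y \<partial>lborel)"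
    using f Y by (subst nn_integral_density) (auto simp: mult.commute)
  ultimately show ?thesis by simp
qed

text \<open>A vector v in the kernel of the Gram matrix satisfies |D v|^2 = 0.\<close>

lemma Gram_det_nonzero:
  fixes D :: "real^'n \<Rightarrow> 'a::euclidean_space"
  assumes "linear D" "inj D"
  shows "det (\<chi> i j. D (axis i 1) \<bullet> D (axis j 1)) \<noteq> 0"
proof -
  let ?G = "\<chi> i j. D (axis i 1) \<bullet> D (axis j 1)"
  have D: "D v = (\<Sum>i\<in>UNIV. v $ i *\<^sub>R D (axis i 1))" for v
    by (subst basis_expansion[symmetric, of v]) (simp add: linear_sum[OF assms(1)] linear_scale[OF assms(1)] scalar_mult_eq_scaleR)
  have G: "(?G *v v) $ i = D (axis i 1) \<bullet> D v" for v i
    by (subst D[of v]) (simp add: matrix_vector_mult_def inner_sum_right mult.commute)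
  have "v = 0" if "?G *v v = 0" for v
  proof -
    have "D (axis i 1) \<bullet> D v = 0" for i using that G[of v i] by simp
    then have "D v \<bullet> D v = 0" by (subst D) (simp add: inner_sum_left)
    then show "v = 0" using assms by (simp add: linear_injective_0)
  qed
  then show ?thesis using matrix_left_invertible_ker[of ?G] invertible_det_nz[of ?G] matrix_left_right_inverse[of _ ?G]
    unfolding invertible_def by blast
qed

lemma area_factor_compose:
  assumes D2: "linear (frechet_derivative f2 (at y))" and T: "linear T"
    and D1: "\<And>v. frechet_derivative f1 (at x) v = frechet_derivative f2 (at y) (T v)"
  shows "area_factor f1 x = area_factor f2 y * \<bar>det (matrix T)\<bar>"
proof -
  let ?D = "frechet_derivative f2 (at y)"
  let ?G = "\<lambda>D. (\<chi> i j. D (axis i 1) \<bullet> D (axis j 1)) :: real^3^3"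
  have T_ax: "T (axis i 1) = (\<Sum>k\<in>UNIV. matrix T $ k $ i *\<^sub>R axis k 1)" for i
    by (subst basis_expansion[symmetric, of "T (axis i 1)"]) (simp add: matrix_def scalar_mult_eq_scaleR)
  have DT: "?D (T (axis i 1)) = (\<Sum>k\<in>UNIV. matrix T $ k $ i *\<^sub>R ?D (axis k 1))" for i
    unfolding T_ax by (simp add: linear_sum[OF D2] linear_scale[OF D2])
  have "?G (frechet_derivative f1 (at x)) = transpose (matrix T) ** ?G ?D ** matrix T"
    by (simp add: vec_eq_iff D1 DT matrix_matrix_mult_def transpose_def inner_sum_left inner_sum_right
        sum_distrib_left sum_distrib_right mult_ac)
  then have "det (?G (frechet_derivative f1 (at x))) = det (?G ?D) * (det (matrix T))^2"
    by (simp add: det_mul det_transpose power2_eq_square)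
  then show ?thesis by (simp add: area_factor_def real_sqrt_mult)
qed

lemma chart_area_continuous:
  assumes "hypersurface_chart S V f"
  shows "continuous_on V (area_factor f)"
proof -
  have "continuous_on V (\<lambda>x. frechet_derivative f (at x) v)" for v
    using assms by (auto simp: hypersurface_chart_def intro: smooth_on_continuous smooth_on_frechet)
  then show ?thesis unfolding area_factor_def[abs_def] det_3 by (auto intro!: continuous_intros)
qed

lemma chart_preimage_borel:
  assumes ch: "hypersurface_chart S V f" and A: "A \<in> sets borel"
  shows "{x \<in> V. f x \<in> A} \<in> sets borel"
proof -
  have V: "open V" "continuous_on V f" using ch by (auto simp: hypersurface_chart_def intro: smooth_on_continuous)
  have "f \<in> borel_measurable (restrict_space borel V)" by (rule borel_measurable_continuous_on_restrict[OF V(2)])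
  from measurable_sets[OF this A] V(1) show ?thesis
    by (auto simp: sets_restrict_space_iff space_restrict_space Int_def vimage_def conj_commute)
qed

text \<open>Makes the local surface measures agree on overlaps: the change of variables formula is
  applied to the transition map \<tau>.\<close>

lemma chart_transition:
  assumes ch1: "hypersurface_chart S V1 f1" and ch2: "hypersurface_chart S V2 f2"
    and A: "A \<in> sets borel" "A \<subseteq> f1 ` V1" "A \<subseteq> f2 ` V2"
  shows "(\<integral>\<^sup>+x. ennreal (area_factor f1 x) * indicator {x\<in>V1. f1 x \<in> A} x \<partial>lborel) =
         (\<integral>\<^sup>+x. ennreal (area_factor f2 x) * indicator {x\<in>V2. f2 x \<in> A} x \<partial>lborel)"
proof -
  have V: "open V1" "open V2" and sm: "smooth_on f1 V1" "smooth_on f2 V2"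
    and inj: "\<And>x. x \<in> V2 \<Longrightarrow> inj (frechet_derivative f2 (at x))"
    and op: "openin (top_of_set S) (f2 ` V2)" using ch1 ch2 by (auto simp: hypersurface_chart_def)
  obtain g1 g2 where hom: "homeomorphism V1 (f1 ` V1) f1 g1" "homeomorphism V2 (f2 ` V2) f2 g2"
    using ch1 ch2 by (auto simp: hypersurface_chart_def)
  let ?X = "{x\<in>V1. f1 x \<in> A}" and ?Y = "{x\<in>V2. f2 x \<in> A}"
  define \<tau> where "\<tau> x = g2 (f1 x)" for x
  have \<tau>: "\<tau> x \<in> V2" "f2 (\<tau> x) = f1 x" if "x \<in> ?X" for x using hom(2) that A(3) by (auto simp: \<tau>_def homeomorphism_def)
  have X: "?X \<in> sets borel" and Y: "?Y \<in> sets borel" using chart_preimage_borel[OF ch1 A(1)] chart_preimage_borel[OF ch2 A(1)] .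
  have im: "\<tau> ` ?X = ?Y"
  proof (intro equalityI subsetI)
    fix y assume "y \<in> \<tau> ` ?X" then show "y \<in> ?Y" using \<tau> by force
  next
    fix y assume y: "y \<in> ?Y"
    then obtain x where x: "x \<in> V1" "f2 y = f1 x" using A(2) by auto
    then have "\<tau> x = y" using hom(2) y by (auto simp: \<tau>_def homeomorphism_def simp flip: x(2))
    then show "y \<in> \<tau> ` ?X" using x y by force
  qed
  have inj\<tau>: "inj_on \<tau> ?X"
  proof (rule inj_onI)
    fix x y assume xy: "x \<in> ?X" "y \<in> ?X" and eq: "\<tau> x = \<tau> y"
    then have "f1 x = f1 y" using \<tau>(2)[OF xy(1)] \<tau>(2)[OF xy(2)] by simp
    moreover have "g1 (f1 x) = x" "g1 (f1 y) = y" using hom(1) xy by (auto simp: homeomorphism_def)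
    ultimately show "x = y" by metis
  qed
  define D1 D2 where "D1 x = frechet_derivative f1 (at x)" and "D2 x = frechet_derivative f2 (at x)" for x
  have d1: "(f1 has_derivative D1 x) (at x)" if "x \<in> V1" for x
    unfolding D1_def by (rule smooth_on_has_derivative[OF sm(1) that])
  have d2: "(f2 has_derivative D2 x) (at x)" if "x \<in> V2" for x
    unfolding D2_def by (rule smooth_on_has_derivative[OF sm(2) that])
  have lin1: "linear (D1 x)" if "x \<in> V1" for x using d1[OF that] has_derivative_linear by blast
  have lin2: "linear (D2 x)" if "x \<in> V2" for x using d2[OF that] has_derivative_linear by blast
  \<comment> \<open>The image of f2 is a thin set in C^2, so g2 is differentiated only within it; a
    left inverse of the derivative of f2 serves as its derivative.\<close>
  have "\<exists>P. linear P \<and> P \<circ> D2 x = id" if "x \<in> V2" for x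
    using linear_injective_left_inverse[OF lin2[OF that]] inj[OF that] by (auto simp: D2_def)
  then obtain P where P: "linear (P x)" "P x \<circ> D2 x = id" if "x \<in> V2" for x by metis
  define T where "T x = P (\<tau> x) \<circ> D1 x" for x
  have linT: "linear (T x)" if "x \<in> ?X" for x
    unfolding T_def using lin1 P(1) \<tau>(1)[OF that] that by (intro linear_compose) auto
  have dg2: "(g2 has_derivative P (\<tau> x)) (at (f2 (\<tau> x)) within f2 ` V2)" if "x \<in> ?X" for x
  proof -
    have c: "continuous (at (f2 (\<tau> x)) within f2 ` V2) g2"
      using hom(2) \<tau>(1)[OF that] by (auto simp: homeomorphism_def continuous_on_eq_continuous_within)
    show ?thesis by (rule has_derivative_inverse_within[OF has_derivative_at_withinI[OF d2[OF \<tau>(1)[OF that]]] c \<tau>(1)[OF that]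
            P(1)[OF \<tau>(1)[OF that]] P(2)[OF \<tau>(1)[OF that]]])
        (use hom(2) in \<open>auto simp: homeomorphism_def\<close>)
  qed
  have inS: "f1 ` V1 \<subseteq> S" by (rule hypersurface_chart_image[OF ch1])
  \<comment> \<open>A is merely Borel. The map \<tau> is therefore examined on the open set
    \<open>W\<close> of points sent by f1 into the second chart, where a full derivative
    exists.\<close>
  have both: "(\<tau> has_derivative T x) (at x)" "D1 x = (\<lambda>v. D2 (\<tau> x) (T x v))" if x: "x \<in> ?X" for x
  proof -
    obtain O' where O': "open O'" "f2 ` V2 = S \<inter> O'" using op by (metis openin_open)
    have cont1: "continuous_on V1 f1" using sm(1) by (rule smooth_on_continuous)
    define W where "W = V1 \<inter> f1 -` O'"
    have W: "open W" "x \<in> W" using cont1 V(1) O' A(3) x by (auto simp: W_def intro: continuous_open_preimage)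
    have fW: "f2 (\<tau> y) = f1 y" "\<tau> y \<in> V2" if "y \<in> W" for y
    proof -
      have "f1 y \<in> f2 ` V2" using that inS O'(2) by (auto simp: W_def)
      then show "f2 (\<tau> y) = f1 y" "\<tau> y \<in> V2" using hom(2) by (auto simp: \<tau>_def homeomorphism_def)
    qed
    have "(g2 has_derivative P (\<tau> x)) (at (f1 x) within f1 ` W)"
      using dg2[OF that] unfolding \<tau>(2)[OF that] by (rule has_derivative_subset) (use fW in force)
    moreover have "(f1 has_derivative D1 x) (at x within W)" using d1[of x] that has_derivative_at_withinI by blast
    ultimately have "(\<tau> has_derivative T x) (at x within W)"
      unfolding T_def \<tau>_def[abs_def] o_def by (rule has_derivative_in_compose[rotated])
    then show d: "(\<tau> has_derivative T x) (at x)" by (simp only: at_within_open[OF W(2,1)])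
    from has_derivative_compose[OF d d2[OF \<tau>(1)[OF x]]]
    have "((\<lambda>y. f2 (\<tau> y)) has_derivative (\<lambda>v. D2 (\<tau> x) (T x v))) (at x)" .
    then have "(f1 has_derivative (\<lambda>v. D2 (\<tau> x) (T x v))) (at x)"
      by (rule has_derivative_transform_within_open[OF _ W]) (use fW in auto)
    then show "D1 x = (\<lambda>v. D2 (\<tau> x) (T x v))" using d1[of x] x has_derivative_unique by blast
  qed
  note der = has_derivative_at_withinI[OF both(1)]
  have area: "area_factor f1 x = area_factor f2 (\<tau> x) * \<bar>det (matrix (T x))\<bar>" if "x \<in> ?X" for x
    using that both(2)[OF that] lin2[OF \<tau>(1)[OF that]] linT[OF that]
    by (intro area_factor_compose) (auto simp: D1_def D2_def)
  have nz2: "area_factor f2 y \<noteq> 0" if "y \<in> V2" for y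
    unfolding area_factor_def using Gram_det_nonzero[OF lin2[OF that]] inj[OF that] by (simp add: D2_def)
  have ar: "(\<lambda>x. indicator V x * area_factor f x) \<in> borel_measurable borel" if "hypersurface_chart S V f" for V f
  proof -
    have "open V" using that by (simp add: hypersurface_chart_def)
    then have "(\<lambda>x. indicator V x *\<^sub>R area_factor f x) \<in> borel_measurable borel"
      by (intro borel_measurable_continuous_on_indicator chart_area_continuous[OF that]) auto
    then show ?thesis by simp
  qed
  \<comment> \<open>The left inverses P are chosen pointwise, without regularity in the point.
    Measurability of the Jacobian is therefore read off from the quotient of the two area
    factors.\<close>
  let ?d = "\<lambda>x. indicator ?X x * \<bar>det (matrix (T x))\<bar>"
  have md: "?d \<in> borel_measurable borel"
  proof -
    have "continuous_on ?X \<tau>" using der by (auto simp: continuous_on_eq_continuous_within intro: has_derivative_continuous)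
    moreover have "continuous_on V2 (\<lambda>y. inverse (area_factor f2 y))"
      using nz2 by (intro continuous_on_inverse chart_area_continuous[OF ch2]) auto
    ultimately have "continuous_on ?X (\<lambda>x. inverse (area_factor f2 (\<tau> x)))"
      using \<tau>(1) by (auto intro: continuous_on_compose2[of V2 "\<lambda>y. inverse (area_factor f2 y)"])
    then have "continuous_on ?X (\<lambda>x. area_factor f1 x * inverse (area_factor f2 (\<tau> x)))"
      by (intro continuous_on_mult continuous_on_subset[OF chart_area_continuous[OF ch1]]) auto
    then have "(\<lambda>x. indicator ?X x *\<^sub>R (area_factor f1 x * inverse (area_factor f2 (\<tau> x)))) \<in> borel_measurable borel"
      by (intro borel_measurable_continuous_on_indicator) (use X in auto)
    also have "(\<lambda>x. indicator ?X x *\<^sub>R (area_factor f1 x * inverse (area_factor f2 (\<tau> x)))) = ?d"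
      using area nz2 \<tau>(1) by (auto simp: indicator_def fun_eq_iff)
    finally show ?thesis .
  qed
  have "(\<integral>\<^sup>+x. ennreal (area_factor f2 x) * indicator ?Y x \<partial>lborel)
      = (\<integral>\<^sup>+y. ennreal (indicator V2 y * area_factor f2 y) * indicator (\<tau> ` ?X) y \<partial>lborel)"
    unfolding im by (rule nn_integral_cong) (auto simp: indicator_def)
  also have "\<dots> = (\<integral>\<^sup>+x. ennreal (indicator V2 (\<tau> x) * area_factor f2 (\<tau> x)) * ennreal (?d x) \<partial>lborel)"
    by (rule nn_integral_change_of_variables[OF X _ inj\<tau> der md]) (use Y im ar[OF ch2] in auto)
  also have "\<dots> = (\<integral>\<^sup>+x. ennreal (area_factor f1 x) * indicator ?X x \<partial>lborel)"
    by (rule nn_integral_cong) (auto simp: indicator_def area \<tau>(1) ennreal_mult'')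
  finally show ?thesis by simp
qed

lemma hypersurface_chart_subset:
  assumes ch: "hypersurface_chart S V f" and W: "open W" "W \<subseteq> V"
  shows "hypersurface_chart S W f"
proof -
  obtain g where hom: "homeomorphism V (f ` V) f g" using ch by (auto simp: hypersurface_chart_def)
  have V: "open V" and op: "openin (top_of_set S) (f ` V)" using ch by (auto simp: hypersurface_chart_def)
  have "openin (top_of_set V) W" using W by (simp add: open_subset)
  then have "openin (top_of_set (f ` V)) (f ` W)" by (rule homeomorphism_imp_open_map[OF hom])
  then have "openin (top_of_set S) (f ` W)" using op openin_trans by blast
  moreover have "homeomorphism W (f ` W) f g" using hom W(2) by (rule homeomorphism_of_subsets) auto
  ultimately show ?thesis using ch W unfolding hypersurface_chart_def by (blast intro: smooth_on_subset)
qed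

lemma chart_image_borel:
  assumes "hypersurface_chart S V f" "closed S"
  shows "f ` V \<in> sets borel"
proof -
  obtain O' where "open O'" "f ` V = S \<inter> O'" using assms(1) by (metis hypersurface_chart_def openin_open)
  then show ?thesis using assms(2) by simp
qed

lemma chart_area_measurable:
  assumes "hypersurface_chart S V f"
  shows "(\<lambda>x. ennreal (area_factor f x) * indicator V x) \<in> borel_measurable borel"
proof -
  have "open V" using assms by (simp add: hypersurface_chart_def)
  then have "(\<lambda>x. indicator V x *\<^sub>R area_factor f x) \<in> borel_measurable borel"
    by (intro borel_measurable_continuous_on_indicator chart_area_continuous[OF assms]) auto
  then have "(\<lambda>x. ennreal (indicator V x *\<^sub>R area_factor f x)) \<in> borel_measurable borel" by measurable
  moreover have "(\<lambda>x. ennreal (indicator V x *\<^sub>R area_factor f x)) = (\<lambda>x. ennreal (area_factor f x) * indicator V x)"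
    by (auto simp: indicator_def)
  ultimately show ?thesis by simp
qed

text \<open>Surface measure of one chart, as a measure on all of C^2. Off V the density is 0, so the
  default value 0 of the map carries no mass.\<close>

definition chart_measure :: "(real^3) set \<Rightarrow> (real^3 \<Rightarrow> C2) \<Rightarrow> C2 measure" where
  "chart_measure V f = distr (density lborel (\<lambda>x. ennreal (area_factor f x) * indicator V x)) borel
     (\<lambda>x. if x \<in> V then f x else 0)"

lemma chart_extend_measurable:
  assumes "hypersurface_chart S V f"
  shows "(\<lambda>x. if x \<in> V then f x else 0) \<in> borel_measurable borel" using assms unfolding hypersurface_chart_def
  by (intro borel_measurable_continuous_on_if) (auto intro: continuous_intros smooth_on_continuous)

lemma chart_measure_sets [simp]: "sets (chart_measure V f) = sets borel" by (simp add: chart_measure_def)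

lemma nn_integral_chart_measure:
  assumes ch: "hypersurface_chart S V g" and f: "f \<in> borel_measurable borel"
  shows "(\<integral>\<^sup>+p. f p \<partial>chart_measure V g) = (\<integral>\<^sup>+x. f (g x) * ennreal (area_factor g x) * indicator V x \<partial>lborel)"
proof -
  have "(\<integral>\<^sup>+p. f p \<partial>chart_measure V g)
    = (\<integral>\<^sup>+x. ennreal (area_factor g x) * indicator V x * f (if x \<in> V then g x else 0) \<partial>lborel)" unfolding chart_measure_def
    using chart_extend_measurable[OF ch] chart_area_measurable[OF ch] f
    by (subst nn_integral_distr) (auto simp: nn_integral_density)
  also have "\<dots> = (\<integral>\<^sup>+x. f (g x) * ennreal (area_factor g x) * indicator V x \<partial>lborel)"
    by (rule nn_integral_cong) (auto simp: indicator_def mult.commute)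
  finally show ?thesis .
qed

lemma emeasure_chart_measure:
  assumes ch: "hypersurface_chart S V f" and A: "A \<in> sets borel"
  shows "emeasure (chart_measure V f) A = (\<integral>\<^sup>+x. ennreal (area_factor f x) * indicator {x\<in>V. f x \<in> A} x \<partial>lborel)"
proof -
  have "emeasure (chart_measure V f) A = (\<integral>\<^sup>+p. indicator A p \<partial>chart_measure V f)" using A by simp
  also have "\<dots> = (\<integral>\<^sup>+x. indicator A (f x) * ennreal (area_factor f x) * indicator V x \<partial>lborel)"
    using A by (intro nn_integral_chart_measure[OF ch]) auto
  also have "\<dots> = (\<integral>\<^sup>+x. ennreal (area_factor f x) * indicator {x\<in>V. f x \<in> A} x \<partial>lborel)"
    by (rule nn_integral_cong) (auto simp: indicator_def)
  finally show ?thesis .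
qed

section \<open>Existence and uniqueness of the surface measure\<close>

context hypersurface
begin

lemma finite_atlas:
  obtains n :: nat and V f where "\<forall>i<n. hypersurface_chart S (V i) (f i)"
    "S = (\<Union>i<n. f i ` V i)"
    "\<forall>i<n. emeasure (chart_measure (V i) (f i)) UNIV < \<infinity>"
proof -
  have ex: "\<exists>V f O'. hypersurface_chart S V f \<and> p \<in> f ` V \<and> emeasure (chart_measure V f) UNIV < \<infinity> \<and> open O' \<and> f ` V = S \<inter> O'"
    if p: "p \<in> S" for p
  proof -
    obtain V f x where ch: "hypersurface_chart S V f" and x: "x \<in> V" "p = f x" using chart_exists[OF p] .
    have "open V" using ch by (simp add: hypersurface_chart_def)
    \<comment> \<open>A closed ball inside the chart domain keeps the area factor bounded, hence the
      chart measure finite.\<close>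
    then obtain r where r: "r > 0" "cball x r \<subseteq> V" using x(1) open_contains_cball by blast
    let ?W = "ball x r"
    have W: "open ?W" "?W \<subseteq> V" "x \<in> ?W" using r ball_subset_cball by auto
    have chW: "hypersurface_chart S ?W f" by (rule hypersurface_chart_subset[OF ch W(1,2)])
    have "continuous_on (cball x r) (area_factor f)" by (rule continuous_on_subset[OF chart_area_continuous[OF ch] r(2)])
    then have "bounded (area_factor f ` cball x r)" by (intro compact_imp_bounded compact_continuous_image compact_cball)
    then obtain K where "\<forall>y\<in>cball x r. \<bar>area_factor f y\<bar> \<le> K" unfolding bounded_iff by auto
    then have K: "area_factor f y \<le> K" if "y \<in> ?W" for y using that by (auto simp: abs_le_iff)
    have "emeasure (chart_measure ?W f) UNIV = (\<integral>\<^sup>+y. ennreal (area_factor f y) * indicator ?W y \<partial>lborel)"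
      by (subst emeasure_chart_measure[OF chW]) (auto intro!: nn_integral_cong simp: indicator_def)
    also have "\<dots> \<le> (\<integral>\<^sup>+y. ennreal K * indicator ?W y \<partial>lborel)"
      by (rule nn_integral_mono) (use K in \<open>auto simp: indicator_def intro!: ennreal_leI\<close>)
    also have "\<dots> = ennreal K * emeasure lborel ?W" by (rule nn_integral_cmult_indicator) simp
    also have "\<dots> < \<infinity>" using emeasure_lborel_ball_finite[of x r] by (simp add: ennreal_mult_less_top)
    finally have fin: "emeasure (chart_measure ?W f) UNIV < \<infinity>" .
    obtain O' where "open O'" "f ` ?W = S \<inter> O'" using chW by (metis hypersurface_chart_def openin_open)
    then show ?thesis using chW fin x(2) W(3) by blast
  qed
  then obtain V f O' where ch: "\<And>p. p \<in> S \<Longrightarrow> hypersurface_chart S (V p) (f p)"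
    and p: "\<And>p. p \<in> S \<Longrightarrow> p \<in> f p ` V p" and fin: "\<And>p. p \<in> S \<Longrightarrow> emeasure (chart_measure (V p) (f p)) UNIV < \<infinity>"
    and O': "\<And>p. p \<in> S \<Longrightarrow> open (O' p)" "\<And>p. p \<in> S \<Longrightarrow> f p ` V p = S \<inter> O' p" by metis
  have "S \<subseteq> (\<Union>p\<in>S. O' p)" using p O' by blast
  then obtain F where F: "finite F" "F \<subseteq> S" "S \<subseteq> (\<Union>p\<in>F. O' p)" using compactE_image[OF compact_S, of S O'] O'(1) by metis
  obtain g :: "nat \<Rightarrow> C2" and n where g: "F = g ` {..<n}"
    using F(1) finite_imp_nat_seg_image_inj_on[of F] by (auto simp: lessThan_def)
  have gS: "g i \<in> S" if "i < n" for i using that g F(2) by auto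
  show thesis
  proof (rule that[of n "\<lambda>i. V (g i)" "\<lambda>i. f (g i)"])
    show "S = (\<Union>i<n. f (g i) ` V (g i))" using F(3) O'(2)[OF gS] by (auto simp: g)
  qed (use ch fin gS in auto)
qed

lemma sets_S: "A \<in> sets (restrict_space borel S) \<longleftrightarrow> A \<in> sets borel \<and> A \<subseteq> S"
  using closed_S by (auto simp: sets_restrict_space_iff)

text \<open>\<open>surface_measure\<close> is a definite description and acquires its meaning here.
  The images of a finite atlas are made disjoint and the chart measures added over the pieces;
  independence of the chart comes from \<open>chart_transition\<close>, and the same decomposition
  shows uniqueness.\<close>

lemma surface_measure_ex1:
  "\<exists>!\<sigma>. sets \<sigma> = sets (restrict_space borel S) \<and>
     (\<forall>V f. hypersurface_chart S V f \<longrightarrow> (\<forall>A\<in>sets \<sigma>. A \<subseteq> f ` V \<longrightarrow>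
        emeasure \<sigma> A =
          (\<integral>\<^sup>+x. ennreal (area_factor f x) * indicator {x\<in>V. f x \<in> A} x \<partial>lborel)))"
  (is "\<exists>!\<sigma>. ?P \<sigma>")
proof -
  obtain n :: nat and V f where ch': "\<forall>i<n. hypersurface_chart S (V i) (f i)"
    and cover: "S = (\<Union>i<n. f i ` V i)"
    and "\<forall>i<n. emeasure (chart_measure (V i) (f i)) UNIV < \<infinity>" using finite_atlas .
  then have ch: "\<And>i. i < n \<Longrightarrow> hypersurface_chart S (V i) (f i)" by blast
  define B where "B = disjointed (\<lambda>i. f i ` V i)"
  have Bborel: "B i \<in> sets borel" if "i < n" for i
    unfolding B_def disjointed_def using that chart_image_borel[OF ch closed_S] by auto
  have disjA: "disjoint_family_on (\<lambda>i. A \<inter> B i) {..<n}" for A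
    using disjoint_family_disjointed[of "\<lambda>i. f i ` V i"] by (fastforce simp: B_def disjoint_family_on_def)
  have SB: "S = (\<Union>i<n. B i)"
    unfolding cover B_def using finite_UN_disjointed_eq[of "\<lambda>i. f i ` V i" n] by (simp only: lessThan_atLeast0)
  let ?N = "\<lambda>i. chart_measure (V i) (f i)"
  define \<sigma>0 where "\<sigma>0 A = (\<Sum>i<n. emeasure (?N i) (A \<inter> B i))" for A
  define \<sigma> where "\<sigma> = measure_of S (sets (restrict_space borel S)) \<sigma>0"
  have sa: "sigma_algebra S (sets (restrict_space borel S))"
    using sets.sigma_algebra_axioms[of "restrict_space borel S"] by (simp add: space_restrict_space)
  have sets\<sigma>: "sets \<sigma> = sets (restrict_space borel S)" unfolding \<sigma>_def using sa by (rule sigma_algebra.sets_measure_of_eq)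
  have em: "emeasure \<sigma> A = \<sigma>0 A" if A: "A \<in> sets (restrict_space borel S)" for A unfolding \<sigma>_def
  proof (rule emeasure_measure_of_sigma[OF sa _ _ A])
    show "positive (sets (restrict_space borel S)) \<sigma>0" by (simp add: positive_def \<sigma>0_def)
    show "countably_additive (sets (restrict_space borel S)) \<sigma>0" unfolding countably_additive_def
    proof (intro allI impI)
      fix A :: "nat \<Rightarrow> C2 set"
      assume A: "range A \<subseteq> sets (restrict_space borel S)" "disjoint_family A" "\<Union> (range A) \<in> sets (restrict_space borel S)"
      have "(\<Sum>k. \<sigma>0 (A k)) = (\<Sum>i<n. \<Sum>k. emeasure (?N i) (A k \<inter> B i))" unfolding \<sigma>0_def by (rule suminf_sum) auto
      also have "\<dots> = (\<Sum>i<n. emeasure (?N i) (\<Union>k. A k \<inter> B i))"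
      proof (intro sum.cong refl suminf_emeasure)
        fix i assume "i \<in> {..<n}"
        then show "range (\<lambda>k. A k \<inter> B i) \<subseteq> sets (?N i)" using A(1) Bborel sets_S by auto
        show "disjoint_family (\<lambda>k. A k \<inter> B i)" using A(2) unfolding disjoint_family_on_def by blast
      qed
      also have "\<dots> = \<sigma>0 (\<Union> (range A))"
      proof -
        have "(\<Union>k. A k \<inter> B i) = \<Union> (range A) \<inter> B i" for i by blast
        then show ?thesis unfolding \<sigma>0_def by (simp only:)
      qed
      finally show "(\<Sum>k. \<sigma>0 (A k)) = \<sigma>0 (\<Union> (range A))" .
    qed
  qed
  have chart: "emeasure \<sigma> A = (\<integral>\<^sup>+x. ennreal (area_factor \<theta> x) * indicator {x\<in>W. \<theta> x \<in> A} x \<partial>lborel)"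
    if W: "hypersurface_chart S W \<theta>" and A: "A \<in> sets \<sigma>" "A \<subseteq> \<theta> ` W" for W \<theta> A
  proof -
    have Ab: "A \<in> sets borel" "A \<subseteq> S" using A(1) sets\<sigma> sets_S by auto
    have "emeasure (?N i) (A \<inter> B i) = emeasure (chart_measure W \<theta>) (A \<inter> B i)" if "i < n" for i
    proof -
      have AB: "A \<inter> B i \<in> sets borel" "A \<inter> B i \<subseteq> f i ` V i" "A \<inter> B i \<subseteq> \<theta> ` W"
        using Ab Bborel[OF that] A(2) by (auto simp: B_def disjointed_def)
      show ?thesis using chart_transition[OF ch[OF that] W AB]
        by (simp add: emeasure_chart_measure[OF ch[OF that] AB(1)] emeasure_chart_measure[OF W AB(1)])
    qed
    then have "emeasure \<sigma> A = (\<Sum>i<n. emeasure (chart_measure W \<theta>) (A \<inter> B i))" using em A sets\<sigma> by (simp add: \<sigma>0_def)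
    also have "\<dots> = emeasure (chart_measure W \<theta>) (\<Union>i<n. A \<inter> B i)" using Ab Bborel by (intro sum_emeasure disjA) auto
    also have "(\<Union>i<n. A \<inter> B i) = A" using SB Ab(2) by blast
    finally show ?thesis using emeasure_chart_measure[OF W Ab(1)] by simp
  qed
  have P\<sigma>: "?P \<sigma>" using sets\<sigma> chart by blast
  have "\<sigma>' = \<sigma>" if P: "?P \<sigma>'" for \<sigma>'
  proof (rule measure_eqI)
    show "sets \<sigma>' = sets \<sigma>" using P sets\<sigma> by simp
    fix A assume A': "A \<in> sets \<sigma>'"
    then have A: "A \<in> sets borel" "A \<subseteq> S" using P sets_S by auto
    have AB: "A \<inter> B i \<in> sets \<sigma>'" "A \<inter> B i \<in> sets \<sigma>" "A \<inter> B i \<subseteq> f i ` V i" if "i < n" for i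
      using P sets\<sigma> sets_S A Bborel[OF that] by (auto simp: B_def disjointed_def)
    have E: "emeasure \<tau> A = (\<Sum>i<n. emeasure \<tau> (A \<inter> B i))" if "\<And>i. i < n \<Longrightarrow> A \<inter> B i \<in> sets \<tau>" for \<tau>
    proof -
      have "(\<Sum>i<n. emeasure \<tau> (A \<inter> B i)) = emeasure \<tau> (\<Union>i<n. A \<inter> B i)" using that by (intro sum_emeasure disjA) auto
      also have "(\<Union>i<n. A \<inter> B i) = A" using SB A(2) by blast
      finally show ?thesis by simp
    qed
    have "emeasure \<sigma>' (A \<inter> B i) = emeasure \<sigma> (A \<inter> B i)" if "i < n" for i
      using conjunct2[OF P, rule_format, OF ch[OF that] AB(1)[OF that] AB(3)[OF that]]
        chart[OF ch[OF that] AB(2)[OF that] AB(3)[OF that]] by (rule trans[OF _ sym])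
    then have "(\<Sum>i<n. emeasure \<sigma>' (A \<inter> B i)) = (\<Sum>i<n. emeasure \<sigma> (A \<inter> B i))" by (intro sum.cong) auto
    then show "emeasure \<sigma>' A = emeasure \<sigma> A" using E[of \<sigma>', OF AB(1)] E[of \<sigma>, OF AB(2)] by (simp only:)
  qed
  with P\<sigma> show ?thesis by (rule ex1I)
qed

abbreviation "\<sigma> \<equiv> surface_measure S"

lemma sets_\<sigma>: "sets \<sigma> = sets (restrict_space borel S)"
  and emeasure_\<sigma>: "hypersurface_chart S V f \<Longrightarrow> A \<in> sets borel \<Longrightarrow> A \<subseteq> f ` V \<Longrightarrow>
     emeasure \<sigma> A = emeasure (chart_measure V f) A"
proof -
  note P = theI'[OF surface_measure_ex1, folded surface_measure_def]
  show 1: "sets \<sigma> = sets (restrict_space borel S)" by (rule conjunct1[OF P])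
  assume A: "hypersurface_chart S V f" "A \<in> sets borel" "A \<subseteq> f ` V"
  then have "A \<in> sets \<sigma>" unfolding 1 sets_S using hypersurface_chart_image[OF A(1)] by auto
  then have "emeasure \<sigma> A = (\<integral>\<^sup>+x. ennreal (area_factor f x) * indicator {x\<in>V. f x \<in> A} x \<partial>lborel)"
    by (rule conjunct2[OF P, rule_format, OF A(1) _ A(3)])
  then show "emeasure \<sigma> A = emeasure (chart_measure V f) A" by (simp only: emeasure_chart_measure[OF A(1,2)])
qed

lemma space_\<sigma> [simp]: "space \<sigma> = S" using sets_eq_imp_space_eq[OF sets_\<sigma>] by (simp add: space_restrict_space)

lemma finite_\<sigma>: "finite_measure \<sigma>"
proof
  obtain n :: nat and V f where ch': "\<forall>i<n. hypersurface_chart S (V i) (f i)"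
    and cover: "S = (\<Union>i<n. f i ` V i)"
    and fin: "\<forall>i<n. emeasure (chart_measure (V i) (f i)) UNIV < \<infinity>" using finite_atlas .
  then have ch: "\<And>i. i < n \<Longrightarrow> hypersurface_chart S (V i) (f i)" by blast
  have im: "f i ` V i \<in> sets \<sigma>" "f i ` V i \<in> sets borel" if "i < n" for i
    using that chart_image_borel[OF ch closed_S] hypersurface_chart_image[OF ch] sets_S by (auto simp: sets_\<sigma>)
  have "emeasure \<sigma> S \<le> (\<Sum>i<n. emeasure \<sigma> (f i ` V i))"
    using emeasure_subadditive_finite[of "{..<n}" "\<lambda>i. f i ` V i" \<sigma>] im cover by auto
  also have "\<dots> \<le> (\<Sum>i<n. emeasure (chart_measure (V i) (f i)) UNIV)"
  proof (rule sum_mono)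
    fix i assume "i \<in> {..<n}"
    then have i: "i < n" by simp
    have "emeasure \<sigma> (f i ` V i) = emeasure (chart_measure (V i) (f i)) (f i ` V i)"
      by (rule emeasure_\<sigma>[OF ch[OF i] im(2)[OF i] order_refl])
    also have "\<dots> \<le> emeasure (chart_measure (V i) (f i)) UNIV" by (rule emeasure_mono) auto
    finally show "emeasure \<sigma> (f i ` V i) \<le> emeasure (chart_measure (V i) (f i)) UNIV" .
  qed
  also have "\<dots> < \<infinity>" using fin by simp
  finally show "emeasure \<sigma> (space \<sigma>) \<noteq> \<infinity>" by simp
qed

lemma nn_integral_chart:
  assumes ch: "hypersurface_chart S V g" and f: "f \<in> borel_measurable borel"
  shows "(\<integral>\<^sup>+p. f p * indicator (g ` V) p \<partial>\<sigma>) = (\<integral>\<^sup>+x. f (g x) * ennreal (area_factor g x) * indicator V x \<partial>lborel)"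
proof -
  let ?I = "g ` V"
  have I: "?I \<in> sets borel" "?I \<subseteq> S" using chart_image_borel[OF ch closed_S] hypersurface_chart_image[OF ch] .
  have idm: "(\<lambda>x. x) \<in> measurable \<sigma> borel"
    unfolding measurable_cong_sets[OF sets_\<sigma> refl] by (rule measurable_restrict_space1) simp
  have eq: "distr (density \<sigma> (indicator ?I)) borel (\<lambda>x. x) = chart_measure V g"
  proof (rule measure_eqI)
    fix A assume "A \<in> sets (distr (density \<sigma> (indicator ?I)) borel (\<lambda>x. x))"
    then have A: "A \<in> sets borel" by simp
    have I\<sigma>: "?I \<in> sets \<sigma>" "A \<inter> S \<in> sets \<sigma>" "A \<inter> ?I \<in> sets \<sigma>" using I A closed_S sets_S by (auto simp: sets_\<sigma>)
    have "emeasure (distr (density \<sigma> (indicator ?I)) borel (\<lambda>x. x)) A = emeasure (density \<sigma> (indicator ?I)) (A \<inter> S)"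
      using A idm by (subst emeasure_distr) (auto simp: Int_commute)
    also have "\<dots> = (\<integral>\<^sup>+x. indicator ?I x * indicator (A \<inter> S) x \<partial>\<sigma>)" using I\<sigma> by (intro emeasure_density) auto
    also have "\<dots> = (\<integral>\<^sup>+x. indicator (A \<inter> ?I) x \<partial>\<sigma>)" by (rule nn_integral_cong) (use I in \<open>auto simp: indicator_def\<close>)
    also have "\<dots> = emeasure \<sigma> (A \<inter> ?I)" using I\<sigma> by simp
    also have "\<dots> = emeasure (chart_measure V g) (A \<inter> ?I)" using emeasure_\<sigma>[OF ch] A I by auto
    also have "\<dots> = emeasure (chart_measure V g) A"
      using A I by (subst (1 2) emeasure_chart_measure[OF ch]) (auto intro!: nn_integral_cong simp: indicator_def)
    finally show "emeasure (distr (density \<sigma> (indicator ?I)) borel (\<lambda>x. x)) A = emeasure (chart_measure V g) A" .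
  qed simp
  have I\<sigma>: "?I \<in> sets \<sigma>" using I sets_S by (auto simp: sets_\<sigma>)
  have "(\<integral>\<^sup>+p. f p \<partial>chart_measure V g) = (\<integral>\<^sup>+p. indicator ?I p * f p \<partial>\<sigma>)" unfolding eq[symmetric]
  proof (subst nn_integral_distr)
    have f\<sigma>: "f \<in> borel_measurable \<sigma>" using measurable_compose[OF idm f] .
    show "(\<lambda>x. x) \<in> measurable (density \<sigma> (indicator ?I)) borel" using idm by simp
    show "(\<integral>\<^sup>+p. f p \<partial>density \<sigma> (indicator ?I)) = (\<integral>\<^sup>+p. indicator ?I p * f p \<partial>\<sigma>)"
      using I\<sigma> f\<sigma> by (intro nn_integral_density) auto
  qed (use f in auto)
  then show ?thesis using nn_integral_chart_measure[OF ch f] by (simp add: mult.commute)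
qed

end

section \<open>Densities of 3-forms\<close>

lemma vector_4 [simp]:
  "(vector [x,y,z,w] :: ('a::zero)^4) $ 1 = x" "(vector [x,y,z,w] :: ('a::zero)^4) $ 2 = y"
  "(vector [x,y,z,w] :: ('a::zero)^4) $ 3 = z" "(vector [x,y,z,w] :: ('a::zero)^4) $ 4 = w" unfolding vector_def by simp_all

lemma det_4_block:
  fixes A :: "'a::comm_ring_1^4^4"
  assumes "A $ 1 $ 2 = 0" "A $ 1 $ 3 = 0" "A $ 1 $ 4 = 0"
  shows "det A = A $ 1 $ 1 * (A $ 2 $ 2 * A $ 3 $ 3 * A $ 4 $ 4 + A $ 2 $ 3 * A $ 3 $ 4 * A $ 4 $ 2 + A $ 2 $ 4 * A $ 3 $ 2 * A $ 4 $ 3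
    - A $ 2 $ 2 * A $ 3 $ 4 * A $ 4 $ 3 - A $ 2 $ 3 * A $ 3 $ 2 * A $ 4 $ 4 - A $ 2 $ 4 * A $ 3 $ 3 * A $ 4 $ 2)"
proof -
  have f1234: "finite {2::4,3,4}" "1 \<notin> {2::4,3,4}" "finite {3::4,4}" "2 \<notin> {3::4,4}" "finite {4::4}" "3 \<notin> {4::4}" by auto
  show ?thesis unfolding det_def UNIV_4 unfolding sum_over_permutations_insert[OF f1234(1,2)]
    unfolding sum_over_permutations_insert[OF f1234(3,4)] unfolding sum_over_permutations_insert[OF f1234(5,6)]
    unfolding permutes_sing using assms
    by (simp add: sign_swap_id permutation_swap_id sign_compose sign_id permutation_compose algebra_simps)
qed

text \<open>The determinant in \<open>oriented_frame\<close>. For a unit normal n it is the signed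
  volume of a tangent triple.\<close>

definition vol4 :: "C2 \<Rightarrow> C2 \<Rightarrow> C2 \<Rightarrow> C2 \<Rightarrow> real" where
  "vol4 n u v t = det (vector [real_coords n, real_coords u, real_coords v, real_coords t] :: real^4^4)"

lemma real_coords_inner: "real_coords u \<bullet> real_coords v = u \<bullet> v"
  by (simp add: real_coords_def inner_vec_def sum_4 UNIV_2 inner_complex_def)

lemma linear_real_coords: "linear real_coords" by (rule linearI) (simp_all add: real_coords_def vec_eq_iff forall_4)

definition gram3 :: "C2 \<Rightarrow> C2 \<Rightarrow> C2 \<Rightarrow> real^3^3" where
  "gram3 u v t = vector [vector [u \<bullet> u, u \<bullet> v, u \<bullet> t], vector [v \<bullet> u, v \<bullet> v, v \<bullet> t], vector [t \<bullet> u, t \<bullet> v, t \<bullet> t]]"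

text \<open>The Gram matrix of n, u, v, t splits off a 1, because n is a unit vector orthogonal to
  the others.\<close>

lemma vol4_gram:
  assumes "n \<bullet> n = 1" "u \<bullet> n = 0" "v \<bullet> n = 0" "t \<bullet> n = 0"
  shows "(vol4 n u v t)^2 = det (gram3 u v t)"
proof -
  let ?A = "vector [real_coords n, real_coords u, real_coords v, real_coords t] :: real^4^4"
  have G: "(?A ** transpose ?A) $ i $ j = ?A $ i \<bullet> ?A $ j" for i j
    by (simp add: matrix_matrix_mult_def transpose_def inner_vec_def)
  have "(vol4 n u v t)^2 = det (?A ** transpose ?A)" by (simp add: vol4_def det_mul power2_eq_square)
  also have "\<dots> = det (gram3 u v t)"
  proof -
    have "n \<bullet> u = 0" "n \<bullet> v = 0" "n \<bullet> t = 0" using assms by (simp_all add: inner_commute)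
    then show ?thesis by (subst det_4_block) (simp_all add: G real_coords_inner det_3 gram3_def assms)
  qed
  finally show ?thesis .
qed

lemma vol4_combination:
  fixes T :: "real^3^3"
  assumes "u = T$1$1 *\<^sub>R e1 + T$1$2 *\<^sub>R e2 + T$1$3 *\<^sub>R e3"
    and "v = T$2$1 *\<^sub>R e1 + T$2$2 *\<^sub>R e2 + T$2$3 *\<^sub>R e3"
    and "t = T$3$1 *\<^sub>R e1 + T$3$2 *\<^sub>R e2 + T$3$3 *\<^sub>R e3"
  shows "vol4 n u v t = det T * vol4 n e1 e2 e3"
proof -
  let ?T = "vector [vector [1, 0, 0, 0], vector [0, T$1$1, T$1$2, T$1$3], vector [0, T$2$1, T$2$2, T$2$3],
     vector [0, T$3$1, T$3$2, T$3$3]] :: real^4^4"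
  let ?A = "\<lambda>u v t. vector [real_coords n, real_coords u, real_coords v, real_coords t] :: real^4^4"
  have add: "real_coords (x + y) = real_coords x + real_coords y" "real_coords (c *\<^sub>R x) = c *\<^sub>R real_coords x" for x y c
    using linear_add[OF linear_real_coords] linear_scale[OF linear_real_coords] by auto
  have "?A u v t = ?T ** ?A e1 e2 e3" by (simp add: vec_eq_iff forall_4 matrix_matrix_mult_def sum_4 assms add)
  then have "vol4 n u v t = det ?T * vol4 n e1 e2 e3" by (simp add: vol4_def det_mul)
  also have "det ?T = det T" by (subst det_4_block) (simp_all add: det_3)
  finally show ?thesis .
qed

text \<open>The determinant is the same as in \<open>vol4_combination\<close>; hence the quotient of
  a 3-form by the volume does not depend on the tangent triple.\<close>

lemma wedge3_combination:
  fixes T :: "real^3^3"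
  assumes "linear a" "linear b" "linear g"
    and "u = T$1$1 *\<^sub>R e1 + T$1$2 *\<^sub>R e2 + T$1$3 *\<^sub>R e3"
    and "v = T$2$1 *\<^sub>R e1 + T$2$2 *\<^sub>R e2 + T$2$3 *\<^sub>R e3"
    and "t = T$3$1 *\<^sub>R e1 + T$3$2 *\<^sub>R e2 + T$3$3 *\<^sub>R e3"
  shows "wedge3 a b g u v t = of_real (det T) * wedge3 a b g e1 e2 e3"
proof -
  let ?W = "\<lambda>u v t. vector [vector [a u, a v, a t], vector [b u, b v, b t], vector [g u, g v, g t]] :: complex^3^3"
  let ?T = "\<chi> i j. complex_of_real (T $ j $ i)"
  have lin: "f (x + y) = f x + f y" "f (c *\<^sub>R x) = of_real c * f x" if "linear f" for f :: form1 and x y c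
    using linear_add[OF that] linear_scale[OF that] by (auto simp: scaleR_conv_of_real)
  have "?W u v t = ?W e1 e2 e3 ** ?T"
    by (simp add: vec_eq_iff forall_3 matrix_matrix_mult_def sum_3 assms(4-6) lin[OF assms(1)] lin[OF assms(2)]
        lin[OF assms(3)] mult.commute)
  moreover have "det ?T = of_real (det T)" by (simp add: det_3 algebra_simps)
  ultimately show ?thesis by (simp add: wedge3_def det_mul mult.commute)
qed

lemma wedge3_expand:
  "wedge3 a b g u v w = a u * (b v * g w - b w * g v) - a v * (b u * g w - b w * g u) + a w * (b u * g v - b v * g u)"
  by (simp add: wedge3_def det_3 algebra_simps)

context hypersurface
begin

definition nrm :: "C2 \<Rightarrow> C2" where "nrm p = sgn (grad \<rho> p)"

lemma nrm: assumes "p \<in> S" shows "nrm p \<bullet> nrm p = 1" "outer_normal S \<Omega> p = nrm p"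
  "D\<rho> p v = 0 \<longleftrightarrow> v \<bullet> nrm p = 0"
proof -
  have g: "grad \<rho> p \<noteq> 0" using grad_nz assms .
  show "nrm p \<bullet> nrm p = 1" using g by (simp add: nrm_def dot_square_norm norm_sgn)
  show "outer_normal S \<Omega> p = nrm p" using outer_normal_eq[OF assms] by (simp add: nrm_def)
  have "D\<rho> p v = v \<bullet> grad \<rho> p" using D\<rho>_grad assms S_U by blast
  then show "D\<rho> p v = 0 \<longleftrightarrow> v \<bullet> nrm p = 0" using g by (simp add: nrm_def sgn_div_norm)
qed

text \<open>\<open>form_density\<close> evaluates at a frame chosen by \<open>SOME\<close>, so a
  frame must exist. An orthonormal basis of the tangent space becomes positive after possibly
  reversing one vector.\<close>

lemma oriented_frame_exists:
  assumes p: "p \<in> S"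
  shows "\<exists>e. oriented_frame S \<Omega> p e"
proof -
  let ?n = "nrm p"
  have n: "?n \<bullet> ?n = 1" by (rule nrm(1)[OF p])
  then have n0: "?n \<noteq> 0" by auto
  let ?H = "{v. ?n \<bullet> v = 0}"
  have "subspace ?H" by (rule subspace_hyperplane)
  then obtain B where B: "B \<subseteq> ?H" "pairwise orthogonal B" "\<And>x. x \<in> B \<Longrightarrow> norm x = 1"
    "independent B" "card B = dim ?H" "span B = ?H" using orthonormal_basis_subspace by metis
  have "dim ?H = 3" using dim_hyperplane[OF n0] by (simp add: DIM_cart)
  then obtain a b c where abc: "B = {a, b, c}" "a \<noteq> b" "a \<noteq> c" "b \<noteq> c" using B(5) by (metis card_3_iff)
  have nn: "norm a = 1" "norm b = 1" "norm c = 1" using B(3) abc by auto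
  have orth: "a \<bullet> b = 0" "a \<bullet> c = 0" "b \<bullet> c = 0" using B(2) abc by (auto simp: pairwise_def orthogonal_def)
  have pn: "a \<bullet> ?n = 0" "b \<bullet> ?n = 0" "c \<bullet> ?n = 0" using B(1) abc by (auto simp: inner_commute)
  have ii: "a \<bullet> a = 1" "b \<bullet> b = 1" "c \<bullet> c = 1" using nn by (simp_all add: dot_square_norm)
  have "(vol4 ?n a b c)^2 = 1" unfolding vol4_gram[OF n pn] using orth ii by (simp add: gram3_def det_3 inner_commute)
  then have v: "vol4 ?n a b c \<noteq> 0" by auto
  have sw: "vol4 ?n (- a) b c = - vol4 ?n a b c"
    by (subst vol4_combination[where T="vector [vector [-1,0,0], vector [0,1,0], vector [0,0,1]]" and ?e1.0=a and ?e2.0=b and ?e3.0=c])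
      (simp_all add: det_3)
  have "oriented_frame S \<Omega> p (a, b, c) \<or> oriented_frame S \<Omega> p (- a, b, c)"
    using v sw nn orth pn by (auto simp: oriented_frame_def nrm(2)[OF p] vol4_def[symmetric] Let_def)
  then show ?thesis by blast
qed

text \<open>Opens the \<open>SOME\<close> in \<open>form_density\<close> once. Later arguments use
  the chosen frame only through these properties.\<close>

lemma form_density_frame:
  assumes p: "p \<in> S"
  obtains e1 e2 e3 where "\<And>a. form_density S \<Omega> a p = a p e1 e2 e3"
    "D\<rho> p e1 = 0" "D\<rho> p e2 = 0" "D\<rho> p e3 = 0" "vol4 (nrm p) e1 e2 e3 = 1"
    "\<And>u. D\<rho> p u = 0 \<Longrightarrow> u = (u \<bullet> e1) *\<^sub>R e1 + (u \<bullet> e2) *\<^sub>R e2 + (u \<bullet> e3) *\<^sub>R e3"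
proof -
  let ?n = "nrm p"
  obtain e1 e2 e3 where e: "(SOME e. oriented_frame S \<Omega> p e) = (e1, e2, e3)" by (metis prod_cases3)
  have of: "oriented_frame S \<Omega> p (e1, e2, e3)" using someI_ex[OF oriented_frame_exists[OF p]] unfolding e .
  then have nn: "norm e1 = 1" "norm e2 = 1" "norm e3 = 1"
    and orth: "e1 \<bullet> e2 = 0" "e1 \<bullet> e3 = 0" "e2 \<bullet> e3 = 0"
    and pn: "e1 \<bullet> ?n = 0" "e2 \<bullet> ?n = 0" "e3 \<bullet> ?n = 0"
    and pos: "vol4 ?n e1 e2 e3 > 0" by (auto simp: oriented_frame_def nrm(2)[OF p] vol4_def[symmetric] Let_def)
  have ii: "e1 \<bullet> e1 = 1" "e2 \<bullet> e2 = 1" "e3 \<bullet> e3 = 1" using nn by (simp_all add: dot_square_norm)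
  have "(vol4 ?n e1 e2 e3)^2 = 1"
    unfolding vol4_gram[OF nrm(1)[OF p] pn] using orth ii by (simp add: gram3_def det_3 inner_commute)
  then have vol: "vol4 ?n e1 e2 e3 = 1" using pos by (simp add: power2_eq_1_iff)
  let ?B = "{e1, e2, e3, ?n}"
  have dist: "e1 \<noteq> e2" "e1 \<noteq> e3" "e2 \<noteq> e3" "e1 \<noteq> ?n" "e2 \<noteq> ?n" "e3 \<noteq> ?n" using ii orth pn by auto
  have pw: "pairwise orthogonal ?B" using orth pn by (auto simp: pairwise_def orthogonal_def inner_commute)
  have nB: "norm i = 1" if "i \<in> ?B" for i using that nn nrm(1)[OF p] by (auto simp: norm_eq_sqrt_inner)
  have "independent ?B" using pw nB by (intro pairwise_orthogonal_independent) force+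
  then have "span ?B = UNIV" using dist card_ge_dim_independent[of ?B UNIV] by (auto simp: DIM_cart)
  then have expand: "(\<Sum>i\<in>?B. (x \<bullet> i) *\<^sub>R i) = x" for x by (intro orthonormal_basis_expand[OF pw nB]) auto
  show thesis
  proof
    show "form_density S \<Omega> a p = a p e1 e2 e3" for a by (simp add: form_density_def e)
    show "D\<rho> p e1 = 0" "D\<rho> p e2 = 0" "D\<rho> p e3 = 0" using pn nrm(3)[OF p] by auto
    show "vol4 ?n e1 e2 e3 = 1" by fact
    fix u assume "D\<rho> p u = 0"
    then have "u \<bullet> ?n = 0" using nrm(3)[OF p] by simp
    then show "u = (u \<bullet> e1) *\<^sub>R e1 + (u \<bullet> e2) *\<^sub>R e2 + (u \<bullet> e3) *\<^sub>R e3" using expand[of u] dist by (simp add: add.assoc)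
  qed
qed

lemma form_density_cong:
  assumes p: "p \<in> S"
    and "\<And>u v t. D\<rho> p u = 0 \<Longrightarrow> D\<rho> p v = 0 \<Longrightarrow> D\<rho> p t = 0 \<Longrightarrow> a1 p u v t = c * a2 p u v t"
  shows "form_density S \<Omega> a1 p = c * form_density S \<Omega> a2 p"
proof -
  obtain e1 e2 e3 where e: "\<And>a. form_density S \<Omega> a p = a p e1 e2 e3"
    "D\<rho> p e1 = 0" "D\<rho> p e2 = 0" "D\<rho> p e3 = 0" using form_density_frame[OF p] by metis
  show ?thesis unfolding e(1) by (rule assms(2)[OF e(2-4)])
qed

text \<open>Reads the density from any tangent triple instead of the chosen orthonormal frame: form
  and volume both scale by the determinant of the coordinates in that frame. It serves for
  coordinate frames of charts and for their images under the derivative of w.\<close>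

lemma form_density_vol4:
  assumes p: "p \<in> S" and lin: "linear k" "linear b" "linear g"
    and a: "\<And>u v t. D\<rho> p u = 0 \<Longrightarrow> D\<rho> p v = 0 \<Longrightarrow> D\<rho> p t = 0 \<Longrightarrow> a p u v t = c * wedge3 k b g u v t"
    and tan: "D\<rho> p u = 0" "D\<rho> p v = 0" "D\<rho> p t = 0"
  shows "form_density S \<Omega> a p * of_real (vol4 (nrm p) u v t) = a p u v t"
proof -
  obtain e1 e2 e3 where e: "\<And>a. form_density S \<Omega> a p = a p e1 e2 e3"
    "D\<rho> p e1 = 0" "D\<rho> p e2 = 0" "D\<rho> p e3 = 0" "vol4 (nrm p) e1 e2 e3 = 1"
    and ex: "\<And>u. D\<rho> p u = 0 \<Longrightarrow> u = (u \<bullet> e1) *\<^sub>R e1 + (u \<bullet> e2) *\<^sub>R e2 + (u \<bullet> e3) *\<^sub>R e3"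
    using form_density_frame[OF p] by blast
  let ?T = "vector [vector [u \<bullet> e1, u \<bullet> e2, u \<bullet> e3], vector [v \<bullet> e1, v \<bullet> e2, v \<bullet> e3], vector [t \<bullet> e1, t \<bullet> e2, t \<bullet> e3]] :: real^3^3"
  have T: "u = ?T$1$1 *\<^sub>R e1 + ?T$1$2 *\<^sub>R e2 + ?T$1$3 *\<^sub>R e3"
    "v = ?T$2$1 *\<^sub>R e1 + ?T$2$2 *\<^sub>R e2 + ?T$2$3 *\<^sub>R e3"
    "t = ?T$3$1 *\<^sub>R e1 + ?T$3$2 *\<^sub>R e2 + ?T$3$3 *\<^sub>R e3" using ex[OF tan(1)] ex[OF tan(2)] ex[OF tan(3)] by simp_all
  have "vol4 (nrm p) u v t = det ?T" using vol4_combination[OF T] e(5) by simp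
  then show ?thesis using wedge3_combination[OF lin T] a[OF tan] a[OF e(2-4)] by (simp add: e(1) mult_ac)
qed

lemma area_factor_vol4:
  assumes ch: "hypersurface_chart S V f" and x: "x \<in> V"
  defines "E i \<equiv> frechet_derivative f (at x) (axis i 1)"
  shows "area_factor f x = \<bar>vol4 (nrm (f x)) (E 1) (E 2) (E 3)\<bar>" "D\<rho> (f x) (E i) = 0"
proof -
  have p: "f x \<in> S" using hypersurface_chart_image[OF ch] x by auto
  show tan: "D\<rho> (f x) (E i) = 0" for i using chart_tangent[OF ch x] by (auto simp: E_def)
  have "(vol4 (nrm (f x)) (E 1) (E 2) (E 3))^2 = det (gram3 (E 1) (E 2) (E 3))"
    by (rule vol4_gram) (use nrm(1)[OF p] nrm(3)[OF p] tan in auto)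
  also have "gram3 (E 1) (E 2) (E 3) = (\<chi> i j. E i \<bullet> E j)" by (simp add: vec_eq_iff forall_3 gram3_def)
  finally have "area_factor f x = sqrt ((vol4 (nrm (f x)) (E 1) (E 2) (E 3))^2)" by (simp add: area_factor_def E_def)
  then show "area_factor f x = \<bar>vol4 (nrm (f x)) (E 1) (E 2) (E 3)\<bar>" by simp
qed

lemma area_factor_positive:
  assumes ch: "hypersurface_chart S V f" and x: "x \<in> V"
  shows "area_factor f x > 0"
proof -
  have "linear (frechet_derivative f (at x))" "inj (frechet_derivative f (at x))"
    using ch x smooth_on_has_derivative[of f V x] has_derivative_linear by (auto simp: hypersurface_chart_def)
  then have "area_factor f x \<noteq> 0" unfolding area_factor_def using Gram_det_nonzero by auto
  then show ?thesis using area_factor_vol4(1)[OF ch x] by linarith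
qed

end

section \<open>The Leray kernel in terms of a contact form\<close>

lemma C2_real_expand:
  "v = Re (v $ 1) *\<^sub>R axis 1 1 + Im (v $ 1) *\<^sub>R axis 1 \<i> + Re (v $ 2) *\<^sub>R axis 2 1 + Im (v $ 2) *\<^sub>R axis 2 \<i>" for v :: C2
  by (simp add: vec_eq_iff forall_2 complex_eq_iff axis_def)

lemma wirtinger:
  fixes L :: "C2 \<Rightarrow> complex"
  assumes "linear L"
  shows "L v = (L (axis 1 1) - \<i> * L (axis 1 \<i>)) / 2 * v $ 1 + (L (axis 1 1) + \<i> * L (axis 1 \<i>)) / 2 * cnj (v $ 1)
     + (L (axis 2 1) - \<i> * L (axis 2 \<i>)) / 2 * v $ 2 + (L (axis 2 1) + \<i> * L (axis 2 \<i>)) / 2 * cnj (v $ 2)"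
proof -
  have "L v = Re (v $ 1) *\<^sub>R L (axis 1 1) + Im (v $ 1) *\<^sub>R L (axis 1 \<i>) + Re (v $ 2) *\<^sub>R L (axis 2 1) + Im (v $ 2) *\<^sub>R L (axis 2 \<i>)"
    by (subst C2_real_expand[of v]) (simp only: linear_add[OF assms] linear_scale[OF assms])
  then show ?thesis by (simp add: complex_eq_iff) (simp add: field_simps)
qed

lemma linear_dzeta: "linear (dzeta j)" by (rule linearI) (simp_all add: dzeta_def)

context hypersurface
begin

abbreviation "r1 \<equiv> d_rho \<rho> 1"
abbreviation "r2 \<equiv> d_rho \<rho> 2"

lemma d_rho_eq: "p \<in> U \<Longrightarrow> d_rho \<rho> j p = (of_real (D\<rho> p (axis j 1)) - \<i> * of_real (D\<rho> p (axis j \<i>))) / 2"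
proof -
  assume "p \<in> U"
  then have "((\<lambda>p. complex_of_real (\<rho> p)) has_derivative (\<lambda>v. of_real (D\<rho> p v))) (at p)"
    using \<rho>_deriv by (intro has_derivative_of_real) auto
  from frechet_derivative_at[OF this] show ?thesis unfolding d_rho_def d_zeta_def by (metis)
qed

lemma D\<rho>_d_rho: assumes "p \<in> U" shows "D\<rho> p v = 2 * Re (r1 p * v $ 1 + r2 p * v $ 2)"
proof -
  have "D\<rho> p v = Re (v $ 1) *\<^sub>R D\<rho> p (axis 1 1) + Im (v $ 1) *\<^sub>R D\<rho> p (axis 1 \<i>) + Re (v $ 2) *\<^sub>R D\<rho> p (axis 2 1) + Im (v $ 2) *\<^sub>R D\<rho> p (axis 2 \<i>)"
    by (subst C2_real_expand[of v]) (simp only: linear_add[OF D\<rho>_linear[OF assms]] linear_scale[OF D\<rho>_linear[OF assms]])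
  moreover have "D\<rho> p (axis j 1) = 2 * Re (d_rho \<rho> j p)" "D\<rho> p (axis j \<i>) = - 2 * Im (d_rho \<rho> j p)" for j
    unfolding d_rho_eq[OF assms] by simp_all
  ultimately show ?thesis by (simp add: algebra_simps)
qed

lemma smooth_d_rho: "smooth_on (d_rho \<rho> j) U"
proof -
  have a: "smooth_on (\<lambda>p. complex_of_real (D\<rho> p v)) U" for v
    by (intro smooth_on_bounded_linear[OF open_U bounded_linear_of_real] smooth_on_frechet smooth_\<rho>)
  have "smooth_on (\<lambda>p. (of_real (D\<rho> p (axis j 1)) + (- \<i>) * of_real (D\<rho> p (axis j \<i>))) * (1/2)) U"
    using a unfolding smooth_on_def by (intro allI Ck_on_mult Ck_on_add Ck_on_const open_U) auto
  then show ?thesis by (rule smooth_on_cong[OF open_U, rotated]) (simp add: d_rho_eq)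
qed

lemma d_rho_nonzero: assumes "p \<in> S" shows "r1 p \<noteq> 0 \<or> r2 p \<noteq> 0"
proof (rule ccontr)
  assume "\<not> ?thesis"
  then have "D\<rho> p v = 0" for v using D\<rho>_d_rho assms S_U by auto
  then show False using grad_nz[OF assms] by (simp add: grad_def)
qed

definition R :: "2 \<Rightarrow> C2 \<Rightarrow> C2 \<Rightarrow> complex" where "R j p = frechet_derivative (d_rho \<rho> j) (at p)"

lemma R_deriv: "p \<in> U \<Longrightarrow> (d_rho \<rho> j has_derivative R j p) (at p)"
  unfolding R_def by (rule smooth_on_has_derivative[OF smooth_d_rho])

lemma R_expand:
  assumes "p \<in> U"
  shows "R j p v = d_zeta 1 (d_rho \<rho> j) p * v $ 1 + levi_coeff \<rho> j 1 p * cnj (v $ 1)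
     + d_zeta 2 (d_rho \<rho> j) p * v $ 2 + levi_coeff \<rho> j 2 p * cnj (v $ 2)"
  unfolding levi_coeff_def d_zeta_def[of _ "d_rho \<rho> j"] d_zetabar_def R_def[symmetric]
  by (rule wirtinger[OF has_derivative_linear[OF R_deriv[OF assms]]])

text \<open>The wedge with d\<zeta>1 and d\<zeta>2 removes the holomorphic parts of the
  differentials of \<open>r1\<close> and \<open>r2\<close>, so on the right only the Levi
  coefficients survive.\<close>

lemma leray_form_R:
  assumes "p \<in> U"
  shows "leray_form \<rho> p u v t = wedge3 (\<lambda>x. r2 p * R 1 p x - r1 p * R 2 p x) (dzeta 1) (dzeta 2) u v t"
  unfolding wedge3_expand leray_form_def UNIV_2 R_expand[OF assms]
  by (simp add: wedge3_expand dzeta_def dzetabar_def) (simp add: algebra_simps)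

text \<open>Passing from the complex gradient of \<rho> to its multiple \<theta> by a factor l
  multiplies the form by l^2. The factor is not known to be differentiable, so the proportionality
  \<theta>1 r2 = \<theta>2 r1 is differentiated along S instead.\<close>

lemma leray_form_contact:
  assumes p: "p \<in> S" and D: "(\<theta> has_derivative D) (at p within S)"
    and par: "\<And>y. y \<in> S \<Longrightarrow> \<theta> y $ 1 * r2 y = \<theta> y $ 2 * r1 y"
    and lam: "\<theta> p $ 1 = l * r1 p" "\<theta> p $ 2 = l * r2 p"
    and tan: "D\<rho> p u = 0" "D\<rho> p v = 0" "D\<rho> p t = 0"
  shows "wedge3 (\<lambda>x. \<theta> p $ 2 * D x $ 1 - \<theta> p $ 1 * D x $ 2) (dzeta 1) (dzeta 2) u v t = l^2 * leray_form \<rho> p u v t"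
proof -
  have pU: "p \<in> U" using p S_U by auto
  have key: "\<theta> p $ 2 * D x $ 1 - \<theta> p $ 1 * D x $ 2 = l^2 * (r2 p * R 1 p x - r1 p * R 2 p x)" if x: "D\<rho> p x = 0" for x
  proof -
    have Dk: "((\<lambda>y. \<theta> y $ k) has_derivative (\<lambda>x. D x $ k)) (at p within S)" for k by (rule has_derivative_vec_nth[OF D])
    have Rk: "(d_rho \<rho> k has_derivative R k p) (at p within S)" for k using R_deriv[OF pU] has_derivative_at_withinI by blast
    have "((\<lambda>y. \<theta> y $ 1 * r2 y - \<theta> y $ 2 * r1 y) has_derivative
       (\<lambda>x. (\<theta> p $ 1 * R 2 p x + D x $ 1 * r2 p) - (\<theta> p $ 2 * R 1 p x + D x $ 2 * r1 p))) (at p within S)"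
      by (intro has_derivative_diff has_derivative_mult Dk Rk)
    then have "(\<theta> p $ 1 * R 2 p x + D x $ 1 * r2 p) - (\<theta> p $ 2 * R 1 p x + D x $ 2 * r1 p) = 0"
      by (rule tangent_derivative_zero[OF p _ _ x, where c=0]) (simp add: par)
    then have "l * (D x $ 1 * r2 p) - l * (D x $ 2 * r1 p) = l * (\<theta> p $ 2 * R 1 p x) - l * (\<theta> p $ 1 * R 2 p x)" by algebra
    then show ?thesis unfolding lam by algebra
  qed
  show ?thesis unfolding leray_form_R[OF pU] wedge3_expand key[OF tan(1)] key[OF tan(2)] key[OF tan(3)]
    by (simp add: algebra_simps)
qed

lemma leray_form_nonzero:
  assumes psc: "strongly_pseudoconvex \<rho> S" and p: "p \<in> S"
  obtains u v t where "D\<rho> p u = 0" "D\<rho> p v = 0" "D\<rho> p t = 0" "leray_form \<rho> p u v t \<noteq> 0"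
proof -
  have pU: "p \<in> U" using p S_U by auto
  \<comment> \<open>t and t' = i t span the complex tangent space, and T is a real tangent direction
    transversal to it. On this triple the form equals -2 |(r1, r2)|^2 times the Levi form at
    t.\<close>
  define t :: C2 where "t = vector [r2 p, - r1 p]"
  define t' :: C2 where "t' = vector [\<i> * r2 p, - \<i> * r1 p]"
  define T :: C2 where "T = vector [\<i> * cnj (r1 p), \<i> * cnj (r2 p)]"
  have tan: "D\<rho> p t = 0" "D\<rho> p t' = 0" "D\<rho> p T = 0" by (simp_all add: D\<rho>_d_rho[OF pU] t_def t'_def T_def)
  let ?l = "levi_coeff \<rho>"
  define L where "L = (\<Sum>j\<in>UNIV. \<Sum>k\<in>UNIV. ?l j k p * t $ j * cnj (t $ k))"
  have t0: "t \<noteq> 0" using d_rho_nonzero[OF p] by (auto simp: t_def vec_eq_iff forall_2)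
  moreover have "(\<Sum>j\<in>UNIV. d_rho \<rho> j p * t $ j) = 0" by (simp add: UNIV_2 t_def)
  ultimately have "Re L > 0" using psc p unfolding strongly_pseudoconvex_def L_def by blast
  then have L0: "L \<noteq> 0" by auto
  define K where "K = r1 p * cnj (r1 p) + r2 p * cnj (r2 p)"
  have "leray_form \<rho> p t t' T = (- 2) * K * L" unfolding leray_form_R[OF pU] wedge3_expand R_expand[OF pU] L_def K_def
    by (simp add: UNIV_2 t_def t'_def T_def dzeta_def) (simp add: algebra_simps)
  moreover have "K \<noteq> 0"
  proof -
    have "K = of_real ((cmod (r1 p))^2 + (cmod (r2 p))^2)" by (simp only: of_real_add complex_norm_square K_def)
    moreover have "(cmod (r1 p))^2 + (cmod (r2 p))^2 \<noteq> 0" using d_rho_nonzero[OF p] by (simp add: sum_power2_eq_zero_iff)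
    ultimately show ?thesis by (metis of_real_eq_0_iff)
  qed
  ultimately have "leray_form \<rho> p t t' T \<noteq> 0" using L0 by simp
  with tan show thesis by (rule that)
qed

lemma continuous_on_S_charts:
  fixes g :: "C2 \<Rightarrow> 'b::topological_space"
  assumes "\<And>V f. hypersurface_chart S V f \<Longrightarrow> continuous_on V (\<lambda>x. g (f x))"
  shows "continuous_on S g" unfolding continuous_on_eq_continuous_within
proof
  fix p assume "p \<in> S"
  then obtain V f where ch: "hypersurface_chart S V f" and p: "p \<in> f ` V" using chart_exists by (metis image_eqI)
  obtain h where hom: "homeomorphism V (f ` V) f h" using ch by (auto simp: hypersurface_chart_def)
  obtain O' where O': "open O'" "f ` V = S \<inter> O'" using ch by (metis hypersurface_chart_def openin_open)
  have "continuous_on (f ` V) (\<lambda>y. g (f (h y)))"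
    by (rule continuous_on_compose2[OF assms[OF ch]]) (use hom in \<open>auto simp: homeomorphism_def\<close>)
  then have "continuous_on (f ` V) g" by (rule continuous_on_eq) (use hom in \<open>auto simp: homeomorphism_def\<close>)
  then have "continuous (at p within S \<inter> O') g" using p O' by (simp add: continuous_on_eq_continuous_within)
  moreover have "at p within S \<inter> O' = at p within S" by (rule at_within_nhd[of _ O']) (use O' p in auto)
  ultimately show "continuous (at p within S) g" by simp
qed

lemma continuous_on_vol4:
  assumes "continuous_on X a" "continuous_on X b" "continuous_on X c" "continuous_on X d"
  shows "continuous_on X (\<lambda>x. vol4 (a x) (b x) (c x) (d x))"
proof -
  have rc: "continuous_on X (\<lambda>x. real_coords (f x) $ j)" if "continuous_on X f" for f j
    using exhaust_4[of j] by (elim disjE; simp add: real_coords_def; intro continuous_intros that)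
  have "continuous_on X (\<lambda>x. (vector [real_coords (a x), real_coords (b x), real_coords (c x), real_coords (d x)] :: real^4^4) $ i $ j)" for i j
    using exhaust_4[of i] rc assms by auto
  then show ?thesis unfolding vol4_def det_def
    by (intro continuous_on_sum continuous_on_mult continuous_on_const continuous_on_prod)
qed

end

text \<open>Abstracts the coefficient vector of the tangent lines: \<theta> is a nonvanishing
  multiple of the complex gradient along S, and \<Theta> is a smooth extension that supplies its
  derivatives.\<close>

locale contact_hypersurface = hypersurface +
  fixes \<theta> \<Theta> :: "C2 \<Rightarrow> C2" and W :: "C2 set"
  assumes open_W: "open W" and S_W: "S \<subseteq> W" and smooth_\<Theta>: "smooth_on \<Theta> W"
    and \<Theta>_eq: "\<And>p. p \<in> S \<Longrightarrow> \<Theta> p = \<theta> p"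
    and \<theta>_prop: "\<And>p. p \<in> S \<Longrightarrow> \<exists>l. l \<noteq> 0 \<and> (\<forall>k. \<theta> p $ k = l * d_rho \<rho> k p)"
    and conn_S: "connected S" and psc: "strongly_pseudoconvex \<rho> S"
begin

definition d\<theta> :: "C2 \<Rightarrow> C2 \<Rightarrow> C2" where "d\<theta> p = frechet_derivative \<Theta> (at p)"

definition nu :: "C2 \<Rightarrow> form3" where
  "nu p u v t = 1 / (2 * complex_of_real pi * \<i>)^2 *
     wedge3 (\<lambda>x. \<theta> p $ 2 * d\<theta> p x $ 1 - \<theta> p $ 1 * d\<theta> p x $ 2) (dzeta 1) (dzeta 2) u v t"

definition m :: "C2 \<Rightarrow> complex" where "m p = form_density S \<Omega> nu p"

lemma \<theta>_deriv: "p \<in> S \<Longrightarrow> (\<theta> has_derivative d\<theta> p) (at p within S)"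
proof -
  assume p: "p \<in> S"
  then have "(\<Theta> has_derivative d\<theta> p) (at p within S)"
    unfolding d\<theta>_def using smooth_on_has_derivative[OF smooth_\<Theta>] S_W has_derivative_at_withinI by blast
  then show ?thesis by (rule has_derivative_transform[OF p, rotated]) (simp add: \<Theta>_eq)
qed

lemma linear_d\<theta>: "p \<in> S \<Longrightarrow> linear (d\<theta> p)" using \<theta>_deriv has_derivative_linear by blast

lemma nu_leray:
  assumes p: "p \<in> S" and lam: "\<And>k. \<theta> p $ k = l * d_rho \<rho> k p"
    and tan: "D\<rho> p u = 0" "D\<rho> p v = 0" "D\<rho> p t = 0"
  shows "nu p u v t = 1 / (2 * complex_of_real pi * \<i>)^2 * l^2 * leray_form \<rho> p u v t"
proof -
  have "\<theta> x $ 1 * r2 x = \<theta> x $ 2 * r1 x" if "x \<in> S" for x using \<theta>_prop[OF that] by auto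
  then show ?thesis unfolding nu_def by (simp add: leray_form_contact[OF p \<theta>_deriv[OF p] _ lam lam tan])
qed

lemma m_vol4:
  assumes p: "p \<in> S" and tan: "D\<rho> p u = 0" "D\<rho> p v = 0" "D\<rho> p t = 0"
  shows "m p * of_real (vol4 (nrm p) u v t) = nu p u v t" unfolding m_def
proof (rule form_density_vol4[OF p _ linear_dzeta[of 1] linear_dzeta[of 2] _ tan,
      where c="1 / (2 * complex_of_real pi * \<i>)^2"])
  show "linear (\<lambda>x. \<theta> p $ 2 * d\<theta> p x $ 1 - \<theta> p $ 1 * d\<theta> p x $ 2)"
    using linear_d\<theta>[OF p] by (auto simp: linear_iff algebra_simps)
qed (simp add: nu_def)

lemma m_nonzero: assumes p: "p \<in> S" shows "m p \<noteq> 0"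
proof
  assume m: "m p = 0"
  obtain l where lam: "l \<noteq> 0" "\<And>k. \<theta> p $ k = l * d_rho \<rho> k p" using \<theta>_prop[OF p] by blast
  obtain u v t where t: "D\<rho> p u = 0" "D\<rho> p v = 0" "D\<rho> p t = 0" "leray_form \<rho> p u v t \<noteq> 0"
    using leray_form_nonzero[OF psc p] .
  have "nu p u v t \<noteq> 0" using nu_leray[OF p lam(2) t(1-3)] lam(1) t(4) by simp
  then show False using m_vol4[OF p t(1-3)] m by simp
qed

lemma chart_d\<theta>:
  assumes ch: "hypersurface_chart S V f" and x: "x \<in> V"
  shows "frechet_derivative (\<lambda>x. \<Theta> (f x)) (at x) v = d\<theta> (f x) (frechet_derivative f (at x) v)"
proof -
  have "f x \<in> W" using hypersurface_chart_image[OF ch] x S_W by auto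
  then have "(\<Theta> has_derivative d\<theta> (f x)) (at (f x))" unfolding d\<theta>_def by (rule smooth_on_has_derivative[OF smooth_\<Theta>])
  moreover have "(f has_derivative frechet_derivative f (at x)) (at x)"
    using ch x smooth_on_has_derivative by (auto simp: hypersurface_chart_def)
  ultimately have "((\<lambda>x. \<Theta> (f x)) has_derivative (\<lambda>v. d\<theta> (f x) (frechet_derivative f (at x) v))) (at x)"
    by (rule has_derivative_compose[rotated])
  from frechet_derivative_at[OF this] show ?thesis by metis
qed

text \<open>\<open>m\<close> is defined through an arbitrary choice of frames. In a chart it is a
  quotient of continuous functions, namely of the form and of the volume at the coordinate
  frame.\<close>

lemma m_continuous: "continuous_on S m"
proof (rule continuous_on_S_charts)
  fix V and f :: "real^3 \<Rightarrow> C2" assume ch: "hypersurface_chart S V f"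
  define E where "E i x = frechet_derivative f (at x) (axis i 1)" for i x
  have V: "open V" and sm: "smooth_on f V" using ch by (auto simp: hypersurface_chart_def)
  have inS: "f x \<in> S" if "x \<in> V" for x using hypersurface_chart_image[OF ch] that by auto
  have cE: "continuous_on V (E i)" for i unfolding E_def[abs_def] by (intro smooth_on_continuous smooth_on_frechet sm)
  have cf: "continuous_on V f" by (rule smooth_on_continuous[OF sm])
  have sm\<Theta>: "smooth_on (\<lambda>x. \<Theta> (f x)) V" by (rule smooth_on_compose[OF V sm open_W smooth_\<Theta>]) (use inS S_W in auto)
  have cD: "continuous_on V (\<lambda>x. d\<theta> (f x) (E i x))" for i
    using smooth_on_continuous[OF smooth_on_frechet[OF sm\<Theta>, of "axis i 1"]]
    by (rule continuous_on_eq) (simp add: chart_d\<theta>[OF ch] E_def)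
  have c\<theta>: "continuous_on V (\<lambda>x. \<theta> (f x))" using smooth_on_continuous[OF sm\<Theta>] by (rule continuous_on_eq) (simp add: \<Theta>_eq inS)
  have cg: "continuous_on U (grad \<rho>)" unfolding grad_def[abs_def] by (intro continuous_intros D\<rho>_cont)
  have cn: "continuous_on V (\<lambda>x. nrm (f x))" unfolding nrm_def
  proof (rule continuous_on_sgn)
    show "continuous_on V (\<lambda>x. grad \<rho> (f x))" by (rule continuous_on_compose2[OF cg cf]) (use inS S_U in auto)
  qed (use grad_nz inS in auto)
  have cnu: "continuous_on V (\<lambda>x. nu (f x) (E 1 x) (E 2 x) (E 3 x))"
    unfolding nu_def wedge3_expand dzeta_def by (intro continuous_intros cD cE c\<theta>)
  have tan: "D\<rho> (f x) (E i x) = 0" if "x \<in> V" for i x using area_factor_vol4(2)[OF ch that] by (simp add: E_def)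
  have vnz: "vol4 (nrm (f x)) (E 1 x) (E 2 x) (E 3 x) \<noteq> 0" if "x \<in> V" for x
    using area_factor_vol4(1)[OF ch that] area_factor_positive[OF ch that] by (auto simp: E_def)
  have "continuous_on V (\<lambda>x. nu (f x) (E 1 x) (E 2 x) (E 3 x) / of_real (vol4 (nrm (f x)) (E 1 x) (E 2 x) (E 3 x)))"
    using vnz by (intro continuous_intros cnu continuous_on_vol4 cn cE) auto
  then show "continuous_on V (\<lambda>x. m (f x))"
  proof (rule continuous_on_eq)
    fix x assume x: "x \<in> V"
    show "nu (f x) (E 1 x) (E 2 x) (E 3 x) / of_real (vol4 (nrm (f x)) (E 1 x) (E 2 x) (E 3 x)) = m (f x)"
      using m_vol4[OF inS[OF x] tan[OF x] tan[OF x] tan[OF x], of 1 2 3] vnz[OF x] by (simp add: field_simps)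
  qed
qed

text \<open>The factor between \<theta> and the complex gradient enters squared in \<open>nu\<close>
  and squared in the denominator, so it cancels.\<close>

lemma leray_eq:
  "leray \<rho> S \<Omega> f z = (\<integral>q. f q * m q / (\<theta> q $ 1 * (q $ 1 - z $ 1) + \<theta> q $ 2 * (q $ 2 - z $ 2))^2 \<partial>\<sigma>)"
  unfolding leray_def form_integral_def
proof (rule Bochner_Integration.integral_cong[OF refl])
  fix q assume "q \<in> space \<sigma>"
  then have q: "q \<in> S" by simp
  obtain l where lam: "l \<noteq> 0" "\<And>k. \<theta> q $ k = l * d_rho \<rho> k q" using \<theta>_prop[OF q] by blast
  let ?p = "r1 q * (q $ 1 - z $ 1) + r2 q * (q $ 2 - z $ 2)"
  have "form_density S \<Omega> (\<lambda>q u v w. f q * (1 / (2 * complex_of_real pi * \<i>)^2) * leray_form \<rho> q u v w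
         / (\<Sum>j\<in>UNIV. d_rho \<rho> j q * (q $ j - z $ j))^2) q = (f q / (l * ?p)^2) * form_density S \<Omega> nu q"
  proof (rule form_density_cong[OF q])
    fix u v t assume tan: "D\<rho> q u = 0" "D\<rho> q v = 0" "D\<rho> q t = 0"
    show "f q * (1 / (2 * complex_of_real pi * \<i>)^2) * leray_form \<rho> q u v t
         / (\<Sum>j\<in>UNIV. d_rho \<rho> j q * (q $ j - z $ j))^2 = f q / (l * ?p)^2 * nu q u v t"
      unfolding nu_leray[OF q lam(2) tan] UNIV_2 using lam(1) by (simp add: power_mult_distrib)
  qed
  then show "form_density S \<Omega> (\<lambda>q u v w. f q * (1 / (2 * complex_of_real pi * \<i>)^2) * leray_form \<rho> q u v w
         / (\<Sum>j\<in>UNIV. d_rho \<rho> j q * (q $ j - z $ j))^2) q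
      = f q * m q / (\<theta> q $ 1 * (q $ 1 - z $ 1) + \<theta> q $ 2 * (q $ 2 - z $ 2))^2"
    unfolding m_def lam(2) by (simp add: algebra_simps)
qed

end

section \<open>Tangent lines avoid the domain\<close>

context hypersurface
begin

lemma Om_iff: "p \<in> U \<Longrightarrow> p \<in> \<Omega> \<longleftrightarrow> \<rho> p < 0" using Om_U by blast

lemma exterior_iff: assumes "p \<in> U" shows "p \<in> - closure \<Omega> \<longleftrightarrow> \<rho> p > 0"
proof -
  have "p \<in> S \<longleftrightarrow> \<rho> p = 0" unfolding S_eq using assms by blast
  then show ?thesis unfolding closure_Om using Om_iff[OF assms] by auto
qed

text \<open>Near each boundary point the exterior is the connected part s > 0 of a box, which lies
  on one side of any separation of the exterior. Since S is connected, this side is the same for all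
  boundary points, and the other side is then open and closed in C^2.\<close>

lemma exterior_connected:
  assumes "connected S"
  shows "connected (- closure \<Omega>)"
proof -
  let ?E = "- closure \<Omega>"
  have ex: "\<exists>N. open N \<and> p \<in> N \<and> connected (N \<inter> ?E)" if p: "p \<in> S" for p
  proof -
    obtain e j k x0 r c C Q where box: "box_coords p e j k x0 r c C Q" using box_coords_exist[OF p] .
    let ?B = "ball x0 r \<times> {-r<..<r}" and ?B' = "ball x0 r \<times> {0<..<r}"
    note bD = box_coordsD[OF box]
    have "Q ` ?B \<inter> ?E = Q ` ?B'"
    proof (intro equalityI subsetI)
      fix y assume y: "y \<in> Q ` ?B \<inter> ?E"
      then obtain x s where xs: "x \<in> ball x0 r" "s \<in> {-r<..<r}" "y = Q (x, s)" by auto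
      have "y \<in> U" using bD(13) y by blast
      moreover have "\<rho> y = s" using bD(14)[OF xs(1,2)] xs(3) by simp
      ultimately have "s > 0" using y exterior_iff by blast
      then show "y \<in> Q ` ?B'" using xs by auto
    next
      fix y assume "y \<in> Q ` ?B'"
      then obtain x s where xs: "x \<in> ball x0 r" "s \<in> {0<..<r}" "y = Q (x, s)" by auto
      have s: "s \<in> {-r<..<r}" using xs by auto
      have "y \<in> Q ` ?B" using xs(1,3) s by blast
      moreover have "y \<in> U" using bD(13) calculation by blast
      moreover have "\<rho> y = s" using bD(14)[OF xs(1) s] xs(3) by simp
      ultimately show "y \<in> Q ` ?B \<inter> ?E" using xs(2) exterior_iff[of y] by auto
    qed
    moreover have "connected (Q ` ?B')"
    proof (rule connected_continuous_image)
      show "continuous_on ?B' Q" by (rule continuous_on_subset[OF smooth_on_continuous[OF bD(11)]]) auto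
      show "connected ?B'" by (intro convex_connected convex_Times) auto
    qed
    moreover have "p \<in> Q ` ?B" using bD(8,10) by force
    ultimately show ?thesis using bD(12) by (intro exI[of _ "Q ` ?B"]) auto
  qed
  then obtain N where N: "\<And>p. p \<in> S \<Longrightarrow> open (N p)" "\<And>p. p \<in> S \<Longrightarrow> p \<in> N p"
    "\<And>p. p \<in> S \<Longrightarrow> connected (N p \<inter> ?E)" by metis
  \<comment> \<open>Every boundary point is a limit of exterior points, approached along s > 0 in a
    box.\<close>
  have S_cl: "N' \<inter> ?E \<noteq> {}" if p: "p \<in> S" "open N'" "p \<in> N'" for p N'
  proof -
    have pU: "p \<in> U" "\<rho> p = 0" using p(1) S_eq by auto
    obtain e j k x0 r c C Q where box: "box_coords p e j k x0 r c C Q" using box_coords_exist[OF p(1)] .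
    note bD = box_coordsD[OF box]
    have "open (ball x0 r \<times> {-r<..<r})" by (intro open_Times) auto
    moreover have x00: "(x0, 0) \<in> ball x0 r \<times> {-r<..<r}" using bD(8) by simp
    ultimately have "isCont Q (x0, 0)" using smooth_on_continuous[OF bD(11)] continuous_on_eq_continuous_at by blast
    moreover have "((\<lambda>s. (x0, s)) \<longlongrightarrow> (x0, 0)) (at_right (0::real))" by (intro tendsto_intros)
    ultimately have "((\<lambda>s. Q (x0, s)) \<longlongrightarrow> p) (at_right 0)" using isCont_tendsto_compose bD(10) by metis
    then have "\<forall>\<^sub>F s in at_right 0. Q (x0, s) \<in> N'" using p(2,3) by (rule topological_tendstoD)
    moreover have "\<forall>\<^sub>F s in at_right 0. s \<in> {0<..<r}" using bD(8) by (rule eventually_at_right_real)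
    ultimately have "\<forall>\<^sub>F s in at_right 0. s \<in> {0<..<r} \<and> Q (x0, s) \<in> N'" by eventually_elim auto
    then obtain s where s: "s \<in> {0<..<r}" "Q (x0, s) \<in> N'" using eventually_happens'[OF trivial_limit_at_right_real] by blast
    have "x0 \<in> ball x0 r" "s \<in> {-r<..<r}" using s bD(8) by auto
    then have "Q (x0, s) \<in> U" "\<rho> (Q (x0, s)) = s" using bD(13,14) by blast+
    then have "Q (x0, s) \<in> ?E" using s exterior_iff[of "Q (x0, s)"] by auto
    then show ?thesis using s(2) by blast
  qed
  show ?thesis
  proof (rule connectedI)
    fix A B assume AB: "open A" "open B" "A \<inter> ?E \<noteq> {}" "B \<inter> ?E \<noteq> {}" "A \<inter> B \<inter> ?E = {}" "?E \<subseteq> A \<union> B"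
    have dich: "N p \<inter> ?E \<subseteq> A \<or> N p \<inter> ?E \<subseteq> B" if "p \<in> S" for p
    proof (rule ccontr)
      assume "\<not> ?thesis"
      then have "A \<inter> (N p \<inter> ?E) \<noteq> {}" "B \<inter> (N p \<inter> ?E) \<noteq> {}" using AB(6) by blast+
      then show False using connectedD[OF N(3)[OF that] AB(1,2)] AB(5,6) by blast
    qed
    \<comment> \<open>If all boundary pieces lie in C, then \<Omega>, the neighbourhoods of S and C
      together form an open set whose complement is the part of D in the exterior. This splits the
      connected space C^2.\<close>
    have one: False if CD: "open C" "open D" "D \<inter> ?E \<noteq> {}" "C \<inter> D \<inter> ?E = {}" "?E \<subseteq> C \<union> D"
      and all: "\<And>p. p \<in> S \<Longrightarrow> N p \<inter> ?E \<subseteq> C" for C D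
    proof -
      let ?X = "\<Omega> \<union> (\<Union>p\<in>S. N p) \<union> (C \<inter> ?E)" and ?Y = "D \<inter> ?E"
      have "open ?X" "open ?Y" using open_Om N(1) CD(1,2) by (auto intro!: open_Un open_UN open_Int)
      moreover have "?X \<inter> ?Y \<inter> UNIV = {}" using CD(4) all closure_subset[of \<Omega>] by blast
      moreover have "UNIV \<subseteq> ?X \<union> ?Y" using CD(5) closure_Om N(2) by blast
      ultimately have "?X \<inter> UNIV = {} \<or> ?Y \<inter> UNIV = {}" by (intro connectedD connected_UNIV)
      then show False using CD(3) Om_nonempty by blast
    qed
    define SA SB where "SA = (\<Union>p\<in>{p\<in>S. N p \<inter> ?E \<subseteq> A}. N p)" and "SB = (\<Union>p\<in>{p\<in>S. N p \<inter> ?E \<subseteq> B}. N p)"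
    have op: "open SA" "open SB" using N(1) by (auto simp: SA_def SB_def)
    have SAA: "SA \<inter> ?E \<subseteq> A" and SBB: "SB \<inter> ?E \<subseteq> B" unfolding SA_def SB_def by blast+
    have "S \<subseteq> SA \<union> SB" using dich N(2) unfolding SA_def SB_def by blast
    moreover have "SA \<inter> SB \<inter> S = {}"
    proof (rule ccontr)
      assume "SA \<inter> SB \<inter> S \<noteq> {}"
      then obtain q where "q \<in> S" "q \<in> SA \<inter> SB" by blast
      then have "(SA \<inter> SB) \<inter> ?E \<noteq> {}" using S_cl[of q "SA \<inter> SB"] op by blast
      then show False using SAA SBB AB(5) by blast
    qed
    ultimately have "SA \<inter> S = {} \<or> SB \<inter> S = {}" using connectedD[OF assms op] by blast
    then show False
    proof
      assume "SA \<inter> S = {}"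
      then have "N p \<inter> ?E \<subseteq> B" if "p \<in> S" for p using dich[OF that] N(2)[OF that] that unfolding SA_def by blast
      then show False using one[of B A] AB by blast
    next
      assume "SB \<inter> S = {}"
      then have "N p \<inter> ?E \<subseteq> A" if "p \<in> S" for p using dich[OF that] N(2)[OF that] that unfolding SB_def by blast
      then show False using one[of A B] AB by blast
    qed
  qed
qed

end

section \<open>The pairing, its incidence relation and dual pairs of hypersurfaces\<close>

lemma Phi_expand:
  "Phi M z w = (M$1$1 + M$1$2 * z$1 + M$1$3 * z$2) + w$1 * (M$2$1 + M$2$2 * z$1 + M$2$3 * z$2)
     + w$2 * (M$3$1 + M$3$2 * z$1 + M$3$3 * z$2)" by (simp add: Phi_def homog_def sum_3 matrix_vector_mult_def)

lemma Phi_transpose: "Phi (transpose M) z w = Phi M w z" by (simp add: Phi_expand transpose_def algebra_simps)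

definition th :: "complex^3^3 \<Rightarrow> C2 \<Rightarrow> C2" where
  "th M w = vector [M$1$2 + w$1 * M$2$2 + w$2 * M$3$2, M$1$3 + w$1 * M$2$3 + w$2 * M$3$3]"

lemma th_1 [simp]: "th M w $ 1 = M$1$2 + w$1 * M$2$2 + w$2 * M$3$2"
  and th_2 [simp]: "th M w $ 2 = M$1$3 + w$1 * M$2$3 + w$2 * M$3$3" by (simp_all add: th_def)

lemma Phi_diff: "Phi M z w - Phi M z' w = th M w $ 1 * (z$1 - z'$1) + th M w $ 2 * (z$2 - z'$2)"
  by (simp add: Phi_expand algebra_simps)

lemma Phi_diff_dual: "Phi M z w - Phi M z w' = th (transpose M) z $ 1 * (w$1 - w'$1) + th (transpose M) z $ 2 * (w$2 - w'$2)"
  using Phi_diff[of "transpose M" w z w'] by (simp add: Phi_transpose)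

lemma homog_kernel:
  assumes "invertible M" "M *v Z = 0" shows "Z = (0 :: complex^3)"
  using assms by (metis invertible_def matrix_left_invertible_ker)

lemma th_zero_const:
  assumes "th M w = 0" shows "Phi M z w = Phi M z' w" using Phi_diff[of M z w z'] assms by simp

lemma smooth_th: "open W \<Longrightarrow> smooth_on F W \<Longrightarrow> smooth_on (\<lambda>p. th M (F p)) W"
proof -
  assume W: "open W" "smooth_on F W"
  let ?L = "\<lambda>v::C2. (vector [v$1 * M$2$2 + v$2 * M$3$2, v$1 * M$2$3 + v$2 * M$3$3] :: C2)"
  have "linear ?L" by (rule linearI) (simp_all add: vec_eq_iff forall_2 algebra_simps)
  then have "bounded_linear ?L" by (simp add: linear_conv_bounded_linear)
  then have "smooth_on (\<lambda>p. vector [M$1$2, M$1$3] + ?L (F p)) W" using W unfolding smooth_on_def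
    by (intro allI Ck_on_add Ck_on_const Ck_on_bounded_linear[of W ?L]) auto
  then show ?thesis by (rule smooth_on_cong[OF W(1), rotated]) (simp add: vec_eq_iff forall_2)
qed

context hypersurface
begin

lemma tangent_incidence:
  assumes p: "p \<in> S" and D: "(w has_derivative D) (at p within S)"
    and 0: "\<And>y. y \<in> S \<Longrightarrow> Phi M y (w y) = 0" and u: "D\<rho> p u = 0"
  shows "th (transpose M) p $ 1 * D u $ 1 + th (transpose M) p $ 2 * D u $ 2
     = - (th M (w p) $ 1 * u $ 1 + th M (w p) $ 2 * u $ 2)"
proof -
  have wk: "((\<lambda>y. w y $ k) has_derivative (\<lambda>x. D x $ k)) (at p within S)" for k by (rule has_derivative_vec_nth[OF D])
  have zk: "((\<lambda>y. y $ k) has_derivative (\<lambda>x. x $ k)) (at p within S)" for k :: 2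
    by (rule has_derivative_vec_nth[OF has_derivative_ident])
  have "((\<lambda>y. Phi M y (w y)) has_derivative
     (\<lambda>x. th (transpose M) p $ 1 * D x $ 1 + th (transpose M) p $ 2 * D x $ 2
        + (th M (w p) $ 1 * x $ 1 + th M (w p) $ 2 * x $ 2))) (at p within S)" unfolding Phi_expand
    by (rule derivative_eq_intros wk zk refl)+ (simp add: fun_eq_iff transpose_def algebra_simps)
  from tangent_derivative_zero[OF p this 0 u] show ?thesis by (simp only: eq_neg_iff_add_eq_0)
qed

lemma tangent_map:
  assumes S': "hypersurface \<rho>' S' \<Omega>' U'" and p: "p \<in> S" and D: "(g has_derivative D) (at p within S)"
    and g: "\<And>y. y \<in> S \<Longrightarrow> g y \<in> S'" and u: "D\<rho> p u = 0"
  shows "frechet_derivative \<rho>' (at (g p)) (D u) = 0"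
proof -
  interpret h': hypersurface \<rho>' S' \<Omega>' U' by (rule S')
  have "g p \<in> U'" using g[OF p] h'.S_U by blast
  from has_derivative_in_compose[OF D has_derivative_at_withinI[OF h'.\<rho>_deriv[OF this]]]
  show ?thesis by (rule tangent_derivative_zero[OF p]) (use g h'.S_eq u in auto)
qed

end

text \<open>Two hypersurfaces with mutually inverse maps w and v, each point being sent to the
  parameter of its tangent line; F and G are smooth extensions of w and v. The data are symmetric
  under exchange of the sides with M transposed, so \<open>swap\<close> yields the dual version of
  each result.\<close>

locale dual_pair = hypersurface \<rho> S \<Omega> U + h': hypersurface \<rho>' S' \<Omega>' U' for \<rho> S \<Omega> U \<rho>' S' \<Omega>' U' +
  fixes M :: "complex^3^3" and w v F G :: "C2 \<Rightarrow> C2" and W V :: "C2 set"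
  assumes inv_M: "invertible M" and w_S: "w ` S = S'" and v_w: "\<And>p. p \<in> S \<Longrightarrow> v (w p) = p"
    and open_W: "open W" and S_W: "S \<subseteq> W" and smooth_F: "smooth_on F W" and F_eq: "\<And>p. p \<in> S \<Longrightarrow> F p = w p"
    and open_V: "open V" and S'_V: "S' \<subseteq> V" and smooth_G: "smooth_on G V" and G_eq: "\<And>q. q \<in> S' \<Longrightarrow> G q = v q"
    and Phi_S: "\<And>p. p \<in> S \<Longrightarrow> Phi M p (w p) = 0"
    and th_prop: "\<And>p. p \<in> S \<Longrightarrow> \<exists>l. l \<noteq> 0 \<and> (\<forall>k. th M (w p) $ k = l * d_rho \<rho> k p)"
    and th_prop': "\<And>q. q \<in> S' \<Longrightarrow> \<exists>l. l \<noteq> 0 \<and> (\<forall>k. th (transpose M) (v q) $ k = l * d_rho \<rho>' k q)"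
    and connected_S: "connected S" and connected_S': "connected S'"
    and psc_S: "strongly_pseudoconvex \<rho> S" and psc_S': "strongly_pseudoconvex \<rho>' S'"
begin

sublocale contact_hypersurface \<rho> S \<Omega> U "\<lambda>p. th M (w p)" "\<lambda>p. th M (F p)" W by unfold_locales
    (use open_W S_W smooth_th[OF open_W smooth_F] F_eq th_prop connected_S psc_S in auto)

lemma w_in: "p \<in> S \<Longrightarrow> w p \<in> S'" and v_in: "q \<in> S' \<Longrightarrow> v q \<in> S" and w_v: "q \<in> S' \<Longrightarrow> w (v q) = q" using w_S v_w by auto

lemma swap: "dual_pair \<rho>' S' \<Omega>' U' \<rho> S \<Omega> U (transpose M) v w G F V W"
proof (unfold_locales)
  show "invertible (transpose M)" using inv_M by (simp add: invertible_det_nz det_transpose)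
  show "v ` S' = S" using w_S v_w by force
  show "Phi (transpose M) q (v q) = 0" if "q \<in> S'" for q
    using Phi_S[OF v_in[OF that]] w_v[OF that] by (simp add: Phi_transpose)
  show "\<exists>l. l \<noteq> 0 \<and> (\<forall>k. th (transpose (transpose M)) (w p) $ k = l * d_rho \<rho> k p)" if "p \<in> S" for p
    using th_prop[OF that] by (simp add: transpose_transpose)
qed (use w_v open_V S'_V smooth_G G_eq open_W S_W smooth_F F_eq th_prop' connected_S connected_S' psc_S psc_S' in auto)

lemma S'_nonempty: "S' \<noteq> {}" and S_nonempty: "S \<noteq> {}"
proof -
  have "\<Omega> \<noteq> UNIV" using bounded_Om by (metis not_bounded_UNIV)
  then show "S \<noteq> {}" using frontier_Om frontier_eq_empty Om_nonempty by metis
  then show "S' \<noteq> {}" using w_S by auto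
qed

definition dw :: "C2 \<Rightarrow> C2 \<Rightarrow> C2" where "dw p = frechet_derivative F (at p)"

lemma w_deriv: "p \<in> S \<Longrightarrow> (w has_derivative dw p) (at p within S)"
proof -
  assume p: "p \<in> S"
  then have "(F has_derivative dw p) (at p within S)"
    unfolding dw_def using smooth_on_has_derivative[OF smooth_F] S_W has_derivative_at_withinI by blast
  then show ?thesis by (rule has_derivative_transform[OF p, rotated]) (simp add: F_eq)
qed

lemma linear_dw: "p \<in> S \<Longrightarrow> linear (dw p)" using w_deriv has_derivative_linear by blast

text \<open>G inverts w on S only, so the derivatives are inverse to each other only on tangent
  vectors.\<close>

lemma dw_inverse:
  assumes p: "p \<in> S" and u: "D\<rho> p u = 0"
  shows "frechet_derivative G (at (w p)) (dw p u) = u"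
proof -
  have G: "(G has_derivative frechet_derivative G (at (w p))) (at (w p) within w ` S)"
    using smooth_on_has_derivative[OF smooth_G] S'_V w_in[OF p] has_derivative_at_withinI by blast
  have "((\<lambda>y. G (w y)) has_derivative (\<lambda>x. frechet_derivative G (at (w p)) (dw p x))) (at p within S)"
    by (rule has_derivative_in_compose[OF w_deriv[OF p] G])
  moreover have "((\<lambda>y. G (w y)) has_derivative (\<lambda>x. x)) (at p within S)"
    by (rule has_derivative_transform[OF p _ has_derivative_ident]) (simp add: G_eq w_in v_w)
  ultimately show ?thesis using tangent_derivative_unique[OF p _ _ u] by blast
qed

lemma dw_inj: "p \<in> S \<Longrightarrow> D\<rho> p u = 0 \<Longrightarrow> dw p u = 0 \<Longrightarrow> u = 0"
  using dw_inverse[of p u] smooth_on_has_derivative[OF smooth_G] S'_V w_in linear_0[OF has_derivative_linear] by (metis subsetD)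

lemma contact_identity:
  assumes p: "p \<in> S" and u: "D\<rho> p u = 0"
  shows "th (transpose M) p $ 1 * dw p u $ 1 + th (transpose M) p $ 2 * dw p u $ 2
     = - (th M (w p) $ 1 * u $ 1 + th M (w p) $ 2 * u $ 2)" by (rule tangent_incidence[OF p w_deriv[OF p] Phi_S u])

text \<open>If a tangent line passes through \<open>z\<close>, then so do tangent lines through all points near \<open>z\<close>,
  unless \<open>z\<close> is the point of tangency: there the derivative of the incidence equation along \<open>S\<close> is onto.\<close>
lemma incidence_open:
  assumes p: "p \<in> S" and z: "Phi M z0 (w p) = 0" "z0 \<noteq> p"
  shows "z0 \<in> interior {z. \<exists>u\<in>S'. Phi M z u = 0}"
proof -
  let ?T = "th (transpose M)"
  have pU: "p \<in> U" using p S_U by auto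
  obtain l where l: "l \<noteq> 0" "\<And>k. th M (w p) $ k = l * d_rho \<rho> k p" using th_prop[OF p] by blast
  define d where "d z = M$1$1 + M$1$2 * z$1 + M$1$3 * z$2" for z :: C2
  have Mh: "M *v homog z = vector [d z, ?T z $ 1, ?T z $ 2]" for z
    by (simp add: vec_eq_iff forall_3 homog_def d_def matrix_vector_mult_def sum_3 transpose_def algebra_simps)
  have Ph: "Phi M z u = d z + u $ 1 * ?T z $ 1 + u $ 2 * ?T z $ 2" for z u
    by (simp add: Phi_expand d_def transpose_def algebra_simps)
  have zp: "Phi M p (w p) = 0" by (rule Phi_S[OF p])
  have homog0: "homog z \<noteq> 0" for z by (simp add: homog_def vec_eq_iff forall_3)
  have T0: "?T p $ 1 \<noteq> 0 \<or> ?T p $ 2 \<noteq> 0"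
  proof (rule ccontr)
    assume *: "\<not> ?thesis"
    then have "d p = 0" using zp Ph by simp
    then have "M *v homog p = 0" using * by (simp add: Mh vec_eq_iff forall_3)
    then show False using homog_kernel[OF inv_M] homog0 by blast
  qed
  \<comment> \<open>The lines dual to z0 and p both contain w(p). If their coefficient vectors were
    proportional, so would be the images of \<open>homog z0\<close> and \<open>homog p\<close> under
    M, and invertibility would give z0 = p.\<close>
  have b: "?T z0 $ 1 * ?T p $ 2 - ?T z0 $ 2 * ?T p $ 1 \<noteq> 0"
  proof
    assume k: "?T z0 $ 1 * ?T p $ 2 - ?T z0 $ 2 * ?T p $ 1 = 0"
    obtain s where s: "?T z0 $ 1 = s * ?T p $ 1" "?T z0 $ 2 = s * ?T p $ 2"
    proof (cases "?T p $ 1 = 0")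
      case True
      then show ?thesis using that[of "?T z0 $ 2 / ?T p $ 2"] T0 k by (simp del: th_1 th_2)
    next
      case False
      then show ?thesis using that[of "?T z0 $ 1 / ?T p $ 1"] k by (simp add: field_simps del: th_1 th_2)
    qed
    have "d z0 = - (w p $ 1 * ?T z0 $ 1 + w p $ 2 * ?T z0 $ 2)"
      using z(1) unfolding Ph by (simp only: eq_neg_iff_add_eq_0 add.assoc)
    moreover have "d p = - (w p $ 1 * ?T p $ 1 + w p $ 2 * ?T p $ 2)"
      using zp unfolding Ph by (simp only: eq_neg_iff_add_eq_0 add.assoc)
    ultimately have a: "d z0 = s * d p" unfolding s by algebra
    have "M *v (homog z0 - s *s homog p) = M *v homog z0 - s *s (M *v homog p)"
      by (simp add: matrix_vector_mult_diff_distrib vector_scalar_commute)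
    also have "\<dots> = 0" unfolding Mh using a s by (simp add: vec_eq_iff forall_3 del: th_1 th_2)
    finally have "homog z0 - s *s homog p = 0" by (rule homog_kernel[OF inv_M])
    then have "1 = s" "z0 $ 1 = s * p $ 1" "z0 $ 2 = s * p $ 2" by (auto simp: homog_def vec_eq_iff forall_3)
    then have "z0 = p" by (simp add: vec_eq_iff forall_2)
    then show False using z(2) by simp
  qed
  \<comment> \<open>A complex tangent vector at p. For it the contact identity makes T(p) annihilate
    the derivative of w; since T(z0) and T(p) are independent, T(z0) cannot annihilate it as well
    unless the vector is 0. A real-linear injection of C into itself is onto.\<close>
  define t where "t q = (vector [q * r2 p, - q * r1 p] :: C2)" for q
  define A where "A x = ?T z0 $ 1 * dw p x $ 1 + ?T z0 $ 2 * dw p x $ 2" for x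
  interpret dw: linear "dw p" by (rule linear_dw[OF p])
  have lint: "linear t" by (rule linearI) (simp_all add: t_def vec_eq_iff forall_2 algebra_simps)
  have linA: "linear A" by (rule linearI) (simp_all add: A_def dw.add dw.scale algebra_simps)
  have tan: "D\<rho> p (t q) = 0" for q by (simp add: D\<rho>_d_rho[OF pU] t_def)
  have "t q = 0" if "A (t q) = 0" for q
  proof -
    have 1: "?T p $ 1 * dw p (t q) $ 1 + ?T p $ 2 * dw p (t q) $ 2 = 0"
      unfolding contact_identity[OF p tan] l(2) by (simp add: t_def)
    have 2: "?T z0 $ 1 * dw p (t q) $ 1 + ?T z0 $ 2 * dw p (t q) $ 2 = 0" using that by (simp only: A_def)
    have "(?T z0 $ 1 * ?T p $ 2 - ?T z0 $ 2 * ?T p $ 1) * dw p (t q) $ 1 = 0"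
      "(?T z0 $ 1 * ?T p $ 2 - ?T z0 $ 2 * ?T p $ 1) * dw p (t q) $ 2 = 0" using 1 2 by algebra+
    then have "dw p (t q) = 0" using b by (simp add: vec_eq_iff forall_2 del: th_1 th_2)
    then show "t q = 0" using dw_inj[OF p tan] by blast
  qed
  moreover have "q = 0" if "t q = 0" for q using that d_rho_nonzero[OF p] by (auto simp: t_def vec_eq_iff forall_2)
  ultimately have "inj (A \<circ> t)" using linear_injective_0[OF linear_compose[OF lint linA]] by auto
  then have surjAt: "surj (A \<circ> t)" by (rule linear_injective_imp_surjective[OF linear_compose[OF lint linA]]) simp
  obtain V0 f x0 where ch: "hypersurface_chart S V0 f" and x0: "x0 \<in> V0" "p = f x0" using chart_exists[OF p] .
  note x0 = x0(1) x0(2)[symmetric]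
  have V0: "open V0" and sm: "smooth_on f V0" using ch by (auto simp: hypersurface_chart_def)
  have inS: "f x \<in> S" if "x \<in> V0" for x using hypersurface_chart_image[OF ch] that by auto
  let ?D = "frechet_derivative f (at x0)"
  have df: "(f has_derivative ?D) (at x0)" by (rule smooth_on_has_derivative[OF sm x0(1)])
  have linD: "linear ?D" using df has_derivative_linear by blast
  have "surj (A \<circ> ?D)"
  proof (rule surjI[of _ "\<lambda>c. SOME x. A (?D x) = c"])
    fix c
    obtain q where q: "A (t q) = c" using surjD[OF surjAt, of c] by auto
    have "t q \<in> range ?D" unfolding chart_tangent[OF ch x0(1)] using tan x0(2) by simp
    then obtain x where "t q = ?D x" by (rule imageE)
    then have "\<exists>x. A (?D x) = c" using q by (intro exI[of _ x]) simp
    then show "(A \<circ> ?D) (SOME x. A (?D x) = c) = c" unfolding o_def by (rule someI_ex)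
  qed
  then obtain R where R: "linear R" "(A \<circ> ?D) \<circ> R = id"
    using linear_surjective_right_inverse[OF linear_compose[OF linD linA]] by blast
  have smFf: "smooth_on (\<lambda>x. F (f x)) V0" by (rule smooth_on_compose[OF V0 sm open_W smooth_F]) (use inS S_W in auto)
  \<comment> \<open>Carrying z along as second component turns the open mapping theorem at (x0, z0)
    into solvability of the incidence equation for all z near z0.\<close>
  define H where "H = (\<lambda>(x, z). (Phi M z (F (f x)), z))"
  define B where "B = (\<lambda>z' :: C2. th M (w p) $ 1 * z' $ 1 + th M (w p) $ 2 * z' $ 2)"
  have linB: "linear B" by (rule linearI) (simp_all add: B_def algebra_simps)
  have "dw p = frechet_derivative F (at (f x0))" by (simp add: dw_def x0)
  moreover have "(F has_derivative frechet_derivative F (at (f x0))) (at (f x0))"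
    using smooth_on_has_derivative[OF smooth_F] S_W inS[OF x0(1)] by blast
  ultimately have "((\<lambda>x. F (f x)) has_derivative (\<lambda>x. dw p (?D x))) (at x0)" using has_derivative_compose[OF df] by metis
  then have "((\<lambda>y. F (f (fst y))) has_derivative (\<lambda>y. dw p (?D (fst y)))) (at (x0, z0))"
    using has_derivative_compose[OF has_derivative_fst[OF has_derivative_ident], of "\<lambda>x. F (f x)" _ "(x0, z0)" UNIV] by simp
  then have Fk: "((\<lambda>y. F (f (fst y)) $ k) has_derivative (\<lambda>y. dw p (?D (fst y)) $ k)) (at (x0, z0))" for k
    by (rule has_derivative_vec_nth)
  have zk: "((\<lambda>y. snd y $ k) has_derivative (\<lambda>y. snd y $ k)) (at (x0, z0))" for k :: 2
    by (intro has_derivative_vec_nth has_derivative_snd has_derivative_ident)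
  have Ff0: "F (f x0) = w p" using F_eq p x0 by simp
  have "((\<lambda>y. Phi M (snd y) (F (f (fst y)))) has_derivative (\<lambda>y. A (?D (fst y)) + B (snd y))) (at (x0, z0))"
    unfolding Phi_expand
    by (rule derivative_eq_intros Fk zk refl)+ (simp add: fun_eq_iff A_def B_def Ff0 transpose_def algebra_simps)
  then have dH: "(H has_derivative (\<lambda>y. (A (?D (fst y)) + B (snd y), snd y))) (at (x0, z0))"
    unfolding H_def case_prod_beta by (intro has_derivative_Pair has_derivative_snd has_derivative_ident)
  \<comment> \<open>A right inverse of the derivative of H, as the open mapping theorem
    requires.\<close>
  let ?g = "\<lambda>(c, z'). (R (c - B z'), z')"
  let ?O = "V0 \<times> (UNIV :: C2 set)"
  have "H (x0, z0) \<in> interior (H ` ?O)"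
  proof (rule sussmann_open_mapping[OF _ _ _ dH])
    show "open ?O" using V0 by (intro open_Times) auto
    then show "(x0, z0) \<in> interior ?O" using x0(1) by (simp add: interior_open)
    have "continuous_on ?O (\<lambda>y. F (f (fst y)))"
      by (rule continuous_on_compose2[OF smooth_on_continuous[OF smFf]]) (auto intro: continuous_intros)
    then show "continuous_on ?O H" unfolding H_def case_prod_beta Phi_expand by (intro continuous_intros)
    have "linear ?g" by (rule linearI) (auto simp: linear_add[OF linB] linear_scale[OF linB] add_diff_add linear_add[OF R(1)]
          linear_scale[OF R(1)] simp flip: scaleR_right_diff_distrib)
    then show "bounded_linear ?g" by (simp add: linear_conv_bounded_linear)
    have "A (?D (R c)) = c" for c using R(2) by (metis comp_apply id_apply)
    then show "(\<lambda>y. (A (?D (fst y)) + B (snd y), snd y)) \<circ> ?g = id" by (auto simp: fun_eq_iff)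
  qed (use x0 in auto)
  then have "(0, z0) \<in> interior (H ` ?O)" using z(1) Ff0 by (simp add: H_def)
  then obtain e where e: "e > 0" "ball (0, z0) e \<subseteq> H ` ?O" using mem_interior by blast
  have "ball z0 e \<subseteq> {z. \<exists>u\<in>S'. Phi M z u = 0}"
  proof
    fix z assume "z \<in> ball z0 e"
    then have "(0, z) \<in> ball (0 :: complex, z0) e" by (simp add: dist_Pair_Pair)
    then have "(0, z) \<in> H ` ?O" using e(2) by blast
    then obtain x where "x \<in> V0" "Phi M z (F (f x)) = 0" by (auto simp: H_def)
    then show "z \<in> {z. \<exists>u\<in>S'. Phi M z u = 0}" using F_eq[OF inS] w_in[OF inS] by auto
  qed
  then show ?thesis using e(1) mem_interior by blast
qed

lemma closed_incidence: "closed {z. \<exists>q\<in>S'. Phi M z q = 0}"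
proof -
  have "closed {y :: C2 \<times> C2. Phi M (snd y) (fst y) = 0}" unfolding Phi_expand by (intro closed_Collect_eq continuous_intros)
  then have "closed {z. \<exists>q. q \<in> S' \<and> (q, z) \<in> {y. Phi M (snd y) (fst y) = 0}}"
    by (rule closed_compact_projection[OF h'.compact_S])
  then show ?thesis by (simp add: Bex_def)
qed

lemma incidence_dichotomy:
  assumes "connected C" "C \<inter> S = {}" and z: "z \<in> C" "\<forall>q\<in>S'. Phi M z q \<noteq> 0"
  shows "\<forall>z\<in>C. \<forall>q\<in>S'. Phi M z q \<noteq> 0"
proof -
  let ?Z = "{z. \<exists>q\<in>S'. Phi M z q = 0}"
  have "C \<inter> ?Z \<subseteq> interior ?Z"
  proof
    fix y assume y: "y \<in> C \<inter> ?Z"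
    then obtain q where "q \<in> S'" "Phi M y q = 0" by blast
    then have *: "Phi M y (w (v q)) = 0" "v q \<in> S" using w_v v_in by auto
    moreover have "y \<noteq> v q" using y *(2) assms(2) by auto
    ultimately show "y \<in> interior ?Z" by (intro incidence_open)
  qed
  then have "C \<subseteq> interior ?Z \<union> - ?Z" by blast
  moreover have "interior ?Z \<inter> - ?Z \<inter> C = {}" using interior_subset by blast
  moreover have "open (- ?Z)" using closed_incidence by (rule open_Compl)
  ultimately have "interior ?Z \<inter> C = {} \<or> - ?Z \<inter> C = {}"
    using connectedD[OF assms(1) open_interior[of ?Z], of "- ?Z"] by blast
  then have "interior ?Z \<inter> C = {}" using z by blast
  then show ?thesis using \<open>C \<inter> ?Z \<subseteq> interior ?Z\<close> by blast
qed

lemma Phi_S'_eq_0: "z \<in> S \<Longrightarrow> \<exists>q\<in>S'. Phi M z q = 0" using Phi_S w_in by blast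

text \<open>Move the tangent line at a farthest point of \<open>S'\<close> away from \<open>S'\<close>.\<close>
lemma exists_avoiding: "\<exists>z. \<forall>y\<in>S'. Phi M z y \<noteq> 0"
proof -
  obtain c0 where c0: "c0 \<notin> S'" using compact_imp_bounded[OF h'.compact_S] by (metis UNIV_eq_I not_bounded_UNIV)
  have "continuous_on S' (\<lambda>y. (y - c0) \<bullet> (y - c0))" by (intro continuous_intros)
  then obtain q where q: "q \<in> S'" "\<And>y. y \<in> S' \<Longrightarrow> (y - c0) \<bullet> (y - c0) \<le> (q - c0) \<bullet> (q - c0)"
    using continuous_attains_sup[OF h'.compact_S S'_nonempty] by blast
  have qU: "q \<in> U'" using q(1) h'.S_U by blast
  \<comment> \<open>The radius vector from c0 to a farthest point q of S'. It is normal to S' at q,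
    and nonzero because c0 is not in S'.\<close>
  define d where "d = q - c0"
  have d0: "d \<noteq> 0" using c0 q(1) by (auto simp: d_def)
  have tan: "u \<bullet> d = 0" if u: "h'.D\<rho> q u = 0" for u
  proof -
    obtain V0 f x0 where ch: "hypersurface_chart S' V0 f" and x0: "x0 \<in> V0" "q = f x0" using h'.chart_exists[OF q(1)] .
    note x0 = x0(1) x0(2)[symmetric]
    have V0: "open V0" and sm: "smooth_on f V0" using ch by (auto simp: hypersurface_chart_def)
    have inS: "f x \<in> S'" if "x \<in> V0" for x using hypersurface_chart_image[OF ch] that by auto
    let ?D = "frechet_derivative f (at x0)"
    have df: "((\<lambda>x. f x - c0) has_derivative ?D) (at x0)"
      by (rule derivative_eq_intros smooth_on_has_derivative[OF sm x0(1)] refl)+ simp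
    have "((\<lambda>x. (f x - c0) \<bullet> (f x - c0)) has_derivative (\<lambda>x. (f x0 - c0) \<bullet> ?D x + ?D x \<bullet> (f x0 - c0))) (at x0)"
      by (rule has_derivative_inner[OF df df])
    then have "(\<lambda>x. (f x0 - c0) \<bullet> ?D x + ?D x \<bullet> (f x0 - c0)) = (\<lambda>x. 0)"
      by (rule differential_zero_maxmin[OF x0(1) V0]) (use q(2)[OF inS] x0 in auto)
    then have z: "?D x \<bullet> d = 0" for x by (auto simp: d_def x0(2) inner_commute dest!: fun_cong[of _ _ x])
    have "u \<in> range ?D" unfolding h'.chart_tangent[OF ch x0(1)] using u x0(2) by simp
    then show ?thesis using z by auto
  qed
  let ?T = "th (transpose M) (v q)"
  obtain l where l: "l \<noteq> 0" "\<And>k. ?T $ k = l * d_rho \<rho>' k q" using th_prop'[OF q(1)] by blast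
  \<comment> \<open>Orthogonality of d to the complex tangent direction multiplied by s = 1 and by s
    = i makes the conjugate of d parallel to the complex gradient, hence to T.\<close>
  have "Re (s * (h'.r2 q * cnj (d $ 1) - h'.r1 q * cnj (d $ 2))) = 0" for s
  proof -
    have "h'.D\<rho> q (vector [s * h'.r2 q, - s * h'.r1 q]) = 0" by (simp add: h'.D\<rho>_d_rho[OF qU])
    from tan[OF this] show ?thesis by (simp add: inner_vec_def UNIV_2 inner_complex_def algebra_simps)
  qed
  from this[of 1] this[of \<i>] have "h'.r2 q * cnj (d $ 1) = h'.r1 q * cnj (d $ 2)" by (simp add: complex_eq_iff)
  then have par: "?T $ 2 * cnj (d $ 1) = ?T $ 1 * cnj (d $ 2)" unfolding l(2) by algebra
  have T0: "?T $ 1 \<noteq> 0 \<or> ?T $ 2 \<noteq> 0" unfolding l(2) using l(1) h'.d_rho_nonzero[OF q(1)] by auto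
  obtain k where k: "cnj (d $ 1) = k * ?T $ 1" "cnj (d $ 2) = k * ?T $ 2"
  proof (cases "?T $ 1 = 0")
    case True
    then show ?thesis using that[of "cnj (d $ 2) / ?T $ 2"] T0 par by (simp del: th_1 th_2)
  next
    case False
    then show ?thesis using that[of "cnj (d $ 1) / ?T $ 1"] par by (simp add: field_simps del: th_1 th_2)
  qed
  have k0: "k \<noteq> 0" using k d0 by (auto simp: vec_eq_iff forall_2)
  obtain N where N: "M ** N = mat 1" using inv_M by (auto simp: invertible_def)
  \<comment> \<open>Adding s times e to the homogeneous vector of v(q) changes its pairing with
    every y by the constant - s / k. In terms of y the tangent line is translated in the direction
    of d.\<close>
  define e where "e = N *v vector [- 1 / k, 0, 0]"
  have Me: "M *v e = vector [- 1 / k, 0, 0]" by (simp add: e_def matrix_vector_mul_assoc N)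
  \<comment> \<open>The values 1 and 1/2 cannot both make the first homogeneous coordinate vanish,
    so the moved point can be kept in the affine chart.\<close>
  obtain s :: real where s: "s > 0" "1 + of_real s * e $ 1 \<noteq> 0"
  proof (cases "1 + e $ 1 = 0")
    case True
    then have "e $ 1 = -1" by (simp add: eq_neg_iff_add_eq_0 add.commute)
    then show ?thesis using that[of "1/2"] by simp
  next
    case False
    then show ?thesis using that[of 1] by simp
  qed
  define t where "t = 1 + of_real s * e $ 1"
  have t0: "t \<noteq> 0" using s(2) by (simp add: t_def)
  define z where "z = (vector [(v q $ 1 + of_real s * e $ 2) / t, (v q $ 2 + of_real s * e $ 3) / t] :: C2)"
  have hz: "t *s homog z = homog (v q) + of_real s *s e"
    using t0 by (simp add: homog_def z_def vec_eq_iff forall_3) (simp add: t_def)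
  have "t * Phi M z y = (\<Sum>i\<in>UNIV. homog y $ i * (M *v (t *s homog z)) $ i)" for y
    by (simp add: Phi_def vector_scalar_commute sum_distrib_left mult_ac)
  also have "\<dots> y = Phi M (v q) y - of_real s / k" for y unfolding hz matrix_vector_right_distrib vector_scalar_commute Me
    by (simp add: Phi_def sum_3 homog_def algebra_simps)
  finally have ez: "t * Phi M z y = Phi M (v q) y - of_real s / k" for y .
  \<comment> \<open>A point y on the translated line satisfies d . (y - q) = s > 0 and would be
    farther from c0 than q.\<close>
  have "Phi M z y \<noteq> 0" if "y \<in> S'" for y
  proof
    assume "Phi M z y = 0"
    then have "Phi M (v q) y = of_real s / k" using ez[of y] by simp
    moreover have "Phi M (v q) q = 0" using Phi_S[OF v_in[OF q(1)]] w_v[OF q(1)] by simp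
    ultimately have "?T $ 1 * (y $ 1 - q $ 1) + ?T $ 2 * (y $ 2 - q $ 2) = of_real s / k"
      using Phi_diff_dual[of M "v q" y q] by (simp del: th_1 th_2)
    then have "k * (?T $ 1 * (y $ 1 - q $ 1) + ?T $ 2 * (y $ 2 - q $ 2)) = of_real s" using k0 by simp
    then have "cnj (d $ 1) * (y $ 1 - q $ 1) + cnj (d $ 2) * (y $ 2 - q $ 2) = of_real s"
      unfolding k by (simp add: algebra_simps del: th_1 th_2)
    then have "Re (cnj (d $ 1) * (y $ 1 - q $ 1) + cnj (d $ 2) * (y $ 2 - q $ 2)) = s" by simp
    then have ds: "d \<bullet> (y - q) = s" by (simp add: inner_vec_def UNIV_2 inner_complex_def algebra_simps)
    have "(y - c0) \<bullet> (y - c0) = d \<bullet> d + 2 * (d \<bullet> (y - q)) + (y - q) \<bullet> (y - q)"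
      by (simp add: d_def inner_diff_left inner_diff_right inner_commute)
    also have "\<dots> > d \<bullet> d" using ds s(1) inner_ge_zero[of "y - q"] by linarith
    finally show False using q(2)[OF that] by (simp add: d_def)
  qed
  then show ?thesis by blast
qed

lemma Phi_nonzero_S':
  assumes z: "z \<in> \<Omega>" and q: "q \<in> S'"
  shows "Phi M z q \<noteq> 0"
proof -
  obtain z0 where z0: "\<forall>q\<in>S'. Phi M z0 q \<noteq> 0" using exists_avoiding by blast
  then have "z0 \<notin> S" using Phi_S'_eq_0 by blast
  then consider "z0 \<in> \<Omega>" | "z0 \<in> - closure \<Omega>" using closure_Om by blast
  then show ?thesis
  proof cases
    case 1
    then show ?thesis using incidence_dichotomy[OF connected_Om Om_S_disjoint 1 z0] z q by blast
  next
    case 2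
    have "- closure \<Omega> \<inter> S = {}" using closure_Om by blast
    note avoid = incidence_dichotomy[OF exterior_connected[OF connected_S] this 2 z0]
    obtain p where p: "p \<in> S" using S_nonempty by blast
    obtain l where l: "\<And>k. th M (w p) $ k = l * d_rho \<rho> k p" using th_prop[OF p] by blast
    \<comment> \<open>Direction of a real line inside the complex tangent line at p; following it
      leads to the exterior.\<close>
    define u where "u = (vector [r2 p, - r1 p] :: C2)"
    have u0: "u \<noteq> 0" using d_rho_nonzero[OF p] by (auto simp: u_def vec_eq_iff forall_2)
    have line: "Phi M (p + s *\<^sub>R u) (w p) = 0" for s using Phi_diff[of M "p + s *\<^sub>R u" "w p" p] Phi_S[OF p] unfolding l
      by (simp add: u_def mult_ac)
    obtain K where K: "\<And>x. x \<in> closure \<Omega> \<Longrightarrow> norm x \<le> K" using bounded_closure[OF bounded_Om] unfolding bounded_iff by blast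
    let ?s = "(\<bar>K\<bar> + 1 + norm p) / norm u"
    have "norm (?s *\<^sub>R u) = \<bar>K\<bar> + 1 + norm p" using u0 by simp
    moreover have "norm (?s *\<^sub>R u) \<le> norm (p + ?s *\<^sub>R u) + norm p" using norm_triangle_ineq4[of "p + ?s *\<^sub>R u" p] by simp
    ultimately have "norm (p + ?s *\<^sub>R u) > K" by linarith
    then have "p + ?s *\<^sub>R u \<in> - closure \<Omega>" using K by force
    then show ?thesis using avoid line w_in[OF p] by blast
  qed
qed

text \<open>Passes from S' to its inside. For fixed z the zero set in the second slot is in general
  a complex line, and a line through a point of the bounded set \<Omega>' crosses its boundary
  S'.\<close>

lemma Phi_nonzero:
  assumes z: "z \<in> \<Omega>" and q: "q \<in> closure \<Omega>'"
  shows "Phi M z q \<noteq> 0"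
proof
  assume 0: "Phi M z q = 0"
  let ?T = "th (transpose M) z"
  have "q \<notin> S'" using Phi_nonzero_S'[OF z] 0 by blast
  then have q': "q \<in> \<Omega>'" using q h'.closure_Om by blast
  show False
  proof (cases "?T = 0")
    \<comment> \<open>There is no line in this case: the pairing with z is constant, and a zero in
      \<Omega>' is also a zero on S'.\<close>
    case True
    obtain q1 where "q1 \<in> S'" using S'_nonempty by blast
    moreover have "Phi M z q1 = Phi M z q" using th_zero_const[OF True, of q1 q] by (simp add: Phi_transpose)
    ultimately show False using Phi_nonzero_S'[OF z] 0 by metis
  next
    case False
    define u where "u = (vector [?T $ 2, - ?T $ 1] :: C2)"
    have u0: "u \<noteq> 0" using False by (auto simp: u_def vec_eq_iff forall_2 simp del: th_1 th_2)
    let ?L = "range (\<lambda>s::real. q + s *\<^sub>R u)"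
    have line: "Phi M z (q + s *\<^sub>R u) = 0" for s
      using Phi_diff_dual[of M z "q + s *\<^sub>R u" q] 0 by (simp add: u_def mult_ac del: th_1 th_2)
    obtain K where K: "\<And>x. x \<in> \<Omega>' \<Longrightarrow> norm x \<le> K" using h'.bounded_Om unfolding bounded_iff by blast
    let ?s = "(\<bar>K\<bar> + 1 + norm q) / norm u"
    have "norm (?s *\<^sub>R u) = \<bar>K\<bar> + 1 + norm q" using u0 by simp
    moreover have "norm (?s *\<^sub>R u) \<le> norm (q + ?s *\<^sub>R u) + norm q" using norm_triangle_ineq4[of "q + ?s *\<^sub>R u" q] by simp
    ultimately have "norm (q + ?s *\<^sub>R u) > K" by linarith
    then have "q + ?s *\<^sub>R u \<notin> \<Omega>'" using K by force
    then have "?L - \<Omega>' \<noteq> {}" by blast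
    moreover have "q + 0 *\<^sub>R u \<in> ?L" by blast
    then have "?L \<inter> \<Omega>' \<noteq> {}" using q' by auto
    moreover have "connected ?L" by (intro connected_continuous_image continuous_intros) auto
    ultimately have "?L \<inter> S' \<noteq> {}" using connected_Int_frontier h'.frontier_Om by metis
    then show False using line Phi_nonzero_S'[OF z] by blast
  qed
qed

end

section \<open>Integrals of powers of the kernel\<close>

context dual_pair
begin

lemma leray_Phi:
  "leray \<rho> S \<Omega> f z = (\<integral>p. f p * m p / (Phi M z (w p))^2 \<partial>\<sigma>)" unfolding leray_eq
proof (rule Bochner_Integration.integral_cong[OF refl])
  fix p assume "p \<in> space \<sigma>"
  then have "p \<in> S" by simp
  then have "Phi M z (w p) = - (th M (w p) $ 1 * (p $ 1 - z $ 1) + th M (w p) $ 2 * (p $ 2 - z $ 2))"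
    using Phi_diff[of M z "w p" p] Phi_S by (simp add: algebra_simps)
  then show "f p * m p / (th M (w p) $ 1 * (p $ 1 - z $ 1) + th M (w p) $ 2 * (p $ 2 - z $ 2))^2
      = f p * m p / (Phi M z (w p))^2" by (simp only: power2_minus)
qed

lemma w_continuous: "continuous_on S w"
proof -
  have "continuous_on S F" using smooth_on_continuous[OF smooth_F] S_W continuous_on_subset by blast
  then show ?thesis by (rule continuous_on_eq) (simp add: F_eq)
qed

lemma continuous_imp_measurable_\<sigma>:
  fixes f :: "C2 \<Rightarrow> 'b::{second_countable_topology,t2_space}"
  assumes "continuous_on S f" shows "f \<in> borel_measurable \<sigma>" unfolding measurable_cong_sets[OF sets_\<sigma> refl]
  using assms by (rule borel_measurable_continuous_on_restrict)

lemma w_measurable: "w \<in> borel_measurable \<sigma>" by (rule continuous_imp_measurable_\<sigma>[OF w_continuous])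

lemma Phi_w_measurable: "(\<lambda>p. Phi M z (w p)) \<in> borel_measurable \<sigma>" unfolding Phi_expand using w_continuous
  by (intro continuous_imp_measurable_\<sigma> continuous_intros)

lemma th_w_measurable: "(\<lambda>p. th M (w p) $ j) \<in> borel_measurable \<sigma>"
proof -
  have "continuous_on S (\<lambda>p. th M (w p) $ 1)" "continuous_on S (\<lambda>p. th M (w p) $ 2)"
    unfolding th_1 th_2 using w_continuous by (intro continuous_intros; assumption)+
  then show ?thesis using exhaust_2[of j] continuous_imp_measurable_\<sigma> by auto
qed

lemma th_w_bounded: "\<exists>K>0. \<forall>p\<in>S. \<forall>j. cmod (th M (w p) $ j) \<le> K"
proof -
  have "continuous_on S (\<lambda>p. th M (w p))"
    using smooth_on_continuous[OF smooth_\<Theta>] continuous_on_subset[OF _ S_W] F_eq by (metis (no_types, lifting) continuous_on_cong)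
  then have "bounded ((\<lambda>p. th M (w p)) ` S)" by (intro compact_imp_bounded compact_continuous_image compact_S)
  then obtain K where "\<forall>p\<in>S. norm (th M (w p)) \<le> K" by (auto simp: bounded_iff)
  then have "cmod (th M (w p) $ j) \<le> \<bar>K\<bar> + 1" if "p \<in> S" for p j
    using Finite_Cartesian_Product.norm_nth_le[of "th M (w p)" j] that by (smt (verit))
  then show ?thesis by (intro exI[of _ "\<bar>K\<bar> + 1"]) (auto simp del: th_1 th_2)
qed

lemma Phi_lower_bound:
  assumes "compact K" "K \<subseteq> \<Omega>"
  shows "\<exists>d>0. \<forall>z\<in>K. \<forall>p\<in>S. d \<le> cmod (Phi M z (w p))"
proof (cases "K = {}")
  case True
  then show ?thesis by (intro exI[of _ 1]) simp
next
  case False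
  have "compact (K \<times> S')" using assms(1) h'.compact_S by (rule compact_Times)
  moreover have "continuous_on (K \<times> S') (\<lambda>y. cmod (Phi M (fst y) (snd y)))" unfolding Phi_expand by (intro continuous_intros)
  moreover have "K \<times> S' \<noteq> {}" using False S'_nonempty by simp
  ultimately have "\<exists>y\<in>K \<times> S'. \<forall>x\<in>K \<times> S'. cmod (Phi M (fst y) (snd y)) \<le> cmod (Phi M (fst x) (snd x))"
    by (intro continuous_attains_inf)
  then obtain y where y: "y \<in> K \<times> S'" "\<And>x. x \<in> K \<times> S' \<Longrightarrow> cmod (Phi M (fst y) (snd y)) \<le> cmod (Phi M (fst x) (snd x))" by blast
  have "fst y \<in> \<Omega>" "snd y \<in> closure \<Omega>'" using y(1) assms(2) h'.closure_Om by auto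
  then have "cmod (Phi M (fst y) (snd y)) > 0" using Phi_nonzero by simp
  moreover have "cmod (Phi M (fst y) (snd y)) \<le> cmod (Phi M z (w p))" if "z \<in> K" "p \<in> S" for z p
    using y(2)[of "(z, w p)"] that w_in by auto
  ultimately show ?thesis by blast
qed

text \<open>With b = f m and n = 2 this is the Leray integral of f; n = 3 and n = 4 occur in its
  first and second derivatives.\<close>

definition I :: "nat \<Rightarrow> (C2 \<Rightarrow> complex) \<Rightarrow> C2 \<Rightarrow> complex" where
  "I n b z = (\<integral>p. b p * inverse (Phi M z (w p)) ^ n \<partial>\<sigma>)"

definition bdd :: "(C2 \<Rightarrow> complex) \<Rightarrow> bool" where
  "bdd b \<longleftrightarrow> b \<in> borel_measurable \<sigma> \<and> (\<exists>B. \<forall>p\<in>S. cmod (b p) \<le> B)"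

lemma bdd_mult: "bdd a \<Longrightarrow> bdd b \<Longrightarrow> bdd (\<lambda>p. a p * b p)"
proof -
  assume ab: "bdd a" "bdd b"
  then obtain A B where AB: "\<forall>p\<in>S. cmod (a p) \<le> A" "\<forall>p\<in>S. cmod (b p) \<le> B" unfolding bdd_def by blast
  have "cmod (a p * b p) \<le> A * B" if "p \<in> S" for p
    unfolding norm_mult using AB that order_trans[OF norm_ge_zero, of "a p" A] by (intro mult_mono) auto
  then show ?thesis using ab unfolding bdd_def by auto
qed

lemma bdd_th: "bdd (\<lambda>p. th M (w p) $ j)" using th_w_bounded th_w_measurable unfolding bdd_def by blast

lemma bdd_continuous: "continuous_on S f \<Longrightarrow> bdd f"
proof -
  assume f: "continuous_on S f"
  then have "bounded (f ` S)" by (intro compact_imp_bounded compact_continuous_image compact_S)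
  then show ?thesis unfolding bdd_def bounded_iff using continuous_imp_measurable_\<sigma>[OF f] by auto
qed

lemma bdd_integrable: "bdd b \<Longrightarrow> integrable \<sigma> b"
proof -
  assume b: "bdd b"
  then obtain B where "\<forall>p\<in>S. cmod (b p) \<le> B" unfolding bdd_def by blast
  then show ?thesis using b unfolding bdd_def by (intro finite_measure.integrable_const_bound[OF finite_\<sigma>, of _ B]) auto
qed

lemma bdd_kernel: assumes "z \<in> \<Omega>" shows "bdd (\<lambda>p. inverse (Phi M z (w p)) ^ n)"
proof -
  obtain d where d: "d > 0" "\<And>p. p \<in> S \<Longrightarrow> d \<le> cmod (Phi M z (w p))" using Phi_lower_bound[of "{z}"] assms by fastforce
  have "cmod (inverse (Phi M z (w p)) ^ n) \<le> inverse d ^ n" if "p \<in> S" for p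
    using d(1) d(2)[OF that] by (simp add: norm_power norm_inverse) (intro power_mono le_imp_inverse_le, auto)
  then show ?thesis unfolding bdd_def using Phi_w_measurable by (intro conjI borel_measurable_power borel_measurable_inverse) auto
qed

lemma norm_axis_C2: "norm (axis j u :: C2) = cmod u"
  using exhaust_2[of j] by (auto simp: norm_vec_def axis_def L2_set_def UNIV_2)

lemma Phi_shift: "Phi M (z + axis j u) q = Phi M z q + u * th M q $ j"
  using exhaust_2[of j] by (auto simp: Phi_expand axis_def algebra_simps)

lemma integral_tendsto_bounded:
  fixes q :: "nat \<Rightarrow> C2 \<Rightarrow> complex"
  assumes m: "\<And>i. q i \<in> borel_measurable \<sigma>" and lim: "\<And>p. p \<in> S \<Longrightarrow> (\<lambda>i. q i p) \<longlonglongrightarrow> l p"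
    and ev: "\<forall>\<^sub>F i in sequentially. \<forall>p\<in>S. cmod (q i p) \<le> B"
  shows "(\<lambda>i. \<integral>p. q i p \<partial>\<sigma>) \<longlonglongrightarrow> (\<integral>p. l p \<partial>\<sigma>)"
proof -
  obtain N where N: "\<And>i p. i \<ge> N \<Longrightarrow> p \<in> S \<Longrightarrow> cmod (q i p) \<le> B" using ev unfolding eventually_sequentially by blast
  have "(\<lambda>i. \<integral>p. q (i + N) p \<partial>\<sigma>) \<longlonglongrightarrow> (\<integral>p. l p \<partial>\<sigma>)"
  proof (rule integral_dominated_convergence[where w="\<lambda>_. B"])
    show "l \<in> borel_measurable \<sigma>" by (rule borel_measurable_LIMSEQ_metric[where f=q]) (simp_all add: m lim)
    show "AE p in \<sigma>. (\<lambda>i. q (i + N) p) \<longlonglongrightarrow> l p" by (intro AE_I2 LIMSEQ_ignore_initial_segment lim) simp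
  qed (use m N finite_\<sigma> in \<open>auto intro!: AE_I2 simp: finite_measure.integrable_const\<close>)
  then show ?thesis by (rule LIMSEQ_offset)
qed

text \<open>Differentiation under the integral in one complex coordinate. \<open>Phi\<close> is
  affine in that coordinate, with slope a component of \<open>th\<close>, and its lower bound on a
  ball around z dominates the difference quotients.\<close>

lemma I_derivative:
  assumes z: "z \<in> \<Omega>" and b: "bdd b"
  shows "((\<lambda>u. I n b (z + axis j u)) has_field_derivative - of_nat n * I (Suc n) (\<lambda>p. b p * th M (w p) $ j) z) (at 0)"
proof -
  obtain r where r: "r > 0" "cball z r \<subseteq> \<Omega>" using open_Om z open_contains_cball by blast
  obtain d where d: "d > 0" "\<And>y p. y \<in> cball z r \<Longrightarrow> p \<in> S \<Longrightarrow> d \<le> cmod (Phi M y (w p))"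
    using Phi_lower_bound[OF compact_cball r(2)] by blast
  obtain K where K: "K > 0" "\<And>p j. p \<in> S \<Longrightarrow> cmod (th M (w p) $ j) \<le> K" using th_w_bounded by blast
  obtain B0 where "\<forall>p\<in>S. cmod (b p) \<le> B0" using b unfolding bdd_def by blast
  then obtain B where B: "B \<ge> 0" "\<And>p. p \<in> S \<Longrightarrow> cmod (b p) \<le> B" by (metis abs_ge_self abs_ge_zero order_trans)
  let ?t = "\<lambda>p. th M (w p) $ j"
  let ?P = "\<lambda>p u. Phi M z (w p) + u * ?t p"
  have inb: "z + axis j u \<in> cball z r" if "cmod u \<le> r" for u using that by (simp add: dist_norm norm_axis_C2)
  have P: "d \<le> cmod (?P p u)" if "p \<in> S" "cmod u \<le> r" for p u
    using d(2)[OF inb[OF that(2)] that(1)] by (simp only: Phi_shift)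
  have Pd: "((\<lambda>u. inverse (?P p u) ^ n) has_field_derivative - of_nat n * inverse (?P p u) ^ Suc n * ?t p) (at u)"
    if "p \<in> S" "cmod u \<le> r" for p u
  proof -
    have nz: "?P p u \<noteq> 0" using P[OF that] d(1) by auto
    have "((\<lambda>u. inverse (?P p u) ^ n) has_field_derivative
       of_nat n * inverse (?P p u) ^ (n - 1) * (- (inverse (?P p u) * ?t p * inverse (?P p u)))) (at u)"
      by (rule derivative_eq_intros refl | use nz in simp)+
    moreover have "of_nat n * inverse (?P p u) ^ (n - 1) * (- (inverse (?P p u) * ?t p * inverse (?P p u)))
       = - of_nat n * inverse (?P p u) ^ Suc n * ?t p" by (cases n) (simp_all add: algebra_simps)
    ultimately show ?thesis by (simp only:)
  qed
  \<comment> \<open>Bounds the derivative of the power of the kernel on the ball of radius r; the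
    mean value inequality turns this into a bound for the difference quotients.\<close>
  define C where "C = real n * inverse d ^ Suc n * K"
  have lip: "cmod (inverse (?P p u) ^ n - inverse (?P p 0) ^ n) \<le> C * cmod (u - 0)" if "p \<in> S" "cmod u \<le> r" for p u
  proof (rule field_differentiable_bound[of "cball 0 r"])
    show "((\<lambda>u. inverse (?P p u) ^ n) has_field_derivative - of_nat n * inverse (?P p u) ^ Suc n * ?t p) (at u within cball 0 r)"
      if "u \<in> cball 0 r" for u using Pd[OF \<open>p \<in> S\<close>, of u] that by (auto intro: has_field_derivative_at_within)
    show "cmod (- of_nat n * inverse (?P p u) ^ Suc n * ?t p) \<le> C" if "u \<in> cball 0 r" for u
    proof -
      have "cmod (inverse (?P p u) ^ Suc n) \<le> inverse d ^ Suc n" unfolding norm_power norm_inverse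
        by (intro power_mono le_imp_inverse_le) (use P[OF \<open>p \<in> S\<close>, of u] d(1) that in auto)
      then show ?thesis unfolding C_def norm_mult norm_minus_cancel norm_of_nat
        using K(2)[OF \<open>p \<in> S\<close>, of j] K(1) d(1) by (intro mult_mono mult_nonneg_nonneg) auto
    qed
  qed (use that r in auto)
  have Ieq: "I n b (z + axis j u) = (\<integral>p. b p * inverse (?P p u) ^ n \<partial>\<sigma>)" for u unfolding I_def Phi_shift ..
  have zin: "z + axis j u \<in> \<Omega>" if "cmod u \<le> r" for u using inb[OF that] r(2) by blast
  have intg: "integrable \<sigma> (\<lambda>p. b p * inverse (?P p u) ^ n)" if "cmod u \<le> r" for u
    using bdd_integrable[OF bdd_mult[OF b bdd_kernel[OF zin[OF that], of n]]] by (simp only: Phi_shift)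
  show ?thesis unfolding has_field_derivative_iff tendsto_at_iff_sequentially
  proof (intro allI impI)
    fix X :: "nat \<Rightarrow> complex" assume X: "\<forall>i. X i \<in> UNIV - {0}" "X \<longlonglongrightarrow> 0"
    have X0: "X i \<noteq> 0" for i using X(1) by auto
    have ev: "\<forall>\<^sub>F i in sequentially. cmod (X i) \<le> r"
      using X(2) r(1) by (auto simp: tendsto_iff dist_norm elim!: allE[of _ r] eventually_mono)
    let ?q = "\<lambda>i p. b p * ((inverse (?P p (X i)) ^ n - inverse (?P p 0) ^ n) / X i)"
    let ?l = "\<lambda>p. b p * (- of_nat n * inverse (?P p 0) ^ Suc n * ?t p)"
    have mP: "(\<lambda>p. ?P p u) \<in> borel_measurable \<sigma>" for u
      by (intro borel_measurable_add borel_measurable_times borel_measurable_const Phi_w_measurable th_w_measurable)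
    have mb: "b \<in> borel_measurable \<sigma>" using b by (simp add: bdd_def)
    have lim: "(\<lambda>i. \<integral>p. ?q i p \<partial>\<sigma>) \<longlonglongrightarrow> (\<integral>p. ?l p \<partial>\<sigma>)"
    proof (rule integral_tendsto_bounded)
      show "?q i \<in> borel_measurable \<sigma>" for i using mb mP[of 0] mP[of "X i"] by measurable
      show "(\<lambda>i. ?q i p) \<longlonglongrightarrow> ?l p" if p: "p \<in> S" for p
        using Pd[OF p, of 0] r X unfolding has_field_derivative_iff tendsto_at_iff_sequentially
        by (intro tendsto_mult tendsto_const) (auto simp: o_def)
      show "\<forall>\<^sub>F i in sequentially. \<forall>p\<in>S. cmod (?q i p) \<le> B * C" using ev
      proof eventually_elim
        case (elim i)
        have "cmod ((inverse (?P p (X i)) ^ n - inverse (?P p 0) ^ n) / X i) \<le> C" if "p \<in> S" for p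
          using lip[OF that elim] X0[of i] by (simp add: norm_divide divide_le_eq)
        then show ?case unfolding norm_mult by (intro ballI mult_mono B) auto
      qed
    qed
    have leq: "(\<integral>p. ?l p \<partial>\<sigma>) = - of_nat n * I (Suc n) (\<lambda>p. b p * ?t p) z"
      unfolding I_def by (subst integral_mult_right_zero[symmetric]) (intro Bochner_Integration.integral_cong refl, simp add: mult_ac)
    have "\<forall>\<^sub>F i in sequentially. (\<integral>p. ?q i p \<partial>\<sigma>) = ((\<lambda>h. (I n b (z + axis j h) - I n b (z + axis j 0)) / (h - 0)) \<circ> X) i"
      using ev
    proof eventually_elim
      case (elim i)
      have "(\<integral>p. ?q i p \<partial>\<sigma>) = (\<integral>p. (b p * inverse (?P p (X i)) ^ n - b p * inverse (?P p 0) ^ n) / X i \<partial>\<sigma>)"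
        using elim by (simp add: right_diff_distrib)
      also have "\<dots> = (I n b (z + axis j (X i)) - I n b (z + axis j 0)) / X i"
        unfolding Ieq using intg[OF elim] intg[of 0] r(1)
        by (subst integral_divide_zero) (simp add: Bochner_Integration.integral_diff)
      finally show ?case by simp
    qed
    with lim[unfolded leq] show "((\<lambda>h. (I n b (z + axis j h) - I n b (z + axis j 0)) / (h - 0)) \<circ> X)
        \<longlonglongrightarrow> - of_nat n * I (Suc n) (\<lambda>p. b p * ?t p) z" by (rule Lim_transform_eventually)
  qed
qed

lemma I_continuous:
  assumes b: "bdd b"
  shows "continuous_on \<Omega> (I n b)" unfolding continuous_on_eq_continuous_at[OF open_Om]
proof
  fix z assume z: "z \<in> \<Omega>"
  obtain r where r: "r > 0" "cball z r \<subseteq> \<Omega>" using open_Om z open_contains_cball by blast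
  obtain d where d: "d > 0" "\<And>y p. y \<in> cball z r \<Longrightarrow> p \<in> S \<Longrightarrow> d \<le> cmod (Phi M y (w p))"
    using Phi_lower_bound[OF compact_cball r(2)] by blast
  obtain B0 where "\<forall>p\<in>S. cmod (b p) \<le> B0" using b unfolding bdd_def by blast
  then obtain B where B: "B \<ge> 0" "\<And>p. p \<in> S \<Longrightarrow> cmod (b p) \<le> B" by (metis abs_ge_self abs_ge_zero order_trans)
  have mb: "b \<in> borel_measurable \<sigma>" using b by (simp add: bdd_def)
  show "isCont (I n b) z" unfolding continuous_at_sequentially
  proof (intro allI impI)
    fix X :: "nat \<Rightarrow> C2" assume X: "X \<longlonglongrightarrow> z"
    have ev: "\<forall>\<^sub>F i in sequentially. X i \<in> cball z r"
      using X r(1) by (auto simp: tendsto_iff dist_commute elim!: allE[of _ r] eventually_mono)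
    have "(\<lambda>i. \<integral>p. b p * inverse (Phi M (X i) (w p)) ^ n \<partial>\<sigma>) \<longlonglongrightarrow> (\<integral>p. b p * inverse (Phi M z (w p)) ^ n \<partial>\<sigma>)"
    proof (rule integral_tendsto_bounded)
      show "(\<lambda>p. b p * inverse (Phi M (X i) (w p)) ^ n) \<in> borel_measurable \<sigma>" for i using mb Phi_w_measurable by measurable
      show "(\<lambda>i. b p * inverse (Phi M (X i) (w p)) ^ n) \<longlonglongrightarrow> b p * inverse (Phi M z (w p)) ^ n" if "p \<in> S" for p
        unfolding Phi_expand by (intro tendsto_intros X) (use d(2)[of z p] d(1) that r(1) in \<open>auto simp: Phi_expand\<close>)
      show "\<forall>\<^sub>F i in sequentially. \<forall>p\<in>S. cmod (b p * inverse (Phi M (X i) (w p)) ^ n) \<le> B * inverse d ^ n" using ev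
      proof eventually_elim
        case (elim i)
        show ?case unfolding norm_mult norm_power norm_inverse
          by (intro ballI mult_mono power_mono le_imp_inverse_le B) (use d(2)[OF elim] d(1) in auto)
      qed
    qed
    then show "(I n b \<circ> X) \<longlonglongrightarrow> I n b z" by (simp add: I_def o_def)
  qed
qed

end

section \<open>Subharmonicity of the squared modulus\<close>

text \<open>The divergence theorem in a single direction. By translation invariance the difference
  quotients of g have integral 0, and dominated convergence passes this to the derivative.\<close>

lemma integral_directional_derivative:
  fixes g g' :: "'a::euclidean_space \<Rightarrow> real" and e :: 'a
  assumes deriv: "\<And>z. ((\<lambda>t. g (z + t *\<^sub>R e)) has_real_derivative g' z) (at 0)"
    and cont: "continuous_on UNIV g" "continuous_on UNIV g'"
    and K: "compact K" "\<And>z. z \<notin> K \<Longrightarrow> g z = 0"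
  shows "integrable lborel g'" "(\<integral>z. g' z \<partial>lborel) = 0"
proof -
  have derivt: "((\<lambda>t. g (z + t *\<^sub>R e)) has_real_derivative g' (z + t *\<^sub>R e)) (at t)" for z t
  proof -
    have "((\<lambda>s. g ((z + t *\<^sub>R e) + s *\<^sub>R e)) has_real_derivative g' (z + t *\<^sub>R e)) (at (t - t))"
      using deriv[of "z + t *\<^sub>R e"] by simp
    moreover have "((\<lambda>s. s - t) has_real_derivative 1) (at t)" by (auto intro!: derivative_eq_intros)
    ultimately have "((\<lambda>s. g ((z + t *\<^sub>R e) + (s - t) *\<^sub>R e)) has_real_derivative g' (z + t *\<^sub>R e) * 1) (at t)"
      by (rule DERIV_chain2)
    moreover have "(z + t *\<^sub>R e) + (s - t) *\<^sub>R e = z + s *\<^sub>R e" for s by (simp add: algebra_simps)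
    ultimately show ?thesis by simp
  qed
  have g'0: "g' z = 0" if "z \<notin> K" for z
  proof -
    have "open (- K)" using K(1) compact_imp_closed open_Compl by blast
    moreover have "((\<lambda>t. z + t *\<^sub>R e) \<longlongrightarrow> z) (at 0)" by (auto intro!: tendsto_eq_intros)
    ultimately have "\<forall>\<^sub>F t in at 0. z + t *\<^sub>R e \<in> - K" using that by (intro topological_tendstoD) auto
    then have "\<forall>\<^sub>F t in at 0. g (z + t *\<^sub>R e) = 0" by eventually_elim (use K in auto)
    then have "\<forall>\<^sub>F t in nhds 0. g (z + t *\<^sub>R e) = 0" using K(2)[OF that] by (simp add: eventually_nhds_conv_at)
    then have "((\<lambda>t. g (z + t *\<^sub>R e)) has_real_derivative 0) (at 0)"
      by (subst DERIV_cong_ev[OF refl _ refl, where g="\<lambda>_. 0"]) auto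
    with deriv[of z] show ?thesis by (rule DERIV_unique)
  qed
  have int: "integrable lborel f" if "continuous_on UNIV f" "\<And>z. z \<notin> K \<Longrightarrow> f z = 0" for f :: "'a \<Rightarrow> real"
  proof -
    have "integrable lborel (\<lambda>x. indicator K x *\<^sub>R f x)"
      by (rule borel_integrable_compact[OF K(1)]) (use that continuous_on_subset in blast)
    moreover have "(\<lambda>x. indicator K x *\<^sub>R f x) = f" using that(2) by (auto simp: fun_eq_iff indicator_def)
    ultimately show ?thesis by simp
  qed
  show intg': "integrable lborel g'" by (rule int[OF cont(2) g'0])
  have intg: "integrable lborel g" by (rule int[OF cont(1) K(2)])
  \<comment> \<open>Contains the supports of all difference quotients with step at most 1.\<close>
  define K' where "K' = (\<lambda>(x, t). x - t *\<^sub>R e) ` (K \<times> {0..1::real})"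
  have K': "compact K'" unfolding K'_def using K(1)
    by (intro compact_continuous_image compact_Times) (auto simp: case_prod_beta intro!: continuous_intros)
  have "bounded (g' ` K)" using K(1) cont(2) by (intro compact_imp_bounded compact_continuous_image) (auto intro: continuous_on_subset)
  then obtain B0 where "\<forall>z\<in>K. \<bar>g' z\<bar> \<le> B0" by (auto simp: bounded_iff)
  then have B: "\<bar>g' z\<bar> \<le> \<bar>B0\<bar>" for z using g'0[of z] by (cases "z \<in> K") auto
  define h where "h n = inverse (real (Suc n))" for n
  have h: "0 < h n" "h n \<le> 1" for n by (auto simp: h_def field_simps)
  have h0: "h \<longlonglongrightarrow> 0" unfolding h_def[abs_def] by (rule LIMSEQ_inverse_real_of_nat)
  define q where "q n z = (g (z + h n *\<^sub>R e) - g z) / h n" for n z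
  have tr: "integrable lborel (\<lambda>z. g (z + c))" "(\<integral>z. g (z + c) \<partial>lborel) = (\<integral>z. g z \<partial>lborel)" for c
  proof -
    have mg: "g \<in> borel_measurable borel" using cont(1) by (rule borel_measurable_continuous_onI)
    show "integrable lborel (\<lambda>z. g (z + c))"
      using intg mg by (subst (asm) lborel_distr_plus[symmetric, of c]) (simp add: integrable_distr_eq add.commute)
    show "(\<integral>z. g (z + c) \<partial>lborel) = (\<integral>z. g z \<partial>lborel)"
      using mg by (subst (2) lborel_distr_plus[symmetric, of c]) (simp add: integral_distr add.commute)
  qed
  have "(\<integral>z. q n z \<partial>lborel) = 0" for n
    unfolding q_def using tr[of "h n *\<^sub>R e"] intg by (simp add: Bochner_Integration.integral_diff)
  moreover have "(\<lambda>n. \<integral>z. q n z \<partial>lborel) \<longlonglongrightarrow> (\<integral>z. g' z \<partial>lborel)"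
  proof (rule integral_dominated_convergence[where w="\<lambda>z. indicator K' z * \<bar>B0\<bar>"])
    show "g' \<in> borel_measurable lborel" using cont(2) borel_measurable_continuous_onI by auto
    have "continuous_on UNIV (q n)" for n unfolding q_def[abs_def]
      using h(1)[of n] by (intro continuous_intros continuous_on_compose2[OF cont(1)]) auto
    then show "q n \<in> borel_measurable lborel" for n using borel_measurable_continuous_onI by auto
    show "integrable lborel (\<lambda>z. indicator K' z * \<bar>B0\<bar>)" using borel_integrable_compact[OF K', of "\<lambda>_. \<bar>B0\<bar>"] by simp
    show "AE z in lborel. (\<lambda>n. q n z) \<longlonglongrightarrow> g' z"
    proof (rule AE_I2)
      fix z
      have "\<forall>i. h i \<in> UNIV - {0}" using h(1) by (auto simp: less_le)
      then show "(\<lambda>n. q n z) \<longlonglongrightarrow> g' z"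
        using deriv[of z, unfolded has_field_derivative_iff tendsto_at_iff_sequentially, rule_format, of h] h0
        by (simp add: q_def o_def)
    qed
    show "AE z in lborel. norm (q n z) \<le> indicator K' z * \<bar>B0\<bar>" for n
    proof (rule AE_I2)
      fix z
      obtain t where t: "0 < t" "t < h n" "g (z + h n *\<^sub>R e) - g (z + 0 *\<^sub>R e) = (h n - 0) * g' (z + t *\<^sub>R e)"
        using MVT2[OF h(1)[of n], of "\<lambda>t. g (z + t *\<^sub>R e)" "\<lambda>t. g' (z + t *\<^sub>R e)"] derivt by auto
      then have q: "q n z = g' (z + t *\<^sub>R e)" using h(1)[of n] by (simp add: q_def)
      show "norm (q n z) \<le> indicator K' z * \<bar>B0\<bar>"
      proof (cases "z + t *\<^sub>R e \<in> K")
        case True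
        have "t \<in> {0..1}" using t h(2)[of n] by auto
        then have "z \<in> K'" unfolding K'_def using True by (intro image_eqI[of _ _ "(z + t *\<^sub>R e, t)"]) auto
        then show ?thesis using q B by simp
      next
        case False
        then show ?thesis using q g'0 by simp
      qed
    qed
  qed
  ultimately show "(\<integral>z. g' z \<partial>lborel) = 0" by (simp add: LIMSEQ_const_iff)
qed

lemma has_vector_derivative_axis:
  fixes f :: "C2 \<Rightarrow> complex"
  assumes "((\<lambda>u. f (z + axis j u)) has_field_derivative d) (at 0)"
  shows "((\<lambda>t::real. f (z + t *\<^sub>R axis j c)) has_vector_derivative c * d) (at 0)"
proof -
  have ax: "t *\<^sub>R axis j c = axis j (of_real t * c)" for t by (simp add: vec_eq_iff axis_def) (simp add: scaleR_conv_of_real)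
  have "((\<lambda>t. of_real t * c) has_vector_derivative 1 * c) (at (0::real))"
    by (intro has_vector_derivative_mult_left) (auto intro!: derivative_eq_intros)
  then have "((\<lambda>u. f (z + axis j u)) \<circ> (\<lambda>t. of_real t * c) has_vector_derivative (1 * c) * d) (at (0::real))"
    using assms by (intro field_vector_diff_chain_at) auto
  then show ?thesis by (simp add: o_def ax)
qed

lemma has_real_derivative_Re_mult_cnj:
  fixes p q :: "real \<Rightarrow> complex"
  assumes "(p has_vector_derivative p') (at t)" "(q has_vector_derivative q') (at t)"
  shows "((\<lambda>t. Re (p t * cnj (q t))) has_real_derivative Re (p t * cnj q' + p' * cnj (q t))) (at t)"
proof -
  have "((\<lambda>t. cnj (q t)) has_vector_derivative cnj q') (at t)"
    by (rule bounded_linear.has_vector_derivative[OF bounded_linear_cnj assms(2)])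
  from has_vector_derivative_mult[OF assms(1) this]
  have "((\<lambda>t. Re (p t * cnj (q t))) has_vector_derivative Re (p t * cnj q' + p' * cnj (q t))) (at t)"
    by (rule bounded_linear.has_vector_derivative[OF bounded_linear_Re])
  then show ?thesis by (simp add: has_real_derivative_iff_has_vector_derivative)
qed

lemma line_derivative_local:
  fixes f g :: "'a::real_normed_vector \<Rightarrow> real"
  assumes "open A" "z \<in> A" "\<And>y. y \<in> A \<Longrightarrow> f y = g y" "((\<lambda>t. g (z + t *\<^sub>R e)) has_real_derivative d) (at 0)"
  shows "((\<lambda>t. f (z + t *\<^sub>R e)) has_real_derivative d) (at 0)"
proof -
  have "((\<lambda>t. z + t *\<^sub>R e) \<longlongrightarrow> z) (nhds (0::real))" by (rule tendsto_eq_intros filterlim_ident refl | simp)+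
  then have "\<forall>\<^sub>F t in nhds 0. z + t *\<^sub>R e \<in> A" using assms(1,2) by (rule topological_tendstoD)
  then have "\<forall>\<^sub>F t in nhds 0. f (z + t *\<^sub>R e) = g (z + t *\<^sub>R e)" by eventually_elim (rule assms(3))
  then show ?thesis using assms(4) by (subst DERIV_cong_ev[OF refl _ refl])
qed

context dual_pair
begin

text \<open>Green's identity for a compactly supported a and G = |I 2 b|^2: in each of the four real
  directions the derivative of a G' - G a' has integral 0, and the Laplacian of G is nonnegative
  because \<open>I 2 b\<close> is holomorphic. \<open>a1 j c\<close> and \<open>a2 j c\<close> are
  the first and second derivatives of a in the direction \<open>axis j c\<close>, with c = 1 or c =
  i.\<close>

lemma Green_inequality:
  fixes a :: "C2 \<Rightarrow> real" and a1 a2 :: "2 \<Rightarrow> complex \<Rightarrow> C2 \<Rightarrow> real"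
  assumes b: "bdd b"
    and d1: "\<And>j c z. c \<in> {1, \<i>} \<Longrightarrow> ((\<lambda>t. a (z + t *\<^sub>R axis j c)) has_real_derivative a1 j c z) (at 0)"
    and d2: "\<And>j c z. c \<in> {1, \<i>} \<Longrightarrow> ((\<lambda>t. a1 j c (z + t *\<^sub>R axis j c)) has_real_derivative a2 j c z) (at 0)"
    and c0: "continuous_on UNIV a" and c1: "\<And>j c. c \<in> {1, \<i>} \<Longrightarrow> continuous_on UNIV (a1 j c)"
    and c2: "\<And>j c. c \<in> {1, \<i>} \<Longrightarrow> continuous_on UNIV (a2 j c)"
    and K: "compact K" "K \<subseteq> \<Omega>" and zero: "\<And>z. z \<notin> K \<Longrightarrow> a z = 0" "\<And>j c z. z \<notin> K \<Longrightarrow> a1 j c z = 0" "\<And>j c z. z \<notin> K \<Longrightarrow> a2 j c z = 0"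
    and nonneg: "\<And>z. a z \<ge> 0"
  defines "Lap \<equiv> \<lambda>z. a2 1 1 z + a2 1 \<i> z + a2 2 1 z + a2 2 \<i> z"
  shows "(\<integral>z. (if z \<in> \<Omega> then (cmod (I 2 b z))^2 * Lap z else 0) \<partial>lborel) \<ge> 0"
    and "integrable lborel (\<lambda>z. if z \<in> \<Omega> then (cmod (I 2 b z))^2 * Lap z else 0)"
proof -
  define f where "f = I 2 b"
  define f1 where "f1 j z = - 2 * I 3 (\<lambda>p. b p * th M (w p) $ j) z" for j z
  define f2 where "f2 j z = 6 * I 4 (\<lambda>p. b p * th M (w p) $ j * th M (w p) $ j) z" for j z
  note b1 = bdd_mult[OF b bdd_th]
  note b2 = bdd_mult[OF bdd_mult[OF b bdd_th] bdd_th]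
  have df: "((\<lambda>u. f (z + axis j u)) has_field_derivative f1 j z) (at 0)" if "z \<in> \<Omega>" for z j
    using I_derivative[OF that b, of 2 j] by (simp add: f_def f1_def)
  have df1: "((\<lambda>u. f1 j (z + axis j u)) has_field_derivative f2 j z) (at 0)" if "z \<in> \<Omega>" for z j unfolding f1_def f2_def
    using DERIV_cmult[OF I_derivative[OF that b1[of j], of 3 j], of "- 2"] by (simp add: eval_nat_numeral)
  have cf: "continuous_on \<Omega> f" "continuous_on \<Omega> (f1 j)" "continuous_on \<Omega> (f2 j)" for j
    unfolding f_def f1_def[abs_def] f2_def[abs_def] by (intro continuous_intros I_continuous b b1 b2)+
  define G where "G z = (cmod (f z))^2" for z
  have GRe: "G z = Re (f z * cnj (f z))" for z by (simp add: G_def complex_norm_square[symmetric])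
  define G1 where "G1 j c z = 2 * Re (c * f1 j z * cnj (f z))" for j c z
  define G2 where "G2 j c z = 2 * Re (c * c * f2 j z * cnj (f z)) + 2 * (cmod c)^2 * (cmod (f1 j z))^2" for j c z
  have dG: "((\<lambda>t. G (z + t *\<^sub>R axis j c)) has_real_derivative G1 j c z) (at 0)" if "z \<in> \<Omega>" for z j c
  proof -
    have "f z * cnj (c * f1 j z) + c * f1 j z * cnj (f z) = c * f1 j z * cnj (f z) + cnj (c * f1 j z * cnj (f z))"
      by (simp add: mult.commute add.commute)
    then have "Re (f z * cnj (c * f1 j z) + c * f1 j z * cnj (f z)) = G1 j c z"
      unfolding G1_def by (simp only: plus_complex.sel cnj.sel mult_2)
    with has_real_derivative_Re_mult_cnj[OF has_vector_derivative_axis[OF df[OF that, of j], where c=c] has_vector_derivative_axis[OF df[OF that, of j], where c=c]]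
    show ?thesis by (simp only: GRe scaleR_zero_left add_0_right)
  qed
  have dG1: "((\<lambda>t. G1 j c (z + t *\<^sub>R axis j c)) has_real_derivative G2 j c z) (at 0)" if "z \<in> \<Omega>" for z j c
  proof -
    have e: "(cmod c)^2 * (cmod (f1 j z))^2 = Re (c * f1 j z * cnj (c * f1 j z))"
      unfolding complex_norm_square[symmetric] norm_mult power_mult_distrib by (simp only: Re_complex_of_real)
    have "((\<lambda>t. c * f1 j (z + t *\<^sub>R axis j c)) has_vector_derivative c * (c * f2 j z)) (at 0)"
      by (intro has_vector_derivative_mult_right has_vector_derivative_axis df1 that)
    from has_real_derivative_Re_mult_cnj[OF this has_vector_derivative_axis[OF df[OF that], where c=c]]
    have "((\<lambda>t. 2 * Re (c * f1 j (z + t *\<^sub>R axis j c) * cnj (f (z + t *\<^sub>R axis j c)))) has_real_derivative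
      2 * Re (c * f1 j z * cnj (c * f1 j z) + c * (c * f2 j z) * cnj (f z))) (at 0)" by (intro DERIV_cmult) simp
    moreover have "2 * Re (c * f1 j z * cnj (c * f1 j z) + c * (c * f2 j z) * cnj (f z)) = G2 j c z"
      unfolding G2_def mult.assoc[of 2 "(cmod c)^2"] e by (simp add: mult.assoc)
    ultimately show ?thesis by (simp only: G1_def)
  qed
  have cG: "continuous_on \<Omega> G" "continuous_on \<Omega> (G1 j c)" "continuous_on \<Omega> (G2 j c)" for j c
    unfolding G_def[abs_def] G1_def[abs_def] G2_def[abs_def] by (intro continuous_intros cf)+
  \<comment> \<open>Extension by 0 from \<Omega> is continuous because the functions vanish off the
    compact set K.\<close>
  have ext: "continuous_on UNIV (\<lambda>z. if z \<in> \<Omega> then k z else 0)"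
    if "continuous_on \<Omega> k" "\<And>z. z \<notin> K \<Longrightarrow> k z = 0" for k :: "C2 \<Rightarrow> real"
  proof -
    have "continuous_on (\<Omega> \<union> - K) (\<lambda>z. if z \<in> \<Omega> then k z else 0)"
    proof (rule continuous_on_open_Un[OF open_Om])
      show "open (- K)" using K(1) compact_imp_closed open_Compl by blast
      show "continuous_on \<Omega> (\<lambda>z. if z \<in> \<Omega> then k z else 0)" using that(1) by (rule continuous_on_eq) simp
      show "continuous_on (- K) (\<lambda>z. if z \<in> \<Omega> then k z else 0)"
        using continuous_on_const[of "- K" "0::real"] by (rule continuous_on_eq) (use that(2) in auto)
    qed
    moreover have "\<Omega> \<union> - K = UNIV" using K(2) by blast
    ultimately show ?thesis by simp
  qed
  have key: "integrable lborel (\<lambda>z. if z \<in> \<Omega> then a z * G2 j c z - G z * a2 j c z else 0)"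
    "(\<integral>z. (if z \<in> \<Omega> then a z * G2 j c z - G z * a2 j c z else 0) \<partial>lborel) = 0" if c: "c \<in> {1, \<i>}" for j c
  proof -
    let ?g = "\<lambda>z. if z \<in> \<Omega> then a z * G1 j c z - G z * a1 j c z else 0"
    let ?g' = "\<lambda>z. if z \<in> \<Omega> then a z * G2 j c z - G z * a2 j c z else 0"
    have "((\<lambda>t. ?g (z + t *\<^sub>R axis j c)) has_real_derivative ?g' z) (at 0)" for z
    proof (cases "z \<in> \<Omega>")
      case True
      have "((\<lambda>t. a (z + t *\<^sub>R axis j c) * G1 j c (z + t *\<^sub>R axis j c) - G (z + t *\<^sub>R axis j c) * a1 j c (z + t *\<^sub>R axis j c))
         has_real_derivative ?g' z) (at 0)"
        using DERIV_diff[OF DERIV_mult[OF d1[OF c, of z j] dG1[OF True, of j c]] DERIV_mult[OF dG[OF True, of j c] d2[OF c, of j z]]] True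
        by (simp add: algebra_simps)
      then show ?thesis by (intro line_derivative_local[OF open_Om True, of ?g "\<lambda>z. a z * G1 j c z - G z * a1 j c z"]) auto
    next
      case False
      then have "z \<in> - K" using K(2) by blast
      moreover have "open (- K)" using K(1) compact_imp_closed open_Compl by blast
      ultimately show ?thesis by (intro line_derivative_local[of "- K" z ?g "\<lambda>_. 0"]) (use zero False in auto)
    qed
    moreover have "continuous_on UNIV ?g" "continuous_on UNIV ?g'"
      using zero by (intro ext continuous_intros cG continuous_on_subset[OF c0] continuous_on_subset[OF c1[OF c]] continuous_on_subset[OF c2[OF c]]; simp)+
    moreover have "?g z = 0" if "z \<notin> K" for z using zero that by simp
    ultimately show "integrable lborel ?g'" "(\<integral>z. ?g' z \<partial>lborel) = 0"
      using integral_directional_derivative[where g="?g" and g'="?g'", OF _ _ _ K(1)] by blast+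
  qed
  have int: "integrable lborel (\<lambda>z. if z \<in> \<Omega> then k z else 0)"
    if "continuous_on \<Omega> k" "\<And>z. z \<notin> K \<Longrightarrow> k z = 0" for k :: "C2 \<Rightarrow> real"
  proof -
    have "integrable lborel (\<lambda>x. indicator K x *\<^sub>R (if x \<in> \<Omega> then k x else 0))"
      by (rule borel_integrable_compact[OF K(1)]) (use ext[OF that] continuous_on_subset in blast)
    moreover have "(\<lambda>x. indicator K x *\<^sub>R (if x \<in> \<Omega> then k x else 0)) = (\<lambda>z. if z \<in> \<Omega> then k z else 0)"
      using that(2) by (auto simp: fun_eq_iff indicator_def)
    ultimately show ?thesis by simp
  qed
  have cpsi: "continuous_on \<Omega> a" "c \<in> {1,\<i>} \<Longrightarrow> continuous_on \<Omega> (a2 j c)" for j c using c0 c2 continuous_on_subset by blast+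
  have cLap: "continuous_on \<Omega> Lap" unfolding Lap_def by (intro continuous_intros cpsi) auto
  show "integrable lborel (\<lambda>z. if z \<in> \<Omega> then (cmod (I 2 b z))^2 * Lap z else 0)" unfolding f_def[symmetric] G_def[symmetric]
    by (rule int) (intro continuous_intros cG cLap, use zero in \<open>simp add: Lap_def\<close>)
  let ?h = "\<lambda>j c z. if z \<in> \<Omega> then a z * G2 j c z - G z * a2 j c z else 0"
  \<comment> \<open>Adding the directions c = 1 and c = i cancels the terms with \<open>f2\<close>,
    since c^2 changes sign, and leaves 4 |f1 j|^2 for each j.\<close>
  let ?s = "\<lambda>z. if z \<in> \<Omega> then a z * (4 * (cmod (f1 1 z))^2 + 4 * (cmod (f1 2 z))^2) else 0"
  have "0 \<le> (\<integral>z. ?s z \<partial>lborel)" by (rule integral_nonneg_AE) (use nonneg in auto)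
  also have "(\<lambda>z. ?s z) = (\<lambda>z. (?h 1 1 z + ?h 1 \<i> z + ?h 2 1 z + ?h 2 \<i> z) + (if z \<in> \<Omega> then G z * Lap z else 0))"
    by (auto simp: fun_eq_iff G2_def Lap_def algebra_simps)
  also have "(\<integral>z. (?h 1 1 z + ?h 1 \<i> z + ?h 2 1 z + ?h 2 \<i> z) + (if z \<in> \<Omega> then G z * Lap z else 0) \<partial>lborel)
     = (\<integral>z. (if z \<in> \<Omega> then G z * Lap z else 0) \<partial>lborel)"
  proof -
    have iL: "integrable lborel (\<lambda>z. if z \<in> \<Omega> then G z * Lap z else 0)"
      by (rule int) (intro continuous_intros cG cLap, use zero in \<open>simp add: Lap_def\<close>)
    have k: "integrable lborel (?h 1 1)" "integrable lborel (?h 1 \<i>)" "integrable lborel (?h 2 1)" "integrable lborel (?h 2 \<i>)"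
      using key(1) by auto
    show ?thesis
      by (simp only: Bochner_Integration.integral_add Bochner_Integration.integrable_add k iL key(2) insert_iff simp_thms)
  qed
  finally show "(\<integral>z. (if z \<in> \<Omega> then (cmod (I 2 b z))^2 * Lap z else 0) \<partial>lborel) \<ge> 0" by (simp only: G_def f_def)
qed

end

section \<open>Boundary layers\<close>

lemma antiderivative_exists:
  fixes f :: "real \<Rightarrow> real"
  assumes "continuous_on UNIV f"
  obtains F where "\<And>x. (F has_real_derivative f x) (at x)"
proof
  fix x :: real
  define a where "a = \<bar>x\<bar> + 1"
  have "((\<lambda>u. LBINT y=ereal 0..ereal u. f y) has_vector_derivative f x) (at x within {-a..a})"
    by (rule interval_integral_FTC2) (auto simp: a_def intro: continuous_on_subset[OF assms])
  moreover have "at x within {-a..a} = at x" by (rule at_within_interior) (auto simp: a_def)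
  ultimately show "((\<lambda>u. LBINT y=ereal 0..ereal u. f y) has_real_derivative f x) (at x)"
    by (simp only: has_real_derivative_iff_has_vector_derivative)
qed

section \<open>Bumps, cutoff functions and layer weights\<close>

definition bump :: "real \<Rightarrow> real" where "bump x = max 0 (6 * x * (1 - x))"

lemma bump_nonneg: "bump x \<ge> 0" and bump_le: "bump x \<le> 2"
  and bump_zero: "x \<le> 0 \<or> 1 \<le> x \<Longrightarrow> bump x = 0" and bump_ge_1: "1/3 \<le> x \<Longrightarrow> x \<le> 2/3 \<Longrightarrow> 1 \<le> bump x"
  and bump_eq: "0 \<le> x \<Longrightarrow> x \<le> 1 \<Longrightarrow> bump x = 6 * x - 6 * x^2"
proof -
  show "bump x \<ge> 0" by (simp add: bump_def)
  have "(2 * x - 1)^2 \<ge> 0" by simp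
  then have "4 * x * (1 - x) \<le> 1" by (simp add: power2_eq_square algebra_simps)
  then show "bump x \<le> 2" by (simp add: bump_def)
  show "bump x = 0" if "x \<le> 0 \<or> 1 \<le> x" using that by (auto simp: bump_def max_def mult_le_0_iff zero_le_mult_iff)
  show "1 \<le> bump x" if "1/3 \<le> x" "x \<le> 2/3"
  proof -
    have "0 \<le> (x - 1/3) * (2/3 - x)" using that by simp
    then have "1 \<le> 6 * x * (1 - x)" by (simp add: field_simps)
    then show ?thesis by (simp add: bump_def)
  qed
  show "bump x = 6 * x - 6 * x^2" if "0 \<le> x" "x \<le> 1"
    using that by (simp add: bump_def power2_eq_square algebra_simps mult_left_le)
qed

lemma bump_continuous: "continuous_on A bump" unfolding bump_def[abs_def] by (intro continuous_intros)

text \<open>The factor 6 in \<open>bump\<close> makes its integral equal to 1; on [0, 1] the step is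
  3 x^2 - 2 x^3. Class C^1 is enough, since the step enters the first derivative of a cutoff that
  has to be C^2.\<close>

lemma smoothstep_exists:
  obtains s :: "real \<Rightarrow> real" where "\<And>x. (s has_real_derivative bump x) (at x)"
    "\<And>x. x \<le> 0 \<Longrightarrow> s x = 0" "\<And>x. 1 \<le> x \<Longrightarrow> s x = 1" "\<And>x. 0 \<le> s x" "\<And>x. s x \<le> 1"
proof -
  obtain F where F: "\<And>x. (F has_real_derivative bump x) (at x)"
    using antiderivative_exists[OF bump_continuous[of UNIV]] by blast
  have contF: "continuous_on A F" for A using F DERIV_isCont continuous_at_imp_continuous_on by blast
  have mono: "F x \<le> F y" if "x \<le> y" for x y by (rule DERIV_nonneg_imp_nondecreasing[OF that]) (use F bump_nonneg in blast)
  have "F 1 - (3 * 1^2 - 2 * 1 ^ 3) = F 0 - (3 * 0^2 - 2 * 0 ^ 3)"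
  proof (rule DERIV_isconst_end[where f="\<lambda>x. F x - (3 * x^2 - 2 * x ^ 3)"])
    show "continuous_on {0..1} (\<lambda>x. F x - (3 * x^2 - 2 * x ^ 3))" by (intro continuous_intros contF)
    show "((\<lambda>x. F x - (3 * x^2 - 2 * x ^ 3)) has_real_derivative 0) (at x)" if "0 < x" "x < 1" for x
    proof -
      have "((\<lambda>x. F x - (3 * x^2 - 2 * x ^ 3)) has_real_derivative (bump x - (6 * x - 6 * x^2))) (at x)"
        by (rule derivative_eq_intros F refl | simp)+
      then show ?thesis using that bump_eq[of x] by simp
    qed
  qed simp
  then have F1: "F 1 = F 0 + 1" by simp
  have le0: "F x = F 0" if "x \<le> 0" for x
  proof (cases "x = 0")
    case False
    then show ?thesis using that by (intro DERIV_isconst_end[symmetric] contF) (use F bump_zero in \<open>auto, metis less_imp_le\<close>)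
  qed simp
  have ge1: "F x = F 1" if "1 \<le> x" for x
  proof (cases "x = 1")
    case False
    then show ?thesis using that by (intro DERIV_isconst_end contF) (use F bump_zero in \<open>auto, metis less_imp_le\<close>)
  qed simp
  show thesis
  proof (rule that[of "\<lambda>x. F x - F 0"])
    show "((\<lambda>x. F x - F 0) has_real_derivative bump x) (at x)" for x using DERIV_diff[OF F DERIV_const] by simp
    show "0 \<le> F x - F 0" for x using mono[of 0 x] le0[of x] by (cases "x \<le> 0") auto
    show "F x - F 0 \<le> 1" for x
    proof (cases "x \<le> 1")
      case True
      then show ?thesis using mono[of x 1] F1 by linarith
    next
      case False
      then show ?thesis using ge1[of x] F1 by linarith
    qed
    show "F x - F 0 = 0" if "x \<le> 0" for x using le0[OF that] by linarith
    show "F x - F 0 = 1" if "1 \<le> x" for x using ge1[OF that] F1 by linarith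
  qed
qed

text \<open>Supported in -2h \<le> t \<le> -h with integral 1. Evaluated at \<rho> it weights a
  layer of points whose value of \<rho> lies between -2h and -h.\<close>

definition layer_weight :: "real \<Rightarrow> real \<Rightarrow> real" where
  "layer_weight h t = bump ((t + 2 * h) / h) / h"

lemma layer_weight_continuous: "continuous_on A f \<Longrightarrow> continuous_on A (\<lambda>x. layer_weight h (f x))"
  unfolding layer_weight_def divide_inverse by (intro continuous_intros continuous_on_compose2[OF bump_continuous[of UNIV]]) auto

lemma layer_weight_nonneg: "h > 0 \<Longrightarrow> 0 \<le> layer_weight h t" by (simp add: layer_weight_def bump_nonneg)

lemma layer_weight_le: "h > 0 \<Longrightarrow> layer_weight h t \<le> 2 / h"
  using bump_le[of "(t + 2 * h) / h"] by (simp add: layer_weight_def divide_right_mono)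

lemma layer_weight_zero: "h > 0 \<Longrightarrow> t \<le> - 2 * h \<or> - h \<le> t \<Longrightarrow> layer_weight h t = 0"
  unfolding layer_weight_def by (subst bump_zero) (auto simp: field_simps)

lemma layer_weight_ge: "h > 0 \<Longrightarrow> - (5/3) * h \<le> t \<Longrightarrow> t \<le> - (4/3) * h \<Longrightarrow> 1 / h \<le> layer_weight h t"
  unfolding layer_weight_def by (intro divide_right_mono bump_ge_1) (auto simp: field_simps)

text \<open>Provides the cutoff for Green's identity, to be composed with \<rho>. In the last clause
  g and l stand for |grad \<rho>|^2 and the Laplacian of \<rho>, so the left side is the Laplacian
  of the composition. The factor exp(K t) in the first derivative produces a term that absorbs l and
  leaves the difference of two layer densities.\<close>

lemma cutoff_exists:
  fixes h h' K :: real
  assumes h: "0 < h'" "2 * h' \<le> h"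
  obtains f f1 f2 :: "real \<Rightarrow> real" where
    "\<And>t. (f has_real_derivative f1 t) (at t)" "\<And>t. (f1 has_real_derivative f2 t) (at t)"
    "continuous_on UNIV f2" "\<And>t. 0 \<le> f t"
    "\<And>t. - h' \<le> t \<Longrightarrow> f t = 0 \<and> f1 t = 0 \<and> f2 t = 0"
    "\<And>t. t \<le> - 2 * h \<Longrightarrow> f t = f (- 2 * h) \<and> f1 t = 0 \<and> f2 t = 0"
    "\<And>t g l. 0 \<le> g \<Longrightarrow> \<bar>l\<bar> \<le> K * g \<Longrightarrow> f2 t * g + f1 t * l \<le> exp (K * t) * g * (layer_weight h' t - layer_weight h t)"
proof -
  obtain s :: "real \<Rightarrow> real" where s: "\<And>x. (s has_real_derivative bump x) (at x)"
    "\<And>x. x \<le> 0 \<Longrightarrow> s x = 0" "\<And>x. 1 \<le> x \<Longrightarrow> s x = 1" "\<And>x. 0 \<le> s x" "\<And>x. s x \<le> 1" using smoothstep_exists by blast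
  have h0: "h > 0" using h by linarith
  \<comment> \<open>k rises from 0 to 1 across the layer of h and returns to 0 across that of h'.
    The condition 2 h' \<le> h keeps the layers apart, so k is nonnegative; its derivative is the
    difference of the weights.\<close>
  define k where "k t = s ((t + 2 * h) / h) - s ((t + 2 * h') / h')" for t
  define k' where "k' t = layer_weight h t - layer_weight h' t" for t
  have dk: "(k has_real_derivative k' t) (at t)" for t
  proof -
    have "((\<lambda>t. s ((t + 2 * a) / a)) has_real_derivative layer_weight a t) (at t)" if "a > 0" for a
    proof -
      have "((\<lambda>t. (t + 2 * a) / a) has_real_derivative 1 / a) (at t)" using that by (auto intro!: derivative_eq_intros)
      from DERIV_chain2[OF s(1) this] show ?thesis by (simp add: layer_weight_def)
    qed
    then show ?thesis unfolding k_def[abs_def] k'_def using h(1) h0 by (intro DERIV_diff) auto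
  qed
  have k0: "0 \<le> k t" for t
  proof (cases "t \<le> - 2 * h'")
    case True
    then have "s ((t + 2 * h') / h') = 0" using h by (intro s(2)) (simp add: field_simps)
    then show ?thesis using s(4) by (simp add: k_def)
  next
    case False
    then have "s ((t + 2 * h) / h) = 1" using h h0 by (intro s(3)) (simp add: field_simps)
    then show ?thesis using s(5) by (simp add: k_def)
  qed
  have kz: "k t = 0" if "- h' \<le> t \<or> t \<le> - 2 * h" for t using that
  proof
    assume "- h' \<le> t"
    then have "s ((t + 2 * h) / h) = 1" "s ((t + 2 * h') / h') = 1" using h h0 by (intro s(3); simp add: field_simps)+
    then show ?thesis by (simp add: k_def)
  next
    assume "t \<le> - 2 * h"
    then have "s ((t + 2 * h) / h) = 0" "s ((t + 2 * h') / h') = 0" using h h0 by (intro s(2); simp add: field_simps)+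
    then show ?thesis by (simp add: k_def)
  qed
  have k'z: "k' t = 0" if "- h' \<le> t \<or> t \<le> - 2 * h" for t
    using that h h0 layer_weight_zero[of h t] layer_weight_zero[of h' t] by (auto simp: k'_def)
  define f1 where "f1 t = - exp (K * t) * k t" for t
  define f2 where "f2 t = - exp (K * t) * (K * k t + k' t)" for t
  have d1: "(f1 has_real_derivative f2 t) (at t)" for t
    unfolding f1_def[abs_def] f2_def by (rule derivative_eq_intros dk refl | simp add: algebra_simps)+
  have "continuous_on UNIV f1" using d1 DERIV_isCont continuous_at_imp_continuous_on by blast
  then obtain X where X: "\<And>t. (X has_real_derivative f1 t) (at t)" using antiderivative_exists by blast
  have contX: "continuous_on A X" for A using X DERIV_isCont continuous_at_imp_continuous_on by blast
  have f1: "f1 t \<le> 0" for t using k0[of t] by (simp add: f1_def)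
  have anti: "X y \<le> X x" if "x \<le> y" for x y by (rule DERIV_nonpos_imp_nonincreasing[OF that]) (use X f1 in blast)
  have ge: "X t = X (- h')" if "- h' \<le> t" for t
  proof (cases "t = - h'")
    case False
    have "DERIV X x :> 0" if "- h' < x" for x using X[of x] kz[of x] that by (simp add: f1_def)
    then show ?thesis using that False by (intro DERIV_isconst_end contX) auto
  qed simp
  have le: "X t = X (- 2 * h)" if "t \<le> - 2 * h" for t
  proof (cases "t = - 2 * h")
    case False
    have "DERIV X x :> 0" if "x < - 2 * h" for x using X[of x] kz[of x] that by (simp add: f1_def)
    then show ?thesis using that False by (intro DERIV_isconst_end[symmetric] contX) auto
  qed simp
  have "continuous_on UNIV k" using dk DERIV_isCont continuous_at_imp_continuous_on by blast
  then have cont: "continuous_on UNIV f2" unfolding f2_def[abs_def] k'_def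
    by (intro continuous_intros layer_weight_continuous)
  show thesis
  proof (rule that[of "\<lambda>t. X t - X (- h')" f1 f2])
    show "((\<lambda>t. X t - X (- h')) has_real_derivative f1 t) (at t)" for t using DERIV_diff[OF X DERIV_const] by simp
    show "0 \<le> X t - X (- h')" for t using ge[of t] anti[of t "- h'"] by (cases "- h' \<le> t") auto
    show "X t - X (- h') = 0 \<and> f1 t = 0 \<and> f2 t = 0" if "- h' \<le> t" for t
      using ge[OF that] kz[of t] k'z[of t] that by (simp add: f1_def f2_def)
    show "X t - X (- h') = X (- 2 * h) - X (- h') \<and> f1 t = 0 \<and> f2 t = 0" if "t \<le> - 2 * h" for t
      using le[OF that] kz[of t] k'z[of t] that by (simp add: f1_def f2_def)
    show "f2 t * g + f1 t * l \<le> exp (K * t) * g * (layer_weight h' t - layer_weight h t)" if "0 \<le> g" "\<bar>l\<bar> \<le> K * g" for t g l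
    proof -
      \<comment> \<open>This is exactly the amount by which the right side of the claim exceeds the
        left side.\<close>
      have "0 \<le> exp (K * t) * k t * (K * g + l)" using k0[of t] that(2) by (intro mult_nonneg_nonneg) auto
      then show ?thesis by (simp add: f1_def f2_def k'_def algebra_simps)
    qed
  qed (use d1 cont in auto)
qed

lemma sum_Basis_C2:
  fixes f :: "C2 \<Rightarrow> 'a::comm_monoid_add"
  shows "sum f Basis = f (axis 1 1) + f (axis 1 \<i>) + f (axis 2 1) + f (axis 2 \<i>)"
proof -
  have B: "Basis = {axis 1 1, axis 1 \<i>, axis 2 1, axis 2 \<i> :: C2}" by (auto simp: Basis_vec_def Basis_complex_def UNIV_2)
  have "axis 1 1 \<noteq> (axis 1 \<i> :: C2)" "axis 1 1 \<noteq> (axis 2 1 :: C2)" "axis 1 1 \<noteq> (axis 2 \<i> :: C2)"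
    "axis 1 \<i> \<noteq> (axis 2 1 :: C2)" "axis 1 \<i> \<noteq> (axis 2 \<i> :: C2)" "axis 2 1 \<noteq> (axis 2 \<i> :: C2)"
    by (auto simp: axis_eq_axis complex_eq_iff)
  then show ?thesis unfolding B by (simp add: add.assoc)
qed

lemma line_derivative:
  fixes f :: "'a::real_normed_vector \<Rightarrow> real"
  assumes "(f has_derivative D) (at z)"
  shows "((\<lambda>t. f (z + t *\<^sub>R e)) has_real_derivative D e) (at 0)"
proof -
  have d0: "((\<lambda>t. z + t *\<^sub>R e) has_derivative (\<lambda>t. t *\<^sub>R e)) (at 0)" by (auto intro!: derivative_eq_intros)
  have "((\<lambda>t. f (z + t *\<^sub>R e)) has_derivative (\<lambda>t. D (t *\<^sub>R e))) (at 0)"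
    using has_derivative_compose[OF d0, of f D] assms by simp
  then show ?thesis unfolding has_field_derivative_def
    by (rule has_derivative_eq_rhs) (simp add: fun_eq_iff linear_scale[OF has_derivative_linear[OF assms]] mult.commute)
qed

section \<open>Collars of the hypersurface and monotonicity of layer integrals\<close>

context hypersurface
begin

lemma hypersurface_nonempty: "S \<noteq> {}"
proof
  assume "S = {}"
  then have "frontier \<Omega> = {}" using bd by (simp add: bounds_domain_def)
  then have "\<Omega> = UNIV" using Om_nonempty frontier_eq_empty by blast
  then show False using bounded_Om not_bounded_UNIV by metis
qed

definition D2\<rho> :: "C2 \<Rightarrow> C2 \<Rightarrow> real" where
  "D2\<rho> z e = frechet_derivative (\<lambda>z. D\<rho> z e) (at z) e"

definition gradsq :: "C2 \<Rightarrow> real" where "gradsq z = (\<Sum>e\<in>Basis. (D\<rho> z e)^2)"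

definition lap :: "C2 \<Rightarrow> real" where "lap z = (\<Sum>e\<in>Basis. D2\<rho> z e)"

lemma D\<rho>_deriv: "z \<in> U \<Longrightarrow> ((\<lambda>z. D\<rho> z e) has_derivative frechet_derivative (\<lambda>z. D\<rho> z e) (at z)) (at z)"
  using smooth_on_has_derivative[OF smooth_on_frechet[OF smooth_\<rho>]] .

lemma D2\<rho>_cont: "continuous_on U (\<lambda>z. D2\<rho> z e)" unfolding D2\<rho>_def by (intro smooth_on_continuous smooth_on_frechet smooth_\<rho>)

lemma gradsq_cont: "continuous_on U gradsq" and lap_cont: "continuous_on U lap"
  unfolding gradsq_def[abs_def] lap_def[abs_def] by (intro continuous_intros D\<rho>_cont D2\<rho>_cont)+

lemma \<rho>_cont: "continuous_on U \<rho>" by (rule smooth_on_continuous[OF smooth_\<rho>])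

lemma gradsq_pos: "z \<in> S \<Longrightarrow> gradsq z > 0"
proof -
  assume z: "z \<in> S"
  have "\<exists>e\<in>Basis. D\<rho> z e \<noteq> 0" using grad_nz[OF z] unfolding grad_def by (metis (no_types, lifting) scaleR_eq_0_iff sum.neutral)
  then obtain e where "e \<in> Basis" "D\<rho> z e \<noteq> 0" by blast
  then show ?thesis unfolding gradsq_def by (intro sum_pos2[of _ e]) auto
qed

text \<open>d is the width of a neighbourhood of S inside U. On its inner edge \<rho> is below
  -\<tau>, so layers with 2h < \<tau> do not reach that edge. K dominates the Laplacian of \<rho>
  relative to |grad \<rho>|^2, and w1, w2 bound the weight exp(K \<rho>) |grad \<rho>|^2.\<close>

definition collar :: "real \<Rightarrow> real \<Rightarrow> real \<Rightarrow> real \<Rightarrow> real \<Rightarrow> bool" where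
  "collar d \<tau> K w1 w2 \<longleftrightarrow> 0 < d \<and> 0 < \<tau> \<and> 0 < w1 \<and> {z. infdist z S \<le> d} \<subseteq> U \<and>
     (\<forall>z\<in>\<Omega>. infdist z S = d \<longrightarrow> \<rho> z < - \<tau>) \<and>
     (\<forall>z. infdist z S \<le> d \<longrightarrow> \<bar>lap z\<bar> \<le> K * gradsq z \<and>
        w1 \<le> exp (K * \<rho> z) * gradsq z \<and> exp (K * \<rho> z) * gradsq z \<le> w2)"

lemma collar_exists: "\<exists>d \<tau> K w1 w2. collar d \<tau> K w1 w2"
proof -
  define Ug where "Ug = {z\<in>U. gradsq z > 0}"
  have "open (U \<inter> gradsq -` {0<..})" by (rule continuous_open_preimage[OF gradsq_cont open_U]) auto
  moreover have "U \<inter> gradsq -` {0<..} = Ug" by (auto simp: Ug_def)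
  ultimately have "open Ug" by simp
  moreover have "S \<subseteq> Ug" using S_U gradsq_pos by (auto simp: Ug_def)
  ultimately obtain d where d: "d > 0" "{z. infdist z S \<le> d} \<subseteq> Ug"
    using compact_in_open_separated[OF hypersurface_nonempty compact_S, of Ug] by blast
  let ?N = "{z. infdist z S \<le> d}"
  have N: "compact ?N" using compact_infdist_le[OF hypersurface_nonempty compact_S d(1)] .
  have NU: "?N \<subseteq> U" using d(2) by (auto simp: Ug_def)
  have SN: "S \<subseteq> ?N" using d(1) by auto
  then have Nne: "?N \<noteq> {}" using hypersurface_nonempty by blast
  have cN: "continuous_on ?N gradsq" "continuous_on ?N lap" "continuous_on ?N \<rho>"
    using gradsq_cont lap_cont \<rho>_cont NU continuous_on_subset by blast+
  obtain z0 where z0: "z0 \<in> ?N" "\<And>z. z \<in> ?N \<Longrightarrow> gradsq z0 \<le> gradsq z" using continuous_attains_inf[OF N Nne cN(1)] by blast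
  define g0 where "g0 = gradsq z0"
  have g0: "g0 > 0" using z0(1) d(2) by (auto simp: Ug_def g0_def)
  have "bounded (lap ` ?N)" using N cN(2) by (intro compact_imp_bounded compact_continuous_image)
  then obtain L where L: "\<And>z. z \<in> ?N \<Longrightarrow> \<bar>lap z\<bar> \<le> L" by (auto simp: bounded_iff)
  define K where "K = L / g0"
  have K: "\<bar>lap z\<bar> \<le> K * gradsq z" if "z \<in> ?N" for z
  proof -
    have "L \<ge> 0" using L[OF that] by linarith
    have "\<bar>lap z\<bar> \<le> L / g0 * g0" using L[OF that] g0 by simp
    also have "\<dots> \<le> K * gradsq z" unfolding K_def
      by (intro mult_left_mono) (use z0(2)[OF that] \<open>L \<ge> 0\<close> g0 in \<open>auto simp: g0_def\<close>)
    finally show ?thesis .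
  qed
  have cw: "continuous_on ?N (\<lambda>z. exp (K * \<rho> z) * gradsq z)" by (intro continuous_intros cN)
  obtain z1 where z1: "z1 \<in> ?N" "\<And>z. z \<in> ?N \<Longrightarrow> exp (K * \<rho> z1) * gradsq z1 \<le> exp (K * \<rho> z) * gradsq z"
    using continuous_attains_inf[OF N Nne cw] by blast
  obtain z2 where z2: "z2 \<in> ?N" "\<And>z. z \<in> ?N \<Longrightarrow> exp (K * \<rho> z) * gradsq z \<le> exp (K * \<rho> z2) * gradsq z2"
    using continuous_attains_sup[OF N Nne cw] by blast
  have w1: "exp (K * \<rho> z1) * gradsq z1 > 0" using z1(1) d(2) by (auto simp: Ug_def)
  let ?E = "closure \<Omega> \<inter> {z. infdist z S = d}"
  have "closed {z. infdist z S = d}" by (intro closed_Collect_eq continuous_intros)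
  then have E: "compact ?E" using bounded_Om by (intro compact_Int_closed) (simp_all add: compact_closure)
  have "\<exists>\<tau>>0. \<forall>z\<in>?E. \<rho> z < - \<tau>"
  proof (cases "?E = {}")
    case False
    have "continuous_on ?E \<rho>" by (rule continuous_on_subset[OF cN(3)]) auto
    then obtain y where y: "y \<in> ?E" "\<And>z. z \<in> ?E \<Longrightarrow> \<rho> z \<le> \<rho> y" using continuous_attains_sup[OF E False] by blast
    have "y \<notin> S" using y(1) d(1) by (auto simp: infdist_zero)
    then have "y \<in> \<Omega> \<inter> U" using y(1) closure_Om NU by auto
    then have "\<rho> y < 0" using Om_U by auto
    then show ?thesis by (intro exI[of _ "- \<rho> y / 2"]) (use y(2) in force)
  qed (auto intro: exI[of _ 1])
  then obtain \<tau> where \<tau>: "\<tau> > 0" "\<And>z. z \<in> ?E \<Longrightarrow> \<rho> z < - \<tau>" by blast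
  have "collar d \<tau> K (exp (K * \<rho> z1) * gradsq z1) (exp (K * \<rho> z2) * gradsq z2)"
    unfolding collar_def using d(1) \<tau> w1 NU K z1(2) z2(2) closure_subset[of \<Omega>] by auto
  then show ?thesis by blast
qed

text \<open>Away from U the values of \<rho> carry no information about depth, so the layer is
  confined to the collar by distance and not by \<rho> alone.\<close>

definition layer_density :: "real \<Rightarrow> real \<Rightarrow> real \<Rightarrow> C2 \<Rightarrow> real" where
  "layer_density d K h z = (if z \<in> \<Omega> \<and> infdist z S < d then exp (K * \<rho> z) * gradsq z * layer_weight h (\<rho> z) else 0)"

definition layer :: "real \<Rightarrow> real \<Rightarrow> real \<Rightarrow> (C2 \<Rightarrow> real) \<Rightarrow> ennreal" where
  "layer d K h f = (\<integral>\<^sup>+z. ennreal (f z * layer_density d K h z) \<partial>lborel)"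

lemma layer_density_nonneg: "h > 0 \<Longrightarrow> layer_density d K h z \<ge> 0"
  unfolding layer_density_def gradsq_def by (auto intro!: mult_nonneg_nonneg sum_nonneg layer_weight_nonneg)

end

context dual_pair
begin

text \<open>Green's identity with the cutoff u: the integral of |F|^2 times the Laplacian of u is
  nonnegative, and this Laplacian is at most the density of the outer layer h' minus that of the
  inner layer h.\<close>

lemma layer_mono:
  assumes col: "collar s \<tau> K w1 w2" and b: "bdd b" and h: "0 < h'" "2 * h' \<le> h" "2 * h < \<tau>"
  shows "layer s K h (\<lambda>z. (cmod (I 2 b z))^2) \<le> layer s K h' (\<lambda>z. (cmod (I 2 b z))^2)"
proof (rule cutoff_exists[OF h(1,2), where K=K])
  have s: "s > 0" and NU: "{z. infdist z S \<le> s} \<subseteq> U" and \<tau>: "\<And>z. z \<in> \<Omega> \<Longrightarrow> infdist z S = s \<Longrightarrow> \<rho> z < - \<tau>"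
    and K: "\<And>z. infdist z S \<le> s \<Longrightarrow> \<bar>lap z\<bar> \<le> K * gradsq z" using col by (auto simp: collar_def)
  fix f f1 f2 :: "real \<Rightarrow> real"
  assume f1: "\<And>t. (f has_real_derivative f1 t) (at t)" and f2: "\<And>t. (f1 has_real_derivative f2 t) (at t)"
    and cf2: "continuous_on UNIV f2" and f_nonneg: "\<And>t. 0 \<le> f t"
    and f_hi: "\<And>t. - h' \<le> t \<Longrightarrow> f t = 0 \<and> f1 t = 0 \<and> f2 t = 0"
    and f_lo: "\<And>t. t \<le> - 2 * h \<Longrightarrow> f t = f (- 2 * h) \<and> f1 t = 0 \<and> f2 t = 0"
    and f_key: "\<And>t g l. 0 \<le> g \<Longrightarrow> \<bar>l\<bar> \<le> K * g \<Longrightarrow> f2 t * g + f1 t * l \<le> exp (K * t) * g * (layer_weight h' t - layer_weight h t)"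
  have h0: "h > 0" using h by linarith
  have cf: "continuous_on UNIV f" "continuous_on UNIV f1"
    using DERIV_continuous_on[of UNIV f f1] DERIV_continuous_on[of UNIV f1 f2] f1 f2 by auto
  have cinf: "continuous_on A (\<lambda>z. infdist z S)" for A by (intro continuous_intros)
  \<comment> \<open>\<open>A1\<close> is the collar, \<open>A2\<close> the part of \<Omega> beyond
    the layer of h, where u is constant, and off C the function u vanishes. \<open>A1\<close>,
    \<open>A2\<close> and the complement of C are open and cover C^2, so regularity of u is checked
    on each separately.\<close>
  define A1 where "A1 = {z\<in>\<Omega>. infdist z S < s}"
  define A2 where "A2 = \<Omega> - ({z. infdist z S \<le> s} \<inter> \<rho> -` {- 2 * h..})"
  define C where "C = (closure \<Omega> \<inter> {z. s \<le> infdist z S}) \<union> (closure \<Omega> \<inter> ({z. infdist z S \<le> s} \<inter> \<rho> -` {..- h'}))"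
  have clN: "closed {z. infdist z S \<le> s}" by (intro closed_Collect_le cinf continuous_on_const)
  have c\<rho>: "continuous_on {z. infdist z S \<le> s} \<rho>" by (rule continuous_on_subset[OF \<rho>_cont NU])
  have A1: "open A1" unfolding A1_def using open_Om by (intro open_Collect_conj open_Collect_less cinf continuous_intros) auto
  have A2: "open A2" unfolding A2_def by (intro open_Diff open_Om continuous_closed_preimage[OF c\<rho> clN] closed_atLeast)
  have clC: "closed C" unfolding C_def
    by (intro closed_Un closed_Int[OF closed_closure] continuous_closed_preimage[OF c\<rho> clN] closed_atMost closed_Collect_le cinf continuous_on_const)
  have "bounded (closure \<Omega>)" using bounded_Om by (rule bounded_closure)
  then have C: "compact C" using clC by (auto simp: compact_eq_bounded_closed C_def intro: bounded_subset)
  have COm: "C \<subseteq> \<Omega>"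
  proof
    fix z assume z: "z \<in> C"
    have "z \<notin> S"
    proof
      assume "z \<in> S"
      then have "infdist z S = 0" "\<rho> z = 0" using S_eq by auto
      then show False using z s h(1) by (auto simp: C_def)
    qed
    then show "z \<in> \<Omega>" using z closure_Om by (auto simp: C_def)
  qed
  have cover: "A1 \<union> A2 = \<Omega>" using \<tau> h by (force simp: A1_def A2_def)
  then have UN: "A1 \<union> A2 \<union> - C = UNIV" using COm by blast
  have A1U: "A1 \<subseteq> U" using NU by (auto simp: A1_def)
  have lo: "\<rho> z \<le> - 2 * h" if "z \<in> A1" "z \<in> A2" for z using that by (auto simp: A1_def A2_def)
  have hi: "- h' \<le> \<rho> z" if "z \<in> A1" "z \<notin> C" for z using that closure_subset[of \<Omega>] by (auto simp: A1_def C_def)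
  have outC: "z \<notin> \<Omega>" if "z \<notin> A1" "z \<notin> C" for z using that closure_subset[of \<Omega>] by (auto simp: A1_def C_def)
  define u where "u z = (if z \<in> A1 then f (\<rho> z) else if z \<in> \<Omega> then f (- 2 * h) else 0)" for z
  define u1 where "u1 j c z = (if z \<in> A1 then f1 (\<rho> z) * D\<rho> z (axis j c) else 0)" for j :: 2 and c z
  define u2 where "u2 j c z = (if z \<in> A1 then f2 (\<rho> z) * (D\<rho> z (axis j c))^2 + f1 (\<rho> z) * D2\<rho> z (axis j c) else 0)" for j :: 2 and c z
  have on2: "u z = f (- 2 * h)" "u1 j c z = 0" "u2 j c z = 0" if "z \<in> A2" for z j c
    using f_lo[OF lo, of z] that by (auto simp: u_def u1_def u2_def A2_def)
  have on3: "u z = 0" "u1 j c z = 0" "u2 j c z = 0" if "z \<in> - C" for z j c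
    using f_hi[OF hi, of z] outC[of z] that by (auto simp: u_def u1_def u2_def)
  have glue: "continuous_on UNIV p"
    if "continuous_on A1 p" "\<And>z. z \<in> A2 \<Longrightarrow> p z = k" "\<And>z. z \<in> - C \<Longrightarrow> p z = 0" for p :: "C2 \<Rightarrow> real" and k
  proof -
    have "continuous_on A2 p" by (rule continuous_on_eq[OF continuous_on_const[of _ k]]) (simp add: that(2))
    moreover have "continuous_on (- C) p" by (rule continuous_on_eq[OF continuous_on_const[of _ 0]]) (simp add: that(3))
    ultimately have "continuous_on (A1 \<union> A2 \<union> - C) p"
      using that(1) A1 A2 clC by (intro continuous_on_open_Un) (auto simp: open_Compl)
    then show ?thesis by (simp only: UN)
  qed
  have \<rho>A1: "continuous_on A1 \<rho>" by (rule continuous_on_subset[OF \<rho>_cont A1U])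
  have comp: "continuous_on A1 (\<lambda>z. p (\<rho> z))" if "continuous_on UNIV p" for p :: "real \<Rightarrow> real"
    by (rule continuous_on_compose2[OF that \<rho>A1]) auto
  have c0: "continuous_on UNIV u"
    by (rule glue[OF _ on2(1) on3(1)]) (auto intro!: continuous_on_eq[OF comp[OF cf(1)]] simp: u_def)
  have c1: "continuous_on UNIV (u1 j c)" for j c
  proof (rule glue[OF _ on2(2) on3(2)])
    have "continuous_on A1 (\<lambda>z. f1 (\<rho> z) * D\<rho> z (axis j c))"
      by (intro continuous_intros comp[OF cf(2)] continuous_on_subset[OF D\<rho>_cont A1U])
    then show "continuous_on A1 (u1 j c)" by (rule continuous_on_eq) (simp add: u1_def)
  qed
  have c2: "continuous_on UNIV (u2 j c)" for j c
  proof (rule glue[OF _ on2(3) on3(3)])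
    have "continuous_on A1 (\<lambda>z. f2 (\<rho> z) * (D\<rho> z (axis j c))^2 + f1 (\<rho> z) * D2\<rho> z (axis j c))"
      by (intro continuous_intros comp[OF cf(2)] comp[OF cf2] continuous_on_subset[OF D\<rho>_cont A1U] continuous_on_subset[OF D2\<rho>_cont A1U])
    then show "continuous_on A1 (u2 j c)" by (rule continuous_on_eq) (simp add: u2_def)
  qed
  have line: "((\<lambda>t. p (z + t *\<^sub>R e)) has_real_derivative q z) (at 0)"
    if "\<And>z. z \<in> A1 \<Longrightarrow> ((\<lambda>t. p' (z + t *\<^sub>R e)) has_real_derivative q z) (at 0)" "\<And>z. z \<in> A1 \<Longrightarrow> p z = p' z"
      "\<And>z. z \<in> A2 \<Longrightarrow> p z = k" "\<And>z. z \<in> - C \<Longrightarrow> p z = 0" "\<And>z. z \<in> A2 \<Longrightarrow> q z = 0" "\<And>z. z \<in> - C \<Longrightarrow> q z = 0"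
    for p p' q :: "C2 \<Rightarrow> real" and k e z
  proof -
    have "z \<in> A1 \<or> z \<in> A2 \<or> z \<in> - C" using UN by blast
    then show ?thesis
    proof (elim disjE)
      assume z: "z \<in> A1"
      show ?thesis by (rule line_derivative_local[OF A1 z that(2) that(1)[OF z]])
    next
      assume z: "z \<in> A2"
      show ?thesis by (rule line_derivative_local[OF A2 z, where g="\<lambda>_. k"]) (simp_all add: that z)
    next
      assume z: "z \<in> - C"
      show ?thesis by (rule line_derivative_local[OF _ z, where g="\<lambda>_. 0"]) (use that z clC in \<open>simp_all add: open_Compl\<close>)
    qed
  qed
  have l\<rho>: "((\<lambda>t. \<rho> (z + t *\<^sub>R e)) has_real_derivative D\<rho> z e) (at 0)" if "z \<in> A1" for z e
    using that A1U by (intro line_derivative \<rho>_deriv) auto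
  have l2: "((\<lambda>t. D\<rho> (z + t *\<^sub>R e) e) has_real_derivative D2\<rho> z e) (at 0)" if "z \<in> A1" for z e
    unfolding D2\<rho>_def using that A1U by (intro line_derivative[OF D\<rho>_deriv]) auto
  have f\<rho>: "((\<lambda>t. p (\<rho> (z + t *\<^sub>R e))) has_real_derivative p' (\<rho> z) * D\<rho> z e) (at 0)"
    if "z \<in> A1" "\<And>t. (p has_real_derivative p' t) (at t)" for p p' :: "real \<Rightarrow> real" and z e
    using DERIV_chain2[OF _ l\<rho>[OF that(1)], of p "p' (\<rho> z)" e] that(2)[of "\<rho> z"] by simp
  have d1: "((\<lambda>t. u (z + t *\<^sub>R axis j c)) has_real_derivative u1 j c z) (at 0)" for j c z
  proof (rule line[OF _ _ on2(1) on3(1) on2(2) on3(2)])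
    show "((\<lambda>t. f (\<rho> (z + t *\<^sub>R axis j c))) has_real_derivative u1 j c z) (at 0)" if "z \<in> A1" for z
      using f\<rho>[OF that f1, of "axis j c"] that by (simp only: u1_def if_True)
  qed (auto simp: u_def)
  have d2: "((\<lambda>t. u1 j c (z + t *\<^sub>R axis j c)) has_real_derivative u2 j c z) (at 0)" for j c z
  proof (rule line[OF _ _ on2(2) on3(2) on2(3) on3(3)])
    show "((\<lambda>t. f1 (\<rho> (z + t *\<^sub>R axis j c)) * D\<rho> (z + t *\<^sub>R axis j c) (axis j c)) has_real_derivative u2 j c z) (at 0)" if "z \<in> A1" for z
    proof -
      have "f2 (\<rho> z) * D\<rho> z (axis j c) * D\<rho> z (axis j c) + D2\<rho> z (axis j c) * f1 (\<rho> z) = u2 j c z"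
        using that by (simp add: u2_def power2_eq_square algebra_simps)
      then show ?thesis using DERIV_mult[OF f\<rho>[OF that f2, of "axis j c"] l2[OF that, of "axis j c"]] by simp
    qed
  qed (auto simp: u1_def)
  have psi0: "u z \<ge> 0" for z using f_nonneg by (simp add: u_def)
  let ?G = "\<lambda>z. (cmod (I 2 b z))^2"
  let ?L = "\<lambda>z. u2 1 1 z + u2 1 \<i> z + u2 2 1 z + u2 2 \<i> z"
  note Green = Green_inequality[of b u u1 u2 C]
  have G: "0 \<le> (\<integral>z. (if z \<in> \<Omega> then ?G z * ?L z else 0) \<partial>lborel)" "integrable lborel (\<lambda>z. if z \<in> \<Omega> then ?G z * ?L z else 0)"
    by (rule Green; (rule b d1 d2 c0 c1 c2 C COm psi0 | (rule on3, simp)))+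
  have Lap: "?L z \<le> layer_density s K h' z - layer_density s K h z" if "z \<in> \<Omega>" for z
  proof (cases "z \<in> A1")
    case True
    have "?L z = f2 (\<rho> z) * gradsq z + f1 (\<rho> z) * lap z"
      using True by (simp add: u2_def gradsq_def lap_def sum_Basis_C2 algebra_simps)
    also have "\<dots> \<le> exp (K * \<rho> z) * gradsq z * (layer_weight h' (\<rho> z) - layer_weight h (\<rho> z))"
      by (rule f_key) (use K[of z] True in \<open>auto simp: A1_def gradsq_def sum_nonneg\<close>)
    finally show ?thesis using True by (simp add: layer_density_def A1_def algebra_simps)
  next
    case False
    then show ?thesis using that by (simp add: layer_density_def A1_def u2_def)
  qed
  have ld: "continuous_on UNIV (layer_density s K a)" if a: "h' \<le> a" "a \<le> h" for a
  proof (rule glue[where k=0])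
    have "continuous_on A1 (\<lambda>z. exp (K * \<rho> z) * gradsq z * layer_weight a (\<rho> z))"
      by (intro continuous_intros \<rho>A1 layer_weight_continuous continuous_on_subset[OF gradsq_cont A1U])
    then show "continuous_on A1 (layer_density s K a)" by (rule continuous_on_eq) (simp add: layer_density_def A1_def)
    show "layer_density s K a z = 0" if "z \<in> A2" for z
      using lo[of z] that layer_weight_zero[of a "\<rho> z"] a h(1) by (auto simp: layer_density_def A1_def)
    show "layer_density s K a z = 0" if "z \<in> - C" for z
      using hi[of z] that layer_weight_zero[of a "\<rho> z"] a h(1) by (auto simp: layer_density_def A1_def)
  qed
  have ldC: "layer_density s K a z = 0" if "h' \<le> a" "z \<notin> C" for a z
    using hi[of z] that layer_weight_zero[of a "\<rho> z"] h(1) by (auto simp: layer_density_def A1_def)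
  have cG: "continuous_on C ?G" by (intro continuous_intros continuous_on_subset[OF I_continuous[OF b] COm])
  have intG: "integrable lborel (\<lambda>z. ?G z * layer_density s K a z)" if a: "h' \<le> a" "a \<le> h" for a
  proof -
    have "integrable lborel (\<lambda>z. indicator C z *\<^sub>R (?G z * layer_density s K a z))"
      by (intro borel_integrable_compact C continuous_intros continuous_on_subset[OF ld[OF a]] cG) auto
    moreover have "indicator C z *\<^sub>R (?G z * layer_density s K a z) = ?G z * layer_density s K a z" for z
      using ldC[OF a(1), of z] by (cases "z \<in> C") simp_all
    ultimately show ?thesis by (simp only:)
  qed
  have h'h: "h' \<le> h" using h by linarith
  have "0 \<le> (\<integral>z. ?G z * layer_density s K h' z - ?G z * layer_density s K h z \<partial>lborel)"
  proof (rule order_trans[OF G(1)], rule integral_mono[OF G(2)])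
    show "integrable lborel (\<lambda>z. ?G z * layer_density s K h' z - ?G z * layer_density s K h z)"
      by (intro Bochner_Integration.integrable_diff intG h'h order_refl)
    show "(if z \<in> \<Omega> then ?G z * ?L z else 0) \<le> ?G z * layer_density s K h' z - ?G z * layer_density s K h z" for z
    proof (cases "z \<in> \<Omega>")
      case True
      then show ?thesis using mult_left_mono[OF Lap[OF True], of "?G z"] by (simp add: right_diff_distrib)
    qed (simp add: layer_density_def)
  qed
  also have "\<dots> = (\<integral>z. ?G z * layer_density s K h' z \<partial>lborel) - (\<integral>z. ?G z * layer_density s K h z \<partial>lborel)"
    by (intro Bochner_Integration.integral_diff intG h'h order_refl)
  finally have "(\<integral>z. ?G z * layer_density s K h z \<partial>lborel) \<le> (\<integral>z. ?G z * layer_density s K h' z \<partial>lborel)" by simp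
  moreover have "layer s K a ?G = ennreal (\<integral>z. ?G z * layer_density s K a z \<partial>lborel)" if "h' \<le> a" "a \<le> h" for a
    unfolding layer_def using that h(1) by (intro nn_integral_eq_integral intG) (auto intro!: AE_I2 mult_nonneg_nonneg layer_density_nonneg)
  ultimately show ?thesis using h'h by (simp add: ennreal_leI)
qed

end

section \<open>Comparison of thin layers with the surface in boxes\<close>

context hypersurface
begin

lemma box_image_iff:
  assumes box: "box_coords p e j q x0 r c C Q"
  shows "j x + t *\<^sub>R e \<in> Q ` (ball x0 r \<times> {-r<..<r}) \<longleftrightarrow> x \<in> ball x0 r \<and> (\<exists>s\<in>{-r<..<r}. t = Q (x, s) \<bullet> e)"
    and "x \<in> ball x0 r \<Longrightarrow> s \<in> {-r<..<r} \<Longrightarrow> j x + (Q (x, s) \<bullet> e) *\<^sub>R e = Q (x, s)"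
proof -
  show Q: "j x + (Q (x, s) \<bullet> e) *\<^sub>R e = Q (x, s)" if "x \<in> ball x0 r" "s \<in> {-r<..<r}" for x s
    using box_coordsD(6)[OF box, of "Q (x, s)"] box_coordsD(15)[OF box that] by simp
  show "j x + t *\<^sub>R e \<in> Q ` (ball x0 r \<times> {-r<..<r}) \<longleftrightarrow> x \<in> ball x0 r \<and> (\<exists>s\<in>{-r<..<r}. t = Q (x, s) \<bullet> e)"
  proof
    assume "j x + t *\<^sub>R e \<in> Q ` (ball x0 r \<times> {-r<..<r})"
    then obtain y s where ys: "y \<in> ball x0 r" "s \<in> {-r<..<r}" "j x + t *\<^sub>R e = Q (y, s)" by auto
    then have "x = y" using box_coordsD(3)[OF box, of x t] box_coordsD(15)[OF box ys(1,2)] by simp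
    moreover have "Q (y, s) \<bullet> e = t" unfolding ys(3)[symmetric] by (simp add: inner_add_left box_coordsD(4,5)[OF box])
    ultimately show "x \<in> ball x0 r \<and> (\<exists>s\<in>{-r<..<r}. t = Q (x, s) \<bullet> e)" using ys(1,2) by auto
  next
    assume "x \<in> ball x0 r \<and> (\<exists>s\<in>{-r<..<r}. t = Q (x, s) \<bullet> e)"
    then obtain s where s: "x \<in> ball x0 r" "s \<in> {-r<..<r}" "t = Q (x, s) \<bullet> e" by blast
    then show "j x + t *\<^sub>R e \<in> Q ` (ball x0 r \<times> {-r<..<r})"
      using Q[OF s(1,2)] by (intro image_eqI[of _ _ "(x, s)"]) (simp_all only: mem_Times_iff fst_conv snd_conv)
  qed
qed

text \<open>For fixed x the height Q(x, s) . e has derivative 1 / D\<rho>(e) in s, because \<rho>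
  takes the value s at Q(x, s) and Q moves only in direction e. The slope bounds and the mean value
  theorem give the estimates.\<close>

lemma box_height:
  assumes box: "box_coords p e j k x0 r c C Q" and x: "x \<in> ball x0 r"
    and s: "s1 \<in> {-r<..<r}" "s2 \<in> {-r<..<r}" "s1 \<le> s2"
  shows "c * (Q (x, s2) \<bullet> e - Q (x, s1) \<bullet> e) \<le> s2 - s1" and "s2 - s1 \<le> C * (Q (x, s2) \<bullet> e - Q (x, s1) \<bullet> e)"
    and "Q (x, s1) \<bullet> e \<le> Q (x, s2) \<bullet> e"
proof -
  let ?B = "ball x0 r \<times> {-r<..<r}"
  note c = box_coordsD(9)[OF box]
  have der: "\<exists>d. ((\<lambda>s. Q (x, s) \<bullet> e) has_real_derivative d) (at s) \<and> d * D\<rho> (Q (x, s)) e = 1" if s: "s \<in> {-r<..<r}" for s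
  proof -
    have in_B: "(x, s) \<in> ?B" using x s by simp
    then have QB: "Q (x, s) \<in> Q ` ?B" by blast
    then have QU: "Q (x, s) \<in> U" using box_coordsD(13)[OF box] by blast
    let ?D = "frechet_derivative Q (at (x, s))"
    have DQ: "(Q has_derivative ?D) (at (x, s))" by (rule smooth_on_has_derivative[OF box_coordsD(11)[OF box] in_B])
    have d0: "((\<lambda>s. (x, s)) has_derivative (\<lambda>t. (0, t))) (at s)" by (auto intro!: derivative_eq_intros)
    have Qs: "((\<lambda>s. Q (x, s)) has_derivative (\<lambda>t. ?D (0, t))) (at s)" using has_derivative_compose[OF d0, of Q ?D] DQ by simp
    have sc: "?D (0, t) = t *\<^sub>R ?D (0, 1)" for t using linear_scale[OF has_derivative_linear[OF DQ], of t "(0, 1)"] by simp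
    let ?q = "?D (0, 1)"
    have ev: "\<forall>\<^sub>F u in nhds s. u \<in> {-r<..<r}" using s by (intro eventually_nhds_in_open) auto
    have "((\<lambda>u. \<rho> (Q (x, u))) has_derivative (\<lambda>t. D\<rho> (Q (x, s)) (?D (0, t)))) (at s)"
      using has_derivative_compose[OF Qs \<rho>_deriv[OF QU]] .
    moreover have "((\<lambda>u. \<rho> (Q (x, u))) has_derivative (\<lambda>t. t)) (at s)"
      by (rule has_derivative_transform_within_open[OF has_derivative_ident open_greaterThanLessThan s])
        (use box_coordsD(14)[OF box x] in auto)
    ultimately have one: "D\<rho> (Q (x, s)) ?q = 1" using has_derivative_unique by (metis (no_types, lifting))
    have q: "?q = (?q \<bullet> e) *\<^sub>R e"
    proof -
      have bl: "bounded_linear k" using box_coordsD(2)[OF box] by (simp add: linear_conv_bounded_linear)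
      have "((\<lambda>u. k (Q (x, u))) has_derivative (\<lambda>t. k (?D (0, t)))) (at s)" by (rule bounded_linear.has_derivative[OF bl Qs])
      moreover have "((\<lambda>u. k (Q (x, u))) has_derivative (\<lambda>t. 0)) (at s)"
        by (rule has_derivative_transform_within_open[OF has_derivative_const[of x] open_greaterThanLessThan s])
          (use box_coordsD(15)[OF box x] in auto)
      ultimately have "k ?q = 0" using has_derivative_unique by (metis (no_types, lifting))
      then show ?thesis using box_coordsD(6)[OF box, of ?q] linear_0[OF box_coordsD(1)[OF box]] by simp
    qed
    have "D\<rho> (Q (x, s)) ?q = (?q \<bullet> e) * D\<rho> (Q (x, s)) e" by (subst q) (simp add: linear_scale[OF D\<rho>_linear[OF QU]])
    moreover have "((\<lambda>s. Q (x, s) \<bullet> e) has_real_derivative ?q \<bullet> e) (at s)" unfolding has_field_derivative_def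
      by (rule has_derivative_eq_rhs[OF bounded_linear.has_derivative[OF bounded_linear_inner_left Qs]])
        (subst sc, simp add: fun_eq_iff mult.commute)
    ultimately show ?thesis using one by auto
  qed
  obtain d where d: "\<And>s. s \<in> {-r<..<r} \<Longrightarrow> ((\<lambda>s. Q (x, s) \<bullet> e) has_real_derivative d s) (at s)"
    "\<And>s. s \<in> {-r<..<r} \<Longrightarrow> d s * D\<rho> (Q (x, s)) e = 1" using der by metis
  have bnd: "c * d s \<le> 1" "1 \<le> C * d s" "d s > 0" if "s \<in> {-r<..<r}" for s
  proof -
    have QB: "Q (x, s) \<in> Q ` ?B" using x that by blast
    have D: "c \<le> D\<rho> (Q (x, s)) e" "D\<rho> (Q (x, s)) e \<le> C" using box_coordsD(16,17)[OF box QB] .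
    show pos: "d s > 0"
    proof (rule ccontr)
      assume "\<not> 0 < d s"
      then have "d s * D\<rho> (Q (x, s)) e \<le> 0" using D(1) c by (intro mult_nonpos_nonneg) auto
      then show False using d(2)[OF that] by linarith
    qed
    show "c * d s \<le> 1" using mult_right_mono[OF D(1), of "d s"] pos d(2)[OF that] by (simp add: mult.commute)
    show "1 \<le> C * d s" using mult_right_mono[OF D(2), of "d s"] pos d(2)[OF that] by (simp add: mult.commute)
  qed
  have "c * (Q (x, s2) \<bullet> e - Q (x, s1) \<bullet> e) \<le> s2 - s1 \<and> s2 - s1 \<le> C * (Q (x, s2) \<bullet> e - Q (x, s1) \<bullet> e) \<and> Q (x, s1) \<bullet> e \<le> Q (x, s2) \<bullet> e"
  proof (cases "s1 = s2")
    case False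
    then have lt: "s1 < s2" using s(3) by simp
    have "\<exists>u. s1 < u \<and> u < s2 \<and> Q (x, s2) \<bullet> e - Q (x, s1) \<bullet> e = (s2 - s1) * d u" by (rule MVT2[OF lt d(1)]) (use s in auto)
    then obtain u where u: "s1 < u" "u < s2" "Q (x, s2) \<bullet> e - Q (x, s1) \<bullet> e = (s2 - s1) * d u" by blast
    then have "u \<in> {-r<..<r}" using s by auto
    note b = bnd[OF this]
    have "c * ((s2 - s1) * d u) \<le> s2 - s1" using mult_left_mono[OF b(1), of "s2 - s1"] lt by (simp add: mult_ac)
    moreover have "s2 - s1 \<le> C * ((s2 - s1) * d u)" using mult_left_mono[OF b(2), of "s2 - s1"] lt by (simp add: mult_ac)
    moreover have "(s2 - s1) * d u \<ge> 0" using lt b(3) by simp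
    ultimately show ?thesis using u(3) by simp
  qed simp
  then show "c * (Q (x, s2) \<bullet> e - Q (x, s1) \<bullet> e) \<le> s2 - s1" "s2 - s1 \<le> C * (Q (x, s2) \<bullet> e - Q (x, s1) \<bullet> e)"
    "Q (x, s1) \<bullet> e \<le> Q (x, s2) \<bullet> e" by auto
qed

text \<open>The coordinates along e and across it preserve Lebesgue measure by construction, so
  integration over C^2 reduces to straight lines without a Jacobian.\<close>

lemma box_Fubini:
  assumes box: "box_coords p e j q x0 r c C Q" and g: "g \<in> borel_measurable borel"
  shows "(\<integral>\<^sup>+z. g z \<partial>lborel) = (\<integral>\<^sup>+x. \<integral>\<^sup>+t. g (j x + t *\<^sub>R e) \<partial>lborel \<partial>lborel)"
    and "(\<lambda>x. \<integral>\<^sup>+t. g (j x + t *\<^sub>R e) \<partial>lborel) \<in> borel_measurable borel"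
proof -
  have lin: "linear j" by (rule box_coordsD(1)[OF box])
  have "continuous_on UNIV (\<lambda>(x, t). j x + t *\<^sub>R e)" unfolding case_prod_beta using lin
    by (intro continuous_intros continuous_on_compose2[OF linear_continuous_on[of j UNIV]]) (auto simp: linear_conv_bounded_linear)
  then have m: "(\<lambda>(x, t). j x + t *\<^sub>R e) \<in> borel_measurable borel" by (rule borel_measurable_continuous_onI)
  then have "(\<integral>\<^sup>+z. g z \<partial>lborel) = (\<integral>\<^sup>+y. g (case y of (x, t) \<Rightarrow> j x + t *\<^sub>R e) \<partial>lborel)"
    using g by (subst box_coordsD(7)[OF box, symmetric], subst nn_integral_distr) auto
  also have "\<dots> = (\<integral>\<^sup>+x. \<integral>\<^sup>+t. g (j x + t *\<^sub>R e) \<partial>lborel \<partial>lborel)" using measurable_compose[OF m g]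
    by (subst lborel_prod[symmetric], subst lborel.nn_integral_fst[symmetric]) (auto simp: lborel_prod)
  finally show "(\<integral>\<^sup>+z. g z \<partial>lborel) = (\<integral>\<^sup>+x. \<integral>\<^sup>+t. g (j x + t *\<^sub>R e) \<partial>lborel \<partial>lborel)" .
  have "(\<lambda>y. g (case y of (x, t) \<Rightarrow> j x + t *\<^sub>R e)) \<in> borel_measurable (lborel \<Otimes>\<^sub>M lborel)"
    using measurable_compose[OF m g] by (simp add: lborel_prod)
  from lborel.borel_measurable_nn_integral_fst[OF this]
  show "(\<lambda>x. \<integral>\<^sup>+t. g (j x + t *\<^sub>R e) \<partial>lborel) \<in> borel_measurable borel" by simp
qed

lemma box_shrink:
  assumes box: "box_coords p e j k x0 r c C Q" and r': "0 < r'" "r' \<le> r"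
  shows "box_coords p e j k x0 r' c C Q"
proof -
  let ?B = "ball x0 r \<times> {-r<..<r}" let ?B' = "ball x0 r' \<times> {-r'<..<r'}"
  have sub: "?B' \<subseteq> ?B" using r' by auto
  have QU: "Q ` ?B \<subseteq> U" by (rule box_coordsD(13)[OF box])
  have op: "open (Q ` ?B)" by (rule box_coordsD(12)[OF box])
  have "Q ` ?B' = Q ` ?B \<inter> (\<lambda>z. (k z, \<rho> z)) -` ?B'"
  proof (intro equalityI subsetI)
    fix z assume "z \<in> Q ` ?B'"
    then obtain x s where xs: "x \<in> ball x0 r'" "s \<in> {-r'<..<r'}" "z = Q (x, s)" by auto
    have xs': "x \<in> ball x0 r" "s \<in> {-r<..<r}" using xs(1,2) r' by auto
    show "z \<in> Q ` ?B \<inter> (\<lambda>z. (k z, \<rho> z)) -` ?B'" using xs xs' box_coordsD(14,15)[OF box xs'] by auto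
  next
    fix z assume z: "z \<in> Q ` ?B \<inter> (\<lambda>z. (k z, \<rho> z)) -` ?B'"
    then obtain x s where xs: "x \<in> ball x0 r" "s \<in> {-r<..<r}" "z = Q (x, s)" by auto
    then have "(k z, \<rho> z) = (x, s)" using box_coordsD(14,15)[OF box xs(1,2)] by simp
    then show "z \<in> Q ` ?B'" using z xs(3) by (auto simp: vimage_def)
  qed
  moreover have "continuous_on (Q ` ?B) (\<lambda>z. (k z, \<rho> z))" using box_coordsD(2)[OF box]
    by (intro continuous_intros continuous_on_subset[OF \<rho>_cont QU]) (simp add: linear_conv_bounded_linear linear_continuous_on)
  ultimately have "open (Q ` ?B')" using op by (simp add: continuous_open_preimage open_Times)
  moreover have "Q ` ?B' \<subseteq> Q ` ?B" using sub by blast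
  moreover have "smooth_on Q ?B'" by (rule smooth_on_subset[OF box_coordsD(11)[OF box] sub])
  ultimately show ?thesis using r' unfolding box_coords_def
  proof (intro conjI)
    show "\<forall>x\<in>ball x0 r'. \<forall>s\<in>{- r'<..<r'}. \<rho> (Q (x, s)) = s \<and> k (Q (x, s)) = x" using sub box_coordsD(14,15)[OF box] by auto
    show "\<forall>q\<in>Q ` ?B'. c \<le> D\<rho> q e \<and> D\<rho> q e \<le> C" if "Q ` ?B' \<subseteq> Q ` ?B" using that box_coordsD(16,17)[OF box] by blast
    show "Q ` ?B' \<subseteq> U" if "Q ` ?B' \<subseteq> Q ` ?B" using that QU by (rule subset_trans)
  qed (use box_coordsD(1-10)[OF box] in \<open>simp_all only: simp_thms\<close>)
qed

end

context hypersurface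
begin

lemma compact_closure_Om: "compact (closure \<Omega>)" using bounded_Om by (simp add: compact_closure)

lemma layer_density_measurable:
  assumes "collar d \<tau> K w1 w2"
  shows "layer_density d K h \<in> borel_measurable borel"
proof -
  let ?A = "{z. z \<in> \<Omega> \<and> infdist z S < d}"
  have A: "open ?A" using open_Om by (intro open_Collect_conj open_Collect_less continuous_intros) auto
  have AU: "?A \<subseteq> U" using assms by (auto simp: collar_def)
  have "continuous_on ?A (\<lambda>z. exp (K * \<rho> z) * gradsq z * layer_weight h (\<rho> z))"
    by (intro continuous_intros layer_weight_continuous continuous_on_subset[OF gradsq_cont AU] continuous_on_subset[OF \<rho>_cont AU])
  then have "(\<lambda>z. indicator ?A z *\<^sub>R (exp (K * \<rho> z) * gradsq z * layer_weight h (\<rho> z))) \<in> borel_measurable borel"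
    using A by (intro borel_measurable_continuous_on_indicator) auto
  moreover have "indicator ?A z *\<^sub>R (exp (K * \<rho> z) * gradsq z * layer_weight h (\<rho> z)) = layer_density d K h z" for z
    by (simp add: layer_density_def indicator_def)
  ultimately show ?thesis by (simp only:)
qed

lemma good_box_exists:
  assumes col: "collar d \<tau> K w1 w2" and p: "p \<in> S"
  shows "\<exists>e j q x0 r c C Q a1 a2. box_coords p e j q x0 r c C Q \<and> (\<forall>z\<in>Q ` (ball x0 r \<times> {-r<..<r}). infdist z S < d)
    \<and> 0 < a1 \<and> (\<forall>x\<in>ball x0 r. a1 \<le> area_factor (\<lambda>x. Q (x, 0)) x \<and> area_factor (\<lambda>x. Q (x, 0)) x \<le> a2)"
proof -
  obtain e j q x0 r c C Q where box: "box_coords p e j q x0 r c C Q" using box_coords_exist[OF p] .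
  let ?B = "ball x0 r \<times> {-r<..<r}" let ?a = "area_factor (\<lambda>x. Q (x, 0))"
  have r: "r > 0" by (rule box_coordsD(8)[OF box])
  have cQ: "continuous_on ?B Q" by (rule smooth_on_continuous[OF box_coordsD(11)[OF box]])
  have "open (?B \<inter> (\<lambda>y. infdist (Q y) S) -` {..<d})"
    by (intro continuous_open_preimage continuous_on_infdist cQ open_Times) auto
  moreover have "(x0, 0) \<in> ?B \<inter> (\<lambda>y. infdist (Q y) S) -` {..<d}"
    using r box_coordsD(10)[OF box] p col by (simp add: collar_def)
  ultimately obtain A B where AB: "open A" "open B" "(x0, 0) \<in> A \<times> B" "A \<times> B \<subseteq> ?B \<inter> (\<lambda>y. infdist (Q y) S) -` {..<d}"
    by (rule open_prod_elim)
  then obtain r1 r2 where r12: "r1 > 0" "ball x0 r1 \<subseteq> A" "r2 > 0" "ball 0 r2 \<subseteq> B"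
    unfolding open_contains_ball by (metis SigmaE2)
  \<comment> \<open>The bound r / 2 keeps the closed ball of radius r' inside the old chart, so the
    area factor attains positive extrema there.\<close>
  define r' where "r' = min (min r1 r2) (r / 2)"
  have r': "0 < r'" "r' \<le> r" "r' < r" using r12 r by (auto simp: r'_def)
  note box' = box_shrink[OF box r'(1,2)]
  have inf: "infdist (Q (x, s)) S < d" if "x \<in> ball x0 r'" "s \<in> {-r'<..<r'}" for x s
  proof -
    have "x \<in> ball x0 r1" "s \<in> ball 0 r2" using that by (auto simp: r'_def)
    then have "(x, s) \<in> A \<times> B" using r12 by blast
    then show ?thesis using AB(4) by blast
  qed
  have "cball x0 r' \<subseteq> ball x0 r" using r' by auto
  then have ca: "continuous_on (cball x0 r') ?a" and pos: "\<And>x. x \<in> cball x0 r' \<Longrightarrow> 0 < ?a x"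
    using chart_area_continuous[OF box_chart[OF box]] area_factor_positive[OF box_chart[OF box]] continuous_on_subset by blast+
  have ne: "cball x0 r' \<noteq> {}" using r'(1) by simp
  obtain y1 where y1: "y1 \<in> cball x0 r'" "\<And>x. x \<in> cball x0 r' \<Longrightarrow> ?a y1 \<le> ?a x"
    using continuous_attains_inf[OF compact_cball ne ca] by blast
  obtain y2 where y2: "y2 \<in> cball x0 r'" "\<And>x. x \<in> cball x0 r' \<Longrightarrow> ?a x \<le> ?a y2"
    using continuous_attains_sup[OF compact_cball ne ca] by blast
  have "\<forall>z\<in>Q ` (ball x0 r' \<times> {-r'<..<r'}). infdist z S < d" using inf by blast
  moreover have "\<forall>x\<in>ball x0 r'. ?a y1 \<le> ?a x \<and> ?a x \<le> ?a y2" using y1(2) y2(2) by simp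
  ultimately show ?thesis using box' pos[OF y1(1)] by blast
qed

lemma box_C_pos: "box_coords p e j q x0 r c C Q \<Longrightarrow> 0 < C"
  using box_coordsD(8,9)[of p e j q x0 r c C Q] box_coordsD(16,17)[of p e j q x0 r c C Q "Q (x0, 0)"]
  by (force intro: order_less_le_trans)

abbreviation surf :: "(C2 \<Rightarrow> real) \<Rightarrow> ennreal" where "surf f \<equiv> \<integral>\<^sup>+q. ennreal (f q) \<partial>\<sigma>"

abbreviation surf_on where "surf_on N f \<equiv> \<integral>\<^sup>+q. ennreal (f q) * indicator N q \<partial>\<sigma>"

abbreviation layer_on where
  "layer_on d K h N f \<equiv> \<integral>\<^sup>+z. ennreal (f z * layer_density d K h z) * indicator N z \<partial>lborel"

text \<open>On each segment the layer of h has length comparable to h and weight comparable to 1 /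
  h, while f differs from its boundary value by at most b once h is small. Integration over x
  compares the layer with the surface, the area factor lying between a1 and a2. The threshold for h
  depends on f and b, the constants do not.\<close>

lemma layer_box:
  assumes col: "collar j \<tau> K w1 w2" and box: "box_coords p e i l x0 r c C Q"
    and near: "\<forall>z\<in>Q ` (ball x0 r \<times> {-r<..<r}). infdist z S < j" and a1: "0 < a1"
    and area: "\<forall>x\<in>ball x0 r. a1 \<le> area_factor (\<lambda>x. Q (x, 0)) x \<and> area_factor (\<lambda>x. Q (x, 0)) x \<le> a2"
    and f: "f \<in> borel_measurable borel" "\<And>z. 0 \<le> f z" "continuous_on (closure \<Omega>) f" and b: "0 < b"
  defines "N \<equiv> Q ` (ball x0 r \<times> {-r<..<r})"
  shows "\<exists>h0>0. \<forall>h. 0 < h \<longrightarrow> h < h0 \<longrightarrow>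
    layer_on j K h N f \<le> ennreal (2 * w2 / (c * a1)) * surf (\<lambda>q. f q + b) \<and>
    surf_on N f \<le> (\<integral>\<^sup>+q. ennreal b \<partial>\<sigma>) + ennreal (3 * C * a2 / w1) * layer j K h f"
proof -
  let ?V = "ball x0 r" let ?J = "{-r<..<r}"
  define u where "u x = Q (x, 0)" for x
  define T where "T x s = Q (x, s) \<bullet> e" for x s
  let ?E = "\<lambda>x s. exp (K * \<rho> (Q (x, s))) * gradsq (Q (x, s))" and ?a = "area_factor u" and ?y = "\<lambda>x t. i x + t *\<^sub>R e"
  let ?f = "\<lambda>x. f (u x) + b" and ?k = "ennreal (2 * w2 / (c * a1))" and ?m = "ennreal (3 * C / w1)" and ?k' = "ennreal (3 * C * a2 / w1)"
  have r: "r > 0" and c: "c > 0" and C: "C > 0" using box_coordsD(8,9)[OF box] box_C_pos[OF box] by auto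
  have w: "0 < w1" and W: "\<And>z. infdist z S \<le> j \<Longrightarrow> w1 \<le> exp (K * \<rho> z) * gradsq z \<and> exp (K * \<rho> z) * gradsq z \<le> w2"
    using col by (auto simp: collar_def)
  have ch: "hypersurface_chart S ?V u" unfolding u_def[abs_def] by (rule box_chart[OF box])
  have a2: "0 < a2" using area[rule_format, of x0] a1 r by auto
  have NU: "N \<subseteq> U" unfolding N_def by (rule box_coordsD(13)[OF box])
  have QN: "Q (x, s) \<in> N" if "x \<in> ?V" "s \<in> ?J" for x s using that by (auto simp: N_def)
  have \<rho>Q: "\<rho> (Q (x, s)) = s" if "x \<in> ?V" "s \<in> ?J" for x s using box_coordsD(14)[OF box that] .
  have QS: "u x \<in> S" if "x \<in> ?V" for x using QN[of x 0] \<rho>Q[of x 0] that r NU by (auto simp: u_def S_eq)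
  have QOm: "Q (x, s) \<in> \<Omega>" if "x \<in> ?V" "s \<in> ?J" "s < 0" for x s
  proof -
    have "Q (x, s) \<in> {q\<in>U. \<rho> q < 0}" using QN[OF that(1,2)] \<rho>Q[OF that(1,2)] that(3) NU by auto
    then show ?thesis unfolding Om_U[symmetric] by simp
  qed
  have near': "infdist (Q (x, s)) S < j" if "x \<in> ?V" "s \<in> ?J" for x s using near that by auto
  have W': "w1 \<le> ?E x s" "?E x s \<le> w2" if "x \<in> ?V" "s \<in> ?J" for x s using W[of "Q (x, s)"] near'[OF that] by auto
  have w2: "0 < w2" using W'[of x0 0] r w by auto
  have line: "?y x t \<in> N \<longleftrightarrow> x \<in> ?V \<and> (\<exists>s\<in>?J. t = T x s)" for x t unfolding N_def T_def by (rule box_image_iff(1)[OF box])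
  have line': "i x + T x s *\<^sub>R e = Q (x, s)" if "x \<in> ?V" "s \<in> ?J" for x s
    unfolding T_def by (rule box_image_iff(2)[OF box that])
  have ht: "c * (T x s2 - T x s1) \<le> s2 - s1" "s2 - s1 \<le> C * (T x s2 - T x s1)" "T x s1 \<le> T x s2"
    if "x \<in> ?V" "s1 \<in> ?J" "s2 \<in> ?J" "s1 \<le> s2" for x s1 s2 unfolding T_def by (rule box_height[OF box that])+
  have QQ: "dist (Q (x, s)) (u x) \<le> - s / c" if "x \<in> ?V" "s \<in> ?J" "s \<le> 0" for x s
  proof -
    have 0: "0 \<in> ?J" using r by simp
    have "Q (x, s) - u x = (i x + T x s *\<^sub>R e) - (i x + T x 0 *\<^sub>R e)"
      using line'[OF that(1,2)] line'[OF that(1) 0] by (simp add: u_def)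
    also have "\<dots> = (T x s - T x 0) *\<^sub>R e" by (simp add: algebra_simps)
    finally have "dist (Q (x, s)) (u x) = T x 0 - T x s"
      using ht(3)[OF that(1,2) 0 that(3)] box_coordsD(4)[OF box] by (simp add: dist_norm norm_eq_sqrt_inner)
    with ht(1)[OF that(1,2) 0 that(3)] have "c * dist (Q (x, s)) (u x) \<le> - s" by simp
    then show ?thesis using c by (simp only: pos_le_divide_eq mult.commute)
  qed
  obtain d where d: "d > 0" "\<And>y z. y \<in> closure \<Omega> \<Longrightarrow> z \<in> closure \<Omega> \<Longrightarrow> dist z y < d \<Longrightarrow> dist (f z) (f y) < b"
    using compact_uniformly_continuous[OF f(3) compact_closure_Om] b unfolding uniformly_continuous_on_def by metis
  \<comment> \<open>h < r / 2 keeps values of \<rho> down to -2h inside the box; h < c d / 2 makes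
    the corresponding points d-close to S along their segment, by \<open>QQ\<close>.\<close>
  define h0 where "h0 = min (r / 2) (c * d / 2)"
  have h0: "h0 > 0" using r c d(1) by (simp add: h0_def)
  have close: "\<bar>f (Q (x, s)) - f (u x)\<bar> \<le> b" if "x \<in> ?V" "- 2 * h \<le> s" "s < 0" "0 < h" "h < h0" for x s h
  proof -
    have s: "s \<in> ?J" using that by (simp add: h0_def)
    have "dist (Q (x, s)) (u x) \<le> - s / c" using that by (intro QQ s) auto
    also have "- s / c \<le> 2 * h / c" using that c by (intro divide_right_mono) auto
    also have "\<dots> < d" using that c by (simp add: h0_def field_simps)
    finally show ?thesis using d(2)[of "u x" "Q (x, s)"] QS[OF that(1)] QOm[OF that(1) s] that(3) closure_Om
      by (simp add: dist_real_def)
  qed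
  have in_ld: "layer_density j K h (Q (x, s)) = ?E x s * layer_weight h s" if "x \<in> ?V" "s \<in> ?J" "s < 0" for x s h
    using QOm[OF that] near'[OF that(1,2)] \<rho>Q[OF that(1,2)] by (simp add: layer_density_def)
  have W0: "0 \<le> ?E x s" if "x \<in> ?V" "s \<in> ?J" for x s using W'(1)[OF that] w by linarith
  have NB: "N \<in> sets borel" unfolding N_def using box_coordsD(12)[OF box] by simp
  define g where "g h z = ennreal (f z * layer_density j K h z) * indicator N z" for h z
  let ?L = "\<lambda>h x. \<integral>\<^sup>+t. g h (i x + t *\<^sub>R e) \<partial>lborel" and ?l = "\<lambda>h x. (f (u x) - b) * (w1 * (1 / h))" and ?w = "\<lambda>h x. (f (u x) + b) * (w2 * (2 / h))" and ?c = "\<lambda>x. ennreal (?a x) * indicator ?V x"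
  have gm: "g h \<in> borel_measurable borel" for h
    unfolding g_def[abs_def] using f(1) layer_density_measurable[OF col, of h] NB by measurable
  have SN: "S \<inter> N = u ` ?V"
  proof (intro equalityI subsetI)
    fix z assume "z \<in> S \<inter> N"
    then obtain x s where xs: "x \<in> ?V" "s \<in> ?J" "z = Q (x, s)" "\<rho> z = 0" by (auto simp: N_def S_eq)
    then have "s = 0" using \<rho>Q by auto
    then show "z \<in> u ` ?V" using xs by (auto simp: u_def)
  qed (use QS QN r in \<open>auto simp: u_def\<close>)
  have chart_int: "(\<integral>\<^sup>+q. k q * indicator N q \<partial>\<sigma>) = (\<integral>\<^sup>+x. k (u x) * ennreal (?a x) * indicator ?V x \<partial>lborel)"
    if "k \<in> borel_measurable borel" for k :: "C2 \<Rightarrow> ennreal"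
  proof -
    have "(\<integral>\<^sup>+q. k q * indicator N q \<partial>\<sigma>) = (\<integral>\<^sup>+q. k q * indicator (u ` ?V) q \<partial>\<sigma>)"
      by (rule nn_integral_cong) (simp add: SN[symmetric] indicator_def)
    then show ?thesis using nn_integral_chart[OF ch that] by simp
  qed
  have ar: "a1 \<le> ?a x" "?a x \<le> a2" if "x \<in> ?V" for x using area that by (auto simp: u_def[abs_def])
  have arm: "(\<lambda>x. ennreal (?a x) * indicator ?V x) \<in> borel_measurable borel"
  proof -
    have "(\<lambda>x. indicator ?V x *\<^sub>R ?a x) \<in> borel_measurable borel"
      by (intro borel_measurable_continuous_on_indicator chart_area_continuous[OF ch]) auto
    then have "(\<lambda>x. ennreal (indicator ?V x *\<^sub>R ?a x)) \<in> borel_measurable borel" by measurable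
    moreover have "ennreal (indicator ?V x *\<^sub>R ?a x) = ennreal (?a x) * indicator ?V x" for x by (simp add: indicator_def)
    ultimately show ?thesis by (simp only:)
  qed
  \<comment> \<open>Length at most h / c, weight at most 2 / h and density factor at most w2 give
    the constant 2 w2 / c.\<close>
  have upper: "?L h x \<le> ennreal (2 * w2 / c) * ennreal (?f x) * indicator ?V x" if h: "0 < h" "h < h0" for h x
  proof (cases "x \<in> ?V")
    case True
    have J: "- 2 * h \<in> ?J" "- h \<in> ?J" using h by (auto simp: h0_def)
    have "g h (?y x t) \<le> ennreal (?w h x) * indicator {T x (- 2 * h)..T x (- h)} t" for t
    proof (cases "\<exists>s\<in>?J. t = T x s \<and> - 2 * h < s \<and> s < - h")
      case True
      then obtain s where s: "s \<in> ?J" "t = T x s" "- 2 * h < s" "s < - h" by blast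
      have s0: "s < 0" using s(4) h by linarith
      have "t \<in> {T x (- 2 * h)..T x (- h)}" using ht(3)[OF \<open>x \<in> ?V\<close> J(1) s(1)] ht(3)[OF \<open>x \<in> ?V\<close> s(1) J(2)] s by simp
      moreover have "f (Q (x, s)) * layer_density j K h (Q (x, s)) \<le> ?w h x" unfolding in_ld[OF \<open>x \<in> ?V\<close> s(1) s0]
      proof (intro mult_mono mult_nonneg_nonneg[OF W0[OF \<open>x \<in> ?V\<close> s(1)]])
        show "f (Q (x, s)) \<le> ?f x" using close[OF \<open>x \<in> ?V\<close> _ s0 h] s(3) by auto
        show "0 \<le> ?f x" using f(2)[of "u x"] b by linarith
      qed (use W'(2)[OF \<open>x \<in> ?V\<close> s(1)] w2 layer_weight_le[OF h(1)] layer_weight_nonneg[OF h(1)] in auto)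
      ultimately show ?thesis using line'[OF \<open>x \<in> ?V\<close> s(1)] s(2) by (simp add: g_def indicator_def ennreal_leI)
    next
      case False
      have "g h (?y x t) = 0"
      proof (cases "?y x t \<in> N")
        case True
        then obtain s where s: "s \<in> ?J" "t = T x s" using line by blast
        then have "s \<le> - 2 * h \<or> - h \<le> s" using False by (metis linorder_not_le)
        then have "layer_weight h s = 0" by (rule layer_weight_zero[OF h(1)])
        then have "layer_density j K h (?y x t) = 0"
          using \<rho>Q[OF \<open>x \<in> ?V\<close> s(1)] s(2) line'[OF \<open>x \<in> ?V\<close> s(1)] by (simp add: layer_density_def)
        then show ?thesis by (simp add: g_def)
      qed (simp add: g_def)
      then show ?thesis by simp
    qed
    then have "?L h x \<le> (\<integral>\<^sup>+t. ennreal (?w h x) * indicator {T x (- 2 * h)..T x (- h)} t \<partial>lborel)"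
      by (intro nn_integral_mono) auto
    also have "\<dots> = ennreal (?w h x) * ennreal (T x (- h) - T x (- 2 * h))"
      using ht(3)[OF True J] h by (subst nn_integral_cmult_indicator) auto
    also have "\<dots> \<le> ennreal (?w h x) * ennreal (h / c)"
      using ht(1)[OF True J] h c by (intro mult_left_mono ennreal_leI) (auto simp: field_simps)
    also have "\<dots> = ennreal (2 * w2 / c) * ennreal (?f x)"
      using f(2)[of "u x"] b w2 h c by (simp add: ennreal_mult[symmetric] field_simps del: ennreal_plus)
    finally show ?thesis using True by simp
  next
    case False
    then have "g h (?y x t) = 0" for t using line by (simp add: g_def)
    then show ?thesis by simp
  qed
  \<comment> \<open>Only the middle third of the layer is used: its weight is at least 1 / h and its
    length at least h / (3 C).\<close>
  have lower: "ennreal (f (u x)) \<le> ennreal b + ?m * ?L h x" if h: "0 < h" "h < h0" and x: "x \<in> ?V" for h x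
  proof (cases "f (u x) \<le> b")
    case True
    then show ?thesis by (simp add: add_increasing2 ennreal_leI)
  next
    case False
    let ?s1 = "- (5/3) * h" let ?s2 = "- (4/3) * h"
    have J: "?s1 \<in> ?J" "?s2 \<in> ?J" using h by (auto simp: h0_def)
    have cJ: "continuous_on ?J (T x)"
    proof -
      have "continuous_on ?J (\<lambda>s. Q (x, s))"
        by (rule continuous_on_compose2[OF smooth_on_continuous[OF box_coordsD(11)[OF box]]]) (use x in \<open>auto intro!: continuous_intros\<close>)
      then show ?thesis unfolding T_def[abs_def] by (intro continuous_intros)
    qed
    have "ennreal (?l h x) * indicator {T x ?s1..T x ?s2} t \<le> g h (?y x t)" for t
    proof (cases "t \<in> {T x ?s1..T x ?s2}")
      case True
      have "{?s1..?s2} \<subseteq> ?J" using J by auto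
      then have cont: "continuous_on {?s1..?s2} (T x)" by (rule continuous_on_subset[OF cJ])
      have "\<exists>s. ?s1 \<le> s \<and> s \<le> ?s2 \<and> T x s = t" by (rule IVT'[OF _ _ _ cont]) (use True h in auto)
      then obtain s where s: "?s1 \<le> s" "s \<le> ?s2" "t = T x s" by blast
      have sJ: "s \<in> ?J" and s0: "s < 0" using s J h by auto
      have f1: "f (u x) - b \<le> f (Q (x, s))" using close[OF x _ s0 h] s(1) h by auto
      have "?l h x \<le> f (Q (x, s)) * (?E x s * layer_weight h s)"
        using f1 False W'(1)[OF x sJ] w layer_weight_ge[OF h(1) s(1,2)] h f(2)[of "Q (x, s)"] W0[OF x sJ]
        by (intro mult_mono) auto
      then have "?l h x \<le> f (Q (x, s)) * layer_density j K h (Q (x, s))" by (simp only: in_ld[OF x sJ s0])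
      then show ?thesis using QN[OF x sJ] line'[OF x sJ] s(3) by (simp add: g_def ennreal_leI indicator_def)
    qed simp
    then have 1: "(\<integral>\<^sup>+t. ennreal (?l h x) * indicator {T x ?s1..T x ?s2} t \<partial>lborel) \<le> ?L h x"
      by (intro nn_integral_mono) auto
    have 2: "(\<integral>\<^sup>+t. ennreal (?l h x) * indicator {T x ?s1..T x ?s2} t \<partial>lborel)
        = ennreal (?l h x) * ennreal (T x ?s2 - T x ?s1)" using ht(3)[OF x J] h by (subst nn_integral_cmult_indicator) auto
    have 3: "ennreal (?l h x) * ennreal (h / (3 * C)) \<le> ennreal (?l h x) * ennreal (T x ?s2 - T x ?s1)"
      using ht(2)[OF x J] h C by (intro mult_left_mono ennreal_leI) (auto simp: field_simps)
    from mult_left_mono[OF order_trans[OF 3 1[unfolded 2]], of "?m"]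
    have "?m * (ennreal (?l h x) * ennreal (h / (3 * C))) \<le> ?m * ?L h x" by simp
    moreover have "?m * (ennreal (?l h x) * ennreal (h / (3 * C))) = ennreal (f (u x) - b)"
      using False w C h by (simp add: ennreal_mult[symmetric])
    ultimately have "ennreal (f (u x) - b) \<le> ?m * ?L h x" by simp
    then have "ennreal b + ennreal (f (u x) - b) \<le> ennreal b + ?m * ?L h x" by (rule add_left_mono)
    then show ?thesis using False b by (simp add: ennreal_plus[symmetric] del: ennreal_plus)
  qed
  have fm: "(\<lambda>z. ennreal (f z)) \<in> borel_measurable borel" "(\<lambda>z. ennreal (f z + b)) \<in> borel_measurable borel"
    using f(1) by measurable
  show ?thesis
  proof (intro exI[of _ h0] conjI h0 allI impI)
    fix h assume h: "0 < h" "h < h0"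
    have "(\<integral>\<^sup>+z. g h z \<partial>lborel) = (\<integral>\<^sup>+x. ?L h x \<partial>lborel)" by (rule box_Fubini(1)[OF box gm])
    also have "\<dots> \<le> (\<integral>\<^sup>+x. ?k * (ennreal (?f x) * ennreal (?a x) * indicator ?V x) \<partial>lborel)"
    proof (intro nn_integral_mono)
      fix x
      show "?L h x \<le> ?k * (ennreal (?f x) * ennreal (?a x) * indicator ?V x)"
      proof (cases "x \<in> ?V")
        case True
        have "ennreal (2 * w2 / c) * ennreal (?f x) \<le> ?k * (ennreal (?f x) * ennreal (?a x))"
        proof -
          have "2 * w2 / c * (?f x) = 2 * w2 / (c * a1) * ((?f x) * a1)" using a1 by simp
          also have "\<dots> \<le> 2 * w2 / (c * a1) * ((?f x) * ?a x)"
            using ar(1)[OF True] f(2)[of "u x"] b w2 c a1 by (intro mult_left_mono) auto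
          finally show ?thesis using f(2)[of "u x"] b w2 c a1 ar(1)[OF True]
            by (simp add: ennreal_mult[symmetric] ennreal_leI del: ennreal_plus)
        qed
        then show ?thesis using upper[OF h, of x] True by simp
      next
        case False
        then show ?thesis using upper[OF h, of x] by simp
      qed
    qed
    also have "\<dots> = ?k * (\<integral>\<^sup>+q. ennreal (f q + b) * indicator N q \<partial>\<sigma>)"
    proof -
      \<comment> \<open>u is controlled only on the ball. It is replaced elsewhere by a constant,
        where the indicator vanishes, to obtain a Borel function.\<close>
      have "(\<lambda>x. ennreal (?f x) * ?c x) = (\<lambda>x. ennreal (f (if x \<in> ?V then u x else x0' ) + b) * ?c x)" for x0'
        by (auto simp: fun_eq_iff)
      moreover have "(\<lambda>x. if x \<in> ?V then u x else undefined) \<in> borel_measurable borel"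
        using smooth_on_continuous[of u ?V] ch by (intro borel_measurable_continuous_on_if) (auto simp: hypersurface_chart_def)
      then have "(\<lambda>x. ennreal (f (if x \<in> ?V then u x else undefined) + b) * ?c x) \<in> borel_measurable borel"
        by (rule borel_measurable_times_ennreal[OF measurable_compose[OF _ fm(2)] arm])
      ultimately have "(\<lambda>x. ennreal (?f x) * ?c x) \<in> borel_measurable borel" by metis
      then show ?thesis unfolding chart_int[OF fm(2)] by (subst nn_integral_cmult) (simp_all add: mult.assoc)
    qed
    also have "\<dots> \<le> ?k * surf (\<lambda>q. f q + b)" by (intro mult_left_mono nn_integral_mono) (auto simp: indicator_def)
    finally show "layer_on j K h N f \<le> ?k * surf (\<lambda>q. f q + b)" by (simp only: g_def)
    have "surf_on N f = (\<integral>\<^sup>+x. ennreal (f (u x)) * ennreal (?a x) * indicator ?V x \<partial>lborel)" by (rule chart_int[OF fm(1)])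
    also have "\<dots> \<le> (\<integral>\<^sup>+x. ennreal b * ennreal (?a x) * indicator ?V x + ?k' * ?L h x \<partial>lborel)"
    proof (intro nn_integral_mono)
      fix x
      show "ennreal (f (u x)) * ennreal (?a x) * indicator ?V x
        \<le> ennreal b * ennreal (?a x) * indicator ?V x + ?k' * ?L h x"
      proof (cases "x \<in> ?V")
        case True
        have "ennreal (f (u x)) * ennreal (?a x) \<le> (ennreal b + ?m * ?L h x) * ennreal (?a x)"
          by (rule mult_right_mono[OF lower[OF h True]]) simp
        also have "\<dots> = ennreal b * ennreal (?a x) + ?m * ennreal (?a x) * ?L h x"
          by (simp add: distrib_right distrib_left mult_ac)
        also have "\<dots> \<le> ennreal b * ennreal (?a x) + ?m * ennreal a2 * ?L h x"
          using ar(2)[OF True] by (intro add_left_mono mult_right_mono mult_left_mono ennreal_leI) auto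
        also have "?m * ennreal a2 = ?k'" using C w a2 by (simp add: ennreal_mult[symmetric])
        finally show ?thesis using True by simp
      qed simp
    qed
    also have "\<dots> = (\<integral>\<^sup>+x. ennreal b * ennreal (?a x) * indicator ?V x \<partial>lborel) + ?k' * (\<integral>\<^sup>+z. g h z \<partial>lborel)"
      using box_Fubini[OF box gm, of h] arm by (subst nn_integral_add) (auto simp: nn_integral_cmult mult.assoc)
    also have "(\<integral>\<^sup>+x. ennreal b * ennreal (?a x) * indicator ?V x \<partial>lborel) = (\<integral>\<^sup>+q. ennreal b * indicator N q \<partial>\<sigma>)"
      by (subst chart_int[of "\<lambda>_. ennreal b"]) auto
    also have "\<dots> \<le> (\<integral>\<^sup>+q. ennreal b \<partial>\<sigma>)" by (intro nn_integral_mono) (auto simp: indicator_def)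
    also have "(\<integral>\<^sup>+z. g h z \<partial>lborel) \<le> layer j K h f"
      unfolding layer_def g_def by (intro nn_integral_mono) (auto simp: indicator_def)
    finally show "surf_on N f \<le> (\<integral>\<^sup>+q. ennreal b \<partial>\<sigma>) + ?k' * layer j K h f" by (simp add: add_mono mult_left_mono)
  qed
qed

end

context hypersurface
begin

definition layer_test :: "(C2 \<Rightarrow> real) \<Rightarrow> bool" where
  "layer_test f \<longleftrightarrow> f \<in> borel_measurable borel \<and> (\<forall>z. 0 \<le> f z) \<and> continuous_on (closure \<Omega>) f"

abbreviation local_bounds where
  "local_bounds d K N A f b h \<equiv> layer_on d K h N f \<le> ennreal A * (surf f + ennreal b) \<and>
     surf_on N f \<le> ennreal A * (layer d K h f + ennreal b)"

abbreviation bounds where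
  "bounds d K A f b h \<equiv> layer d K h f \<le> ennreal A * (surf f + ennreal b) \<and>
     surf f \<le> ennreal A * (layer d K h f + ennreal b)"

lemma layer_local:
  assumes col: "collar d \<tau> K w1 w2" and p: "p \<in> S"
  shows "\<exists>N A. open N \<and> p \<in> N \<and> 0 < A \<and> (\<forall>f b. layer_test f \<longrightarrow> 0 < b \<longrightarrow> (\<forall>\<^sub>F h in at_right 0. local_bounds d K N A f b h))"
proof -
  obtain e j k x0 r c C Q a1 a2 where box: "box_coords p e j k x0 r c C Q"
    and near: "\<forall>z\<in>Q ` (ball x0 r \<times> {-r<..<r}). infdist z S < d" and a1: "0 < a1"
    and area: "\<forall>x\<in>ball x0 r. a1 \<le> area_factor (\<lambda>x. Q (x, 0)) x \<and> area_factor (\<lambda>x. Q (x, 0)) x \<le> a2"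
    using good_box_exists[OF col p] by (elim exE conjE) (rule that)
  let ?N = "Q ` (ball x0 r \<times> {-r<..<r})"
  define A where "A = \<bar>2 * w2 / (c * a1)\<bar> + \<bar>3 * C * a2 / w1\<bar> + 1"
  have A: "2 * w2 / (c * a1) \<le> A" "3 * C * a2 / w1 \<le> A" "1 \<le> A" unfolding A_def by linarith+
  have r: "r > 0" using box_coordsD(8)[OF box] .
  have pN: "p \<in> ?N" using box_coordsD(10)[OF box] r by (intro image_eqI[of _ _ "(x0, 0)"]) auto
  define s where "s = measure \<sigma> S"
  have s: "emeasure \<sigma> S = ennreal s" "s \<ge> 0"
    using finite_measure.emeasure_eq_measure[OF finite_\<sigma>, of S] by (auto simp: s_def)
  have ev: "\<forall>\<^sub>F h in at_right 0. local_bounds d K ?N A f b h" if f: "layer_test f" and b: "0 < b" for f b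
  proof -
    have f1: "f \<in> borel_measurable borel" "\<And>z. 0 \<le> f z" "continuous_on (closure \<Omega>) f" using f by (auto simp: layer_test_def)
    \<comment> \<open>The error y is spread over the finite area s of S; adding 1 avoids division by
      zero.\<close>
    define y where "y = b / (s + 1)"
    have y: "0 < y" "y * s \<le> b" using b s(2) by (auto simp: y_def field_simps)
    have ys: "(\<integral>\<^sup>+q. ennreal y \<partial>\<sigma>) \<le> ennreal b" using y s by (simp add: ennreal_mult[symmetric] ennreal_leI)
    have f\<sigma>: "(\<lambda>q. ennreal (f q)) \<in> borel_measurable \<sigma>"
      unfolding measurable_cong_sets[OF sets_\<sigma> refl] using f1(1) by (intro measurable_restrict_space1) measurable
    have fy: "surf (\<lambda>q. f q + y) \<le> surf f + ennreal b"
    proof -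
      have "surf (\<lambda>q. f q + y) = (\<integral>\<^sup>+q. ennreal (f q) + ennreal y \<partial>\<sigma>)"
        using f1(2) y(1) by (intro nn_integral_cong ennreal_plus) auto
      also have "\<dots> = surf f + (\<integral>\<^sup>+q. ennreal y \<partial>\<sigma>)" by (rule nn_integral_add[OF f\<sigma>]) simp
      finally show ?thesis using ys by (simp add: add_left_mono)
    qed
    obtain h0 where h0: "h0 > 0" and H: "\<And>h. 0 < h \<Longrightarrow> h < h0 \<Longrightarrow>
      layer_on d K h ?N f \<le> ennreal (2 * w2 / (c * a1)) * surf (\<lambda>q. f q + y) \<and>
      surf_on ?N f \<le> (\<integral>\<^sup>+q. ennreal y \<partial>\<sigma>) + ennreal (3 * C * a2 / w1) * layer d K h f"
      using layer_box[OF col box near a1 area f1 y(1)] by blast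
    show ?thesis unfolding eventually_at_right_field
    proof (intro exI[of _ h0] conjI h0 allI impI)
      fix h assume h: "0 < h" "h < h0"
      show "layer_on d K h ?N f \<le> ennreal A * (surf f + ennreal b)"
        by (rule order_trans[OF conjunct1[OF H[OF h]]]) (intro mult_mono ennreal_leI A fy, auto)
      show "surf_on ?N f \<le> ennreal A * (layer d K h f + ennreal b)"
      proof (rule order_trans[OF conjunct2[OF H[OF h]]])
        have "(\<integral>\<^sup>+q. ennreal y \<partial>\<sigma>) \<le> ennreal A * ennreal b"
        proof (rule order_trans[OF ys])
          have "1 * ennreal b \<le> ennreal A * ennreal b" using A(3) by (intro mult_right_mono) auto
          then show "ennreal b \<le> ennreal A * ennreal b" by simp
        qed
        moreover have "ennreal (3 * C * a2 / w1) * layer d K h f \<le> ennreal A * layer d K h f"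
          by (intro mult_right_mono ennreal_leI A) auto
        ultimately show "(\<integral>\<^sup>+q. ennreal y \<partial>\<sigma>) + ennreal (3 * C * a2 / w1) * layer d K h f \<le> ennreal A * (layer d K h f + ennreal b)"
          by (simp add: distrib_left add.commute add_mono)
      qed
    qed
  qed
  have "open ?N" using box_coordsD(12)[OF box] .
  moreover have "0 < A" using A(3) by linarith
  ultimately show ?thesis using pN ev by blast
qed

text \<open>Finitely many boxes cover S. The essential point is that A is uniform in f and r, and
  only the range of admissible h depends on them, which permits application to a sequence of
  functions.\<close>

lemma layer_surface:
  assumes col: "collar d \<tau> K w1 w2"
  shows "\<exists>A>0. \<forall>f r. layer_test f \<longrightarrow> 0 < r \<longrightarrow> (\<forall>\<^sub>F h in at_right 0. bounds d K A f r h)"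
proof -
  have "\<forall>p\<in>S. \<exists>N A. open N \<and> p \<in> N \<and> 0 < A \<and> (\<forall>f r. layer_test f \<longrightarrow> 0 < r \<longrightarrow> (\<forall>\<^sub>F h in at_right 0. local_bounds d K N A f r h))"
    using layer_local[OF col] by blast
  then obtain N A where NA: "\<forall>p\<in>S. open (N p) \<and> p \<in> N p \<and> 0 < A p \<and> (\<forall>f r. layer_test f \<longrightarrow> 0 < r \<longrightarrow> (\<forall>\<^sub>F h in at_right 0. local_bounds d K (N p) (A p) f r h))"
    unfolding bchoice_iff by blast
  have N: "\<And>p. p \<in> S \<Longrightarrow> open (N p)" "S \<subseteq> (\<Union>p\<in>S. N p)" using NA by auto
  obtain T where T: "T \<subseteq> S" "finite T" "S \<subseteq> (\<Union>p\<in>T. N p)" by (rule compactE_image[OF compact_S N])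
  define A0 where "A0 = (\<Sum>p\<in>T. A p) + 1"
  have A_nn: "0 \<le> A p" if "p \<in> T" for p using NA T(1) that by (meson less_imp_le subsetD)
  have A0: "(\<Sum>p\<in>T. A p) \<le> A0" "0 < A0" using sum_nonneg[of T A] A_nn by (auto simp: A0_def add_nonneg_pos)
  let ?U = "\<Union>p\<in>T. N p"
  have U: "open ?U" using N(1) T(1) by (intro open_UN) auto
  have NU: "{z. infdist z S \<le> d} \<subseteq> U" using col by (simp add: collar_def)
  \<comment> \<open>The part of the collar missed by the boxes stays away from S, so \<rho> \<le> -x
    there and layers with 2h < x do not meet it.\<close>
  let ?E = "closure \<Omega> \<inter> ({z. infdist z S \<le> d} - ?U)"
  have "closed {z. infdist z S \<le> d}" by (intro closed_Collect_le continuous_intros)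
  then have E: "compact ?E" using compact_closure_Om U by (intro compact_Int_closed closed_Diff)
  have "\<exists>x>0. \<forall>z\<in>?E. \<rho> z \<le> - x"
  proof (cases "?E = {}")
    case False
    have "continuous_on ?E \<rho>" by (rule continuous_on_subset[OF \<rho>_cont]) (use NU in blast)
    from continuous_attains_sup[OF E False this] obtain y where y: "y \<in> ?E" "\<forall>z\<in>?E. \<rho> z \<le> \<rho> y" ..
    have "y \<notin> S" using y(1) T(3) by blast
    moreover have "y \<in> \<Omega> \<union> S" "y \<in> U" using y(1) NU unfolding closure_Om by blast+
    ultimately have "y \<in> \<Omega> \<inter> U" by blast
    then have "\<rho> y < 0" unfolding Om_U by simp
    then show ?thesis using y(2) by (intro exI[of _ "- \<rho> y"]) (simp only: neg_0_less_iff_less minus_minus simp_thms)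
  qed (auto intro: exI[of _ 1])
  then obtain x where x: "x > 0" "\<And>z. z \<in> ?E \<Longrightarrow> \<rho> z \<le> - x" by blast
  have "\<forall>\<^sub>F h in at_right 0. bounds d K A0 f r h" if f: "layer_test f" and r: "0 < r" for f r
  proof -
    have fm: "f \<in> borel_measurable borel" using f by (simp add: layer_test_def)
    have f\<sigma>: "(\<lambda>q. ennreal (f q)) \<in> borel_measurable \<sigma>"
      unfolding measurable_cong_sets[OF sets_\<sigma> refl] using fm by (intro measurable_restrict_space1) measurable
    have ind: "indicator (N p) \<in> borel_measurable \<sigma>" if "p \<in> T" for p
      unfolding measurable_cong_sets[OF sets_\<sigma> refl] using N(1) T(1) that
      by (intro measurable_restrict_space1 borel_measurable_indicator) auto
    have "\<forall>p\<in>T. \<forall>\<^sub>F h in at_right 0. local_bounds d K (N p) (A p) f r h" using NA T(1) f r by blast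
    then have "\<forall>\<^sub>F h in at_right 0. \<forall>p\<in>T.
      local_bounds d K (N p) (A p) f r h" using T(2) by (simp add: eventually_ball_finite)
    moreover have "\<forall>\<^sub>F h in at_right 0. 0 < h \<and> h < x / 2"
      using x(1) unfolding eventually_at_right_field by (intro exI[of _ "x / 2"]) auto
    ultimately show ?thesis
    proof eventually_elim
      case (elim h)
      have sumA: "(\<Sum>p\<in>T. ennreal (A p) * X) \<le> ennreal A0 * X" for X
        using A0(1) A_nn by (simp add: sum_distrib_right[symmetric] ennreal_leI mult_right_mono)
      have "layer d K h f \<le> (\<integral>\<^sup>+z. (\<Sum>p\<in>T. ennreal (f z * layer_density d K h z) * indicator (N p) z) \<partial>lborel)"
        unfolding layer_def
      proof (rule nn_integral_mono)
        fix z
        show "ennreal (f z * layer_density d K h z) \<le> (\<Sum>p\<in>T. ennreal (f z * layer_density d K h z) * indicator (N p) z)"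
        proof (cases "z \<in> ?U")
          case True
          then obtain p where p: "p \<in> T" "z \<in> N p" by blast
          then have "ennreal (f z * layer_density d K h z) = ennreal (f z * layer_density d K h z) * indicator (N p) z" by simp
          also have "\<dots> \<le> (\<Sum>p\<in>T. ennreal (f z * layer_density d K h z) * indicator (N p) z)"
            by (rule member_le_sum[OF p(1)]) (use T(2) in auto)
          finally show ?thesis .
        next
          case False
          have "layer_density d K h z = 0"
          proof (cases "z \<in> \<Omega> \<and> infdist z S < d")
            case True
            then have "z \<in> ?E" using False closure_subset[of \<Omega>] by auto
            then have "layer_weight h (\<rho> z) = 0" using x(2)[of z] elim by (intro layer_weight_zero) auto
            then show ?thesis by (simp add: layer_density_def)
          qed (auto simp: layer_density_def)
          then show ?thesis by simp
        qed
      qed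
      also have "\<dots> = (\<Sum>p\<in>T. layer_on d K h (N p) f)" using fm layer_density_measurable[OF col, of h] N(1) T(1)
        by (intro nn_integral_sum borel_measurable_times_ennreal borel_measurable_indicator) auto
      also have "\<dots> \<le> (\<Sum>p\<in>T. ennreal (A p) * (surf f + ennreal r))" using elim by (intro sum_mono) auto
      also note sumA
      finally have 1: "layer d K h f \<le> ennreal A0 * (surf f + ennreal r)" .
      have "surf f \<le> (\<integral>\<^sup>+q. (\<Sum>p\<in>T. ennreal (f q) * indicator (N p) q) \<partial>\<sigma>)"
      proof (rule nn_integral_mono)
        fix z assume "z \<in> space \<sigma>"
        then obtain p where p: "p \<in> T" "z \<in> N p" using T(3) by auto
        then have "ennreal (f z) = ennreal (f z) * indicator (N p) z" by simp
        also have "\<dots> \<le> (\<Sum>p\<in>T. ennreal (f z) * indicator (N p) z)" by (rule member_le_sum[OF p(1)]) (use T(2) in auto)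
        finally show "ennreal (f z) \<le> (\<Sum>p\<in>T. ennreal (f z) * indicator (N p) z)" .
      qed
      also have "\<dots> = (\<Sum>p\<in>T. surf_on (N p) f)" by (intro nn_integral_sum borel_measurable_times_ennreal f\<sigma> ind)
      also have "\<dots> \<le> (\<Sum>p\<in>T. ennreal (A p) * (layer d K h f + ennreal r))" using elim by (intro sum_mono) auto
      also note sumA
      finally show ?case using 1 by simp
    qed
  qed
  then show ?thesis using A0(2) by blast
qed

end

section \<open>Square-integrable functions\<close>

lemma cmod_add_sq: "(cmod (a + b))^2 \<le> 2 * (cmod a)^2 + 2 * (cmod b)^2"
proof -
  have "(cmod (a + b))^2 + (cmod (a - b))^2 = 2 * (cmod a)^2 + 2 * (cmod b)^2"
    unfolding cmod_power2 by (simp add: power2_eq_square algebra_simps)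
  then show ?thesis by (smt (verit) zero_le_power2)
qed

lemma L2_measurable: "f \<in> L2 N \<Longrightarrow> f \<in> borel_measurable N"
  and L2_integrable: "f \<in> L2 N \<Longrightarrow> integrable N (\<lambda>x. (cmod (f x))^2)" by (auto simp: L2_def)

lemma L2_normsq_eq: "f \<in> L2 N \<Longrightarrow> L2_normsq N f = ennreal (\<integral>x. (cmod (f x))^2 \<partial>N)"
  unfolding L2_normsq_def by (intro nn_integral_eq_integral) (auto simp: L2_def)

lemma L2_normsqI: "f \<in> borel_measurable N \<Longrightarrow> L2_normsq N f < \<infinity> \<Longrightarrow> f \<in> L2 N"
  unfolding L2_def L2_normsq_def by (auto intro!: integrableI_bounded)

lemma L2_normsq_add_le:
  assumes "f \<in> borel_measurable N" "g \<in> borel_measurable N"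
  shows "L2_normsq N (\<lambda>x. f x + g x) \<le> 2 * L2_normsq N f + 2 * L2_normsq N g"
proof -
  have "L2_normsq N (\<lambda>x. f x + g x) \<le> (\<integral>\<^sup>+x. 2 * ennreal ((cmod (f x))^2) + 2 * ennreal ((cmod (g x))^2) \<partial>N)"
    unfolding L2_normsq_def
  proof (rule nn_integral_mono)
    fix x
    have "ennreal ((cmod (f x + g x))^2) \<le> ennreal (2 * (cmod (f x))^2 + 2 * (cmod (g x))^2)"
      by (rule ennreal_leI[OF cmod_add_sq])
    also have "\<dots> = 2 * ennreal ((cmod (f x))^2) + 2 * ennreal ((cmod (g x))^2)" by (simp add: ennreal_plus ennreal_mult)
    finally show "ennreal ((cmod (f x + g x))^2) \<le> 2 * ennreal ((cmod (f x))^2) + 2 * ennreal ((cmod (g x))^2)" .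
  qed
  also have "\<dots> = 2 * L2_normsq N f + 2 * L2_normsq N g"
    unfolding L2_normsq_def using assms by (simp add: nn_integral_add nn_integral_cmult)
  finally show ?thesis .
qed

lemma L2_normsq_mult_le:
  assumes "f \<in> borel_measurable N" "AE x in N. cmod (c x) \<le> B" "0 \<le> B"
  shows "L2_normsq N (\<lambda>x. c x * f x) \<le> ennreal (B^2) * L2_normsq N f"
proof -
  have "L2_normsq N (\<lambda>x. c x * f x) \<le> (\<integral>\<^sup>+x. ennreal (B^2) * ennreal ((cmod (f x))^2) \<partial>N)" unfolding L2_normsq_def
  proof (rule nn_integral_mono_AE, use assms(2) in eventually_elim)
    case (elim x)
    have "(cmod (c x * f x))^2 \<le> B^2 * (cmod (f x))^2"
      unfolding norm_mult power_mult_distrib using elim by (intro mult_right_mono power_mono) auto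
    then show ?case by (simp add: ennreal_mult[symmetric] ennreal_leI)
  qed
  then show ?thesis unfolding L2_normsq_def using assms(1) by (simp add: nn_integral_cmult)
qed

lemma L2_normsq_finite: "f \<in> L2 N \<Longrightarrow> L2_normsq N f < \<infinity>" by (simp add: L2_normsq_eq)

lemma L2_add: "f \<in> L2 N \<Longrightarrow> g \<in> L2 N \<Longrightarrow> (\<lambda>x. f x + g x) \<in> L2 N"
proof -
  assume fg: "f \<in> L2 N" "g \<in> L2 N"
  note m = fg[THEN L2_measurable]
  have "2 * L2_normsq N f + 2 * L2_normsq N g < \<infinity>" using fg[THEN L2_normsq_finite] by (simp add: ennreal_mult_less_top)
  with L2_normsq_add_le[OF m] show ?thesis using m by (intro L2_normsqI) (auto intro: le_less_trans)
qed

lemma L2_mult_bounded: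
  assumes "f \<in> L2 N" "c \<in> borel_measurable N" "AE x in N. cmod (c x) \<le> B"
  shows "(\<lambda>x. c x * f x) \<in> L2 N"
proof -
  have B: "AE x in N. cmod (c x) \<le> \<bar>B\<bar>" using assms(3) by eventually_elim auto
  have "ennreal (\<bar>B\<bar>^2) * L2_normsq N f < \<infinity>" using L2_normsq_finite[OF assms(1)] by (simp add: ennreal_mult_less_top)
  with L2_normsq_mult_le[OF L2_measurable[OF assms(1)] B] show ?thesis
    using L2_measurable[OF assms(1)] assms(2) by (intro L2_normsqI) (auto intro: le_less_trans)
qed

lemma L2_scale: "f \<in> L2 N \<Longrightarrow> (\<lambda>x. c * f x) \<in> L2 N" by (rule L2_mult_bounded[where B="cmod c"]) auto

lemma L2_diff: "f \<in> L2 N \<Longrightarrow> g \<in> L2 N \<Longrightarrow> (\<lambda>x. f x - g x) \<in> L2 N" using L2_add[OF _ L2_scale[of g N "-1"], of f] by simp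

lemma L2_cnj: "f \<in> L2 N \<Longrightarrow> (\<lambda>x. cnj (f x)) \<in> L2 N"
  unfolding L2_def using borel_measurable_continuous_onI[OF continuous_on_cnj[OF continuous_on_id]]
  by (auto intro: measurable_compose[where g=cnj])

lemma L2_zero: "(\<lambda>_. 0) \<in> L2 N" by (simp add: L2_def)

lemma L2_AE_cong:
  assumes "f \<in> L2 N" "g \<in> borel_measurable N" "AE x in N. g x = f x"
  shows "g \<in> L2 N"
proof -
  have "L2_normsq N g = L2_normsq N f" unfolding L2_normsq_def
    by (rule nn_integral_cong_AE) (use assms(3) in \<open>eventually_elim, simp\<close>)
  then show ?thesis using L2_normsq_finite[OF assms(1)] assms(2) by (intro L2_normsqI) auto
qed

lemma L2_product: assumes "f \<in> L2 N" "g \<in> L2 N" shows "integrable N (\<lambda>x. f x * g x)"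
proof (rule Bochner_Integration.integrable_bound[of N "\<lambda>x. (cmod (f x))^2 + (cmod (g x))^2"])
  show "integrable N (\<lambda>x. (cmod (f x))^2 + (cmod (g x))^2)" using assms by (auto simp: L2_def)
  show "(\<lambda>x. f x * g x) \<in> borel_measurable N" using assms by (auto simp: L2_def)
  have "a * b \<le> a^2 + b^2" for a b :: real
  proof -
    have "0 \<le> (a - b)^2 + a^2 + b^2" by simp
    then show ?thesis by (simp add: power2_eq_square algebra_simps)
  qed
  then show "AE x in N. norm (f x * g x) \<le> norm ((cmod (f x))^2 + (cmod (g x))^2)" by (auto simp: norm_mult)
qed

lemma L2_Cauchy_Schwarz:
  assumes "f \<in> L2 N" "g \<in> L2 N"
  shows "ennreal ((cmod (\<integral>x. f x * g x \<partial>N))^2) \<le> L2_normsq N f * L2_normsq N g"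
proof -
  have "ennreal (cmod (\<integral>x. f x * g x \<partial>N)) \<le> (\<integral>\<^sup>+x. ennreal (cmod (f x)) * ennreal (cmod (g x)) \<partial>N)"
    using integral_norm_bound_ennreal[OF L2_product[OF assms]] by (simp add: norm_mult ennreal_mult)
  then have "(ennreal (cmod (\<integral>x. f x * g x \<partial>N)))^2 \<le> (\<integral>\<^sup>+x. ennreal (cmod (f x)) * ennreal (cmod (g x)) \<partial>N)^2"
    by (rule power_mono) simp
  also have "\<dots> \<le> (\<integral>\<^sup>+x. (ennreal (cmod (f x)))^2 \<partial>N) * (\<integral>\<^sup>+x. (ennreal (cmod (g x)))^2 \<partial>N)"
    using assms[THEN L2_measurable] by (intro Cauchy_Schwarz_nn_integral) auto
  finally show ?thesis by (simp add: L2_normsq_def ennreal_power)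
qed

lemma L2_pairing_tendsto:
  assumes h: "\<And>n. h n \<in> L2 N" and f: "f \<in> L2 N" and g: "g \<in> L2 N"
    and lim: "(\<lambda>n::nat. L2_normsq N (\<lambda>x. h n x - f x)) \<longlonglongrightarrow> 0"
  shows "(\<lambda>n. \<integral>x. h n x * g x \<partial>N) \<longlonglongrightarrow> (\<integral>x. f x * g x \<partial>N)"
proof -
  have "(\<lambda>n. L2_normsq N g * L2_normsq N (\<lambda>x. h n x - f x)) \<longlonglongrightarrow> L2_normsq N g * 0"
    using L2_normsq_finite[OF g] by (intro ennreal_tendsto_cmult lim) auto
  then have "(\<lambda>n. L2_normsq N (\<lambda>x. h n x - f x) * L2_normsq N g) \<longlonglongrightarrow> 0" by (simp add: mult.commute)
  from tendsto_sandwich[OF _ _ tendsto_const this]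
  have "(\<lambda>n. ennreal ((cmod (\<integral>x. (h n x - f x) * g x \<partial>N))^2)) \<longlonglongrightarrow> 0"
    using L2_Cauchy_Schwarz[OF L2_diff[OF h f] g] by (auto intro!: always_eventually)
  then have "(\<lambda>n. (cmod (\<integral>x. (h n x - f x) * g x \<partial>N))^2) \<longlonglongrightarrow> 0" by (simp add: ennreal_tendsto_0_iff)
  then have "(\<lambda>n. sqrt ((cmod (\<integral>x. (h n x - f x) * g x \<partial>N))^2)) \<longlonglongrightarrow> sqrt 0" by (rule tendsto_real_sqrt)
  then have "(\<lambda>n. \<integral>x. (h n x - f x) * g x \<partial>N) \<longlonglongrightarrow> 0" by (simp add: tendsto_norm_zero_iff)
  moreover have "(\<integral>x. (h n x - f x) * g x \<partial>N) = (\<integral>x. h n x * g x \<partial>N) - (\<integral>x. f x * g x \<partial>N)" for n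
    unfolding left_diff_distrib by (intro Bochner_Integration.integral_diff L2_product h f g)
  ultimately show ?thesis by (simp add: LIM_zero_iff)
qed

lemma L2_normsq_zero_iff: "f \<in> borel_measurable N \<Longrightarrow> L2_normsq N f = 0 \<longleftrightarrow> (AE x in N. f x = 0)"
  unfolding L2_normsq_def by (subst nn_integral_0_iff_AE) auto

text \<open>Stated for rapidly Cauchy sequences with the rate that occurs in
  \<open>L2_Riesz\<close>. The increments are summable in L^1, hence almost everywhere, which gives
  a pointwise limit; Fatou's lemma turns the rate into an estimate for the distance to the
  limit.\<close>

lemma L2_complete:
  assumes fin: "finite_measure N" and x: "\<And>n. x n \<in> L2 N"
    and cauchy: "\<And>n k. n \<le> k \<Longrightarrow> L2_normsq N (\<lambda>t. x k t - x n t) \<le> ennreal (4 * (1/4) ^ n)"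
  shows "\<exists>y\<in>L2 N. (\<lambda>n. L2_normsq N (\<lambda>t. x n t - y t)) \<longlonglongrightarrow> 0"
proof -
  have m: "x n \<in> borel_measurable N" for n using L2_measurable[OF x] .
  define s where "s n t = ennreal (cmod (x (Suc n) t - x n t))" for n t
  have sm: "s n \<in> borel_measurable N" for n unfolding s_def[abs_def] using m by measurable
  define V where "V = measure N (space N)"
  have V: "emeasure N (space N) = ennreal V" "0 \<le> V" using finite_measure.emeasure_eq_measure[OF fin] by (auto simp: V_def)
  have sb: "(\<integral>\<^sup>+t. s n t \<partial>N) \<le> ennreal ((V + 4) * (1/2) ^ n)" for n
  proof -
    have "(\<integral>\<^sup>+t. s n t \<partial>N) \<le> (\<integral>\<^sup>+t. ennreal ((1/2) ^ n) + ennreal (2 ^ n) * ennreal ((cmod (x (Suc n) t - x n t))^2) \<partial>N)"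
    proof (rule nn_integral_mono)
      fix t
      let ?a = "cmod (x (Suc n) t - x n t)"
      \<comment> \<open>The bound a \<le> 2^-n + 2^n a^2 trades the rate 4^-n of the squared norms
        for the L^1 rate 2^-n on a space of finite measure.\<close>
      have "0 \<le> (2 ^ n * ?a - 1)^2 + 2 ^ n * ?a" by simp
      then have "2 ^ n * ?a \<le> 1 + (2 ^ n * ?a)^2" by (simp add: power2_eq_square algebra_simps)
      then have "?a \<le> (1 + (2 ^ n * ?a)^2) / 2 ^ n" by (simp add: field_simps)
      also have "\<dots> = (1/2) ^ n + 2 ^ n * ?a^2" by (simp add: power2_eq_square power_divide add_divide_distrib)
      finally have "ennreal ?a \<le> ennreal ((1/2) ^ n + 2 ^ n * ?a^2)" by (rule ennreal_leI)
      then show "s n t \<le> ennreal ((1/2) ^ n) + ennreal (2 ^ n) * ennreal (?a^2)" unfolding s_def by (simp add: ennreal_mult)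
    qed
    also have "\<dots> = ennreal ((1/2) ^ n) * ennreal V + ennreal (2 ^ n) * L2_normsq N (\<lambda>t. x (Suc n) t - x n t)"
      unfolding L2_normsq_def using m by (subst nn_integral_add) (auto simp: nn_integral_cmult V)
    also have "\<dots> \<le> ennreal ((1/2) ^ n) * ennreal V + ennreal (2 ^ n) * ennreal (4 * (1/4) ^ n)"
      by (intro add_left_mono mult_left_mono cauchy) auto
    also have "\<dots> = ennreal ((1/2) ^ n * V + 2 ^ n * (4 * (1/4) ^ n))" using V(2) by (simp add: ennreal_mult ennreal_plus)
    also have "(1/2) ^ n * V + 2 ^ n * (4 * (1/4) ^ n) = (V + 4) * (1/2) ^ n"
    proof -
      have "2 ^ n * (1/4) ^ n = (1/2 :: real) ^ n" by (simp add: power_mult_distrib[symmetric])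
      then show ?thesis by (simp add: algebra_simps)
    qed
    finally show ?thesis .
  qed
  have "(\<integral>\<^sup>+t. (\<Sum>n. s n t) \<partial>N) = (\<Sum>n. \<integral>\<^sup>+t. s n t \<partial>N)" by (rule nn_integral_suminf[OF sm])
  also have "\<dots> \<le> (\<Sum>n. ennreal ((V + 4) * (1/2) ^ n))" by (intro suminf_le sb) auto
  also have "\<dots> = ennreal (\<Sum>n. (V + 4) * (1/2) ^ n)" using V(2) by (intro suminf_ennreal2 summable_mult) auto
  also have "\<dots> < \<infinity>" by simp
  finally have "AE t in N. (\<Sum>n. s n t) \<noteq> \<infinity>" using sm by (intro nn_integral_PInf_AE) auto
  then have conv: "AE t in N. convergent (\<lambda>n. x n t)"
  proof eventually_elim
    case (elim t)
    then have "summable (\<lambda>n. cmod (x (Suc n) t - x n t))" unfolding s_def by (intro summable_suminf_not_top) auto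
    then have "summable (\<lambda>n. x (Suc n) t - x n t)" by (rule summable_norm_cancel)
    then have "convergent (\<lambda>n. \<Sum>i<n. x (Suc i) t - x i t)" by (simp add: summable_iff_convergent)
    then have "convergent (\<lambda>n. (x n t - x 0 t) + x 0 t)"
      unfolding sum_lessThan_telescope[of "\<lambda>n. x n t"] by (intro convergent_add convergent_const)
    then show ?case by simp
  qed
  define y where "y t = lim (\<lambda>n. x n t)" for t
  have ym: "y \<in> borel_measurable N" unfolding y_def[abs_def] by (rule borel_measurable_lim_metric[OF m])
  have lim: "AE t in N. (\<lambda>k. x k t) \<longlonglongrightarrow> y t" using conv by eventually_elim (simp add: y_def convergent_LIMSEQ_iff)
  have bound: "L2_normsq N (\<lambda>t. x n t - y t) \<le> ennreal (4 * (1/4) ^ n)" for n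
  proof -
    have "L2_normsq N (\<lambda>t. x n t - y t) = (\<integral>\<^sup>+t. liminf (\<lambda>k. ennreal ((cmod (x k t - x n t))^2)) \<partial>N)" unfolding L2_normsq_def
    proof (rule nn_integral_cong_AE, use lim in eventually_elim)
      case (elim t)
      have "(\<lambda>k. ennreal ((cmod (x k t - x n t))^2)) \<longlonglongrightarrow> ennreal ((cmod (y t - x n t))^2)"
        by (intro tendsto_intros tendsto_ennrealI elim)
      from lim_imp_Liminf[OF _ this] show ?case by (simp add: norm_minus_commute)
    qed
    also have "\<dots> \<le> liminf (\<lambda>k. L2_normsq N (\<lambda>t. x k t - x n t))"
      unfolding L2_normsq_def using m by (intro nn_integral_liminf) auto
    also have "\<dots> \<le> liminf (\<lambda>k. ennreal (4 * (1/4) ^ n))"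
      by (rule Liminf_mono, rule eventually_sequentiallyI[of n], rule cauchy)
    finally show ?thesis by (simp add: Liminf_const)
  qed
  have "(\<lambda>n. ennreal (4 * (1/4) ^ n)) \<longlonglongrightarrow> ennreal (4 * 0)"
    by (intro tendsto_ennrealI tendsto_mult tendsto_const LIMSEQ_power_zero) auto
  then have "(\<lambda>n. ennreal (4 * (1/4) ^ n)) \<longlonglongrightarrow> 0" by simp
  from tendsto_sandwich[OF _ _ tendsto_const this]
  have "(\<lambda>n. L2_normsq N (\<lambda>t. x n t - y t)) \<longlonglongrightarrow> 0" using bound by (auto intro!: always_eventually)
  moreover have "y \<in> L2 N"
  proof -
    have "L2_normsq N (\<lambda>t. x 0 t - y t) < \<infinity>" using bound[of 0] by (rule le_less_trans) simp
    then have "(\<lambda>t. x 0 t - y t) \<in> L2 N" using m ym by (intro L2_normsqI) auto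
    from L2_diff[OF x[of 0] this] show ?thesis by simp
  qed
  ultimately show ?thesis by blast
qed

text \<open>The functional J x = |x|^2 - 2 Re (l x) is minimised. A minimising sequence with gap
  4^-n is Cauchy, and the first variation at its limit identifies l. The conjugate of the limit is
  returned, because the pairing in the conclusion is bilinear.\<close>

lemma L2_Riesz:
  fixes l :: "(C2 \<Rightarrow> complex) \<Rightarrow> complex"
  assumes fin: "finite_measure N"
    and add: "\<And>x y. x \<in> L2 N \<Longrightarrow> y \<in> L2 N \<Longrightarrow> l (\<lambda>t. x t + y t) = l x + l y"
    and scale: "\<And>c x. x \<in> L2 N \<Longrightarrow> l (\<lambda>t. c * x t) = c * l x"
    and bound: "\<And>x. x \<in> L2 N \<Longrightarrow> (cmod (l x))^2 \<le> C * (\<integral>t. (cmod (x t))^2 \<partial>N)"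
  shows "\<exists>r\<in>L2 N. \<forall>x\<in>L2 N. l x = (\<integral>t. x t * r t \<partial>N)"
proof -
  define n2 where "n2 x = (\<integral>t. (cmod (x t))^2 \<partial>N)" for x
  define J where "J x = n2 x - 2 * Re (l x)" for x
  have n2_nonneg: "n2 x \<ge> 0" for x by (simp add: n2_def)
  have J_low: "- \<bar>C\<bar> \<le> J x" if "x \<in> L2 N" for x
  proof -
    have "(cmod (l x))^2 \<le> \<bar>C\<bar> * n2 x"
      using bound[OF that] mult_right_mono[OF abs_ge_self[of C] n2_nonneg[of x]] by (simp only: n2_def)
    then have "cmod (l x) \<le> sqrt (\<bar>C\<bar> * n2 x)" by (simp add: real_le_rsqrt)
    also have "\<dots> \<le> (\<bar>C\<bar> + n2 x) / 2" using n2_nonneg[of x] by (intro arith_geo_mean_sqrt) auto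
    finally show ?thesis using complex_Re_le_cmod[of "l x"] by (simp add: J_def)
  qed
  define d where "d = Inf (J ` L2 N)"
  have bdd: "bdd_below (J ` L2 N)" by (rule bdd_belowI2[OF J_low])
  have ne: "J ` L2 N \<noteq> {}" using L2_zero by blast
  have d_le: "d \<le> J x" if "x \<in> L2 N" for x unfolding d_def using that bdd by (intro cInf_lower) auto
  have "\<forall>n. \<exists>x\<in>L2 N. J x < d + (1/4) ^ n"
  proof
    fix n
    have "Inf (J ` L2 N) < d + (1/4) ^ n" by (simp add: d_def)
    then show "\<exists>x\<in>L2 N. J x < d + (1/4) ^ n" using cInf_less_iff[OF ne bdd] by auto
  qed
  then have "\<exists>x. \<forall>n. x n \<in> L2 N \<and> J (x n) < d + (1/4) ^ n" unfolding Bex_def by (rule choice)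
  then obtain x where "\<forall>n. x n \<in> L2 N \<and> J (x n) < d + (1/4) ^ n" ..
  then have x: "\<And>n. x n \<in> L2 N" "\<And>n. J (x n) < d + (1/4) ^ n" by auto
  \<comment> \<open>J differs from the squared norm by a real-linear term, which cancels in the
    parallelogram law.\<close>
  have parallelogram: "n2 (\<lambda>t. a t - b t) = 2 * (J a + J b - 2 * J (\<lambda>t. (1/2) * (a t + b t)))"
    if ab: "a \<in> L2 N" "b \<in> L2 N" for a b
  proof -
    note i = L2_integrable[OF ab(1)] L2_integrable[OF ab(2)] L2_integrable[OF L2_add[OF ab]] L2_integrable[OF L2_diff[OF ab]]
    have "(cmod (a t - b t))^2 = 2 * (cmod (a t))^2 + 2 * (cmod (b t))^2 - (cmod (a t + b t))^2" for t
      unfolding cmod_power2 by (simp add: power2_eq_square algebra_simps)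
    then have "n2 (\<lambda>t. a t - b t) = 2 * n2 a + 2 * n2 b - n2 (\<lambda>t. a t + b t)" using i by (simp add: n2_def)
    moreover have "n2 (\<lambda>t. (1/2) * (a t + b t)) = 1/4 * n2 (\<lambda>t. a t + b t)" by (simp add: n2_def norm_divide power_divide)
    moreover have "Re (l (\<lambda>t. (1/2) * (a t + b t))) = 1/2 * (Re (l a) + Re (l b))"
      unfolding scale[OF L2_add[OF ab], of "1/2"] add[OF ab] by simp
    ultimately show ?thesis unfolding J_def by argo
  qed
  have cauchy_arith: "e \<le> 4 * q" if "e = 2 * (a + b - 2 * c)" "p \<le> q" "d \<le> c" "a < d + p" "b < d + q" for e a b c p q
    using that by argo
  have cauchy: "L2_normsq N (\<lambda>t. x k t - x n t) \<le> ennreal (4 * (1/4) ^ n)" if "n \<le> k" for n k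
  proof -
    have "(1/4 :: real) ^ k \<le> (1/4) ^ n" using that by (intro power_decreasing) auto
    moreover have "d \<le> J (\<lambda>t. (1/2) * (x k t + x n t))" by (intro d_le L2_scale L2_add x)
    ultimately have "n2 (\<lambda>t. x k t - x n t) \<le> 4 * (1/4) ^ n"
      by (rule cauchy_arith[OF parallelogram[OF x(1) x(1)] _ _ x(2) x(2)])
    then show ?thesis using L2_normsq_eq[OF L2_diff[OF x(1)[of k] x(1)[of n]]] by (simp only: n2_def ennreal_leI)
  qed
  obtain r where r: "r \<in> L2 N" "(\<lambda>n. L2_normsq N (\<lambda>t. x n t - r t)) \<longlonglongrightarrow> 0" using L2_complete[OF fin x(1) cauchy] by blast
  have Re_eq: "Re (\<integral>t. r t * cnj (y t) \<partial>N) = Re (l y)" if y: "y \<in> L2 N" for y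
  proof -
    \<comment> \<open>Half the first variation of J at r in the direction y; the quadratic
      inequality below forces it to vanish.\<close>
    define D where "D = Re (\<integral>t. r t * cnj (y t) \<partial>N) - Re (l y)"
    have quad: "0 \<le> s^2 * n2 y + 2 * s * D" for s :: real
    proof -
      have step: "- ((1/4) ^ n) \<le> s^2 * n2 y + 2 * s * (Re (\<integral>t. x n t * cnj (y t) \<partial>N) - Re (l y))" for n
      proof -
        have sy: "(\<lambda>t. of_real s * y t) \<in> L2 N" by (rule L2_scale[OF y])
        have "(cmod (x n t + of_real s * y t))^2 = (cmod (x n t))^2 + s^2 * (cmod (y t))^2 + 2 * s * Re (x n t * cnj (y t))" for t
          unfolding cmod_power2 by (simp add: power2_eq_square algebra_simps)
        then have "n2 (\<lambda>t. x n t + of_real s * y t) = n2 (x n) + s^2 * n2 y + 2 * s * (\<integral>t. Re (x n t * cnj (y t)) \<partial>N)"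
          using L2_integrable[OF x(1)[of n]] L2_integrable[OF y] integrable_Re[OF L2_product[OF x(1)[of n] L2_cnj[OF y]]]
          unfolding n2_def by simp
        also have "(\<integral>t. Re (x n t * cnj (y t)) \<partial>N) = Re (\<integral>t. x n t * cnj (y t) \<partial>N)"
          by (rule integral_Re[OF L2_product[OF x(1) L2_cnj[OF y]]])
        finally have "J (\<lambda>t. x n t + of_real s * y t) = J (x n) + s^2 * n2 y + 2 * s * (Re (\<integral>t. x n t * cnj (y t) \<partial>N) - Re (l y))"
          using add[OF x(1)[of n] sy] scale[OF y, of "of_real s"] by (simp add: J_def algebra_simps)
        then show ?thesis using d_le[OF L2_add[OF x(1)[of n] sy]] x(2)[of n] by linarith
      qed
      have "(\<lambda>n. s^2 * n2 y + 2 * s * (Re (\<integral>t. x n t * cnj (y t) \<partial>N) - Re (l y))) \<longlonglongrightarrow> s^2 * n2 y + 2 * s * D"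
        unfolding D_def by (intro tendsto_intros L2_pairing_tendsto x r L2_cnj y)
      moreover have "(\<lambda>n. - ((1/4 :: real) ^ n)) \<longlonglongrightarrow> - 0" by (intro tendsto_minus LIMSEQ_power_zero) auto
      ultimately show ?thesis using LIMSEQ_le[of "\<lambda>n. - ((1/4 :: real) ^ n)"] step by fastforce
    qed
    have "D = 0"
    proof (rule ccontr)
      assume D: "D \<noteq> 0"
      \<comment> \<open>Adding 1 to the squared norm keeps the denominator positive when y is null,
        and the quadratic is still negative at this s.\<close>
      define s where "s = - D / (n2 y + 1)"
      have n1: "n2 y + 1 > 0" using n2_nonneg[of y] by linarith
      have "s^2 * n2 y + 2 * s * D = - D\<^sup>2 * (n2 y + 2) / (n2 y + 1)^2"
        using n1 by (simp add: s_def power2_eq_square divide_simps) (simp add: algebra_simps)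
      also have "\<dots> < 0" using D n1 n2_nonneg[of y] by (simp add: divide_neg_pos mult_neg_pos)
      finally show False using quad[of s] by linarith
    qed
    then show ?thesis by (simp add: D_def)
  qed
  have eq: "l y = (\<integral>t. y t * cnj (r t) \<partial>N)" if y: "y \<in> L2 N" for y
  proof -
    let ?K = "\<integral>t. r t * cnj (y t) \<partial>N"
    have "Re ?K = Re (l y)" by (rule Re_eq[OF y])
    \<comment> \<open>The identity of real parts, applied to i y, gives the imaginary part.\<close>
    moreover have "Im ?K = - Im (l y)"
    proof -
      have "(\<integral>t. r t * cnj (\<i> * y t) \<partial>N) = (\<integral>t. - \<i> * (r t * cnj (y t)) \<partial>N)" by (simp add: mult_ac)
      also have "\<dots> = - \<i> * ?K" by (rule integral_mult_right_zero)
      finally have "Re (\<integral>t. r t * cnj (\<i> * y t) \<partial>N) = Im ?K" by simp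
      then show ?thesis using Re_eq[OF L2_scale[OF y, of "\<i>"]] scale[OF y, of "\<i>"] by simp
    qed
    ultimately have "l y = cnj ?K" by (simp add: complex_eq_iff)
    also have "cnj ?K = (\<integral>t. cnj (r t * cnj (y t)) \<partial>N)" by (rule Bochner_Integration.integral_cnj[symmetric])
    finally show ?thesis by (simp add: mult.commute)
  qed
  show ?thesis by (rule bexI[OF _ L2_cnj[OF r(1)]]) (use eq in blast)
qed

text \<open>A bounded projection as a relation whose values are determined up to null functions.
  This is the form in which the Leray operator is given, namely as the closure of a graph.\<close>

definition L2_projection :: "C2 measure \<Rightarrow> ((C2 \<Rightarrow> complex) \<Rightarrow> (C2 \<Rightarrow> complex) \<Rightarrow> bool) \<Rightarrow> bool" where
  "L2_projection N P \<longleftrightarrow>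
    (\<forall>f g. P f g \<longrightarrow> f \<in> L2 N \<and> g \<in> L2 N \<and> P g g) \<and> (\<forall>f\<in>L2 N. \<exists>g. P f g) \<and>
    (\<forall>f g f' g' c. P f g \<longrightarrow> P f' g' \<longrightarrow> P (\<lambda>x. f x + c * f' x) (\<lambda>x. g x + c * g' x)) \<and>
    (\<exists>C::real. \<forall>f g. P f g \<longrightarrow> L2_normsq N g \<le> ennreal C * L2_normsq N f) \<and>
    (\<forall>f g f' g'. P f g \<longrightarrow> f' \<in> borel_measurable N \<longrightarrow> g' \<in> borel_measurable N \<longrightarrow>
       (AE x in N. f' x = f x) \<longrightarrow> (AE x in N. g' x = g x) \<longrightarrow> P f' g')"

lemma L2_projectionD:
  assumes "L2_projection N P"
  shows "P f g \<Longrightarrow> f \<in> L2 N" "P f g \<Longrightarrow> g \<in> L2 N" "P f g \<Longrightarrow> P g g" "f \<in> L2 N \<Longrightarrow> \<exists>g. P f g"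
    "P f g \<Longrightarrow> P f' g' \<Longrightarrow> P (\<lambda>x. f x + c * f' x) (\<lambda>x. g x + c * g' x)"
    "\<exists>C::real. \<forall>f g. P f g \<longrightarrow> L2_normsq N g \<le> ennreal C * L2_normsq N f"
    "P f g \<Longrightarrow> f' \<in> borel_measurable N \<Longrightarrow> g' \<in> borel_measurable N \<Longrightarrow>
       AE x in N. f' x = f x \<Longrightarrow> AE x in N. g' x = g x \<Longrightarrow> P f' g'" using assms unfolding L2_projection_def by blast+

section \<open>Annihilators with respect to a bilinear pairing\<close>

locale unimodular_pairing =
  fixes N :: "C2 measure" and \<tau> :: "C2 \<Rightarrow> complex"
  assumes finite_N: "finite_measure N" and \<tau>_measurable: "\<tau> \<in> borel_measurable N"
    and \<tau>_unimodular: "AE x in N. cmod (\<tau> x) = 1"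
begin

text \<open>Integration of f g against a complex measure with modulus N and phase \<tau>. No
  conjugate appears, so B is symmetric and bilinear; since \<tau> is unimodular it obeys the bounds
  of the L^2 inner product.\<close>

definition B :: "(C2 \<Rightarrow> complex) \<Rightarrow> (C2 \<Rightarrow> complex) \<Rightarrow> complex" where
  "B f g = (\<integral>x. f x * g x * \<tau> x \<partial>N)"

lemma B_sym: "B f g = B g f" by (simp add: B_def mult_ac)

lemma L2_\<tau>: "f \<in> L2 N \<Longrightarrow> (\<lambda>x. f x * \<tau> x) \<in> L2 N"
  using L2_mult_bounded[OF _ \<tau>_measurable, of f 1] eventually_mono[OF \<tau>_unimodular, of "\<lambda>x. cmod (\<tau> x) \<le> 1"]
  by (simp add: mult.commute)

lemma B_eq: "B f g = (\<integral>x. f x * (g x * \<tau> x) \<partial>N)" by (simp add: B_def mult.assoc)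

lemma B_integrable: "f \<in> L2 N \<Longrightarrow> g \<in> L2 N \<Longrightarrow> integrable N (\<lambda>x. f x * (g x * \<tau> x))" by (intro L2_product L2_\<tau>)

lemma B_add: "f \<in> L2 N \<Longrightarrow> f' \<in> L2 N \<Longrightarrow> g \<in> L2 N \<Longrightarrow> B (\<lambda>x. f x + f' x) g = B f g + B f' g"
  unfolding B_eq distrib_right by (intro Bochner_Integration.integral_add B_integrable)

lemma B_diff: "f \<in> L2 N \<Longrightarrow> f' \<in> L2 N \<Longrightarrow> g \<in> L2 N \<Longrightarrow> B (\<lambda>x. f x - f' x) g = B f g - B f' g"
  unfolding B_eq left_diff_distrib by (intro Bochner_Integration.integral_diff B_integrable)

lemma B_scale: "B (\<lambda>x. c * f x) g = c * B f g" unfolding B_eq mult.assoc by (rule integral_mult_right_zero)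

lemma B_cong: "f \<in> L2 N \<Longrightarrow> f' \<in> L2 N \<Longrightarrow> g \<in> L2 N \<Longrightarrow> AE x in N. f x = f' x \<Longrightarrow> B f g = B f' g"
  unfolding B_eq by (intro integral_cong_AE) (auto intro: borel_measurable_integrable B_integrable elim: eventually_mono)

lemma B_bound:
  assumes "f \<in> L2 N" "g \<in> L2 N"
  shows "ennreal ((cmod (B f g))^2) \<le> L2_normsq N f * L2_normsq N g"
proof -
  have "L2_normsq N (\<lambda>x. g x * \<tau> x) = L2_normsq N g" unfolding L2_normsq_def
    by (rule nn_integral_cong_AE) (use \<tau>_unimodular in \<open>eventually_elim, simp add: norm_mult\<close>)
  then show ?thesis using L2_Cauchy_Schwarz[OF assms(1) L2_\<tau>[OF assms(2)]] by (simp add: B_eq)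
qed

lemma B_nondegenerate:
  assumes g: "g \<in> L2 N" and 0: "\<And>x. x \<in> L2 N \<Longrightarrow> B x g = 0"
  shows "AE x in N. g x = 0"
proof -
  let ?x = "\<lambda>x. cnj (g x * \<tau> x)"
  have gt: "(\<lambda>x. g x * \<tau> x) \<in> L2 N" by (rule L2_\<tau>[OF g])
  have "B ?x g = of_real (\<integral>x. (cmod (g x * \<tau> x))^2 \<partial>N)"
  proof -
    have "B ?x g = (\<integral>x. of_real ((cmod (g x * \<tau> x))^2) \<partial>N)"
      unfolding B_eq by (intro Bochner_Integration.integral_cong refl) (simp only: complex_norm_square mult.commute)
    then show ?thesis by (simp only: integral_complex_of_real)
  qed
  then have "(\<integral>x. (cmod (g x * \<tau> x))^2 \<partial>N) = 0" using 0[OF L2_cnj[OF gt]] by simp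
  then have "AE x in N. (cmod (g x * \<tau> x))^2 = 0" using integral_nonneg_eq_0_iff_AE[OF L2_integrable[OF gt]] by simp
  with \<tau>_unimodular show ?thesis by eventually_elim auto
qed

text \<open>The difference of two values is a value at 0, which boundedness forces to have norm
  0.\<close>

lemma projection_unique:
  assumes P: "L2_projection N P" and "P x y" "P x y'"
  shows "AE t in N. y t = y' t"
proof -
  obtain C where C: "\<forall>f g. P f g \<longrightarrow> L2_normsq N g \<le> ennreal C * L2_normsq N f" using L2_projectionD(6)[OF P] by blast
  have 1: "P (\<lambda>t. x t + -1 * x t) (\<lambda>t. y t + -1 * y' t)" by (intro L2_projectionD(5)[OF P] assms)
  have "L2_normsq N (\<lambda>t. y t + -1 * y' t) \<le> ennreal C * L2_normsq N (\<lambda>t. x t + -1 * x t)" using C 1 by blast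
  then have "L2_normsq N (\<lambda>t. y t + -1 * y' t) = 0" by (simp add: L2_normsq_def)
  moreover have "(\<lambda>t. y t + -1 * y' t) \<in> borel_measurable N" by (rule L2_measurable[OF L2_projectionD(2)[OF P 1]])
  ultimately have "AE t in N. y t + -1 * y' t = 0" by (simp only: L2_normsq_zero_iff)
  then show ?thesis by eventually_elim simp
qed

text \<open>Riesz representation of the functional sending x to B(P x, g). Multiplying the
  representing function by the conjugate of \<tau> converts the plain integral into B.\<close>

lemma projection_adjoint:
  assumes P: "L2_projection N P" and g: "g \<in> L2 N"
  shows "\<exists>g'\<in>L2 N. \<forall>x y. P x y \<longrightarrow> B y g = B x g'"
proof -
  define l where "l x = B (SOME y. P x y) g" for x
  note dom = L2_projectionD(1,2)[OF P]
  have l: "l x = B y g" if "P x y" for x y unfolding l_def using someI[of "P x", OF that] that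
    by (intro B_cong g dom(2) projection_unique[OF P])
  note ex = L2_projectionD(4)[OF P]
  obtain C where C: "\<And>f h. P f h \<Longrightarrow> L2_normsq N h \<le> ennreal C * L2_normsq N f" using L2_projectionD(6)[OF P] by blast
  define G where "G = (\<integral>t. (cmod (g t))^2 \<partial>N)"
  have "\<exists>r\<in>L2 N. \<forall>x\<in>L2 N. l x = (\<integral>t. x t * r t \<partial>N)"
  proof (rule L2_Riesz[OF finite_N, where C="max C 0 * G"])
    fix x y assume xy: "x \<in> L2 N" "y \<in> L2 N"
    then obtain x' y' where P': "P x x'" "P y y'" using ex by blast
    then have "P (\<lambda>t. x t + y t) (\<lambda>t. x' t + y' t)" using L2_projectionD(5)[OF P, where c=1] by simp
    then show "l (\<lambda>t. x t + y t) = l x + l y" using P' by (simp add: l B_add dom(2) g)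
  next
    fix x c assume "x \<in> L2 N"
    then obtain x' where P': "P x x'" using ex by blast
    then have "P (\<lambda>t. c * x t) (\<lambda>t. c * x' t)" using L2_projectionD(5)[OF P P' P', of "c - 1"] by (simp add: algebra_simps)
    then show "l (\<lambda>t. c * x t) = c * l x" using P' by (simp add: l B_scale)
  next
    fix x assume x: "x \<in> L2 N"
    then obtain x' where P': "P x x'" using ex by blast
    let ?X = "\<integral>t. (cmod (x t))^2 \<partial>N"
    have "ennreal ((cmod (l x))^2) \<le> L2_normsq N x' * L2_normsq N g" unfolding l[OF P'] by (rule B_bound[OF dom(2)[OF P'] g])
    also have "\<dots> \<le> ennreal C * L2_normsq N x * L2_normsq N g" by (rule mult_right_mono[OF C[OF P']]) simp
    also have "\<dots> \<le> ennreal (max C 0) * ennreal ?X * ennreal G"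
      unfolding L2_normsq_eq[OF x] L2_normsq_eq[OF g] G_def by (intro mult_right_mono ennreal_leI) auto
    also have "\<dots> = ennreal (max C 0 * G * ?X)" by (simp add: ennreal_mult[symmetric] G_def mult_ac)
    finally show "(cmod (l x))^2 \<le> max C 0 * G * ?X"
      by (subst (asm) ennreal_le_iff) (auto simp: G_def intro!: mult_nonneg_nonneg)
  qed
  then obtain r where r: "r \<in> L2 N" "\<And>x. x \<in> L2 N \<Longrightarrow> l x = (\<integral>t. x t * r t \<partial>N)" by blast
  let ?g = "\<lambda>t. cnj (\<tau> t) * r t"
  have gL: "?g \<in> L2 N" by (rule L2_mult_bounded[OF r(1), of _ 1])
      (use \<tau>_measurable \<tau>_unimodular borel_measurable_continuous_onI[OF continuous_on_cnj[OF continuous_on_id]] in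
        \<open>auto intro: measurable_compose[where g=cnj] elim: eventually_mono\<close>)
  have "B y g = B x ?g" if "P x y" for x y
  proof -
    have "B x ?g = (\<integral>t. x t * r t \<partial>N)" unfolding B_eq
    proof (rule integral_cong_AE)
      show "AE t in N. x t * (cnj (\<tau> t) * r t * \<tau> t) = x t * r t" using \<tau>_unimodular
      proof eventually_elim
        case (elim t)
        then have "\<tau> t * cnj (\<tau> t) = 1" using complex_norm_square[of "\<tau> t"] by simp
        then have "cnj (\<tau> t) * r t * \<tau> t = r t" by (metis mult.assoc mult.commute mult_1)
        then show ?case by simp
      qed
    qed (use B_integrable[OF dom(1)[OF that] gL] L2_product[OF dom(1)[OF that] r(1)] in auto)
    then show ?thesis using l[OF that] r(2)[OF dom(1)[OF that]] by simp
  qed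
  then show ?thesis using gL by blast
qed

text \<open>Write P^t and Q^t for transposes with respect to B, so that g' = P^t g and f' = Q^t f in
  the proof. The differences g - P^t g and f - Q^t f annihilate the kernel functions, hence lie in
  ker Q and in ker P. Then B(f, Q P^t g) = B(Q^t f, P^t g) = B(P Q^t f, g) = B(P f, g) = B(f, P^t
  g), so P^t g lies in ran Q. An annihilator g of ker P satisfies g = P^t g and therefore lies in
  ran Q.\<close>

lemma annihilator_of_kernel:
  assumes P: "L2_projection N P" and Q: "L2_projection N Q"
    and k: "\<And>z. z \<in> X \<Longrightarrow> Q (k z) (k z)" and k': "\<And>z. z \<in> X' \<Longrightarrow> P (k' z) (k' z)"
    and HP: "\<And>u. u \<in> L2 N \<Longrightarrow> (\<And>z. z \<in> X \<Longrightarrow> B u (k z) = 0) \<Longrightarrow> P u (\<lambda>_. 0)"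
    and HQ: "\<And>u. u \<in> L2 N \<Longrightarrow> (\<And>z. z \<in> X' \<Longrightarrow> B u (k' z) = 0) \<Longrightarrow> Q u (\<lambda>_. 0)"
    and g: "g \<in> L2 N"
  shows "(\<forall>f. P f (\<lambda>_. 0) \<longrightarrow> B f g = 0) \<longleftrightarrow> Q g g"
proof -
  note domP = L2_projectionD(1-3)[OF P] and domQ = L2_projectionD(1-3)[OF Q]
    and exP = L2_projectionD(4)[OF P] and exQ = L2_projectionD(4)[OF Q]
  have diff: "R (\<lambda>t. f t - f' t) (\<lambda>t. h t - h' t)" if R: "L2_projection N R" and fh: "R f h" "R f' h'" for R f h f' h'
    using L2_projectionD(5)[OF R fh, of "-1"] by simp
  have cong: "R f h'" if R: "L2_projection N R" and fh: "R f h" and h': "h' \<in> L2 N" "AE t in N. h' t = h t" for R f h h'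
    by (rule L2_projectionD(7)[OF R fh L2_measurable[OF L2_projectionD(1)[OF R fh]] L2_measurable[OF h'(1)] _ h'(2)]) simp
  obtain g' where g': "g' \<in> L2 N" "\<And>x y. P x y \<Longrightarrow> B y g = B x g'" using projection_adjoint[OF P g] by blast
  have gQ: "Q (\<lambda>t. g t - g' t) (\<lambda>_. 0)" by (rule HQ[OF L2_diff[OF g g'(1)]])
      (use g'(2)[OF k'] in \<open>simp add: B_diff[OF g g'(1)] domP(1)[OF k'] B_sym[of g] B_sym[of g']\<close>)
  have star: "\<exists>f'\<in>L2 N. (\<forall>x y. Q x y \<longrightarrow> B f y = B f' x) \<and> P (\<lambda>t. f t - f' t) (\<lambda>_. 0)" if f: "f \<in> L2 N" for f
  proof -
    obtain f' where f': "f' \<in> L2 N" "\<And>x y. Q x y \<Longrightarrow> B y f = B x f'" using projection_adjoint[OF Q f] by blast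
    have "P (\<lambda>t. f t - f' t) (\<lambda>_. 0)" by (rule HP[OF L2_diff[OF f f'(1)]])
        (use f'(2)[OF k] in \<open>simp add: B_diff[OF f f'(1)] domQ(1)[OF k] B_sym[of f] B_sym[of f']\<close>)
    then show ?thesis using f' B_sym by metis
  qed
  have Pg: "AE t in N. y t = y' t" if "P f y" "P f' y'" "P (\<lambda>t. f t - f' t) (\<lambda>_. 0)" for f f' y y'
  proof -
    have "AE t in N. y t - y' t = 0" by (rule projection_unique[OF P diff[OF P that(1,2)] that(3)])
    then show ?thesis by eventually_elim simp
  qed
  obtain q where q: "Q g' q" using exQ[OF g'(1)] by blast
  have qg: "AE t in N. q t - g' t = 0"
  proof (rule B_nondegenerate[OF L2_diff[OF domQ(2)[OF q] g'(1)]])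
    fix f assume f: "f \<in> L2 N"
    obtain f' where f': "f' \<in> L2 N" "\<And>x y. Q x y \<Longrightarrow> B f y = B f' x" "P (\<lambda>t. f t - f' t) (\<lambda>_. 0)" using star[OF f] by blast
    obtain y y' where y: "P f y" "P f' y'" using exP f f'(1) by blast
    have "B f q = B f' g'" by (rule f'(2)[OF q])
    also have "\<dots> = B y' g" by (rule g'(2)[OF y(2), symmetric])
    also have "\<dots> = B y g" using Pg[OF y f'(3)] by (intro B_cong domP(2)[OF y(1)] domP(2)[OF y(2)] g) (auto elim: eventually_mono)
    also have "\<dots> = B f g'" by (rule g'(2)[OF y(1)])
    finally show "B f (\<lambda>t. q t - g' t) = 0" using B_diff[OF domQ(2)[OF q] g'(1) f] by (simp add: B_sym[of f])
  qed
  have Qg': "Q g' g'" by (rule cong[OF Q q g'(1)]) (use qg in \<open>eventually_elim, simp\<close>)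
  show ?thesis
  proof
    assume ann: "\<forall>f. P f (\<lambda>_. 0) \<longrightarrow> B f g = 0"
    have "AE t in N. g t - g' t = 0"
    proof (rule B_nondegenerate[OF L2_diff[OF g g'(1)]])
      fix x assume x: "x \<in> L2 N"
      then obtain y where y: "P x y" using exP by blast
      have "P (\<lambda>t. x t - y t) (\<lambda>t. y t - y t)" by (rule diff[OF P y domP(3)[OF y]])
      then have "B (\<lambda>t. x t - y t) g = 0" using ann by simp
      then have "B x g = B y g" using B_diff[OF x domP(2)[OF y] g] by simp
      then show "B x (\<lambda>t. g t - g' t) = 0" using g'(2)[OF y] B_diff[OF g g'(1) x] by (simp add: B_sym[of x])
    qed
    then have eq: "AE t in N. g t = g' t" by eventually_elim simp
    have "Q g' g" by (rule cong[OF Q Qg' g eq])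
    then show "Q g g" by (rule domQ(3))
  next
    assume Qg: "Q g g"
    show "\<forall>f. P f (\<lambda>_. 0) \<longrightarrow> B f g = 0"
    proof (intro allI impI)
      fix f assume Pf: "P f (\<lambda>_. 0)"
      have f: "f \<in> L2 N" by (rule domP(1)[OF Pf])
      obtain f' where f': "f' \<in> L2 N" "\<And>x y. Q x y \<Longrightarrow> B f y = B f' x" "P (\<lambda>t. f t - f' t) (\<lambda>_. 0)" using star[OF f] by blast
      have "P (\<lambda>t. f t - (f t - f' t)) (\<lambda>t. 0 - 0)" by (rule diff[OF P Pf f'(3)])
      then have Pf': "P f' (\<lambda>_. 0)" by simp
      \<comment> \<open>Both f and f' lie in ker P. The part P^t g of g contributes B(P f', g) = 0,
        and the remainder contributes B(f, Q(g - P^t g)) = 0.\<close>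
      have "B f g = B f' g" by (rule f'(2)[OF Qg])
      also have "\<dots> = B f' g' + B f' (\<lambda>t. g t - g' t)" using B_diff[OF g g'(1) f'(1)] by (simp add: B_sym[of f'])
      also have "B f' g' = B (\<lambda>_. 0) g" by (rule g'(2)[OF Pf', symmetric])
      also have "B f' (\<lambda>t. g t - g' t) = B f (\<lambda>_. 0)" by (rule f'(2)[OF gQ, symmetric])
      finally show "B f g = 0" by (simp add: B_def)
    qed
  qed
qed

end

section \<open>The Leray transform on the boundary\<close>

text \<open>Unrestricted limits from A assemble to a continuous function: near x the values of f on
  A are within e / 2 of F x, and limits of such values inherit the bound with \<le>.\<close>

lemma continuous_on_closure_limits:
  fixes f F :: "'a::metric_space \<Rightarrow> 'b::metric_space"
  assumes lim: "\<And>x. x \<in> closure A \<Longrightarrow> (f \<longlongrightarrow> F x) (at x within A)" and eq: "\<And>x. x \<in> A \<Longrightarrow> F x = f x"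
    and limpt: "\<And>x. x \<in> closure A \<Longrightarrow> at x within A \<noteq> bot"
  shows "continuous_on (closure A) F" unfolding continuous_on_iff
proof (intro ballI allI impI)
  fix x and e :: real assume x: "x \<in> closure A" and e: "0 < e"
  have "\<forall>\<^sub>F y in at x within A. dist (f y) (F x) < e / 2" using tendstoD[OF lim[OF x], of "e / 2"] e by simp
  then obtain d where d: "d > 0" "\<And>y. y \<in> A \<Longrightarrow> y \<noteq> x \<Longrightarrow> dist y x < d \<Longrightarrow> dist (f y) (F x) < e / 2"
    unfolding eventually_at by blast
  show "\<exists>d>0. \<forall>x'\<in>closure A. dist x' x < d \<longrightarrow> dist (F x') (F x) < e"
  proof (intro exI[of _ d] conjI d(1) ballI impI)
    fix y assume y: "y \<in> closure A" "dist y x < d"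
    show "dist (F y) (F x) < e"
    proof (cases "y = x")
      case False
      have "((\<lambda>z. dist (f z) (F x)) \<longlongrightarrow> dist (F y) (F x)) (at y within A)" by (intro tendsto_intros lim y)
      moreover have "\<forall>\<^sub>F z in at y within A. dist (f z) (F x) \<le> e / 2"
      proof -
        have "\<forall>\<^sub>F z in at y within A. dist z x < d" by (rule order_tendstoD(2)[OF _ y(2)]) (intro tendsto_intros)
        moreover have "\<forall>\<^sub>F z in at y within A. z \<noteq> x" using tendsto_imp_eventually_ne[OF tendsto_ident_at False] .
        moreover have "\<forall>\<^sub>F z in at y within A. z \<in> A" by (simp add: eventually_at_filter)
        ultimately show ?thesis by eventually_elim (use d(2) in \<open>auto intro: less_imp_le\<close>)
      qed
      ultimately have "dist (F y) (F x) \<le> e / 2" by (rule tendsto_upperbound) (rule limpt[OF y(1)])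
      then show ?thesis using e by linarith
    qed (use e in simp)
  qed
qed

lemma C1_function_linear: "C1_function S f \<Longrightarrow> C1_function S g \<Longrightarrow> C1_function S (\<lambda>x. f x + c * g x)" unfolding C1_function_def
proof (elim exE conjE)
  fix U F V G assume *: "open U" "S \<subseteq> U" "Ck_on 1 F U" "\<forall>p\<in>S. F p = f p" "open V" "S \<subseteq> V" "Ck_on 1 G V" "\<forall>p\<in>S. G p = g p"
  show "\<exists>U F. open U \<and> S \<subseteq> U \<and> Ck_on 1 F U \<and> (\<forall>p\<in>S. F p = f p + c * g p)"
    by (intro exI[of _ "U \<inter> V"] exI[of _ "\<lambda>x. F x + c * G x"] conjI Ck_on_add Ck_on_mult Ck_on_const
        Ck_on_subset[OF *(3)] Ck_on_subset[OF *(7)] open_Int) (use * in auto)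
qed

lemma C1_function_continuous: "C1_function S f \<Longrightarrow> continuous_on S f" unfolding C1_function_def
proof (elim exE conjE)
  fix U F assume *: "S \<subseteq> U" "Ck_on 1 F U" "\<forall>p\<in>S. F p = f p"
  show "continuous_on S f"
    by (rule continuous_on_eq[OF continuous_on_subset[OF Ck_on_imp_continuous_on[OF *(2)] *(1)]]) (use *(3) in blast)
qed

context hypersurface
begin

lemma at_within_Om: "z \<in> closure \<Omega> \<Longrightarrow> at z within \<Omega> \<noteq> bot"
proof -
  assume z: "z \<in> closure \<Omega>"
  show ?thesis
  proof (cases "z \<in> \<Omega>")
    case True
    show ?thesis unfolding at_within_open[OF True open_Om] by (rule at_neq_bot)
  next
    case False
    then have "z islimpt \<Omega>" using z by (simp add: closure_def)
    then show ?thesis by (simp add: trivial_limit_within)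
  qed
qed

end

context dual_pair
begin

text \<open>The measure |\<nu>|. It is identified with \<open>nu_measure\<close> when w is
  specialised to \<open>w_map\<close>.\<close>

abbreviation mu :: "C2 measure" where "mu \<equiv> density \<sigma> (\<lambda>p. ennreal (cmod (m p)))"

abbreviation graph where "graph \<equiv> leray_graph \<rho> S \<Omega> mu"

abbreviation bval where "bval \<equiv> leray_boundary \<rho> S \<Omega>"

abbreviation kern :: "C2 \<Rightarrow> C2 \<Rightarrow> complex" where "kern z p \<equiv> inverse (Phi M z (w p)) ^ 2"

lemma m_measurable: "m \<in> borel_measurable \<sigma>" by (rule continuous_imp_measurable_\<sigma>[OF m_continuous])

lemma measurable_mu: "borel_measurable mu = borel_measurable \<sigma>" by (rule measurable_cong_sets) auto

lemma m_bounds: "\<exists>c C. 0 < c \<and> (\<forall>p\<in>S. c \<le> cmod (m p) \<and> cmod (m p) \<le> C)"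
proof -
  have c: "continuous_on S (\<lambda>p. cmod (m p))" by (intro continuous_intros m_continuous)
  obtain y where y: "y \<in> S" "\<forall>x\<in>S. cmod (m y) \<le> cmod (m x)" using continuous_attains_inf[OF compact_S S_nonempty c] ..
  obtain y' where y': "y' \<in> S" "\<forall>x\<in>S. cmod (m x) \<le> cmod (m y')" using continuous_attains_sup[OF compact_S S_nonempty c] ..
  have "0 < cmod (m y)" using m_nonzero[OF y(1)] by simp
  then show ?thesis using y(2) y'(2) by blast
qed

lemma finite_mu: "finite_measure mu"
proof
  obtain c C where C: "\<forall>p\<in>S. c \<le> cmod (m p) \<and> cmod (m p) \<le> C" using m_bounds by blast
  have "emeasure mu (space mu) = (\<integral>\<^sup>+p. ennreal (cmod (m p)) * indicator S p \<partial>\<sigma>)"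
    using m_measurable sets.top[of \<sigma>] by (simp add: emeasure_density)
  also have "\<dots> \<le> (\<integral>\<^sup>+p. ennreal C \<partial>\<sigma>)" using C by (intro nn_integral_mono) (auto simp: indicator_def intro: ennreal_leI)
  also have "\<dots> < \<infinity>" using finite_measure.emeasure_finite[OF finite_\<sigma>, of S] by (simp add: ennreal_mult_less_top top.not_eq_extremum)
  finally show "emeasure mu (space mu) \<noteq> \<infinity>" by simp
qed

lemma AE_mu: "(AE p in mu. P p) \<longleftrightarrow> (AE p in \<sigma>. P p)"
proof -
  have "(AE p in mu. P p) \<longleftrightarrow> (AE p in \<sigma>. 0 < ennreal (cmod (m p)) \<longrightarrow> P p)" using m_measurable by (intro AE_density) auto
  also have "\<dots> \<longleftrightarrow> (AE p in \<sigma>. P p)" by (rule AE_cong) (simp add: m_nonzero)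
  finally show ?thesis .
qed

lemma L2_normsq_mu: "f \<in> borel_measurable \<sigma> \<Longrightarrow> L2_normsq mu f = (\<integral>\<^sup>+p. ennreal (cmod (m p)) * ennreal ((cmod (f p))^2) \<partial>\<sigma>)"
  unfolding L2_normsq_def using m_measurable by (intro nn_integral_density) auto

lemma L2_normsq_\<sigma>_le: "\<exists>C::real. \<forall>f. f \<in> borel_measurable \<sigma> \<longrightarrow> L2_normsq \<sigma> f \<le> ennreal C * L2_normsq mu f"
proof -
  obtain c C where c: "0 < c" "\<forall>p\<in>S. c \<le> cmod (m p) \<and> cmod (m p) \<le> C" using m_bounds by blast
  have "L2_normsq \<sigma> f \<le> ennreal (1 / c) * L2_normsq mu f" if f: "f \<in> borel_measurable \<sigma>" for f
  proof -
    have "L2_normsq \<sigma> f \<le> (\<integral>\<^sup>+p. ennreal (1 / c) * (ennreal (cmod (m p)) * ennreal ((cmod (f p))^2)) \<partial>\<sigma>)"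
      unfolding L2_normsq_def
    proof (rule nn_integral_mono)
      fix p assume "p \<in> space \<sigma>"
      then have "1 \<le> 1 / c * cmod (m p)" using c by (simp add: field_simps)
      then have "1 * (cmod (f p))^2 \<le> 1 / c * cmod (m p) * (cmod (f p))^2" by (intro mult_right_mono) auto
      then show "ennreal ((cmod (f p))^2) \<le> ennreal (1 / c) * (ennreal (cmod (m p)) * ennreal ((cmod (f p))^2))"
        using c(1) by (simp add: ennreal_mult[symmetric] ennreal_leI mult.assoc)
    qed
    also have "\<dots> = ennreal (1 / c) * L2_normsq mu f"
      unfolding L2_normsq_mu[OF f] using f m_measurable by (intro nn_integral_cmult) auto
    finally show ?thesis .
  qed
  then show ?thesis by blast
qed

lemma continuous_L2: "continuous_on S f \<Longrightarrow> f \<in> L2 mu"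
proof -
  assume f: "continuous_on S f"
  then have b: "bdd f" by (rule bdd_continuous)
  then obtain B where B: "\<forall>p\<in>S. cmod (f p) \<le> B" by (auto simp: bdd_def)
  have "(\<lambda>_. 1) \<in> L2 mu" using finite_mu by (simp add: L2_def finite_measure.integrable_const)
  then have "(\<lambda>p. f p * 1) \<in> L2 mu"
    by (rule L2_mult_bounded[where B=B]) (use b B in \<open>auto simp: bdd_def measurable_mu intro!: AE_I2\<close>)
  then show ?thesis by simp
qed

sublocale pairing: unimodular_pairing mu "\<lambda>p. sgn (m p)"
proof (rule unimodular_pairing.intro)
  show "finite_measure mu" by (rule finite_mu)
  show "(\<lambda>p. sgn (m p)) \<in> borel_measurable mu" unfolding measurable_mu sgn_div_norm using m_measurable by measurable
  show "AE x in mu. cmod (sgn (m x)) = 1" using m_nonzero by (auto simp: AE_mu norm_sgn intro!: AE_I2)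
qed

text \<open>The modulus of m, coming from the measure, and its phase, coming from the pairing,
  recombine to m.\<close>

lemma pairing_eq:
  assumes "f \<in> borel_measurable \<sigma>" "g \<in> borel_measurable \<sigma>"
  shows "pairing.B f g = (\<integral>p. f p * m p * g p \<partial>\<sigma>)"
proof -
  have "(\<lambda>p. sgn (m p)) \<in> borel_measurable \<sigma>" using pairing.\<tau>_measurable by (simp only: measurable_mu)
  then have "pairing.B f g = (\<integral>p. cmod (m p) *\<^sub>R (f p * g p * sgn (m p)) \<partial>\<sigma>)"
    unfolding pairing.B_def using assms m_measurable by (intro integral_density) auto
  also have "\<dots> = (\<integral>p. f p * m p * g p \<partial>\<sigma>)"
    by (intro Bochner_Integration.integral_cong refl) (simp add: sgn_div_norm scaleR_conv_of_real m_nonzero field_simps)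
  finally show ?thesis .
qed

lemma kern_continuous: "z \<in> \<Omega> \<Longrightarrow> continuous_on S (kern z)"
proof -
  assume z: "z \<in> \<Omega>"
  have "Phi M z (w p) \<noteq> 0" if "p \<in> S" for p using Phi_nonzero[OF z, of "w p"] w_in[OF that] h'.closure_Om by simp
  moreover have "continuous_on S (\<lambda>p. Phi M z (w p))" unfolding Phi_expand using w_continuous by (intro continuous_intros)
  ultimately show ?thesis by (intro continuous_intros) auto
qed

lemma leray_pairing:
  assumes "f \<in> borel_measurable \<sigma>" "z \<in> \<Omega>"
  shows "leray \<rho> S \<Omega> f z = pairing.B f (kern z)" unfolding leray_Phi
  by (subst pairing_eq[OF assms(1) continuous_imp_measurable_\<sigma>[OF kern_continuous[OF assms(2)]]])
    (simp add: divide_inverse power_inverse)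

lemma leray_I: "leray \<rho> S \<Omega> f z = I 2 (\<lambda>p. f p * m p) z"
  unfolding leray_Phi I_def by (simp add: divide_inverse power_inverse)

definition boundary_limits :: bool where
  "boundary_limits \<longleftrightarrow> (\<forall>f. C1_function S f \<longrightarrow> (\<forall>p\<in>S. \<exists>l. (leray \<rho> S \<Omega> f \<longlongrightarrow> l) (at p within \<Omega>)))"

text \<open>The Leray integral continued to S by its boundary values. The value 0 outside the
  closure of \<Omega> yields Borel functions on all of C^2, as \<open>layer_test\<close>
  requires.\<close>

definition leray_ext :: "(C2 \<Rightarrow> complex) \<Rightarrow> C2 \<Rightarrow> complex" where
  "leray_ext f z = (if z \<in> \<Omega> then leray \<rho> S \<Omega> f z else if z \<in> S then bval f z else 0)"

lemma leray_ext_limit: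
  assumes "boundary_limits" "C1_function S f" "z \<in> closure \<Omega>"
  shows "(leray \<rho> S \<Omega> f \<longlongrightarrow> leray_ext f z) (at z within \<Omega>)"
proof (cases "z \<in> \<Omega>")
  case True
  have "continuous_on \<Omega> (leray \<rho> S \<Omega> f)"
    unfolding leray_I[abs_def] by (intro I_continuous bdd_continuous continuous_intros C1_function_continuous assms m_continuous)
  then show ?thesis using True by (simp add: continuous_on leray_ext_def)
next
  case False
  then have "z \<in> S" using assms(3) closure_Om by simp
  then obtain l where l: "(leray \<rho> S \<Omega> f \<longlongrightarrow> l) (at z within \<Omega>)" using assms(1,2) unfolding boundary_limits_def by blast
  then have "bval f z = l" unfolding leray_boundary_def by (rule tendsto_Lim[OF at_within_Om[OF assms(3)]])
  then show ?thesis using l False \<open>z \<in> S\<close> by (simp add: leray_ext_def)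
qed

lemma leray_ext_continuous: "boundary_limits \<Longrightarrow> C1_function S f \<Longrightarrow> continuous_on (closure \<Omega>) (leray_ext f)"
  by (rule continuous_on_closure_limits[OF leray_ext_limit]) (auto simp: leray_ext_def at_within_Om)

lemma leray_ext_boundary: "p \<in> S \<Longrightarrow> leray_ext f p = bval f p" using Om_S_disjoint by (auto simp: leray_ext_def)

lemma bval_continuous: "boundary_limits \<Longrightarrow> C1_function S f \<Longrightarrow> continuous_on S (bval f)"
  by (rule continuous_on_eq[OF continuous_on_subset[OF leray_ext_continuous]]) (auto simp: closure_Om leray_ext_boundary)

lemma bval_linear:
  assumes bl: "boundary_limits" and f: "C1_function S f" and g: "C1_function S g" and p: "p \<in> S"
  shows "bval (\<lambda>p. f p + c * g p) p = bval f p + c * bval g p"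
proof -
  note L = continuous_L2[OF C1_function_continuous[OF f]] L2_scale[OF continuous_L2[OF C1_function_continuous[OF g]], of c]
  note me = L[THEN L2_measurable, unfolded measurable_mu] continuous_imp_measurable_\<sigma>[OF C1_function_continuous[OF g]]
  have linear: "leray \<rho> S \<Omega> (\<lambda>p. f p + c * g p) z = leray \<rho> S \<Omega> f z + c * leray \<rho> S \<Omega> g z" if z: "z \<in> \<Omega>" for z
    using me pairing.B_add[OF L continuous_L2[OF kern_continuous[OF z]]] by (simp add: leray_pairing z pairing.B_scale)
  have cl: "p \<in> closure \<Omega>" using p closure_Om by simp
  note lf = leray_ext_limit[OF bl f cl, unfolded leray_ext_boundary[OF p]] and lg = leray_ext_limit[OF bl g cl, unfolded leray_ext_boundary[OF p]]
  have ev: "\<forall>\<^sub>F z in at p within \<Omega>. z \<in> \<Omega>" by (simp add: eventually_at_filter)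
  have "(leray \<rho> S \<Omega> (\<lambda>p. f p + c * g p) \<longlongrightarrow> bval f p + c * bval g p) (at p within \<Omega>)"
    by (rule Lim_transform_eventually[OF tendsto_add[OF lf tendsto_mult[OF tendsto_const lg]]])
      (use ev in \<open>eventually_elim, simp add: linear\<close>)
  then show ?thesis unfolding leray_boundary_def[of _ _ _ "\<lambda>p. f p + c * g p"] by (rule tendsto_Lim[OF at_within_Om[OF cl]])
qed

end

lemma tendsto_0_ennrealI:
  fixes f :: "'a \<Rightarrow> ennreal"
  assumes "\<And>e::real. 0 < e \<Longrightarrow> \<forall>\<^sub>F x in F. f x \<le> ennreal e"
  shows "(f \<longlongrightarrow> 0) F"
proof (rule order_tendstoI)
  fix a :: ennreal assume "0 < a"
  then obtain b where b: "0 < b" "b < a" using dense by blast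
  then obtain e where e: "b = ennreal e" "0 \<le> e" by (cases b) auto
  then have "\<forall>\<^sub>F x in F. f x \<le> ennreal e" using b by (intro assms) simp
  then show "\<forall>\<^sub>F x in F. f x < a" by eventually_elim (use b e in auto)
qed simp

lemma tendsto_0_ennrealD:
  fixes f :: "'a \<Rightarrow> ennreal"
  assumes "(f \<longlongrightarrow> 0) F" "0 < (e::real)"
  shows "\<forall>\<^sub>F x in F. f x \<le> ennreal e"
proof -
  have "\<forall>\<^sub>F x in F. f x < ennreal e" using assms by (intro order_tendstoD(2)) auto
  then show ?thesis by eventually_elim simp
qed

lemma L2_normsq_cong: "(\<And>x. x \<in> space N \<Longrightarrow> f x = g x) \<Longrightarrow> L2_normsq N f = L2_normsq N g"
  unfolding L2_normsq_def by (intro nn_integral_cong) simp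

lemma L2_normsq_cong_AE: "AE x in N. f x = g x \<Longrightarrow> L2_normsq N f = L2_normsq N g"
  unfolding L2_normsq_def by (rule nn_integral_cong_AE) (auto elim: eventually_mono)

context dual_pair
begin

lemma leray_graph_linear:
  assumes bl: "boundary_limits" and "graph f g" "graph f' g'"
  shows "graph (\<lambda>x. f x + c * f' x) (\<lambda>x. g x + c * g' x)"
proof -
  obtain h h' where h: "\<And>n. C1_function S (h n)" "(\<lambda>n. L2_normsq mu (\<lambda>p. h n p - f p)) \<longlonglongrightarrow> 0"
      "(\<lambda>n. L2_normsq mu (\<lambda>p. bval (h n) p - g p)) \<longlonglongrightarrow> 0"
    and h': "\<And>n. C1_function S (h' n)" "(\<lambda>n. L2_normsq mu (\<lambda>p. h' n p - f' p)) \<longlonglongrightarrow> 0"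
      "(\<lambda>n. L2_normsq mu (\<lambda>p. bval (h' n) p - g' p)) \<longlonglongrightarrow> 0" using assms(2,3) unfolding leray_graph_def by blast
  have L: "f \<in> L2 mu" "g \<in> L2 mu" "f' \<in> L2 mu" "g' \<in> L2 mu" using assms(2,3) by (auto simp: leray_graph_def)
  note cont = continuous_L2[OF C1_function_continuous[OF h(1)]] continuous_L2[OF C1_function_continuous[OF h'(1)]]
    continuous_L2[OF bval_continuous[OF bl h(1)]] continuous_L2[OF bval_continuous[OF bl h'(1)]]
  have lim: "(\<lambda>n. L2_normsq mu (\<lambda>x. a n x + c * a' n x)) \<longlonglongrightarrow> 0"
    if "(\<lambda>n. L2_normsq mu (a n)) \<longlonglongrightarrow> 0" "(\<lambda>n. L2_normsq mu (a' n)) \<longlonglongrightarrow> 0" "\<And>n. a n \<in> L2 mu" "\<And>n. a' n \<in> L2 mu" for a a' :: "nat \<Rightarrow> _"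
  proof -
    have bound: "L2_normsq mu (\<lambda>x. a n x + c * a' n x) \<le> 2 * L2_normsq mu (a n) + 2 * (ennreal ((cmod c)^2) * L2_normsq mu (a' n))" for n
      by (rule order_trans[OF L2_normsq_add_le[OF L2_measurable[OF that(3)] L2_measurable[OF L2_scale[OF that(4)]]]])
        (intro add_left_mono mult_left_mono L2_normsq_mult_le L2_measurable that, auto)
    have "(\<lambda>n. 2 * L2_normsq mu (a n) + 2 * (ennreal ((cmod c)^2) * L2_normsq mu (a' n))) \<longlonglongrightarrow> 2 * 0 + 2 * (ennreal ((cmod c)^2) * 0)"
      by (intro tendsto_add ennreal_tendsto_cmult that) auto
    then have "(\<lambda>n. 2 * L2_normsq mu (a n) + 2 * (ennreal ((cmod c)^2) * L2_normsq mu (a' n))) \<longlonglongrightarrow> 0" by simp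
    from tendsto_sandwich[OF _ _ tendsto_const this] show ?thesis using bound by (auto intro!: always_eventually)
  qed
  have "(\<lambda>n. L2_normsq mu (\<lambda>p. (h n p - f p) + c * (h' n p - f' p))) \<longlonglongrightarrow> 0"
    by (rule lim[OF h(2) h'(2)]) (intro L2_diff cont L)+
  moreover have "(\<lambda>n. L2_normsq mu (\<lambda>p. (bval (h n) p - g p) + c * (bval (h' n) p - g' p))) \<longlonglongrightarrow> 0"
    by (rule lim[OF h(3) h'(3)]) (intro L2_diff cont L)+
  moreover have "L2_normsq mu (\<lambda>p. (bval (h n) p - g p) + c * (bval (h' n) p - g' p))
      = L2_normsq mu (\<lambda>p. bval (\<lambda>x. h n x + c * h' n x) p - (g p + c * g' p))" for n
    by (rule L2_normsq_cong) (simp add: bval_linear[OF bl h(1) h'(1)] algebra_simps)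
  ultimately show ?thesis unfolding leray_graph_def using C1_function_linear[OF h(1) h'(1), where c=c] L
    by (intro conjI L2_add L2_scale exI[of _ "\<lambda>n x. h n x + c * h' n x"]) (simp_all add: algebra_simps)
qed

lemma leray_graph_cong:
  assumes "graph f g" "f' \<in> borel_measurable mu" "g' \<in> borel_measurable mu"
    "AE x in mu. f' x = f x" "AE x in mu. g' x = g x"
  shows "graph f' g'"
proof -
  have "L2_normsq mu (\<lambda>p. a p - f' p) = L2_normsq mu (\<lambda>p. a p - f p)" for a
    by (rule L2_normsq_cong_AE) (use assms(4) in \<open>eventually_elim, simp\<close>)
  moreover have "L2_normsq mu (\<lambda>p. a p - g' p) = L2_normsq mu (\<lambda>p. a p - g p)" for a
    by (rule L2_normsq_cong_AE) (use assms(5) in \<open>eventually_elim, simp\<close>)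
  ultimately show ?thesis using assms(1) L2_AE_cong[of f mu f'] L2_AE_cong[of g mu g'] assms(2-5)
    unfolding leray_graph_def by simp
qed

text \<open>The assertions of the Lanzani-Stein theorem for this hypersurface and the measure
  |\<nu>|.\<close>

definition leray_bounded :: bool where
  "leray_bounded \<longleftrightarrow> boundary_limits \<and> (\<forall>f\<in>L2 mu. \<exists>g. graph f g) \<and>
     (\<exists>C::real. \<forall>f g. graph f g \<longrightarrow> L2_normsq mu g \<le> ennreal C * L2_normsq mu f) \<and>
     (\<forall>f g. graph f g \<longrightarrow> graph g g) \<and>
     {g. \<exists>f. graph f g} = hardy_space S \<Omega>"

lemma leray_projection:
  assumes "leray_bounded" shows "L2_projection mu (graph)" unfolding L2_projection_def
proof (intro conjI allI impI)
  show "f \<in> L2 mu" "g \<in> L2 mu" if "graph f g" for f g using that by (auto simp: leray_graph_def)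
  have bl: "boundary_limits" using assms by (simp add: leray_bounded_def)
  show "graph (\<lambda>x. f x + c * f' x) (\<lambda>x. g x + c * g' x)"
    if "graph f g" "graph f' g'" for f g f' g' c by (rule leray_graph_linear[OF bl that])
  show "graph f' g'" if "graph f g" "f' \<in> borel_measurable mu" "g' \<in> borel_measurable mu"
    "AE x in mu. f' x = f x" "AE x in mu. g' x = g x" for f g f' g' by (rule leray_graph_cong[OF that])
qed (use assms in \<open>auto simp: leray_bounded_def\<close>)

lemma layer_test_sq:
  assumes "continuous_on (closure \<Omega>) H" "\<And>z. z \<notin> closure \<Omega> \<Longrightarrow> H z = (0::complex)"
  shows "layer_test (\<lambda>z. (cmod (H z))^2)"
proof -
  have "(\<lambda>z. indicator (closure \<Omega>) z *\<^sub>R H z) \<in> borel_measurable borel"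
    by (intro borel_measurable_continuous_on_indicator assms(1)) auto
  moreover have "indicator (closure \<Omega>) z *\<^sub>R H z = H z" for z using assms(2)[of z] by (cases "z \<in> closure \<Omega>") auto
  ultimately have "H \<in> borel_measurable borel" by (simp only:)
  then show ?thesis unfolding layer_test_def by (auto intro!: continuous_intros assms(1))
qed

lemma layer_cong: "(\<And>z. z \<in> \<Omega> \<Longrightarrow> f z = g z) \<Longrightarrow> layer d K h f = layer d K h g"
  unfolding layer_def by (intro nn_integral_cong) (simp add: layer_density_def)

lemma kernel_criterion:
  assumes bl: "boundary_limits" and ex: "\<And>f. f \<in> L2 mu \<Longrightarrow> \<exists>g. graph f g"
    and u: "u \<in> L2 mu" and 0: "\<And>z. z \<in> \<Omega> \<Longrightarrow> pairing.B u (kern z) = 0"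
  shows "graph u (\<lambda>_. 0)"
proof -
  obtain g where "graph u g" using ex[OF u] by blast
  then obtain q where g: "g \<in> L2 mu" and q: "\<And>n. C1_function S (q n)" "(\<lambda>n. L2_normsq mu (\<lambda>p. q n p - u p)) \<longlonglongrightarrow> 0"
      "(\<lambda>n. L2_normsq mu (\<lambda>p. bval (q n) p - g p)) \<longlonglongrightarrow> 0" unfolding leray_graph_def by blast
  define F where "F n = leray_ext (q n)" for n
  let ?s = "\<lambda>n z. (cmod (F n z))^2" and ?d = "\<lambda>n k z. (cmod (F n z - F k z))^2"
    and ?N = "\<lambda>n k. L2_normsq \<sigma> (\<lambda>p. F n p - F k p)" and ?G = "\<lambda>n. L2_normsq mu (\<lambda>p. F n p - g p)"
  have Fc: "continuous_on (closure \<Omega>) (F n)" for n unfolding F_def by (rule leray_ext_continuous[OF bl q(1)])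
  have F0: "F n z = 0" if "z \<notin> closure \<Omega>" for n z using that closure_Om by (auto simp: F_def leray_ext_def)
  have FS: "F n p = bval (q n) p" if "p \<in> S" for n p unfolding F_def by (rule leray_ext_boundary[OF that])
  have FL: "F n \<in> L2 mu" for n by (rule continuous_L2[OF continuous_on_subset[OF Fc]]) (simp add: closure_Om)
  have Fm: "F n \<in> borel_measurable \<sigma>" for n using L2_measurable[OF FL] by (simp only: measurable_mu)
  define b where "b n p = q n p * m p" for n p
  have b: "bdd (b n)" for n unfolding b_def[abs_def]
    by (intro bdd_continuous continuous_intros C1_function_continuous q m_continuous)
  have FI: "F n z = I 2 (b n) z" if "z \<in> \<Omega>" for n z using that by (simp add: F_def leray_ext_def leray_I b_def[abs_def])
  have bd: "bdd (\<lambda>p. b n p - b k p)" for n k unfolding b_def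
    by (intro bdd_continuous continuous_intros C1_function_continuous q m_continuous)
  have FId: "F n z - F k z = I 2 (\<lambda>p. b n p - b k p) z" if "z \<in> \<Omega>" for n k z
    using bdd_integrable[OF bdd_mult[OF b bdd_kernel[OF that, of 2]]] unfolding FI[OF that] I_def left_diff_distrib
    by (intro Bochner_Integration.integral_diff[symmetric]) auto
  \<comment> \<open>Inside \<Omega> evaluation is the L^2-continuous functional given by pairing
    with \<open>kern z\<close>, and it vanishes at u.\<close>
  have pointwise: "(\<lambda>n. F n z) \<longlonglongrightarrow> 0" if z: "z \<in> \<Omega>" for z
  proof -
    have kL: "kern z \<in> L2 mu" by (rule continuous_L2[OF kern_continuous[OF z]])
    note cL = continuous_L2[OF C1_function_continuous[OF q(1)]]
    have "(\<lambda>n. pairing.B (q n) (kern z)) \<longlonglongrightarrow> pairing.B u (kern z)"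
      unfolding pairing.B_eq by (rule L2_pairing_tendsto[OF cL u pairing.L2_\<tau>[OF kL] q(2)])
    moreover have "pairing.B (q n) (kern z) = F n z" for n
      using leray_pairing[OF L2_measurable[OF cL, unfolded measurable_mu] z] z by (simp add: F_def leray_ext_def)
    ultimately show ?thesis using 0[OF z] by simp
  qed
  obtain d \<tau> K w1 w2 where col: "collar d \<tau> K w1 w2" using collar_exists by blast
  have \<tau>: "\<tau> > 0" using col by (simp add: collar_def)
  obtain A where A: "A > 0" and surf: "\<And>f r. layer_test f \<Longrightarrow> 0 < r \<Longrightarrow> \<forall>\<^sub>F h in at_right 0. bounds d K A f r h"
    using layer_surface[OF col] by blast
  \<comment> \<open>A layer h is fixed first for \<open>F n\<close>. On it |F n|^2 is the limit of
    |F n - F k|^2, since F k tends to 0 pointwise in \<Omega>. For each k a thinner layer h',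
    depending on k, bounds the layer h from above by \<open>layer_mono\<close> and is itself
    controlled by the surface norm of F n - F k. Fatou's lemma then removes k.\<close>
  have key: "L2_normsq \<sigma> (F n) \<le> ennreal (A * (A * (2 * j) + j))"
    if j: "j > 0" and near: "\<And>k. k \<ge> n0 \<Longrightarrow> ?N n k \<le> ennreal j" for n n0 and j :: real
  proof -
    have "\<forall>\<^sub>F h in at_right 0. 0 < h \<and> 2 * h < \<tau>"
      using \<tau> unfolding eventually_at_right_field by (intro exI[of _ "\<tau> / 2"]) auto
    moreover have "layer_test (?s n)" by (rule layer_test_sq[OF Fc]) (rule F0)
    note surf[OF this j]
    ultimately
    have "\<forall>\<^sub>F h in at_right 0. 0 < h \<and> 2 * h < \<tau> \<and> L2_normsq \<sigma> (F n) \<le> ennreal A * (layer d K h (?s n) + ennreal j)"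
      by eventually_elim (simp add: L2_normsq_def)
    then obtain h where h: "0 < h" "2 * h < \<tau>" and hF: "L2_normsq \<sigma> (F n) \<le> ennreal A * (layer d K h (?s n) + ennreal j)"
      using eventually_happens'[OF trivial_limit_at_right_real] by blast
    have step: "layer d K h (?d n k) \<le> ennreal (A * (2 * j))" if k: "k \<ge> n0" for k
    proof -
      have test: "layer_test (?d n k)" using F0 by (intro layer_test_sq continuous_intros Fc) auto
      have "\<forall>\<^sub>F h' in at_right 0. 0 < h' \<and> 2 * h' \<le> h"
        using h(1) unfolding eventually_at_right_field by (intro exI[of _ "h / 2"]) auto
      with surf[OF test j]
      have "\<forall>\<^sub>F h' in at_right 0. 0 < h' \<and> 2 * h' \<le> h \<and> layer d K h' (?d n k) \<le> ennreal A * (?N n k + ennreal j)"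
        by eventually_elim (simp add: L2_normsq_def)
      then obtain h' where h': "0 < h'" "2 * h' \<le> h" and hF': "layer d K h' (?d n k) \<le> ennreal A * (?N n k + ennreal j)"
        using eventually_happens'[OF trivial_limit_at_right_real] by blast
      have eq: "layer d K a (?d n k) = layer d K a (\<lambda>z. (cmod (I 2 (\<lambda>p. b n p - b k p) z))^2)" for a
        by (rule layer_cong) (simp add: FId)
      have "layer d K h (?d n k) \<le> layer d K h' (?d n k)" unfolding eq by (rule layer_mono[OF col bd h' h(2)])
      also note hF'
      also have "ennreal A * (?N n k + ennreal j) \<le> ennreal A * (ennreal j + ennreal j)"
        by (intro mult_left_mono add_right_mono near k) auto
      also have "\<dots> = ennreal (A * (2 * j))" using A j by (simp add: ennreal_plus[symmetric] ennreal_mult[symmetric] del: ennreal_plus)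
      finally show ?thesis .
    qed
    have "layer d K h (?s n) = (\<integral>\<^sup>+z. liminf (\<lambda>k. ennreal (?d n k z * layer_density d K h z)) \<partial>lborel)" unfolding layer_def
    proof (rule nn_integral_cong)
      fix z
      show "ennreal (?s n z * layer_density d K h z) = liminf (\<lambda>k. ennreal (?d n k z * layer_density d K h z))"
      proof (cases "z \<in> \<Omega>")
        case True
        have "(\<lambda>k. ennreal (?d n k z * layer_density d K h z)) \<longlonglongrightarrow> ennreal ((cmod (F n z - 0))^2 * layer_density d K h z)"
          by (intro tendsto_ennrealI tendsto_intros pointwise[OF True])
        from lim_imp_Liminf[OF sequentially_bot this] show ?thesis by simp
      qed (simp add: layer_density_def Liminf_const)
    qed
    also have "\<dots> \<le> liminf (\<lambda>k. layer d K h (?d n k))" unfolding layer_def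
    proof (rule nn_integral_liminf)
      fix k
      have "layer_test (?d n k)" using F0 by (intro layer_test_sq continuous_intros Fc) auto
      then have "(?d n k) \<in> borel_measurable borel" by (simp add: layer_test_def)
      then show "(\<lambda>z. ennreal (?d n k z * layer_density d K h z)) \<in> borel_measurable lborel"
        using layer_density_measurable[OF col, of h] by auto
    qed
    also have "\<dots> \<le> liminf (\<lambda>k::nat. ennreal (A * (2 * j)))"
      by (rule Liminf_mono, rule eventually_sequentiallyI[of n0], rule step)
    also have "\<dots> = ennreal (A * (2 * j))" by (simp add: Liminf_const)
    finally have "layer d K h (?s n) \<le> ennreal (A * (2 * j))" .
    then have "ennreal A * (layer d K h (?s n) + ennreal j) \<le> ennreal A * (ennreal (A * (2 * j)) + ennreal j)"
      by (intro mult_left_mono add_right_mono) auto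
    also have "\<dots> = ennreal (A * (A * (2 * j) + j))" using A j by (simp add: ennreal_plus[symmetric] ennreal_mult[symmetric] del: ennreal_plus)
    finally show ?thesis using hF by (rule order_trans[rotated])
  qed
  obtain C where C: "\<And>f. f \<in> borel_measurable \<sigma> \<Longrightarrow> L2_normsq \<sigma> f \<le> ennreal C * L2_normsq mu f" using L2_normsq_\<sigma>_le by blast
  obtain c' C' where C': "\<forall>p\<in>S. c' \<le> cmod (m p) \<and> cmod (m p) \<le> C'" using m_bounds by blast
  have mu_le: "L2_normsq mu f \<le> ennreal C' * L2_normsq \<sigma> f" if "f \<in> borel_measurable \<sigma>" for f
  proof -
    have "L2_normsq mu f \<le> (\<integral>\<^sup>+p. ennreal C' * ennreal ((cmod (f p))^2) \<partial>\<sigma>)"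
      unfolding L2_normsq_mu[OF that] using C' by (intro nn_integral_mono mult_right_mono ennreal_leI) auto
    also have "\<dots> = ennreal C' * L2_normsq \<sigma> f" unfolding L2_normsq_def using that by (intro nn_integral_cmult) auto
    finally show ?thesis .
  qed
  have "(\<lambda>n. L2_normsq mu (F n)) \<longlonglongrightarrow> 0"
  proof (rule tendsto_0_ennrealI)
    fix e :: real assume e: "0 < e"
    \<comment> \<open>Collects the constants so that the final bound is D j = e.\<close>
    define D where "D = (\<bar>C'\<bar> + 1) * (A * (2 * A + 1))"
    have D: "D > 0" using A by (simp add: D_def)
    define j where "j = e / D"
    have j: "j > 0" using e D by (simp add: j_def)
    define E where "E = \<bar>C\<bar> + 1"
    have E: "E > 0" "C \<le> E" by (auto simp: E_def)
    \<comment> \<open>The triangle inequality for squared norms gives 4 y in \<open>mu\<close>, and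
      E is the price of passing to \<sigma>.\<close>
    define y where "y = j / (4 * E)"
    have y: "y > 0" using j E by (simp add: y_def)
    have "?G n = L2_normsq mu (\<lambda>p. bval (q n) p - g p)" for n by (rule L2_normsq_cong) (simp add: FS)
    then have "(\<lambda>n. ?G n) \<longlonglongrightarrow> 0" using q(3) by (simp only:)
    from tendsto_0_ennrealD[OF this y] obtain n0 where n0: "\<And>n. n \<ge> n0 \<Longrightarrow> ?G n \<le> ennreal y"
      unfolding eventually_sequentially by blast
    have near: "?N n k \<le> ennreal j" if "n \<ge> n0" "k \<ge> n0" for n k
    proof -
      have eq: "L2_normsq mu (\<lambda>p. g p - F k p) = L2_normsq mu (\<lambda>p. F k p - g p)" by (simp add: L2_normsq_def norm_minus_commute)
      have "L2_normsq mu (\<lambda>p. (F n p - g p) + (g p - F k p)) \<le> 2 * ?G n + 2 * L2_normsq mu (\<lambda>p. g p - F k p)"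
        by (intro L2_normsq_add_le L2_measurable L2_diff FL g)
      also have "\<dots> \<le> 2 * ennreal y + 2 * ennreal y" unfolding eq by (intro add_mono mult_left_mono n0 that) auto
      also have "\<dots> = ennreal (4 * y)" using y by (simp add: ennreal_mult ennreal_plus[symmetric] mult_2[symmetric] del: ennreal_plus)
      finally have le: "L2_normsq mu (\<lambda>p. F n p - F k p) \<le> ennreal (4 * y)" by simp
      have "?N n k \<le> ennreal C * L2_normsq mu (\<lambda>p. F n p - F k p)" using Fm by (intro C) auto
      also have "\<dots> \<le> ennreal E * ennreal (4 * y)" using le E by (intro mult_mono ennreal_leI) auto
      also have "\<dots> = ennreal j" using j E by (simp add: ennreal_mult[symmetric] y_def)
      finally show ?thesis .
    qed
    show "\<forall>\<^sub>F n in sequentially. L2_normsq mu (F n) \<le> ennreal e"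
    proof (rule eventually_sequentiallyI[of n0])
      fix n assume n: "n \<ge> n0"
      have "L2_normsq mu (F n) \<le> ennreal C' * L2_normsq \<sigma> (F n)" by (rule mu_le[OF Fm])
      also have "\<dots> \<le> ennreal (\<bar>C'\<bar> + 1) * ennreal (A * (A * (2 * j) + j))"
        by (intro mult_mono ennreal_leI key[OF j near[OF n]]) auto
      also have "\<dots> = ennreal ((\<bar>C'\<bar> + 1) * (A * (A * (2 * j) + j)))" using A j by (simp add: ennreal_mult)
      also have "(\<bar>C'\<bar> + 1) * (A * (A * (2 * j) + j)) = D * j" by (simp add: D_def algebra_simps)
      also have "D * j = e" using D by (simp add: j_def)
      finally show "L2_normsq mu (F n) \<le> ennreal e" .
    qed
  qed
  moreover have "L2_normsq mu (F n) = L2_normsq mu (\<lambda>p. bval (q n) p - 0)" for n by (rule L2_normsq_cong) (simp add: FS)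
  ultimately show ?thesis unfolding leray_graph_def using u L2_zero q(1,2) by auto
qed

end

section \<open>Pulling back to the dual hypersurface\<close>

context dual_pair
begin

lemma dw_tangent:
  assumes p: "p \<in> S" and u: "D\<rho> p u = 0"
  shows "frechet_derivative \<rho>' (at (w p)) (dw p u) = 0"
  by (rule tangent_map[OF h'.hypersurface_axioms p w_deriv[OF p] w_in u])

lemma d\<theta>_eq:
  assumes "p \<in> S"
  shows "d\<theta> p x $ 1 = dw p x $ 1 * M$2$2 + dw p x $ 2 * M$3$2"
    and "d\<theta> p x $ 2 = dw p x $ 1 * M$2$3 + dw p x $ 2 * M$3$3"
proof -
  have pW: "p \<in> W" using assms S_W by blast
  have D: "((\<lambda>p. th M (F p)) has_derivative d\<theta> p) (at p)" unfolding d\<theta>_def by (rule smooth_on_has_derivative[OF smooth_\<Theta> pW])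
  have Fd: "((\<lambda>p. F p $ k) has_derivative (\<lambda>x. dw p x $ k)) (at p)" for k
    unfolding dw_def by (rule has_derivative_vec_nth[OF smooth_on_has_derivative[OF smooth_F pW]])
  have Dk: "((\<lambda>p. th M (F p) $ k) has_derivative (\<lambda>x. d\<theta> p x $ k)) (at p)" for k by (rule has_derivative_vec_nth[OF D])
  have "((\<lambda>p. th M (F p) $ 1) has_derivative (\<lambda>x. dw p x $ 1 * M$2$2 + dw p x $ 2 * M$3$2)) (at p)"
    unfolding th_1 by (rule derivative_eq_intros Fd refl)+ simp
  from has_derivative_unique[OF Dk this] show "d\<theta> p x $ 1 = dw p x $ 1 * M$2$2 + dw p x $ 2 * M$3$2" by metis
  have "((\<lambda>p. th M (F p) $ 2) has_derivative (\<lambda>x. dw p x $ 1 * M$2$3 + dw p x $ 2 * M$3$3)) (at p)"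
    unfolding th_2 by (rule derivative_eq_intros Fd refl)+ simp
  from has_derivative_unique[OF Dk this] show "d\<theta> p x $ 2 = dw p x $ 1 * M$2$3 + dw p x $ 2 * M$3$3" by metis
qed

text \<open>With \<open>\<Theta> = \<theta>\<^sub>1 d\<zeta>\<^sub>1 + \<theta>\<^sub>2 d\<zeta>\<^sub>2\<close> the form \<open>nu\<close> is a multiple of \<open>\<Theta> \<and> d\<Theta>\<close>, and the dual form
  \<open>\<Theta>'\<close> pulls back to \<open>- \<Theta>\<close>.\<close>

lemma nu_pullback:
  assumes q: "q \<in> S" and tan: "D\<rho> q x = 0" "D\<rho> q y = 0" "D\<rho> q t = 0"
  shows "contact_hypersurface.nu (\<lambda>s. th (transpose M) (v s)) (\<lambda>s. th (transpose M) (G s)) (w q) (dw q x) (dw q y) (dw q t)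
    = nu q x y t"
proof -
  interpret d: dual_pair \<rho>' S' \<Omega>' U' \<rho> S \<Omega> U "transpose M" v w G F V W by (rule swap)
  let ?T1 = "th (transpose M) q $ 1" and ?T2 = "th (transpose M) q $ 2"
  let ?t1 = "th M (w q) $ 1" and ?t2 = "th M (w q) $ 2"
  have ddw: "d.dw (w q) (dw q u) = u" if "D\<rho> q u = 0" for u unfolding d.dw_def by (rule dw_inverse[OF q that])
  have dd\<theta>: "d.d\<theta> (w q) (dw q u) $ 1 = u $ 1 * M$2$2 + u $ 2 * M$2$3" "d.d\<theta> (w q) (dw q u) $ 2 = u $ 1 * M$3$2 + u $ 2 * M$3$3"
    if "D\<rho> q u = 0" for u unfolding d.d\<theta>_eq[OF w_in[OF q]] ddw[OF that] by (simp_all add: transpose_def)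
  \<comment> \<open>Written as a cyclic sum, the wedge contains values of the contact form as
    separate factors, so the contact identity can be substituted.\<close>
  have wedge: "wedge3 (\<lambda>x. p2 * a1 x - p1 * a2 x) (dzeta 1) (dzeta 2) x y t
     = (p1 * x$1 + p2 * x$2) * (a1 y * t$1 - a1 t * y$1 + (a2 y * t$2 - a2 t * y$2))
     + (p1 * y$1 + p2 * y$2) * (a1 t * x$1 - a1 x * t$1 + (a2 t * x$2 - a2 x * t$2))
     + (p1 * t$1 + p2 * t$2) * (a1 x * y$1 - a1 y * x$1 + (a2 x * y$2 - a2 y * x$2))"
    for p1 p2 and a1 a2 :: "C2 \<Rightarrow> complex" and x y t unfolding wedge3_expand dzeta_def by (simp add: algebra_simps)
  note c = contact_identity[OF q tan(1)] contact_identity[OF q tan(2)] contact_identity[OF q tan(3)]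
  show ?thesis unfolding d.nu_def nu_def v_w[OF q] wedge c dd\<theta>[OF tan(1)] dd\<theta>[OF tan(2)] dd\<theta>[OF tan(3)] d\<theta>_eq[OF q]
    by (simp add: algebra_simps del: th_1 th_2)
qed

text \<open>The density \<open>m\<close> of the dual hypersurface, written out so that it can occur
  in statements where the dual locale is not interpreted.\<close>

abbreviation m' :: "C2 \<Rightarrow> complex" where
  "m' \<equiv> contact_hypersurface.m S' \<Omega>' (\<lambda>q. th (transpose M) (v q)) (\<lambda>q. th (transpose M) (G q))"

lemma m_pullback:
  assumes p: "p \<in> S" and tan: "D\<rho> p x = 0" "D\<rho> p y = 0" "D\<rho> p t = 0"
  shows "m' (w p) * of_real (vol4 (h'.nrm (w p)) (dw p x) (dw p y) (dw p t)) = m p * of_real (vol4 (nrm p) x y t)"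
proof -
  interpret d: dual_pair \<rho>' S' \<Omega>' U' \<rho> S \<Omega> U "transpose M" v w G F V W by (rule swap)
  show ?thesis unfolding m_vol4[OF p tan] nu_pullback[OF p tan, symmetric]
    by (rule d.m_vol4[OF w_in[OF p]]) (intro dw_tangent[OF p] tan)+
qed

lemma chart_pullback:
  assumes ch: "hypersurface_chart S X f"
  shows "hypersurface_chart S' X (\<lambda>x. w (f x))"
    and "x \<in> X \<Longrightarrow> frechet_derivative (\<lambda>x. w (f x)) (at x) e = dw (f x) (frechet_derivative f (at x) e)"
proof -
  have X: "open X" and sm: "smooth_on f X" and inj: "\<And>x. x \<in> X \<Longrightarrow> inj (frechet_derivative f (at x))"
    and op: "openin (top_of_set S) (f ` X)" and hom: "\<exists>g. homeomorphism X (f ` X) f g"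
    using ch by (auto simp: hypersurface_chart_def)
  have im: "f ` X \<subseteq> S" by (rule hypersurface_chart_image[OF ch])
  have smF: "smooth_on (\<lambda>x. F (f x)) X" by (rule smooth_on_compose[OF X sm open_W smooth_F]) (use im S_W in auto)
  have smw: "smooth_on (\<lambda>x. w (f x)) X" by (rule smooth_on_cong[OF X _ smF]) (use im F_eq in auto)
  have der: "frechet_derivative (\<lambda>x. w (f x)) (at x) = (\<lambda>e. dw (f x) (frechet_derivative f (at x) e))" if x: "x \<in> X" for x
  proof -
    have "(F has_derivative dw (f x)) (at (f x))"
      unfolding dw_def using smooth_on_has_derivative[OF smooth_F] im S_W x by blast
    from has_derivative_compose[OF smooth_on_has_derivative[OF sm x] this]
    have "((\<lambda>x. w (f x)) has_derivative (\<lambda>e. dw (f x) (frechet_derivative f (at x) e))) (at x)"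
      by (rule has_derivative_transform_within_open[OF _ X x]) (use im F_eq in auto)
    from frechet_derivative_at[OF this] show ?thesis by simp
  qed
  show "frechet_derivative (\<lambda>x. w (f x)) (at x) e = dw (f x) (frechet_derivative f (at x) e)" if "x \<in> X" for x e
    by (simp add: der[OF that])
  have inj': "inj (frechet_derivative (\<lambda>x. w (f x)) (at x))" if x: "x \<in> X" for x
  proof -
    have p: "f x \<in> S" using im x by blast
    have lin: "linear (frechet_derivative f (at x))" by (rule has_derivative_linear[OF smooth_on_has_derivative[OF sm x]])
    have lin': "linear (\<lambda>e. dw (f x) (frechet_derivative f (at x) e))"
      using linear_compose[OF lin linear_dw[OF p]] by (simp add: o_def)
    show ?thesis unfolding der[OF x] linear_injective_0[OF lin']
    proof (intro allI impI)
      fix e assume "dw (f x) (frechet_derivative f (at x) e) = 0"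
      then have "frechet_derivative f (at x) e = 0" using dw_inj[OF p] chart_tangent[OF ch x] by blast
      then show "e = 0" using inj[OF x] lin linear_injective_0 by blast
    qed
  qed
  have vc: "continuous_on S' v" using dual_pair.w_continuous[OF swap] .
  have homw: "homeomorphism S S' w v"
    unfolding homeomorphism_def using w_continuous vc w_S w_v v_w v_in by (auto simp: image_iff)
  have op': "openin (top_of_set S') (w ` f ` X)" using homeomorphism_imp_open_map[OF homw op] .
  obtain g where g: "homeomorphism X (f ` X) f g" using hom by blast
  have "homeomorphism (f ` X) (w ` f ` X) w v" by (rule homeomorphism_of_subsets[OF homw im order_refl refl])
  from homeomorphism_compose[OF g this]
  have "homeomorphism X (w ` f ` X) (w \<circ> f) (g \<circ> v)" .
  then show "hypersurface_chart S' X (\<lambda>x. w (f x))"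
    unfolding hypersurface_chart_def using X smw inj' op' by (auto simp: image_image o_def)
qed

text \<open>Moduli of \<open>m_pullback\<close> at a coordinate frame: in corresponding charts
  |\<nu>| and its dual have the same Lebesgue density.\<close>

lemma area_pullback:
  assumes ch: "hypersurface_chart S X f" and x: "x \<in> X"
  shows "cmod (m' (w (f x))) * area_factor (\<lambda>x. w (f x)) x = cmod (m (f x)) * area_factor f x"
proof -
  have p: "f x \<in> S" using hypersurface_chart_image[OF ch] x by blast
  note tan = area_factor_vol4(2)[OF ch x]
  from arg_cong[OF m_pullback[OF p tan[of 1] tan[of 2] tan[of 3]], of cmod]
  show ?thesis
    unfolding h'.area_factor_vol4(1)[OF chart_pullback(1)[OF ch] x] area_factor_vol4(1)[OF ch x] chart_pullback(2)[OF ch x]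
    by (simp add: norm_mult)
qed

text \<open>Both densities reproduce the same value of a 3-form on corresponding frames, so they
  differ by a quotient of real volumes.\<close>

lemma m_ratio_real:
  assumes p: "p \<in> S" shows "\<exists>r::real. r \<noteq> 0 \<and> m' (w p) = of_real r * m p"
proof -
  obtain X f x where ch: "hypersurface_chart S X f" and x: "x \<in> X" "p = f x" using chart_exists[OF p] .
  note tan = area_factor_vol4(2)[OF ch x(1)]
  let ?e = "\<lambda>i. frechet_derivative f (at x) (axis i 1)"
  let ?a = "vol4 (nrm p) (?e 1) (?e 2) (?e 3)" and ?b = "vol4 (h'.nrm (w p)) (dw p (?e 1)) (dw p (?e 2)) (dw p (?e 3))"
  have a: "?a \<noteq> 0" using area_factor_positive[OF ch x(1)] unfolding area_factor_vol4(1)[OF ch x(1)] x(2) by simp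
  have b: "?b \<noteq> 0" using h'.area_factor_positive[OF chart_pullback(1)[OF ch] x(1)]
    unfolding h'.area_factor_vol4(1)[OF chart_pullback(1)[OF ch] x(1)] chart_pullback(2)[OF ch x(1)] x(2) by simp
  have "m' (w p) * of_real ?b = m p * of_real ?a" using m_pullback[OF _ tan[of 1] tan[of 2] tan[of 3]] p x(2) by simp
  then have "m' (w p) = of_real (?a / ?b) * m p" using b by (simp add: field_simps)
  then show ?thesis using a b by (intro exI[of _ "?a / ?b"]) simp
qed

text \<open>The ratio of the two densities is real, continuous and nowhere 0 on the connected set S,
  so its sign is constant. The sign records whether w respects the orientations; being a global
  constant, it does not affect annihilators.\<close>

lemma sgn_m_pullback: "\<exists>s::complex. (s = 1 \<or> s = -1) \<and> (\<forall>x\<in>S. sgn (m' (w x)) = s * sgn (m x))"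
proof -
  interpret d: dual_pair \<rho>' S' \<Omega>' U' \<rho> S \<Omega> U "transpose M" v w G F V W by (rule swap)
  define q where "q x = Re (m' (w x) / m x)" for x
  have q: "q x \<noteq> 0" "m' (w x) = of_real (q x) * m x" if x: "x \<in> S" for x
  proof -
    obtain r where r: "r \<noteq> 0" "m' (w x) = of_real r * m x" using m_ratio_real[OF x] by blast
    then have "q x = r" using m_nonzero[OF x] by (simp add: q_def)
    then show "q x \<noteq> 0" "m' (w x) = of_real (q x) * m x" using r by auto
  qed
  have "continuous_on S (\<lambda>x. m' (w x))" by (rule continuous_on_compose2[OF d.m_continuous w_continuous]) (use w_S in auto)
  then have "continuous_on S q" unfolding q_def using m_continuous m_nonzero by (intro continuous_intros) auto
  then have conn: "connected (q ` S)" by (rule connected_continuous_image[OF _ conn_S])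
  obtain p where p: "p \<in> S" using S_nonempty by blast
  have sgn: "sgn (q x) = sgn (q p)" if x: "x \<in> S" for x
  proof (rule ccontr)
    assume "sgn (q x) \<noteq> sgn (q p)"
    then have "0 \<in> {min (q x) (q p)..max (q x) (q p)}" using q(1)[OF x] q(1)[OF p]
      by (auto simp: sgn_if min_def max_def split: if_splits)
    moreover have "{min (q x) (q p)..max (q x) (q p)} \<subseteq> q ` S"
      by (rule connected_contains_Icc[OF conn]) (use x p in \<open>auto simp: min_def max_def\<close>)
    ultimately show False using q(1) by auto
  qed
  show ?thesis
  proof (intro exI[of _ "of_real (sgn (q p))"] conjI ballI)
    show "complex_of_real (sgn (q p)) = 1 \<or> complex_of_real (sgn (q p)) = - 1" using q(1)[OF p] by (simp add: sgn_if)
    show "sgn (m' (w x)) = of_real (sgn (q p)) * sgn (m x)" if "x \<in> S" for x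
      unfolding q(2)[OF that] sgn_mult sgn[OF that, symmetric] by (simp add: sgn_of_real)
  qed
qed

end

section \<open>Transport of measures and L^2 spaces, and the annihilator identity\<close>

context dual_pair
begin

abbreviation mu' :: "C2 measure" where
  "mu' \<equiv> density (surface_measure S') (\<lambda>q. ennreal (cmod (m' q)))"

lemma w_measurable_mu: "w \<in> measurable mu mu'"
proof -
  have "w \<in> measurable \<sigma> (restrict_space borel S')"
    by (rule measurable_restrict_space2[OF _ w_measurable]) (use w_in in auto)
  then show ?thesis unfolding measurable_cong_sets[OF sets_density sets_density] measurable_cong_sets[OF refl h'.sets_\<sigma>] .
qed

lemma m_extension_measurable: "(\<lambda>p. ennreal (cmod (indicator S p *\<^sub>R m p))) \<in> borel_measurable borel"
proof -
  have "(\<lambda>p. indicator S p *\<^sub>R m p) \<in> borel_measurable borel"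
    by (intro borel_measurable_continuous_on_indicator m_continuous) (simp add: closed_S borel_closed)
  then show ?thesis by measurable
qed

lemma emeasure_mu_chart:
  assumes ch: "hypersurface_chart S X g" and A: "A \<in> sets \<sigma>" "A \<subseteq> g ` X"
  shows "emeasure mu A = (\<integral>\<^sup>+x. indicator A (g x) * ennreal (cmod (m (g x)) * area_factor g x) * indicator X x \<partial>lborel)"
proof -
  have AB: "A \<in> sets borel" "A \<subseteq> S" using A(1) by (auto simp: sets_\<sigma> sets_S)
  let ?f = "\<lambda>p. ennreal (cmod (indicator S p *\<^sub>R m p)) * indicator A p"
  have fm: "?f \<in> borel_measurable borel" using m_extension_measurable AB(1) by measurable
  have "emeasure mu A = (\<integral>\<^sup>+p. ennreal (cmod (m p)) * indicator A p \<partial>\<sigma>)"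
    using A(1) m_measurable by (intro emeasure_density) auto
  also have "\<dots> = (\<integral>\<^sup>+p. ?f p * indicator (g ` X) p \<partial>\<sigma>)" by (rule nn_integral_cong) (use A(2) in \<open>auto simp: indicator_def\<close>)
  also have "\<dots> = (\<integral>\<^sup>+x. ?f (g x) * ennreal (area_factor g x) * indicator X x \<partial>lborel)" by (rule nn_integral_chart[OF ch fm])
  also have "\<dots> = (\<integral>\<^sup>+x. indicator A (g x) * ennreal (cmod (m (g x)) * area_factor g x) * indicator X x \<partial>lborel)"
  proof (rule nn_integral_cong)
    fix x
    show "?f (g x) * ennreal (area_factor g x) * indicator X x = indicator A (g x) * ennreal (cmod (m (g x)) * area_factor g x) * indicator X x"
    proof (cases "x \<in> X")
      case True
      then show ?thesis using hypersurface_chart_image[OF ch] area_factor_positive[OF ch True]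
        by (auto simp: indicator_def ennreal_mult)
    qed simp
  qed
  finally show ?thesis .
qed

text \<open>Chart by chart this is \<open>area_pullback\<close>. The images of a finite atlas, made
  disjoint, cut a general set into pieces that lie in single charts.\<close>

lemma distr_mu: "distr mu mu' w = mu'"
proof (rule measure_eqI)
  interpret d: dual_pair \<rho>' S' \<Omega>' U' \<rho> S \<Omega> U "transpose M" v w G F V W by (rule swap)
  fix A assume "A \<in> sets (distr mu mu' w)"
  then have A: "A \<in> sets mu'" by simp
  have piece: "emeasure mu (w -` C \<inter> S) = emeasure mu' C"
    if ch: "hypersurface_chart S X f" and C: "C \<in> sets mu'" "C \<subseteq> w ` f ` X" for X f C
  proof -
    have im: "f ` X \<subseteq> S" by (rule hypersurface_chart_image[OF ch])
    have sub: "w -` C \<inter> S \<subseteq> f ` X"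
    proof
      fix p assume p: "p \<in> w -` C \<inter> S"
      then obtain x where x: "x \<in> X" "w p = w (f x)" using C(2) by auto
      then have "p = f x" using v_w p im by (metis IntD2 image_subset_iff)
      then show "p \<in> f ` X" using x by simp
    qed
    have "w -` C \<inter> S \<in> sets \<sigma>" using measurable_sets[OF w_measurable_mu C(1)] by simp
    then have "emeasure mu (w -` C \<inter> S) = (\<integral>\<^sup>+x. indicator (w -` C \<inter> S) (f x) * ennreal (cmod (m (f x)) * area_factor f x) * indicator X x \<partial>lborel)"
      by (rule emeasure_mu_chart[OF ch _ sub])
    also have "\<dots> = (\<integral>\<^sup>+x. indicator C (w (f x)) * ennreal (cmod (m' (w (f x))) * area_factor (\<lambda>x. w (f x)) x) * indicator X x \<partial>lborel)"
    proof (rule nn_integral_cong)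
      fix x
      show "indicator (w -` C \<inter> S) (f x) * ennreal (cmod (m (f x)) * area_factor f x) * indicator X x
        = indicator C (w (f x)) * ennreal (cmod (m' (w (f x))) * area_factor (\<lambda>x. w (f x)) x) * indicator X x"
        using im area_pullback[OF ch, of x] by (cases "x \<in> X") (auto simp: indicator_def)
    qed
    also have "\<dots> = emeasure mu' C" using d.emeasure_mu_chart[OF chart_pullback(1)[OF ch], of C] C by (simp add: image_image)
    finally show ?thesis .
  qed
  obtain n :: nat and X f where ch: "\<forall>i<n. hypersurface_chart S (X i) (f i)" and S: "S = (\<Union>i<n. f i ` X i)"
    by (rule finite_atlas)
  define D where "D i = f i ` X i - (\<Union>j<i. f j ` X j)" for i
  have D: "D i \<in> sets \<sigma>" if "i < n" for i
    using chart_image_borel[OF _ closed_S] ch that hypersurface_chart_image[of S "X i" "f i"]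
    by (auto simp: D_def sets_\<sigma> sets_S)
  have DS: "S = (\<Union>i<n. D i)"
  proof
    show "S \<subseteq> (\<Union>i<n. D i)"
    proof
      fix p assume "p \<in> S"
      then have ex: "\<exists>i. i < n \<and> p \<in> f i ` X i" using S by auto
      define i where "i = (LEAST i. i < n \<and> p \<in> f i ` X i)"
      have i: "i < n \<and> p \<in> f i ` X i" unfolding i_def by (rule LeastI_ex[OF ex])
      have "\<not> (j < n \<and> p \<in> f j ` X j)" if "j < i" for j using not_less_Least[OF that[unfolded i_def]] .
      then have "p \<in> D i" using i by (auto simp: D_def dest: less_trans)
      then show "p \<in> (\<Union>i<n. D i)" using i by blast
    qed
    show "(\<Union>i<n. D i) \<subseteq> S" using S by (auto simp: D_def)
  qed
  have disj: "D i \<inter> D j = {}" if "i < j" for i j using that by (auto simp: D_def)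
  define C where "C i = A \<inter> (v -` D i \<inter> S')" for i
  have AS': "A \<subseteq> S'" using A by (auto simp: h'.sets_\<sigma> h'.sets_S)
  have vm: "v -` D i \<inter> S' \<in> sets mu'" if "i < n" for i
  proof -
    have "D i \<in> sets borel" using D[OF that] by (simp add: sets_\<sigma> sets_S)
    from measurable_sets[OF d.w_measurable this] show ?thesis by simp
  qed
  have C: "C i \<in> sets mu'" if "i < n" for i unfolding C_def using A vm[OF that] by blast
  have AC: "A = (\<Union>i<n. C i)" using AS' DS v_in by (auto simp: C_def)
  have Cdisj: "disjoint_family_on C {..<n}"
    unfolding disjoint_family_on_def using disj by (auto simp: C_def) (metis disjoint_iff linorder_neqE_nat)
  have Csub: "C i \<subseteq> w ` f i ` X i" for i
  proof
    fix q assume "q \<in> C i"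
    then have "v q \<in> f i ` X i" "q \<in> S'" by (auto simp: C_def D_def)
    then show "q \<in> w ` f i ` X i" using w_v[of q] by (metis image_eqI)
  qed
  have "emeasure (distr mu mu' w) A = emeasure mu (w -` A \<inter> S)" using emeasure_distr[OF w_measurable_mu A] by simp
  also have "w -` A \<inter> S = (\<Union>i<n. w -` C i \<inter> S)" by (subst AC) auto
  also have "emeasure mu \<dots> = (\<Sum>i<n. emeasure mu (w -` C i \<inter> S))"
  proof (rule sum_emeasure[symmetric])
    show "(\<lambda>i. w -` C i \<inter> S) ` {..<n} \<subseteq> sets mu" using measurable_sets[OF w_measurable_mu C] by auto
    show "disjoint_family_on (\<lambda>i. w -` C i \<inter> S) {..<n}" using Cdisj unfolding disjoint_family_on_def by blast
  qed simp
  also have "\<dots> = (\<Sum>i<n. emeasure mu' (C i))" using ch by (intro sum.cong refl piece[OF _ C Csub]) auto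
  also have "\<dots> = emeasure mu' (\<Union>i<n. C i)" by (rule sum_emeasure) (use C Cdisj in auto)
  also have "\<dots> = emeasure mu' A" by (simp only: AC[symmetric])
  finally show "emeasure (distr mu mu' w) A = emeasure mu' A" .
qed simp

lemma v_measurable_mu: "v \<in> measurable mu' mu" using dual_pair.w_measurable_mu[OF swap] by (simp only: transpose_transpose)

lemma distr_mu': "distr mu' mu v = mu" using dual_pair.distr_mu[OF swap] by (simp only: transpose_transpose)

lemma L2_normsq_pullback: "f \<in> borel_measurable mu' \<Longrightarrow> L2_normsq mu' f = L2_normsq mu (\<lambda>p. f (w p))" unfolding L2_normsq_def
  by (subst (1) distr_mu[symmetric], subst nn_integral_distr[OF w_measurable_mu]) auto

lemma L2_normsq_pullback': "f \<in> borel_measurable mu \<Longrightarrow> L2_normsq mu' (\<lambda>q. f (v q)) = L2_normsq mu f"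
  using dual_pair.L2_normsq_pullback[OF swap] by (simp only: transpose_transpose)

lemma L2_pullback: assumes "f \<in> L2 mu'" shows "(\<lambda>p. f (w p)) \<in> L2 mu"
proof (rule L2_normsqI)
  note fm = L2_measurable[OF assms]
  show "(\<lambda>p. f (w p)) \<in> borel_measurable mu" by (rule measurable_compose[OF w_measurable_mu fm])
  show "L2_normsq mu (\<lambda>p. f (w p)) < \<infinity>" unfolding L2_normsq_pullback[OF fm, symmetric] by (rule L2_normsq_finite[OF assms])
qed

lemma L2_pullback': "f \<in> L2 mu \<Longrightarrow> (\<lambda>q. f (v q)) \<in> L2 mu'"
  using dual_pair.L2_pullback[OF swap] by (simp only: transpose_transpose)

lemma AE_pullback': "AE p in mu. P p \<Longrightarrow> AE q in mu'. P (v q)" using AE_distrD[OF v_measurable_mu] by (simp only: distr_mu')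

lemma Lanzani_Stein_leray_bounded:
  assumes "Lanzani_Stein_theorem" "strongly_C_convex_boundary \<rho> S \<Omega>"
  shows "leray_bounded"
proof -
  have "continuous_on S (\<lambda>p. cmod (m p))" by (intro continuous_intros m_continuous)
  moreover have "\<forall>p\<in>S. 0 < cmod (m p)" using m_nonzero by simp
  ultimately show ?thesis
    using assms(1)[unfolded Lanzani_Stein_theorem_def Let_def, rule_format, of \<rho> S \<Omega> "\<lambda>p. cmod (m p)"] assms(2)
    unfolding leray_bounded_def boundary_limits_def by blast
qed

lemma Phi_deriv: "((\<lambda>z. Phi M z q) has_derivative (\<lambda>x. th M q $ 1 * x $ 1 + th M q $ 2 * x $ 2)) (at z)" unfolding Phi_expand
  by (rule derivative_eq_intros has_derivative_vec_nth[OF has_derivative_ident] refl)+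
    (simp add: fun_eq_iff algebra_simps)

text \<open>The pairing with q has no zero on the compact closure of \<Omega>, hence none on a
  compact neighbourhood, where the kernel function is uniformly continuous. Its translates along the
  normal therefore converge uniformly on S.\<close>

lemma kernel_in_hardy_space:
  assumes q: "q \<in> \<Omega>'"
  shows "(\<lambda>p. inverse (Phi M p q) ^ 2) \<in> hardy_space S \<Omega>"
proof -
  let ?k = "\<lambda>p. inverse (Phi M p q) ^ 2"
  have nz: "Phi M z q \<noteq> 0" if "z \<in> closure \<Omega>" for z using dual_pair.Phi_nonzero[OF swap q that] by (simp add: Phi_transpose)
  have cPhi: "continuous_on A (\<lambda>z. Phi M z q)" for A unfolding Phi_expand by (intro continuous_intros)
  have hol: "holomorphic2_on ?k \<Omega>" unfolding holomorphic2_on_def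
  proof (intro ballI exI conjI allI)
    fix z assume "z \<in> \<Omega>"
    then have z: "Phi M z q \<noteq> 0" using nz closure_subset[of \<Omega>] by blast
    let ?D = "\<lambda>x. - 2 * inverse (Phi M z q) ^ 3 * (th M q $ 1 * x $ 1 + th M q $ 2 * x $ 2)"
    have "((\<lambda>t. inverse t ^ 2) has_field_derivative - 2 * inverse (Phi M z q) ^ 3) (at (Phi M z q))"
      using z by (auto intro!: derivative_eq_intros simp: power2_eq_square power3_eq_cube)
    from has_derivative_compose[OF Phi_deriv this[unfolded has_field_derivative_def]] show "(?k has_derivative ?D) (at z)" .
    show "?D (c *s x) = c * ?D x" for c x by (simp add: algebra_simps)
  qed
  let ?O = "(\<lambda>z. Phi M z q) -` (- {0})"
  have "open ?O" by (rule open_vimage) (auto intro: cPhi)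
  moreover have "closure \<Omega> \<subseteq> ?O" using nz by auto
  moreover have ne: "closure \<Omega> \<noteq> {}" using Om_nonempty by simp
  ultimately obtain e where e: "e > 0" "{z. infdist z (closure \<Omega>) \<le> e} \<subseteq> ?O"
    using compact_in_open_separated[OF ne compact_closure_Om] by blast
  let ?N = "{z. infdist z (closure \<Omega>) \<le> e}"
  have N: "compact ?N" by (rule compact_infdist_le[OF ne compact_closure_Om e(1)])
  have ck: "continuous_on ?N ?k" using e(2) by (intro continuous_intros cPhi) auto
  have "S \<subseteq> ?N" using e(1) closure_Om by auto
  then have kS: "continuous_on S ?k" using ck continuous_on_subset by blast
  obtain V0 where V0: "emeasure \<sigma> S = ennreal V0" "0 \<le> V0"
    using finite_measure.emeasure_eq_measure[OF finite_\<sigma>, of S] by auto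
  have "((\<lambda>a. L2_normsq \<sigma> (\<lambda>p. ?k (p - a *\<^sub>R outer_normal S \<Omega> p) - ?k p)) \<longlongrightarrow> 0) (at_right 0)"
  proof (rule tendsto_0_ennrealI)
    fix r :: real assume r: "0 < r"
    \<comment> \<open>A uniform error b for which b^2 times the area of S is at most r.\<close>
    define b where "b = sqrt (r / (V0 + 1))"
    have b: "b > 0" "b^2 * V0 \<le> r" using r V0(2) by (auto simp: b_def field_simps)
    obtain d where d: "d > 0" "\<And>y z. y \<in> ?N \<Longrightarrow> z \<in> ?N \<Longrightarrow> dist z y < d \<Longrightarrow> dist (?k z) (?k y) < b"
      using compact_uniformly_continuous[OF ck N] b(1) unfolding uniformly_continuous_on_def by metis
    show "\<forall>\<^sub>F a in at_right 0. L2_normsq \<sigma> (\<lambda>p. ?k (p - a *\<^sub>R outer_normal S \<Omega> p) - ?k p) \<le> ennreal r"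
      unfolding eventually_at_right_field
    proof (intro exI[of _ "min d e"] conjI allI impI)
      fix a :: real assume a: "0 < a" "a < min d e"
      have "L2_normsq \<sigma> (\<lambda>p. ?k (p - a *\<^sub>R outer_normal S \<Omega> p) - ?k p) \<le> (\<integral>\<^sup>+p. ennreal (b^2) \<partial>\<sigma>)" unfolding L2_normsq_def
      proof (rule nn_integral_mono)
        fix p assume "p \<in> space \<sigma>"
        then have p: "p \<in> S" by simp
        let ?y = "p - a *\<^sub>R outer_normal S \<Omega> p"
        have dist: "dist ?y p = a" using nrm(1)[OF p] a(1) by (simp add: nrm(2)[OF p] dist_norm norm_eq_sqrt_inner)
        have "infdist ?y (closure \<Omega>) \<le> e" using infdist_le2[of p "closure \<Omega>" ?y e] p closure_Om dist a by auto
        then have "dist (?k ?y) (?k p) < b" using d(2)[of p ?y] \<open>S \<subseteq> ?N\<close> p dist a by auto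
        then have "(cmod (?k ?y - ?k p))^2 \<le> b^2" by (intro power_mono) (auto simp: dist_norm)
        then show "ennreal ((cmod (?k ?y - ?k p))^2) \<le> ennreal (b^2)" by (rule ennreal_leI)
      qed
      also have "\<dots> = ennreal (b^2 * V0)" using V0 by (simp add: ennreal_mult)
      also have "\<dots> \<le> ennreal r" by (rule ennreal_leI[OF b(2)])
      finally show "L2_normsq \<sigma> (\<lambda>p. ?k (p - a *\<^sub>R outer_normal S \<Omega> p) - ?k p) \<le> ennreal r" .
    qed (use d(1) e(1) in auto)
  qed
  moreover have "?k \<in> L2 \<sigma>"
  proof -
    obtain B where B: "\<forall>p\<in>S. cmod (?k p) \<le> B" using bdd_continuous[OF kS] by (auto simp: bdd_def)
    have "(\<lambda>_. 1) \<in> L2 \<sigma>" using finite_\<sigma> by (simp add: L2_def finite_measure.integrable_const)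
    then have "(\<lambda>p. ?k p * 1) \<in> L2 \<sigma>"
      by (rule L2_mult_bounded[where B=B]) (use B continuous_imp_measurable_\<sigma>[OF kS] in \<open>auto intro!: AE_I2\<close>)
    then show ?thesis by simp
  qed
  ultimately show ?thesis using hol unfolding hardy_space_def by blast
qed

text \<open>Change of variables under w; the factor s is the orientation sign.\<close>

lemma pairing_pullback:
  "\<exists>s. s \<noteq> 0 \<and> (\<forall>f g. f \<in> L2 mu' \<longrightarrow> g \<in> L2 mu' \<longrightarrow>
     (\<integral>q. f q * g q * sgn (m' q) \<partial>mu') = s * pairing.B (\<lambda>p. f (w p)) (\<lambda>p. g (w p)))"
proof -
  interpret d: dual_pair \<rho>' S' \<Omega>' U' \<rho> S \<Omega> U "transpose M" v w G F V W by (rule swap)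
  obtain s :: complex where s: "s = 1 \<or> s = -1" "\<And>p. p \<in> S \<Longrightarrow> sgn (m' (w p)) = s * sgn (m p)" using sgn_m_pullback by blast
  have "(\<integral>q. f q * g q * sgn (m' q) \<partial>mu') = s * pairing.B (\<lambda>p. f (w p)) (\<lambda>p. g (w p))"
    if fg: "f \<in> L2 mu'" "g \<in> L2 mu'" for f g
  proof -
    have meas: "(\<lambda>q. f q * g q * sgn (m' q)) \<in> borel_measurable mu'"
      using fg[THEN L2_measurable] d.pairing.\<tau>_measurable by (intro borel_measurable_times)
    have "(\<integral>q. f q * g q * sgn (m' q) \<partial>mu') = (\<integral>q. f q * g q * sgn (m' q) \<partial>distr mu mu' w)" by (simp only: distr_mu)
    also have "\<dots> = (\<integral>p. f (w p) * g (w p) * sgn (m' (w p)) \<partial>mu)" by (rule integral_distr[OF w_measurable_mu meas])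
    also have "\<dots> = (\<integral>p. s * (f (w p) * g (w p) * sgn (m p)) \<partial>mu)"
      by (intro Bochner_Integration.integral_cong refl) (simp add: s(2))
    also have "\<dots> = s * pairing.B (\<lambda>p. f (w p)) (\<lambda>p. g (w p))" unfolding pairing.B_def by (rule integral_mult_right_zero)
    finally show ?thesis .
  qed
  then show ?thesis using s(1) by (intro exI[of _ s]) auto
qed

theorem annihilator_eq_dual_hardy:
  assumes LS: "Lanzani_Stein_theorem" and sc: "strongly_C_convex_boundary \<rho> S \<Omega>" "strongly_C_convex_boundary \<rho>' S' \<Omega>'"
    and g: "g \<in> L2 mu"
  shows "(\<forall>f\<in>leray_kernel \<rho> S \<Omega> mu. pairing.B f g = 0) \<longleftrightarrow> (\<lambda>q. g (v q)) \<in> hardy_space S' \<Omega>'"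
proof -
  interpret d: dual_pair \<rho>' S' \<Omega>' U' \<rho> S \<Omega> U "transpose M" v w G F V W by (rule swap)
  have lb: "leray_bounded" by (rule Lanzani_Stein_leray_bounded[OF LS sc(1)])
  have lb': "d.leray_bounded" by (rule d.Lanzani_Stein_leray_bounded[OF LS sc(2)])
  let ?P = graph and ?P' = d.graph
  \<comment> \<open>The dual Leray projection transported to S by v.\<close>
  define Q where "Q x y \<longleftrightarrow> x \<in> borel_measurable mu \<and> y \<in> borel_measurable mu \<and> ?P' (\<lambda>q. x (v q)) (\<lambda>q. y (v q))" for x y
  have P: "L2_projection mu ?P" by (rule leray_projection[OF lb])
  have P': "L2_projection mu' ?P'" by (rule d.leray_projection[OF lb'])
  note D = L2_projectionD[OF P']
  have inL2: "f \<in> L2 mu" if "f \<in> borel_measurable mu" "(\<lambda>q. f (v q)) \<in> L2 mu'" for f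
    using L2_normsq_pullback'[OF that(1)] L2_normsq_finite[OF that(2)] that(1) by (intro L2_normsqI) auto
  have Qproj: "L2_projection mu Q" unfolding L2_projection_def
  proof (intro conjI allI impI ballI)
    fix f h assume fh: "Q f h"
    then have m: "f \<in> borel_measurable mu" "h \<in> borel_measurable mu" and g: "?P' (\<lambda>q. f (v q)) (\<lambda>q. h (v q))"
      by (simp_all only: Q_def)
    show "f \<in> L2 mu" by (rule inL2[OF m(1) D(1)[OF g]])
    show "h \<in> L2 mu" by (rule inL2[OF m(2) D(2)[OF g]])
    show "Q h h" using m(2) D(3)[OF g] by (simp only: Q_def)
  next
    show "Q (\<lambda>x. f x + c * f' x) (\<lambda>x. h x + c * h' x)" if "Q f h" "Q f' h'" for f h f' h' c
      using that D(5)[of "\<lambda>q. f (v q)" "\<lambda>q. h (v q)" "\<lambda>q. f' (v q)" "\<lambda>q. h' (v q)"] unfolding Q_def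
      by (intro conjI borel_measurable_add borel_measurable_times borel_measurable_const) simp_all
    obtain C :: real where C: "\<And>f h. ?P' f h \<Longrightarrow> L2_normsq mu' h \<le> ennreal C * L2_normsq mu' f" using D(6) by blast
    have "\<forall>f h. Q f h \<longrightarrow> L2_normsq mu h \<le> ennreal C * L2_normsq mu f"
    proof (intro allI impI)
      fix f h assume "Q f h"
      then have m: "f \<in> borel_measurable mu" "h \<in> borel_measurable mu" and g: "?P' (\<lambda>q. f (v q)) (\<lambda>q. h (v q))"
        by (simp_all only: Q_def)
      show "L2_normsq mu h \<le> ennreal C * L2_normsq mu f"
        using C[OF g] by (simp only: L2_normsq_pullback'[OF m(1)] L2_normsq_pullback'[OF m(2)])
    qed
    then show "\<exists>C::real. \<forall>f h. Q f h \<longrightarrow> L2_normsq mu h \<le> ennreal C * L2_normsq mu f" by blast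
    show "\<exists>h. Q f h" if f: "f \<in> L2 mu" for f
    proof -
      obtain h where h: "?P' (\<lambda>q. f (v q)) h" using D(4)[OF L2_pullback'[OF f]] by blast
      have hm: "(\<lambda>p. h (w p)) \<in> borel_measurable mu" by (rule L2_measurable[OF L2_pullback[OF D(2)[OF h]]])
      \<comment> \<open>w o v is the identity on S' but not elsewhere; agreement on S' is agreement
        almost everywhere.\<close>
      have "?P' (\<lambda>q. f (v q)) (\<lambda>q. h (w (v q)))"
        by (rule D(7)[OF h L2_measurable[OF D(1)[OF h]] measurable_compose[OF v_measurable_mu hm]]) (auto intro!: AE_I2 simp: w_v)
      then show ?thesis unfolding Q_def using L2_measurable[OF f] hm by (intro exI[of _ "\<lambda>p. h (w p)"]) simp
    qed
    show "Q f' h'" if "Q f h" "f' \<in> borel_measurable mu" "h' \<in> borel_measurable mu" "AE x in mu. f' x = f x" "AE x in mu. h' x = h x" for f h f' h'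
    proof -
      have "?P' (\<lambda>q. f' (v q)) (\<lambda>q. h' (v q))" by (rule D(7)[of "\<lambda>q. f (v q)" "\<lambda>q. h (v q)"])
          (use that measurable_compose[OF v_measurable_mu] AE_pullback' in \<open>simp_all only: Q_def\<close>)
      then show ?thesis using that(2,3) by (simp only: Q_def)
    qed
  qed
  obtain s where s: "s \<noteq> 0" "\<And>f g. f \<in> L2 mu' \<Longrightarrow> g \<in> L2 mu' \<Longrightarrow>
     (\<integral>q. f q * g q * sgn (m' q) \<partial>mu') = s * pairing.B (\<lambda>p. f (w p)) (\<lambda>p. g (w p))" using pairing_pullback by blast
  have hardyD: "?P f f" if "f \<in> hardy_space S \<Omega>" for f using lb that unfolding leray_bounded_def by blast
  have hardy'D: "?P' f f" if "f \<in> hardy_space S' \<Omega>'" for f using lb' that unfolding d.leray_bounded_def by blast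
  \<comment> \<open>Seen from the dual side, \<open>kern z\<close> is the kernel function with
    parameter z in \<Omega>, holomorphic in the variable on \<Omega>'.\<close>
  have kQ: "Q (kern z) (kern z)" if z: "z \<in> \<Omega>" for z
  proof -
    have kL: "kern z \<in> L2 mu" by (rule continuous_L2[OF kern_continuous[OF z]])
    have "(\<lambda>q. inverse (Phi (transpose M) q z) ^ 2) \<in> hardy_space S' \<Omega>'" by (rule d.kernel_in_hardy_space[OF z])
    note h = hardy'D[OF this[unfolded Phi_transpose]]
    have km: "(\<lambda>q. kern z (v q)) \<in> borel_measurable mu'"
      by (rule measurable_compose[OF v_measurable_mu L2_measurable[OF kL]])
    have "?P' (\<lambda>q. kern z (v q)) (\<lambda>q. kern z (v q))" by (rule D(7)[OF h km km]; rule AE_I2; simp add: w_v)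
    then show ?thesis unfolding Q_def using L2_measurable[OF kL] by blast
  qed
  let ?k' = "\<lambda>q p. inverse (Phi M p q) ^ 2"
  have k'P: "?P (?k' q) (?k' q)" if "q \<in> \<Omega>'" for q by (rule hardyD[OF kernel_in_hardy_space[OF that]])
  have HP: "?P u (\<lambda>_. 0)" if "u \<in> L2 mu" "\<And>z. z \<in> \<Omega> \<Longrightarrow> pairing.B u (kern z) = 0" for u
    using lb by (intro kernel_criterion that) (auto simp: leray_bounded_def)
  have HQ: "Q u (\<lambda>_. 0)" if u: "u \<in> L2 mu" and 0: "\<And>q. q \<in> \<Omega>' \<Longrightarrow> pairing.B u (?k' q) = 0" for u
  proof -
    have "?P' (\<lambda>q. u (v q)) (\<lambda>_. 0)"
    proof (rule d.kernel_criterion)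
      show "d.boundary_limits" using lb' by (simp add: d.leray_bounded_def)
      show "\<exists>g. ?P' f g" if "f \<in> L2 mu'" for f by (rule D(4)[OF that])
      show uL: "(\<lambda>q. u (v q)) \<in> L2 mu'" by (rule L2_pullback'[OF u])
      fix q assume q: "q \<in> \<Omega>'"
      have "d.pairing.B (\<lambda>q. u (v q)) (d.kern q) = s * pairing.B (\<lambda>p. u (v (w p))) (\<lambda>p. d.kern q (w p))"
        unfolding d.pairing.B_def by (rule s(2)[OF uL d.continuous_L2[OF d.kern_continuous[OF q]]])
      also have "pairing.B (\<lambda>p. u (v (w p))) (\<lambda>p. d.kern q (w p)) = pairing.B u (?k' q)"
        unfolding pairing.B_def by (intro Bochner_Integration.integral_cong refl) (simp add: v_w Phi_transpose)
      finally show "d.pairing.B (\<lambda>q. u (v q)) (d.kern q) = 0" using 0[OF q] by simp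
    qed
    then show ?thesis unfolding Q_def using L2_measurable[OF u] by simp
  qed
  have "(\<forall>f. ?P f (\<lambda>_. 0) \<longrightarrow> pairing.B f g = 0) \<longleftrightarrow> Q g g" by (rule pairing.annihilator_of_kernel[OF P Qproj kQ k'P HP HQ g])
  moreover have "Q g g \<longleftrightarrow> (\<lambda>q. g (v q)) \<in> hardy_space S' \<Omega>'"
  proof
    assume "Q g g"
    then have "(\<lambda>q. g (v q)) \<in> {g. \<exists>f. ?P' f g}" unfolding Q_def by blast
    then show "(\<lambda>q. g (v q)) \<in> hardy_space S' \<Omega>'" using lb' by (simp only: d.leray_bounded_def)
  next
    assume "(\<lambda>q. g (v q)) \<in> hardy_space S' \<Omega>'"
    then show "Q g g" unfolding Q_def by (intro conjI L2_measurable[OF g] hardy'D)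
  qed
  ultimately show ?thesis by (simp add: leray_kernel_def)
qed

end

section \<open>The dual pair of an admissible hypersurface\<close>

text \<open>If both coefficients of z vanish, so does the constant term, and then the transpose of M
  annihilates \<open>homog w\<close>.\<close>

lemma Phi_zero_th_nonzero:
  assumes "invertible M" "Phi M z w = 0"
  shows "th M w $ 1 \<noteq> 0 \<or> th M w $ 2 \<noteq> 0"
proof (rule ccontr)
  assume "\<not> ?thesis"
  then have z: "th M w $ 1 = 0" "th M w $ 2 = 0" by auto
  have "Phi M 0 w = 0" using Phi_diff[of M z w 0] assms(2) z by simp
  then have "M $ 1 $ 1 + w $ 1 * M $ 2 $ 1 + w $ 2 * M $ 3 $ 1 = 0" by (simp add: Phi_expand)
  then have "transpose M *v homog w = 0"
    using z by (simp add: vec_eq_iff forall_3 matrix_vector_mult_def sum_3 transpose_def homog_def algebra_simps)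
  moreover have "invertible (transpose M)" using assms(1) by (simp add: invertible_det_nz det_transpose)
  ultimately have "homog w = 0" by (rule homog_kernel[rotated])
  then have "homog w $ 1 = 0" by simp
  then show False by (simp add: homog_def)
qed

lemma linear_system_2:
  fixes a b c d p q :: complex
  assumes "a * d - b * c \<noteq> 0"
  shows "(x * a + y * b = p \<and> x * c + y * d = q) \<longleftrightarrow> x = (p * d - b * q) / (a * d - b * c) \<and> y = (a * q - p * c) / (a * d - b * c)"
proof
  assume "x * a + y * b = p \<and> x * c + y * d = q"
  then have pq: "p = x * a + y * b" "q = x * c + y * d" by auto
  show "x = (p * d - b * q) / (a * d - b * c) \<and> y = (a * q - p * c) / (a * d - b * c)"
    using assms unfolding pq by (auto simp: eq_divide_eq algebra_simps)
next
  assume xy: "x = (p * d - b * q) / (a * d - b * c) \<and> y = (a * q - p * c) / (a * d - b * c)"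
  define D where "D = a * d - b * c"
  have D: "D \<noteq> 0" using assms by (simp add: D_def)
  have x: "x = (p * d - b * q) / D" and y: "y = (a * q - p * c) / D" using xy by (auto simp: D_def)
  have "x * a + y * b = ((p * d - b * q) * a + (a * q - p * c) * b) / D" unfolding x y by (simp add: add_divide_distrib)
  moreover have "(p * d - b * q) * a + (a * q - p * c) * b = p * D" by (simp add: D_def algebra_simps)
  moreover have "x * c + y * d = ((p * d - b * q) * c + (a * q - p * c) * d) / D"
    unfolding x y by (simp add: add_divide_distrib)
  moreover have "(p * d - b * q) * c + (a * q - p * c) * d = q * D" by (simp add: D_def algebra_simps)
  ultimately show "x * a + y * b = p \<and> x * c + y * d = q" using D by simp
qed

text \<open>The line belonging to w is the tangent line at x when it passes through x and its
  coefficient vector is parallel to (r1, r2). These are two linear equations for w whose determinant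
  is the one in \<open>M_admissible\<close>, so Cramer's rule gives existence and
  uniqueness.\<close>

lemma (in hypersurface) w_map_properties:
  assumes inv: "invertible M" and adm: "M_admissible M \<rho> S" and x: "x \<in> S"
  shows "Phi M x (w_map M \<rho> x) = 0" "\<exists>l. l \<noteq> 0 \<and> (\<forall>k. th M (w_map M \<rho> x) $ k = l * d_rho \<rho> k x)"
proof -
  define A where "A = M$2$2 * r2 x - M$2$3 * r1 x"
  define B where "B = M$3$2 * r2 x - M$3$3 * r1 x"
  define C where "C = M$2$2 * x $ 1 + M$2$3 * x $ 2 + M$2$1"
  define D where "D = M$3$2 * x $ 1 + M$3$3 * x $ 2 + M$3$1"
  define p where "p = - (M$1$2 * r2 x - M$1$3 * r1 x)"
  define q where "q = - (M$1$1 + M$1$2 * x $ 1 + M$1$3 * x $ 2)"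
  have det: "A * D - B * C \<noteq> 0"
    using adm x unfolding M_admissible_def Let_def A_def B_def C_def D_def by (auto simp: det_2 algebra_simps)
  have sys1: "th M w $ 1 * r2 x - th M w $ 2 * r1 x = 0 \<longleftrightarrow> w $ 1 * A + w $ 2 * B = p" for w
    unfolding A_def B_def p_def th_1 th_2 by (auto simp: algebra_simps)
  have sys2: "Phi M x w = 0 \<longleftrightarrow> w $ 1 * C + w $ 2 * D = q" for w
    unfolding C_def D_def q_def Phi_expand by (auto simp: algebra_simps eq_neg_iff_add_eq_0)
  define w :: C2 where "w = vector [(p * D - B * q) / (A * D - B * C), (A * q - p * C) / (A * D - B * C)]"
  have uniq: "th M w' $ 1 * r2 x - th M w' $ 2 * r1 x = 0 \<and> Phi M x w' = 0 \<longleftrightarrow> w' = w" for w'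
    unfolding sys1 sys2 linear_system_2[OF det] w_def by (auto simp: vec_eq_iff forall_2)
  have w: "th M w $ 1 * r2 x - th M w $ 2 * r1 x = 0" "Phi M x w = 0" using uniq by auto
  have "\<exists>l. l \<noteq> 0 \<and> (\<forall>k. th M w $ k = l * d_rho \<rho> k x)"
  proof -
    have cross: "th M w $ 1 * r2 x = th M w $ 2 * r1 x" using w(1) by (simp del: th_1 th_2)
    have nz: "th M w $ 1 \<noteq> 0 \<or> th M w $ 2 \<noteq> 0" by (rule Phi_zero_th_nonzero[OF inv w(2)])
    \<comment> \<open>One component of the complex gradient may vanish, so l is read from one that
      does not.\<close>
    define l where "l = (if r1 x \<noteq> 0 then th M w $ 1 / r1 x else th M w $ 2 / r2 x)"
    have l: "th M w $ 1 = l * r1 x" "th M w $ 2 = l * r2 x"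
      using cross d_rho_nonzero[OF x] by (auto simp: l_def field_simps simp del: th_1 th_2)
    then have "l \<noteq> 0" using nz by auto
    moreover have "th M w $ k = l * d_rho \<rho> k x" for k using exhaust_2[of k] l by metis
    ultimately show ?thesis by blast
  qed
  then obtain l where l: "l \<noteq> 0" "\<And>k. th M w $ k = l * d_rho \<rho> k x" by blast
  have line: "complex_tangent_line \<rho> x = {z. Phi M z w = 0}"
  proof -
    have "Phi M z w = l * (\<Sum>j\<in>UNIV. d_rho \<rho> j x * (z $ j - x $ j))" for z
      using Phi_diff[of M z w x] w(2) unfolding l(2) UNIV_2 by (simp add: algebra_simps)
    then show ?thesis using l(1) by (auto simp: complex_tangent_line_def)
  qed
  have "w_map M \<rho> x = w" unfolding w_map_def
  proof (rule the_equality)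
    show "complex_tangent_line \<rho> x = {z. Phi M z w = 0}" by (rule line)
    fix w' assume "complex_tangent_line \<rho> x = {z. Phi M z w' = 0}"
    then have L: "Phi M z w' = 0 \<longleftrightarrow> (\<Sum>j\<in>UNIV. d_rho \<rho> j x * (z $ j - x $ j)) = 0" for z
      by (auto simp: complex_tangent_line_def)
    have 1: "Phi M x w' = 0" using L[of x] by simp
    have "Phi M (x + vector [r2 x, - r1 x]) w' = 0" using L[of "x + vector [r2 x, - r1 x]"] by (simp add: UNIV_2)
    then have "th M w' $ 1 * r2 x - th M w' $ 2 * r1 x = 0"
      using Phi_diff[of M "x + vector [r2 x, - r1 x]" w' x] 1 by (simp del: th_1 th_2)
    with 1 show "w' = w" using uniq by blast
  qed
  then show "Phi M x (w_map M \<rho> x) = 0" "\<exists>l. l \<noteq> 0 \<and> (\<forall>k. th M (w_map M \<rho> x) $ k = l * d_rho \<rho> k x)"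
    using w(2) l by (auto simp del: th_1 th_2)
qed

text \<open>Every vector becomes a kernel vector of the second functional after subtraction of a
  real multiple of the conjugate of (q1, q2). The quotient of the two functionals at that conjugate
  vector is k.\<close>

lemma Re_functional_multiple:
  fixes p1 p2 q1 q2 :: complex
  assumes ker: "\<And>x1 x2. Re (q1 * x1 + q2 * x2) = 0 \<Longrightarrow> Re (p1 * x1 + p2 * x2) = 0" and q: "q1 \<noteq> 0 \<or> q2 \<noteq> 0"
  shows "\<exists>k::real. p1 = of_real k * q1 \<and> p2 = of_real k * q2"
proof -
  define n where "n = (cmod q1)^2 + (cmod q2)^2"
  have n: "n > 0" using q by (auto simp: n_def add_pos_nonneg add_nonneg_pos)
  have qq: "q1 * cnj q1 + q2 * cnj q2 = of_real n" unfolding n_def of_real_add complex_norm_square ..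
  define k where "k = Re (p1 * cnj q1 + p2 * cnj q2) / n"
  have eq: "Re (p1 * x1 + p2 * x2) = k * Re (q1 * x1 + q2 * x2)" for x1 x2
  proof -
    define t where "t = Re (q1 * x1 + q2 * x2) / n"
    have "q1 * (x1 - of_real t * cnj q1) + q2 * (x2 - of_real t * cnj q2) = (q1 * x1 + q2 * x2) - of_real t * (q1 * cnj q1 + q2 * cnj q2)"
      by (simp add: algebra_simps)
    then have "Re (q1 * (x1 - of_real t * cnj q1) + q2 * (x2 - of_real t * cnj q2)) = 0"
      unfolding qq using n by (simp add: t_def)
    from ker[OF this]
    have "Re ((p1 * x1 + p2 * x2) - of_real t * (p1 * cnj q1 + p2 * cnj q2)) = 0" by (simp add: algebra_simps)
    then have "Re (p1 * x1 + p2 * x2) = t * Re (p1 * cnj q1 + p2 * cnj q2)" by simp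
    then show ?thesis using n by (simp add: t_def k_def)
  qed
  have 0: "(p1 - of_real k * q1) = 0"
  proof -
    have "Re ((p1 - of_real k * q1) * cnj (p1 - of_real k * q1)) = 0"
      using eq[of "cnj (p1 - of_real k * q1)" 0] by (simp add: algebra_simps)
    then show ?thesis unfolding complex_norm_square[symmetric] by simp
  qed
  have "(p2 - of_real k * q2) = 0"
  proof -
    have "Re ((p2 - of_real k * q2) * cnj (p2 - of_real k * q2)) = 0"
      using eq[of 0 "cnj (p2 - of_real k * q2)"] by (simp add: algebra_simps)
    then show ?thesis unfolding complex_norm_square[symmetric] by simp
  qed
  with 0 show ?thesis by (intro exI[of _ k]) simp
qed

text \<open>The symmetric half of the duality: the tangent line of S' at q is the one dual to the
  point G q. On tangent vectors x of S' the contact identity turns T . x / l into minus the complex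
  gradient of \<rho> applied to the derivative of G, whose real part is 0. So Re (T . x / l)
  vanishes on the kernel of the differential of \<rho>' and is a real multiple of Re (h'.r1 q * x1 +
  h'.r2 q * x2).\<close>

lemma dual_gradient:
  assumes S: "hypersurface \<rho> S \<Omega> U" and S': "hypersurface \<rho>' S' \<Omega>' U'" and inv: "invertible M"
    and V: "S' \<subseteq> V" and G: "smooth_on G V" and GS: "\<And>q. q \<in> S' \<Longrightarrow> G q \<in> S"
    and Phi0: "\<And>q. q \<in> S' \<Longrightarrow> Phi M (G q) q = 0"
    and th: "\<And>q. q \<in> S' \<Longrightarrow> \<exists>l. l \<noteq> 0 \<and> (\<forall>k. th M q $ k = l * d_rho \<rho> k (G q))" and q: "q \<in> S'"
  shows "\<exists>l. l \<noteq> 0 \<and> (\<forall>k. th (transpose M) (G q) $ k = l * d_rho \<rho>' k q)"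
proof -
  interpret h: hypersurface \<rho> S \<Omega> U by (rule S)
  interpret h': hypersurface \<rho>' S' \<Omega>' U' by (rule S')
  let ?D = "frechet_derivative G (at q)" let ?T = "th (transpose M) (G q)" let ?t = "th M q"
  have GU: "G q \<in> U" and qU: "q \<in> U'" using GS[OF q] h.S_U q h'.S_U by auto
  have D: "(G has_derivative ?D) (at q within S')"
    using smooth_on_has_derivative[OF G] V q has_derivative_at_withinI by blast
  obtain l where l: "l \<noteq> 0" "\<And>k. ?t $ k = l * d_rho \<rho> k (G q)" using th[OF q] by blast
  have tangent: "h.D\<rho> (G q) (?D x) = 0" if x: "h'.D\<rho> q x = 0" for x by (rule h'.tangent_map[OF S q D GS x])
  have contact: "?t $ 1 * ?D x $ 1 + ?t $ 2 * ?D x $ 2 = - (?T $ 1 * x $ 1 + ?T $ 2 * x $ 2)" if x: "h'.D\<rho> q x = 0" for x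
    using h'.tangent_incidence[OF q D _ x, of "transpose M"] Phi0 by (simp only: transpose_transpose Phi_transpose)
  have "\<exists>k::real. ?T $ 1 / l = of_real k * h'.r1 q \<and> ?T $ 2 / l = of_real k * h'.r2 q"
  proof (rule Re_functional_multiple[OF _ h'.d_rho_nonzero[OF q]])
    fix x1 x2 assume x: "Re (h'.r1 q * x1 + h'.r2 q * x2) = 0"
    define x :: C2 where "x = vector [x1, x2]"
    have tx: "h'.D\<rho> q x = 0" using h'.D\<rho>_d_rho[OF qU, of x] x by (simp add: x_def)
    have "Re (h.r1 (G q) * ?D x $ 1 + h.r2 (G q) * ?D x $ 2) = 0" using h.D\<rho>_d_rho[OF GU, of "?D x"] tangent[OF tx] by simp
    moreover have "?T $ 1 / l * x1 + ?T $ 2 / l * x2 = - (h.r1 (G q) * ?D x $ 1 + h.r2 (G q) * ?D x $ 2)"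
    proof -
      have "?T $ 1 * x1 + ?T $ 2 * x2 = - (l * (h.r1 (G q) * ?D x $ 1 + h.r2 (G q) * ?D x $ 2))"
        using contact[OF tx] unfolding l(2) by (simp add: x_def algebra_simps eq_neg_iff_add_eq_0 neg_eq_iff_add_eq_0 del: th_1 th_2)
      then have "(?T $ 1 * x1 + ?T $ 2 * x2) / l = - (h.r1 (G q) * ?D x $ 1 + h.r2 (G q) * ?D x $ 2)"
        using l(1) by (simp del: th_1 th_2)
      then show ?thesis by (simp add: add_divide_distrib del: th_1 th_2)
    qed
    ultimately show "Re (?T $ 1 / l * x1 + ?T $ 2 / l * x2) = 0" by (simp del: th_1 th_2)
  qed
  then obtain k :: real where k: "?T $ 1 / l = of_real k * h'.r1 q" "?T $ 2 / l = of_real k * h'.r2 q" by blast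
  have T: "?T $ 1 = l * of_real k * h'.r1 q" "?T $ 2 = l * of_real k * h'.r2 q"
    using k l(1) by (simp_all add: field_simps del: th_1 th_2)
  have "invertible (transpose M)" using inv by (simp add: invertible_det_nz det_transpose)
  then have "?T $ 1 \<noteq> 0 \<or> ?T $ 2 \<noteq> 0" by (rule Phi_zero_th_nonzero[where z=q]) (simp add: Phi_transpose Phi0[OF q])
  then have "l * of_real k \<noteq> 0" using T by auto
  moreover have "?T $ j = l * of_real k * d_rho \<rho>' j q" for j using exhaust_2[of j] T by metis
  ultimately show ?thesis by blast
qed

lemma dual_pair_exists:
  assumes duality: "Projective_duality_theorem" and inv: "invertible M"
    and sc: "strongly_C_convex_boundary \<rho> S \<Omega>" and adm: "M_admissible M \<rho> S"
  shows "\<exists>U \<rho>' U' v F G W V. dual_pair \<rho> S \<Omega> U \<rho>' (dual_surface M \<rho> S) (dual_domain M \<rho> S) U' M (w_map M \<rho>) v F G W V \<and>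
    strongly_C_convex_boundary \<rho>' (dual_surface M \<rho> S) (dual_domain M \<rho> S)"
proof -
  let ?w = "w_map M \<rho>" let ?S' = "dual_surface M \<rho> S" let ?O' = "dual_domain M \<rho> S"
  have hyp: "\<exists>U. hypersurface \<rho> S \<Omega> U" if "strongly_C_convex_boundary \<rho> S \<Omega>" for \<rho> S \<Omega>
    using that unfolding strongly_C_convex_boundary_def defining_function_def hypersurface_def by blast
  have "diffeomorphism_on ?w S ?S' \<and> (\<exists>\<rho>'. strongly_C_convex_boundary \<rho>' ?S' ?O')"
    using duality inv sc adm unfolding Projective_duality_theorem_def by blast
  then obtain \<rho>' where diff: "diffeomorphism_on ?w S ?S'" and sc': "strongly_C_convex_boundary \<rho>' ?S' ?O'" by blast
  obtain U where h: "hypersurface \<rho> S \<Omega> U" using hyp[OF sc] by blast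
  obtain U' where h': "hypersurface \<rho>' ?S' ?O' U'" using hyp[OF sc'] by blast
  obtain W F V G where F: "open W" "S \<subseteq> W" "smooth_on F W" "\<And>p. p \<in> S \<Longrightarrow> F p = ?w p"
    and G: "open V" "?S' \<subseteq> V" "smooth_on G V" "\<And>p. p \<in> S \<Longrightarrow> G (?w p) = p" using diff unfolding diffeomorphism_on_def by blast
  note w = hypersurface.w_map_properties[OF h inv adm]
  have G_in: "G q \<in> S" "?w (G q) = q" if "q \<in> ?S'" for q using that G(4) by (auto simp: dual_surface_def)
  have th': "\<exists>l. l \<noteq> 0 \<and> (\<forall>k. th (transpose M) (G q) $ k = l * d_rho \<rho>' k q)" if q: "q \<in> ?S'" for q
    by (rule dual_gradient[OF h h' inv G(2,3) G_in(1) _ _ q]) (use w G_in in fastforce)+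
  \<comment> \<open>The smooth extension G of the inverse also serves as the map v.\<close>
  have "dual_pair \<rho> S \<Omega> U \<rho>' ?S' ?O' U' M ?w G F G W V"
    by (intro dual_pair.intro dual_pair_axioms.intro h h' inv F G w th' refl)
      (use sc sc' in \<open>auto simp: dual_surface_def strongly_C_convex_boundary_def strongly_C_convex_def\<close>)
  then show ?thesis using sc' by blast
qed

section \<open>Identification with the spaces of the statement\<close>

context dual_pair
begin

text \<open>Expanding \<theta>2 d\<theta>1 - \<theta>1 d\<theta>2 for \<theta> =
  \<open>th M w\<close> gives the bracket in \<open>nu_form\<close>. The derivative within S used
  there agrees with \<open>dw\<close> on tangent vectors, and \<open>form_density\<close> evaluates
  on tangent vectors.\<close>

lemma nu_form_density:
  assumes w: "w = w_map M \<rho>" and p: "p \<in> S"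
  shows "form_density S \<Omega> (nu_form M \<rho> S) p = m p"
proof -
  have "(w has_derivative frechet_derivative w (at p within S)) (at p within S)"
    using w_deriv[OF p] frechet_derivative_works differentiable_def by blast
  then have dw': "Defs.dw M \<rho> S j p u = dw p u $ j" if "D\<rho> p u = 0" for j u
    unfolding Defs.dw_def w[symmetric] using tangent_derivative_unique[OF p _ w_deriv[OF p] that] by metis
  have "form_density S \<Omega> (nu_form M \<rho> S) p = 1 * form_density S \<Omega> nu p"
  proof (rule form_density_cong[OF p])
    fix x y t assume tan: "D\<rho> p x = 0" "D\<rho> p y = 0" "D\<rho> p t = 0"
    show "nu_form M \<rho> S p x y t = 1 * nu p x y t"
      unfolding nu_form_def nu_def wedge3_expand d\<theta>_eq[OF p] dw'[OF tan(1)] dw'[OF tan(2)] dw'[OF tan(3)] w[symmetric] th_1 th_2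
      by (simp add: algebra_simps)
  qed
  then show ?thesis by (simp add: m_def)
qed

lemma nu_measure_eq: assumes "w = w_map M \<rho>" shows "nu_measure M \<rho> S \<Omega> = mu" unfolding nu_measure_def
proof (rule density_cong)
  show m: "(\<lambda>p. ennreal (cmod (m p))) \<in> borel_measurable \<sigma>" using m_measurable by measurable
  show "(\<lambda>p. ennreal (cmod (form_density S \<Omega> (nu_form M \<rho> S) p))) \<in> borel_measurable \<sigma>"
    by (subst measurable_cong[where g="\<lambda>p. ennreal (cmod (m p))"]) (simp_all add: m nu_form_density[OF assms])
  show "AE p in \<sigma>. ennreal (cmod (form_density S \<Omega> (nu_form M \<rho> S) p)) = ennreal (cmod (m p))"
    by (rule AE_I2) (simp add: nu_form_density[OF assms])
qed

text \<open>Since \<tau> is unimodular, B(k, conj(\<tau> h)) is the conjugate of the inner product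
  of h and k. Orthogonality of h to the Leray kernel thus says that the conjugate of \<tau> h
  annihilates that kernel under B. Classes are compared because the functions are given on all of
  C^2 but are determined only almost everywhere on S.\<close>

lemma conjugate_W_eq_hardy_dual:
  assumes LS: "Lanzani_Stein_theorem" and sc: "strongly_C_convex_boundary \<rho> S \<Omega>" "strongly_C_convex_boundary \<rho>' S' \<Omega>'"
    and w: "w = w_map M \<rho>" and S': "S' = dual_surface M \<rho> S" and Om': "\<Omega>' = dual_domain M \<rho> S"
  shows "W_space M \<rho> S \<Omega> \<subseteq> L2 mu \<and>
    ae_class mu ` conjugate_space (W_space M \<rho> S \<Omega>) = ae_class mu ` hardy_dual M \<rho> S"
proof -
  interpret d: dual_pair \<rho>' S' \<Omega>' U' \<rho> S \<Omega> U "transpose M" v w G F V W by (rule swap)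
  have lb': "d.leray_bounded" by (rule d.Lanzani_Stein_leray_bounded[OF LS sc(2)])
  let ?t = "tau M \<rho> S \<Omega>" let ?K = "leray_kernel \<rho> S \<Omega> mu"
  have tau: "?t p = sgn (m p)" if "p \<in> S" for p by (simp add: tau_def nu_form_density[OF w that])
  have tau1: "?t p * cnj (?t p) = 1" if "p \<in> S" for p
    using m_nonzero[OF that] unfolding tau[OF that] complex_norm_square[symmetric] by (simp add: norm_sgn)
  have taum: "?t \<in> borel_measurable mu"
    by (subst measurable_cong[where g="\<lambda>p. sgn (m p)"]) (simp add: tau, rule pairing.\<tau>_measurable)
  have taub: "AE p in mu. cmod (?t p) \<le> 1" by (rule AE_I2) (simp add: tau norm_sgn)
  have KL: "k \<in> L2 mu" if "k \<in> ?K" for k using that by (simp add: leray_kernel_def leray_graph_def)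
  have W: "W_space M \<rho> S \<Omega> = {(\<lambda>p. ?t p * h p) | h. h \<in> orthogonal_complement mu ?K}"
    by (simp add: W_space_def nu_measure_eq[OF w])
  have orth: "h \<in> orthogonal_complement mu ?K \<longleftrightarrow> h \<in> L2 mu \<and> (\<forall>k\<in>?K. pairing.B k (\<lambda>p. cnj (?t p * h p)) = 0)" for h
  proof -
    have "pairing.B k (\<lambda>p. cnj (?t p * h p)) = cnj (\<integral>p. h p * cnj (k p) \<partial>mu)" for k
    proof -
      have "pairing.B k (\<lambda>p. cnj (?t p * h p)) = (\<integral>p. cnj (h p * cnj (k p)) \<partial>mu)" unfolding pairing.B_def
      proof (intro Bochner_Integration.integral_cong refl)
        fix p assume "p \<in> space mu"
        then have p: "p \<in> S" by simp
        have "k p * cnj (?t p * h p) * sgn (m p) = k p * cnj (h p) * (?t p * cnj (?t p))" by (simp add: tau[OF p])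
        then show "k p * cnj (?t p * h p) * sgn (m p) = cnj (h p * cnj (k p))" by (simp add: tau1[OF p])
      qed
      also have "\<dots> = cnj (\<integral>p. h p * cnj (k p) \<partial>mu)" by (rule Bochner_Integration.integral_cnj)
      finally show ?thesis .
    qed
    then show ?thesis by (simp add: orthogonal_complement_def)
  qed
  have tL: "(\<lambda>p. ?t p * h p) \<in> L2 mu" if "h \<in> L2 mu" for h by (rule L2_mult_bounded[OF that taum taub])
  have ann: "(\<forall>k\<in>?K. pairing.B k g = 0) \<longleftrightarrow> (\<lambda>q. g (v q)) \<in> hardy_space S' \<Omega>'" if "g \<in> L2 mu" for g
    by (rule annihilator_eq_dual_hardy[OF LS sc that])
  have hardyP: "d.graph f f" if "f \<in> hardy_space S' \<Omega>'" for f using lb' that unfolding d.leray_bounded_def by blast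
  have hardyL: "f \<in> L2 mu'" if "f \<in> hardy_space S' \<Omega>'" for f using hardyP[OF that] by (simp add: leray_graph_def)
  have cls: "ae_class mu f = ae_class mu g" if "\<And>p. p \<in> S \<Longrightarrow> f p = g p" for f g
  proof -
    have "(AE p in mu. k p = f p) \<longleftrightarrow> (AE p in mu. k p = g p)" for k by (rule AE_cong) (use that in auto)
    then show ?thesis by (simp add: ae_class_def)
  qed
  show ?thesis
  proof (intro conjI equalityI)
    show "W_space M \<rho> S \<Omega> \<subseteq> L2 mu" unfolding W using tL orth by auto
    show "ae_class mu ` conjugate_space (W_space M \<rho> S \<Omega>) \<subseteq> ae_class mu ` hardy_dual M \<rho> S"
    proof
      fix X assume "X \<in> ae_class mu ` conjugate_space (W_space M \<rho> S \<Omega>)"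
      then obtain h where h: "h \<in> orthogonal_complement mu ?K" and X: "X = ae_class mu (\<lambda>p. cnj (?t p * h p))"
        unfolding conjugate_space_def W by blast
      let ?g = "\<lambda>p. cnj (?t p * h p)"
      have "?g \<in> L2 mu" using h orth by (intro L2_cnj tL) blast
      then have "(\<lambda>q. ?g (v q)) \<in> hardy_space S' \<Omega>'" using ann h orth by blast
      then have "(\<lambda>q. ?g (v q)) \<circ> w_map M \<rho> \<in> hardy_dual M \<rho> S" unfolding hardy_dual_def S'[symmetric] Om'[symmetric] by blast
      moreover have "X = ae_class mu ((\<lambda>q. ?g (v q)) \<circ> w_map M \<rho>)" unfolding X w[symmetric] by (rule cls) (simp add: v_w)
      ultimately show "X \<in> ae_class mu ` hardy_dual M \<rho> S" by blast
    qed
    show "ae_class mu ` hardy_dual M \<rho> S \<subseteq> ae_class mu ` conjugate_space (W_space M \<rho> S \<Omega>)"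
    proof
      fix X assume "X \<in> ae_class mu ` hardy_dual M \<rho> S"
      then obtain f where f: "f \<in> hardy_space S' \<Omega>'" and X: "X = ae_class mu (f \<circ> w)"
        unfolding hardy_dual_def S'[symmetric] Om'[symmetric] w[symmetric] by blast
      have g: "(\<lambda>p. f (w p)) \<in> L2 mu" by (rule L2_pullback[OF hardyL[OF f]])
      have fv: "(\<lambda>q. f (w (v q))) \<in> borel_measurable mu'"
        by (rule measurable_compose[OF v_measurable_mu L2_measurable[OF g]])
      \<comment> \<open>f o w o v agrees with f on S' only, so membership in the Hardy space is
        transferred through the Leray relation, which is stable under changes on null sets.\<close>
      have "d.graph f (\<lambda>q. f (w (v q)))"
        by (rule d.leray_graph_cong[OF hardyP[OF f] L2_measurable[OF hardyL[OF f]] fv]; rule AE_I2; simp add: w_v)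
      then have "(\<lambda>q. f (w (v q))) \<in> {g. \<exists>f. d.graph f g}" by blast
      then have "(\<lambda>q. f (w (v q))) \<in> hardy_space S' \<Omega>'" using lb' by (simp only: d.leray_bounded_def)
      then have 0: "\<forall>k\<in>?K. pairing.B k (\<lambda>p. f (w p)) = 0" using ann[OF g] by blast
      \<comment> \<open>Solves conj(\<tau> h) = f o w on S, where \<tau> is unimodular.\<close>
      let ?h = "\<lambda>p. cnj (?t p * f (w p))"
      have eq: "cnj (?t p * ?h p) = f (w p)" if "p \<in> S" for p
      proof -
        have "cnj (?t p * ?h p) = (?t p * cnj (?t p)) * f (w p)" by simp
        then show ?thesis by (simp only: tau1[OF that] mult_1)
      qed
      have "pairing.B k (\<lambda>p. cnj (?t p * ?h p)) = pairing.B k (\<lambda>p. f (w p))" for k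
        unfolding pairing.B_def by (intro Bochner_Integration.integral_cong refl) (simp only: eq space_density space_\<sigma>)
      then have "?h \<in> orthogonal_complement mu ?K" unfolding orth using 0 by (intro conjI L2_cnj tL g) (simp only:)
      then have "(\<lambda>p. ?t p * ?h p) \<in> W_space M \<rho> S \<Omega>" unfolding W by (intro CollectI exI[of _ ?h]) simp
      then have "(\<lambda>p. cnj (?t p * ?h p)) \<in> conjugate_space (W_space M \<rho> S \<Omega>)"
        unfolding conjugate_space_def by (intro CollectI exI[of _ "\<lambda>p. ?t p * ?h p"]) simp
      moreover have "X = ae_class mu (\<lambda>p. cnj (?t p * ?h p))" unfolding X by (rule cls) (simp only: eq o_def)
      ultimately show "X \<in> ae_class mu ` conjugate_space (W_space M \<rho> S \<Omega>)" by blast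
    qed
  qed
qed

end

theorem proposition6p5:
  fixes M :: "complex ^ 3 ^ 3" and S \<Omega> :: "(complex ^ 2) set" and \<rho> :: "complex ^ 2 \<Rightarrow> real"
  assumes known_Lanzani_Stein: "Lanzani_Stein_theorem"
    and known_duality: "Projective_duality_theorem"
    and "invertible M"
    and "strongly_C_convex_boundary \<rho> S \<Omega>"
    and "M_admissible M \<rho> S"
  shows "W_space M \<rho> S \<Omega> \<subseteq> L2 (nu_measure M \<rho> S \<Omega>) \<and>
         ae_class (nu_measure M \<rho> S \<Omega>) ` conjugate_space (W_space M \<rho> S \<Omega>)
           = ae_class (nu_measure M \<rho> S \<Omega>) ` hardy_dual M \<rho> S"
proof -
  obtain U \<rho>' U' v F G W V
    where dual: "dual_pair \<rho> S \<Omega> U \<rho>' (dual_surface M \<rho> S) (dual_domain M \<rho> S) U' M (w_map M \<rho>) v F G W V"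
      and sc': "strongly_C_convex_boundary \<rho>' (dual_surface M \<rho> S) (dual_domain M \<rho> S)"
    using dual_pair_exists[OF known_duality assms(3-5)] by blast
  show ?thesis using dual_pair.conjugate_W_eq_hardy_dual[OF dual known_Lanzani_Stein assms(4) sc' refl refl refl]
    by (simp only: dual_pair.nu_measure_eq[OF dual refl])
qed

end
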